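(* Let $(M^4,g)$ be an oriented and time-oriented spacetime, let $S^2$ be a closed spacelike surface in $M$ enclosing a spacelike domain $\Omega$ (a spacelike hypersurface with boundary $S$), and let $N$ be a future-directed timelike vector field on $S$ orthogonal to $\Omega$. Orient $S$ so that $N$, the outward unit normal of $S$ in $\Omega$, and the orientation of $S$ form the orientation of $M$. Let $(\overline M,\overline g)$ be the dS or AdS spacetime, $\overline M=\mathbb R\times\hat M$ with $\overline g=-V^2dT^2+\hat g$. Then for any 4D isometric matching reference $\varphi$ such that (1) $\varphi_*N=\frac{\partial}{\partial T}$ on $\varphi(S)$, and (2) $\varphi(S)\subset\hat M$, we have \[E(S,N,\varphi)=\frac{1}{8\pi}\int_S|V|\,(k_0-k)\,dV_S,\] where $k$ is the mean curvature of $S$ in $\Omega$ with respect to the outward unit normal $\nu$, $k_0$ is the mean curvature of $\varphi(S)$ in $\hat M$ with respect to its outward unit normal, which is $\varphi_*\nu$, and $V$, $k_0$ are evaluated at $\varphi(p)$ for $p\in S$.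
   Context: Lorentzian metrics have signature $(-,+,+,+)$; everything is smooth. In the dS (resp. AdS) spacetime, $\hat M$ is the 3-sphere (resp. hyperbolic 3-space) with its standard metric $\hat g$ of curvature $1$ (resp. $-1$), and $V$ is the static potential on $\hat M$, i.e. a nontrivial function with $\hat\nabla^2V=-V\hat g$ (resp. $\hat\nabla^2V=V\hat g$), for instance $V=\cos r$ (resp. $V=\cosh r$) with $r$ the distance to a fixed point; the Lorentz metric is considered where $V\ne0$. The vector field $\partial/\partial T$ is a future-directed timelike Killing field of length $|V|$. $\hat M$ is identified with a slice $\{T=\text{const}\}$. A reference is a smooth embedding $\varphi:U\to\overline M$ of an open neighborhood $U$ of $S$ in $M$ that preserves orientation and time orientation. It is a 4D isometric matching reference if $\varphi^*\overline g=g$ at every point of $S$ (on all of $T_pM$, $p\in S$). Let $\omega^a{}_b$ and $\overline\omega^a{}_b$ be the connection forms, with respect to a common local frame $(e_a)$ near $S$, of the Levi-Civita connections of $g$ and $\varphi^*\overline g$ ($\nabla e_b=\omega^a{}_b\otimes e_a$), $\iota:S\to M$ the inclusion, and \[\eta_a{}^b=\tfrac12\sqrt{-\det g}\,g^{b\beta}\epsilon_{a\beta\mu\nu}\,dx^\mu\wedge dx^\nu\] in positively oriented coordinates (indices $0,\dots,3$, $\epsilon_{0123}=1$). For a 4D isometric matching reference the Chen-Nester-Tung quasi-local energy is \[E(S,N,\varphi)=\frac{1}{16\pi}\int_S\iota^*\left[(\omega^a{}_b-\overline\omega^a{}_b)\wedge i_N\eta_a{}^b\right].\] Mean curvature is the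 sum of the principal curvatures, with sign such that small geodesic spheres have positive mean curvature with respect to the normal pointing away from the center. *)

theory Defs
  imports "HOL-Analysis.Analysis"
begin

section \<open>Smooth maps between Euclidean spaces\<close>

primrec Ck_on :: "nat \<Rightarrow> ('a::real_normed_vector \<Rightarrow> 'b::real_normed_vector) \<Rightarrow> 'a set \<Rightarrow> bool" where
  "Ck_on 0 f S \<longleftrightarrow> continuous_on S f"
| "Ck_on (Suc k) f S \<longleftrightarrow> f differentiable_on S \<and> (\<forall>v. Ck_on k (\<lambda>x. frechet_derivative f (at x) v) S)"

text \<open>Only used on open sets.\<close>

definition smooth_on :: "'a::real_normed_vector set \<Rightarrow> ('a \<Rightarrow> 'b::real_normed_vector) \<Rightarrow> bool" where
  "smooth_on S f \<longleftrightarrow> (\<forall>k. Ck_on k f S)"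


section \<open>Manifolds and tangent vectors\<close>

type_synonym ('m, 'n) chart = "'m set \<times> ('m \<Rightarrow> real^'n)"

text \<open>
  A tangent vector is the family of its component vectors in all charts. It is taken to be \<open>0\<close>
  outside the charts around its base point, so that tangent vectors are equal iff their
  components are.
\<close>

type_synonym ('m, 'n) tvec = "('m, 'n) chart \<Rightarrow> real^'n"

abbreviation cinv :: "('m, 'n) chart \<Rightarrow> real^'n \<Rightarrow> 'm" where
  "cinv c \<equiv> inv_into (fst c) (snd c)"

definition smooth_atlas :: "'m topology \<Rightarrow> ('m, 'n::finite) chart set \<Rightarrow> bool" where
  "smooth_atlas X A \<longleftrightarrow>
     (\<Union>c\<in>A. fst c) = topspace X \<and>
     (\<forall>c\<in>A. openin X (fst c) \<and> open (snd c ` fst c) \<and>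
        homeomorphic_map (subtopology X (fst c)) (top_of_set (snd c ` fst c)) (snd c)) \<and>
     (\<forall>c\<in>A. \<forall>c'\<in>A. smooth_on (snd c ` (fst c \<inter> fst c')) (snd c' \<circ> cinv c))"

text \<open>
  An orientation is given by an atlas with positive transition determinants; all the charts of
  such an atlas count as positively oriented.
\<close>

definition oriented_manifold :: "'m topology \<Rightarrow> ('m, 'n::finite) chart set \<Rightarrow> bool" where
  "oriented_manifold X A \<longleftrightarrow>
     Hausdorff_space X \<and> second_countable X \<and> smooth_atlas X A \<and>
     (\<forall>c\<in>A. \<forall>c'\<in>A. \<forall>p\<in>fst c \<inter> fst c'.
        det (matrix (frechet_derivative (snd c' \<circ> cinv c) (at (snd c p)))) > 0)"

definition tangent_space :: "('m, 'n::finite) chart set \<Rightarrow> 'm \<Rightarrow> ('m, 'n) tvec set" where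
  "tangent_space A p =
     {v. (\<forall>c. c \<notin> A \<or> p \<notin> fst c \<longrightarrow> v c = 0) \<and>
         (\<forall>c\<in>A. \<forall>c'\<in>A. p \<in> fst c \<inter> fst c' \<longrightarrow>
            v c' = frechet_derivative (snd c' \<circ> cinv c) (at (snd c p)) (v c))}"

text \<open>The differential at \<open>x\<close> of a map from a normed space into a manifold, applied to \<open>w\<close>.\<close>

definition push :: "('m, 'n::finite) chart set \<Rightarrow> ('e::real_normed_vector \<Rightarrow> 'm) \<Rightarrow> 'e \<Rightarrow> 'e \<Rightarrow> ('m, 'n) tvec" where
  "push A \<tau> x w =
     (\<lambda>c. if c \<in> A \<and> \<tau> x \<in> fst c then frechet_derivative (snd c \<circ> \<tau>) (at x) w else 0)"

text \<open>
  Differentials of maps defined on a manifold are computed in a chart around the point; by the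
  chain rule it does not matter which one.
\<close>

definition chart_at :: "('m, 'n) chart set \<Rightarrow> 'm \<Rightarrow> ('m, 'n) chart" where
  "chart_at A p = (SOME c. c \<in> A \<and> p \<in> fst c)"

definition differential ::
  "('m, 'n::finite) chart set \<Rightarrow> ('k, 'l::finite) chart set \<Rightarrow> ('m \<Rightarrow> 'k) \<Rightarrow> 'm \<Rightarrow> ('m, 'n) tvec \<Rightarrow> ('k, 'l) tvec" where
  "differential A B \<phi> p v =
     (let c = chart_at A p in push B (\<phi> \<circ> cinv c) (snd c p) (v c))"

definition ambient_vec ::
  "('a::real_normed_vector, 'n::finite) chart set \<Rightarrow> 'a \<Rightarrow> ('a, 'n) tvec \<Rightarrow> 'a" where
  "ambient_vec A p v = (let c = chart_at A p in frechet_derivative (cinv c) (at (snd c p)) (v c))"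

definition smooth_into ::
  "'m topology \<Rightarrow> ('m, 'n::finite) chart set \<Rightarrow> 'e::real_normed_vector set \<Rightarrow> ('e \<Rightarrow> 'm) \<Rightarrow> bool" where
  "smooth_into X A W \<tau> \<longleftrightarrow>
     open W \<and> continuous_map (top_of_set W) X \<tau> \<and>
     (\<forall>c\<in>A. smooth_on (W \<inter> \<tau> -` fst c) (snd c \<circ> \<tau>))"

definition smooth_vector_field ::
  "('m, 'n::finite) chart set \<Rightarrow> 'm set \<Rightarrow> ('m \<Rightarrow> ('m, 'n) tvec) \<Rightarrow> bool" where
  "smooth_vector_field A U Y \<longleftrightarrow>
     (\<forall>q\<in>U. Y q \<in> tangent_space A q) \<and>
     (\<forall>c\<in>A. smooth_on (snd c ` (fst c \<inter> U)) (\<lambda>x. Y (cinv c x) c))"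

definition smooth_embedding ::
  "'m topology \<Rightarrow> ('m, 'n::finite) chart set \<Rightarrow> 'm set \<Rightarrow> 'k topology \<Rightarrow> ('k, 'l::finite) chart set \<Rightarrow>
   ('m \<Rightarrow> 'k) \<Rightarrow> bool" where
  "smooth_embedding X A U Y B \<phi> \<longleftrightarrow>
     openin X U \<and>
     (\<forall>c\<in>A. smooth_into Y B (snd c ` (fst c \<inter> U)) (\<phi> \<circ> cinv c)) \<and>
     (\<forall>p\<in>U. inj_on (differential A B \<phi> p) (tangent_space A p)) \<and>
     \<phi> ` U \<subseteq> topspace Y \<and>
     homeomorphic_map (subtopology X U) (subtopology Y (\<phi> ` U)) \<phi>"

definition preserves_orientation ::
  "('m, 'n::finite) chart set \<Rightarrow> 'm set \<Rightarrow> ('k, 'n) chart set \<Rightarrow> ('m \<Rightarrow> 'k) \<Rightarrow> bool" where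
  "preserves_orientation A U B \<phi> \<longleftrightarrow>
     (\<forall>p\<in>U. \<forall>c\<in>A. \<forall>d\<in>B. p \<in> fst c \<and> \<phi> p \<in> fst d \<longrightarrow>
        det (matrix (frechet_derivative (snd d \<circ> \<phi> \<circ> cinv c) (at (snd c p)))) > 0)"


section \<open>Submanifolds\<close>

definition half_space :: "(real^3) set" where
  "half_space = {x. x$0 \<le> 0}"

text \<open>
  A local parametrization of \<open>P\<close> is an immersion of an open set \<open>W\<close> whose restriction to
  \<open>W \<inter> H\<close> is a homeomorphism onto an open subset of \<open>P\<close>. For \<open>H = UNIV\<close> this describes
  submanifolds without boundary, for \<open>H = half_space\<close> submanifolds with boundary. Since
  \<open>W\<close> may lie in the open half-space, submanifolds without boundary are included in the latter.
\<close>

definition local_param ::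
  "'m topology \<Rightarrow> ('m, 'n::finite) chart set \<Rightarrow> (real^'k::finite) set \<Rightarrow> 'm set \<Rightarrow>
   (real^'k) set \<Rightarrow> (real^'k \<Rightarrow> 'm) \<Rightarrow> bool" where
  "local_param X A H P W \<sigma> \<longleftrightarrow>
     smooth_into X A W \<sigma> \<and> (\<forall>x\<in>W. inj (push A \<sigma> x)) \<and>
     openin (subtopology X P) (\<sigma> ` (W \<inter> H)) \<and>
     homeomorphic_map (top_of_set (W \<inter> H)) (subtopology X (\<sigma> ` (W \<inter> H))) \<sigma>"

definition submanifold ::
  "'m topology \<Rightarrow> ('m, 'n::finite) chart set \<Rightarrow> (real^'k::finite) set \<Rightarrow> 'm set \<Rightarrow> bool" where
  "submanifold X A H P \<longleftrightarrow>
     P \<subseteq> topspace X \<and> (\<forall>p\<in>P. \<exists>W \<sigma>. local_param X A H P W \<sigma> \<and> p \<in> \<sigma> ` (W \<inter> H))"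

definition submanifold_boundary ::
  "'m topology \<Rightarrow> ('m, 'n::finite) chart set \<Rightarrow> 'm set \<Rightarrow> 'm set" where
  "submanifold_boundary X A P =
     {\<tau> x | W \<tau> x. local_param X A half_space P W \<tau> \<and> x \<in> W \<and> x$0 = 0}"

definition tangent_sub ::
  "'m topology \<Rightarrow> ('m, 'n::finite) chart set \<Rightarrow> (real^'k::finite) set \<Rightarrow> 'm set \<Rightarrow> 'm \<Rightarrow> ('m, 'n) tvec set" where
  "tangent_sub X A H P p =
     {push A \<sigma> x w | W \<sigma> x w. local_param X A H P W \<sigma> \<and> x \<in> W \<inter> H \<and> \<sigma> x = p}"

abbreviation "surface_tangent X A S p \<equiv> tangent_sub X A (UNIV :: (real^2) set) S p"

definition smooth_along_surface ::
  "'m topology \<Rightarrow> ('m, 'n::finite) chart set \<Rightarrow> 'm set \<Rightarrow> ('m \<Rightarrow> ('m, 'n) tvec) \<Rightarrow> bool" where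
  "smooth_along_surface X A S N \<longleftrightarrow>
     (\<forall>p\<in>S. N p \<in> tangent_space A p) \<and>
     (\<forall>W \<sigma>. local_param X A (UNIV :: (real^2) set) S W \<sigma> \<longrightarrow>
        (\<forall>c\<in>A. smooth_on (W \<inter> \<sigma> -` fst c) (\<lambda>u. N (\<sigma> u) c)))"


section \<open>Metrics and connections\<close>

type_synonym ('m, 'n) metric = "'m \<Rightarrow> ('m, 'n) tvec \<Rightarrow> ('m, 'n) tvec \<Rightarrow> real"

text \<open>The components of the pullback of \<open>g\<close> by \<open>\<tau>\<close>; for \<open>\<tau> = cinv c\<close>, those of \<open>g\<close> in the chart.\<close>

definition gram ::
  "('m, 'n::finite) chart set \<Rightarrow> ('m, 'n) metric \<Rightarrow> (real^'k::finite \<Rightarrow> 'm) \<Rightarrow> real^'k \<Rightarrow> real^'k^'k" where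
  "gram A g \<tau> x = (\<chi> i j. g (\<tau> x) (push A \<tau> x (axis i 1)) (push A \<tau> x (axis j 1)))"

definition lorentz_metric :: "('m, 4) chart set \<Rightarrow> 'm set \<Rightarrow> ('m, 4) metric \<Rightarrow> bool" where
  "lorentz_metric A U g \<longleftrightarrow>
     (\<forall>p\<in>U. \<forall>X\<in>tangent_space A p. \<forall>Y\<in>tangent_space A p. g p X Y = g p Y X) \<and>
     (\<forall>p\<in>U. \<forall>X\<in>tangent_space A p. \<forall>Y\<in>tangent_space A p. \<forall>Z\<in>tangent_space A p. \<forall>a b.
        g p (\<lambda>c. a *\<^sub>R X c + b *\<^sub>R Y c) Z = a * g p X Z + b * g p Y Z) \<and>
     (\<forall>p\<in>U. \<exists>e :: 4 \<Rightarrow> _. \<forall>a b. e a \<in> tangent_space A p \<and>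
        g p (e a) (e b) = (if a \<noteq> b then 0 else if a = 0 then -1 else 1)) \<and>
     (\<forall>c\<in>A. smooth_on (snd c ` (fst c \<inter> U)) (gram A g (cinv c)))"

definition spacelike ::
  "'m topology \<Rightarrow> ('m, 'n::finite) chart set \<Rightarrow> ('m, 'n) metric \<Rightarrow> (real^'k::finite) set \<Rightarrow> 'm set \<Rightarrow> bool" where
  "spacelike X A g H P \<longleftrightarrow>
     (\<forall>p\<in>P. \<forall>Y\<in>tangent_sub X A H P p. Y \<noteq> (\<lambda>c. 0) \<longrightarrow> g p Y Y > 0)"

text \<open>
  A time orientation is represented by a timelike vector field \<open>t\<close>; the future cone is the one
  containing \<open>t\<close>.
\<close>

definition time_orientation :: "'m topology \<Rightarrow> ('m, 4) chart set \<Rightarrow> ('m, 4) metric \<Rightarrow> ('m \<Rightarrow> ('m, 4) tvec) \<Rightarrow> bool" where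
  "time_orientation X A g t \<longleftrightarrow>
     smooth_vector_field A (topspace X) t \<and> (\<forall>p\<in>topspace X. g p (t p) (t p) < 0)"

definition future_timelike ::
  "('m, 4) chart set \<Rightarrow> ('m, 4) metric \<Rightarrow> ('m \<Rightarrow> ('m, 4) tvec) \<Rightarrow> 'm \<Rightarrow> ('m, 4) tvec \<Rightarrow> bool" where
  "future_timelike A g t p v \<longleftrightarrow> v \<in> tangent_space A p \<and> g p v v < 0 \<and> g p v (t p) < 0"

text \<open>
  As \<open>\<phi>\<close> need not be conformal, a timelike vector may be mapped to one that is not timelike;
  time orientations are compared only on vectors that stay timelike.
\<close>

definition preserves_time_orientation ::
  "('m, 4) chart set \<Rightarrow> 'm set \<Rightarrow> ('m, 4) metric \<Rightarrow> ('m \<Rightarrow> ('m, 4) tvec) \<Rightarrow>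
   ('k, 4) chart set \<Rightarrow> ('k, 4) metric \<Rightarrow> ('k \<Rightarrow> ('k, 4) tvec) \<Rightarrow> ('m \<Rightarrow> 'k) \<Rightarrow> bool" where
  "preserves_time_orientation A U g t B h s \<phi> \<longleftrightarrow>
     (\<forall>p\<in>U. \<forall>v. future_timelike A g t p v \<and>
          h (\<phi> p) (differential A B \<phi> p v) (differential A B \<phi> p v) < 0 \<longrightarrow>
        future_timelike B h s (\<phi> p) (differential A B \<phi> p v))"

definition pullback_metric ::
  "('m, 'n::finite) chart set \<Rightarrow> ('k, 'l::finite) chart set \<Rightarrow> ('m \<Rightarrow> 'k) \<Rightarrow> ('k, 'l) metric \<Rightarrow> ('m, 'n) metric" where
  "pullback_metric A B \<phi> h = (\<lambda>p X Y. h (\<phi> p) (differential A B \<phi> p X) (differential A B \<phi> p Y))"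

definition pd :: "'n::finite \<Rightarrow> (real^'n \<Rightarrow> 'b::real_normed_vector) \<Rightarrow> real^'n \<Rightarrow> 'b" where
  "pd i f x = frechet_derivative f (at x) (axis i 1)"

text \<open>\<open>christoffel G x k i j\<close> is \<open>\<Gamma>\<^sup>k\<^sub>i\<^sub>j\<close> of the Levi-Civita connection of the metric components \<open>G\<close>.\<close>

definition christoffel :: "(real^'n \<Rightarrow> real^'n^'n) \<Rightarrow> real^'n \<Rightarrow> 'n \<Rightarrow> 'n \<Rightarrow> 'n::finite \<Rightarrow> real" where
  "christoffel G x k i j =
     (\<Sum>l\<in>UNIV. matrix_inv (G x) $ k $ l *
        (pd i (\<lambda>y. G y $ j $ l) x + pd j (\<lambda>y. G y $ i $ l) x - pd l (\<lambda>y. G y $ i $ j) x)) / 2"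

definition christoffel_vec ::
  "(real^'n \<Rightarrow> real^'n^'n) \<Rightarrow> real^'n \<Rightarrow> real^'n \<Rightarrow> real^'n \<Rightarrow> real^'n::finite" where
  "christoffel_vec G x u v = (\<chi> k. \<Sum>i\<in>UNIV. \<Sum>j\<in>UNIV. christoffel G x k i j * u$i * v$j)"

text \<open>
  The covariant derivative \<open>\<nabla>\<^bsub>ds(w)\<^esub> m\<close>, at \<open>u\<close>, of a vector field \<open>m\<close> along a map \<open>s\<close>, in
  coordinates in which the metric is \<open>G\<close>. With \<open>s = (\<lambda>x. x)\<close> it is the covariant derivative of a
  vector field on an open set.
\<close>

definition cov_deriv ::
  "(real^'n \<Rightarrow> real^'n^'n) \<Rightarrow> ('e::real_normed_vector \<Rightarrow> real^'n) \<Rightarrow> ('e \<Rightarrow> real^'n) \<Rightarrow> 'e \<Rightarrow> 'e \<Rightarrow> real^'n::finite" where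
  "cov_deriv G s m u w =
     frechet_derivative m (at u) w + christoffel_vec G (s u) (frechet_derivative s (at u) w) (m u)"

definition hessian ::
  "('m, 'n::finite) chart set \<Rightarrow> ('m, 'n) metric \<Rightarrow> ('m, 'n) chart \<Rightarrow> ('m \<Rightarrow> real) \<Rightarrow> real^'n \<Rightarrow> real^'n^'n" where
  "hessian A g c f x =
     (\<chi> i j. pd i (pd j (f \<circ> cinv c)) x
        - (\<Sum>k\<in>UNIV. christoffel (gram A g (cinv c)) x k i j * pd k (f \<circ> cinv c) x))"


section \<open>Mean curvature\<close>

text \<open>
  \<open>k\<close> is the sum of the principal curvatures at \<open>p\<close> of the surface \<open>S\<close> in the Riemannian
  3-manifold \<open>Q\<close> (a submanifold of \<open>(X, g)\<close>, possibly with boundary, with the induced metric)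
  with respect to the unit normal field \<open>n\<close> of \<open>S\<close> in \<open>Q\<close>. Here \<open>s\<close> and \<open>m\<close> are \<open>S\<close> and \<open>n\<close> in
  coordinates \<open>\<tau>\<close> of \<open>Q\<close>, \<open>gram A g \<tau>\<close> is the induced metric, so that \<open>cov_deriv\<close> is with respect to
  the intrinsic connection of \<open>Q\<close>. The principal curvatures are the eigenvalues of the
  Weingarten map \<open>E \<mapsto> \<nabla>\<^sub>E n\<close>, with an eigenbasis \<open>w1, w2\<close> given in the parameters of \<open>S\<close>. If \<open>S\<close> is
  the boundary of \<open>Q\<close>, \<open>\<tau>\<close> is also defined on the other side, but the derivatives of \<open>gram A g \<tau>\<close>
  at boundary points are determined by the values on the half-space.
\<close>

definition is_mean_curvature ::
  "'m topology \<Rightarrow> ('m, 'n::finite) chart set \<Rightarrow> ('m, 'n) metric \<Rightarrow> 'm set \<Rightarrow> 'm set \<Rightarrow>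
   ('m \<Rightarrow> ('m, 'n) tvec) \<Rightarrow> 'm \<Rightarrow> real \<Rightarrow> bool" where
  "is_mean_curvature X A g Q S n p k \<longleftrightarrow>
     (\<exists>W \<tau> W' \<sigma> (s :: real^2 \<Rightarrow> real^3) m u w1 w2 \<kappa>1 \<kappa>2.
        local_param X A half_space Q W \<tau> \<and> local_param X A UNIV S W' \<sigma> \<and> u \<in> W' \<and> \<sigma> u = p \<and>
        s differentiable_on W' \<and> m differentiable_on W' \<and>
        (\<forall>y\<in>W'. s y \<in> W \<inter> half_space \<and> \<tau> (s y) = \<sigma> y \<and> push A \<tau> (s y) (m y) = n (\<sigma> y)) \<and>
        w1 \<noteq> w2 \<and> independent {w1, w2} \<and>
        cov_deriv (gram A g \<tau>) s m u w1 = \<kappa>1 *\<^sub>R frechet_derivative s (at u) w1 \<and>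
        cov_deriv (gram A g \<tau>) s m u w2 = \<kappa>2 *\<^sub>R frechet_derivative s (at u) w2 \<and>
        k = \<kappa>1 + \<kappa>2)"

definition mean_curvature ::
  "'m topology \<Rightarrow> ('m, 'n::finite) chart set \<Rightarrow> ('m, 'n) metric \<Rightarrow> 'm set \<Rightarrow> 'm set \<Rightarrow>
   ('m \<Rightarrow> ('m, 'n) tvec) \<Rightarrow> 'm \<Rightarrow> real" where
  "mean_curvature X A g Q S n p = (THE k. is_mean_curvature X A g Q S n p k)"

definition outward_unit_normal ::
  "'m topology \<Rightarrow> ('m, 'n::finite) chart set \<Rightarrow> ('m, 'n) metric \<Rightarrow> 'm set \<Rightarrow> 'm set \<Rightarrow> 'm \<Rightarrow> ('m, 'n) tvec \<Rightarrow> bool" where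
  "outward_unit_normal X A g \<Omega> S p v \<longleftrightarrow>
     (\<exists>W \<tau> x w. local_param X A half_space \<Omega> W \<tau> \<and> x \<in> W \<and> x$0 = 0 \<and> \<tau> x = p \<and>
        w$0 > 0 \<and> v = push A \<tau> x w) \<and>
     (\<forall>Y\<in>surface_tangent X A S p. g p v Y = 0) \<and> g p v v = 1"


section \<open>Integration over an oriented closed surface\<close>

text \<open>
  \<open>pos p Y Z\<close> says that the basis \<open>Y, Z\<close> of the tangent plane at \<open>p\<close> is positively oriented.
\<close>

definition oriented_partition ::
  "'m topology \<Rightarrow> ('m, 'n::finite) chart set \<Rightarrow> 'm set \<Rightarrow> ('m \<Rightarrow> ('m, 'n) tvec \<Rightarrow> ('m, 'n) tvec \<Rightarrow> bool) \<Rightarrow>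
   nat \<times> (nat \<Rightarrow> (real^2) set) \<times> (nat \<Rightarrow> real^2 \<Rightarrow> 'm) \<times> (nat \<Rightarrow> 'm \<Rightarrow> real) \<Rightarrow> bool" where
  "oriented_partition X A S pos = (\<lambda>(r, W, \<sigma>, f).
     (\<forall>i<r. local_param X A UNIV S (W i) (\<sigma> i) \<and>
        (\<forall>u\<in>W i. pos (\<sigma> i u) (push A (\<sigma> i) u (axis 0 1)) (push A (\<sigma> i) u (axis 1 1))) \<and>
        continuous_map (subtopology X S) euclideanreal (f i) \<and> (\<forall>p\<in>S. 0 \<le> f i p) \<and>
        subtopology X S closure_of {p \<in> S. f i p \<noteq> 0} \<subseteq> \<sigma> i ` W i) \<and>
     (\<forall>p\<in>S. (\<Sum>i<r. f i p) = 1))"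

text \<open>
  The integral of a 2-form, or of a 2-density, both given by their values on pairs of tangent
  vectors. It does not depend on the choice of the partition of unity, and one exists if \<open>S\<close> is
  compact and \<open>pos\<close> is an orientation.
\<close>

definition surface_integral ::
  "'m topology \<Rightarrow> ('m, 'n::finite) chart set \<Rightarrow> 'm set \<Rightarrow> ('m \<Rightarrow> ('m, 'n) tvec \<Rightarrow> ('m, 'n) tvec \<Rightarrow> bool) \<Rightarrow>
   ('m \<Rightarrow> ('m, 'n) tvec \<Rightarrow> ('m, 'n) tvec \<Rightarrow> real) \<Rightarrow> real" where
  "surface_integral X A S pos F =
     (let (r, W, \<sigma>, f) = (SOME P. oriented_partition X A S pos P)
      in \<Sum>i<r. LINT u:W i|lborel.
           f i (\<sigma> i u) * F (\<sigma> i u) (push A (\<sigma> i) u (axis 0 1)) (push A (\<sigma> i) u (axis 1 1)))"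

definition area_element :: "('m, 'n) metric \<Rightarrow> 'm \<Rightarrow> ('m, 'n) tvec \<Rightarrow> ('m, 'n) tvec \<Rightarrow> real" where
  "area_element g p Y Z = sqrt (g p Y Y * g p Z Z - (g p Y Z)\<^sup>2)"

text \<open>
  The orientation of \<open>S\<close> for which \<open>N, \<nu>\<close> followed by a positive basis of the tangent plane of \<open>S\<close>
  is a positive basis of the tangent space of the 4-manifold.
\<close>

definition induced_orientation ::
  "('m, 4) chart set \<Rightarrow> ('m \<Rightarrow> ('m, 4) tvec) \<Rightarrow> ('m \<Rightarrow> ('m, 4) tvec) \<Rightarrow>
   'm \<Rightarrow> ('m, 4) tvec \<Rightarrow> ('m, 4) tvec \<Rightarrow> bool" where
  "induced_orientation A N \<nu> p Y Z \<longleftrightarrow>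
     (\<forall>c\<in>A. p \<in> fst c \<longrightarrow>
        det (\<chi> i::4. if i = 0 then N p c else if i = 1 then \<nu> p c else if i = 2 then Y c else Z c) > 0)"


section \<open>The Chen-Nester-Tung quasi-local energy\<close>

definition levi_civita_symbol :: "4 \<Rightarrow> 4 \<Rightarrow> 4 \<Rightarrow> 4 \<Rightarrow> real" where
  "levi_civita_symbol a b c d =
     det (\<chi> i::4. axis (if i = 0 then a else if i = 1 then b else if i = 2 then c else d) 1)"

definition local_frame :: "'m topology \<Rightarrow> ('m, 4) chart set \<Rightarrow> 'm \<Rightarrow> ('m \<Rightarrow> 4 \<Rightarrow> ('m, 4) tvec) \<Rightarrow> bool" where
  "local_frame X A p e \<longleftrightarrow>
     (\<exists>U. openin X U \<and> p \<in> U \<and> (\<forall>a. smooth_vector_field A U (\<lambda>q. e q a)) \<and>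
        (\<forall>q\<in>U. \<forall>c\<in>A. q \<in> fst c \<longrightarrow> det (\<chi> a. e q a c) \<noteq> 0))"

text \<open>\<open>e\<^sub>b = frame_matrix $ d $ b \<partial>\<^sub>d\<close>, so the rows of the inverse matrix are the dual coframe.\<close>

definition frame_matrix :: "('m, 4) chart \<Rightarrow> ('m \<Rightarrow> 4 \<Rightarrow> ('m, 4) tvec) \<Rightarrow> 'm \<Rightarrow> real^4^4" where
  "frame_matrix c e p = (\<chi> d b. e p b c $ d)"

text \<open>\<open>conn_form A g c e p a b\<close> is \<open>\<omega>\<^sup>a\<^sub>b\<close> at \<open>p\<close>, computed in the chart \<open>c\<close> from \<open>\<nabla>e\<^sub>b = \<omega>\<^sup>a\<^sub>b \<otimes> e\<^sub>a\<close>.\<close>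

definition conn_form ::
  "('m, 4) chart set \<Rightarrow> ('m, 4) metric \<Rightarrow> ('m, 4) chart \<Rightarrow> ('m \<Rightarrow> 4 \<Rightarrow> ('m, 4) tvec) \<Rightarrow> 'm \<Rightarrow>
   4 \<Rightarrow> 4 \<Rightarrow> ('m, 4) tvec \<Rightarrow> real" where
  "conn_form A g c e p a b Y =
     (matrix_inv (frame_matrix c e p) *v
        cov_deriv (gram A g (cinv c)) (\<lambda>x. x) (\<lambda>x. e (cinv c x) b c) (snd c p) (Y c)) $ a"

text \<open>\<open>eta_coord A g c p a b\<close> is the 2-form \<open>\<eta>\<^sub>a\<^sup>b\<close> for coordinate indices, in the chart \<open>c\<close>.\<close>

definition eta_coord ::
  "('m, 4) chart set \<Rightarrow> ('m, 4) metric \<Rightarrow> ('m, 4) chart \<Rightarrow> 'm \<Rightarrow> 4 \<Rightarrow> 4 \<Rightarrow>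
   ('m, 4) tvec \<Rightarrow> ('m, 4) tvec \<Rightarrow> real" where
  "eta_coord A g c p a b Y Z =
     (let G = gram A g (cinv c) (snd c p) in
      1/2 * sqrt (- det G) *
        (\<Sum>\<beta>\<in>UNIV. \<Sum>\<mu>\<in>UNIV. \<Sum>\<nu>\<in>UNIV. matrix_inv G $ b $ \<beta> * levi_civita_symbol a \<beta> \<mu> \<nu> *
           (Y c $ \<mu> * Z c $ \<nu> - Y c $ \<nu> * Z c $ \<mu>)))"

text \<open>The same tensor-valued form with indices referring to the frame \<open>e\<close>.\<close>

definition eta_frame ::
  "('m, 4) chart set \<Rightarrow> ('m, 4) metric \<Rightarrow> ('m, 4) chart \<Rightarrow> ('m \<Rightarrow> 4 \<Rightarrow> ('m, 4) tvec) \<Rightarrow> 'm \<Rightarrow> 4 \<Rightarrow> 4 \<Rightarrow>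
   ('m, 4) tvec \<Rightarrow> ('m, 4) tvec \<Rightarrow> real" where
  "eta_frame A g c e p a b Y Z =
     (\<Sum>\<alpha>\<in>UNIV. \<Sum>\<beta>\<in>UNIV. frame_matrix c e p $ \<alpha> $ a * matrix_inv (frame_matrix c e p) $ b $ \<beta> *
        eta_coord A g c p \<alpha> \<beta> Y Z)"

text \<open>\<open>(\<omega>\<^sup>a\<^sub>b - \<omega>'\<^sup>a\<^sub>b) \<and> i\<^sub>N \<eta>\<^sub>a\<^sup>b\<close>, with \<open>\<omega>\<close>, \<open>\<omega>'\<close> the connection forms of \<open>g\<close> and \<open>g'\<close>\<close>

definition cnt_form ::
  "('m, 4) chart set \<Rightarrow> ('m, 4) metric \<Rightarrow> ('m, 4) metric \<Rightarrow> ('m, 4) chart \<Rightarrow> ('m \<Rightarrow> 4 \<Rightarrow> ('m, 4) tvec) \<Rightarrow>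
   ('m \<Rightarrow> ('m, 4) tvec) \<Rightarrow> 'm \<Rightarrow> ('m, 4) tvec \<Rightarrow> ('m, 4) tvec \<Rightarrow> real" where
  "cnt_form A g g' c e N p Y Z =
     (\<Sum>a\<in>UNIV. \<Sum>b\<in>UNIV.
        (conn_form A g c e p a b Y - conn_form A g' c e p a b Y) * eta_frame A g c e p a b (N p) Z
      - (conn_form A g c e p a b Z - conn_form A g' c e p a b Z) * eta_frame A g c e p a b (N p) Y)"

text \<open>
  \<open>c p\<close> and \<open>e p\<close> are the positively oriented coordinates and the local frame used near \<open>p\<close>; the
  integrand at \<open>p\<close> does not depend on them.
\<close>

definition cnt_energy ::
  "'m topology \<Rightarrow> ('m, 4) chart set \<Rightarrow> ('m, 4) metric \<Rightarrow> 'm set \<Rightarrow>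
   ('m \<Rightarrow> ('m, 4) tvec \<Rightarrow> ('m, 4) tvec \<Rightarrow> bool) \<Rightarrow> ('m \<Rightarrow> ('m, 4) tvec) \<Rightarrow>
   ('k, 4) chart set \<Rightarrow> ('k, 4) metric \<Rightarrow> ('m \<Rightarrow> 'k) \<Rightarrow>
   ('m \<Rightarrow> ('m, 4) chart) \<Rightarrow> ('m \<Rightarrow> 'm \<Rightarrow> 4 \<Rightarrow> ('m, 4) tvec) \<Rightarrow> real" where
  "cnt_energy X A g S pos N B h \<phi> c e =
     1 / (16 * pi) * surface_integral X A S pos
       (\<lambda>p. cnt_form A g (pullback_metric A B \<phi> h) (c p) (e p) N p)"


section \<open>De Sitter and anti-de Sitter spacetime\<close>

text \<open>
  \<open>\<epsilon> = 1\<close> gives the unit 3-sphere in Euclidean 4-space, and \<open>\<epsilon> = -1\<close> the upper sheet of the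
  unit hyperboloid in Minkowski space, i.e. hyperbolic 3-space.
\<close>

definition ambient_form :: "real \<Rightarrow> real^4 \<Rightarrow> real^4 \<Rightarrow> real" where
  "ambient_form \<epsilon> x y = \<epsilon> * x$0 * y$0 + x$1 * y$1 + x$2 * y$2 + x$3 * y$3"

definition space_form :: "real \<Rightarrow> (real^4) set" where
  "space_form \<epsilon> = {x. ambient_form \<epsilon> x x = \<epsilon> \<and> (\<epsilon> = -1 \<longrightarrow> x$0 > 0)}"

definition submanifold_atlas :: "'a::euclidean_space set \<Rightarrow> ('a, 'n::finite) chart set" where
  "submanifold_atlas Q =
     {c. openin (top_of_set Q) (fst c) \<and> open (snd c ` fst c) \<and>
         homeomorphic_map (top_of_set (fst c)) (top_of_set (snd c ` fst c)) (snd c) \<and>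
         smooth_on (snd c ` fst c) (cinv c) \<and>
         (\<forall>x\<in>snd c ` fst c. inj (frechet_derivative (cinv c) (at x)))}"

abbreviation space_form_atlas :: "real \<Rightarrow> (real^4, 3) chart set" where
  "space_form_atlas \<epsilon> \<equiv> submanifold_atlas (space_form \<epsilon>)"

definition space_form_metric :: "real \<Rightarrow> (real^4, 3) metric" where
  "space_form_metric \<epsilon> p u v =
     ambient_form \<epsilon> (ambient_vec (space_form_atlas \<epsilon>) p u) (ambient_vec (space_form_atlas \<epsilon>) p v)"

definition static_potential :: "real \<Rightarrow> (real^4 \<Rightarrow> real) \<Rightarrow> bool" where
  "static_potential \<epsilon> V \<longleftrightarrow>
     (\<exists>x\<in>space_form \<epsilon>. V x \<noteq> 0) \<and>
     (\<forall>c\<in>space_form_atlas \<epsilon>. smooth_on (snd c ` fst c) (V \<circ> cinv c) \<and>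
        (\<forall>x\<in>snd c ` fst c.
           hessian (space_form_atlas \<epsilon>) (space_form_metric \<epsilon>) c V x =
           (- \<epsilon> * V (cinv c x)) *\<^sub>R gram (space_form_atlas \<epsilon>) (space_form_metric \<epsilon>) (cinv c) x))"

definition static_spacetime :: "real \<Rightarrow> (real^4 \<Rightarrow> real) \<Rightarrow> (real \<times> (real^4)) set" where
  "static_spacetime \<epsilon> V = UNIV \<times> {x \<in> space_form \<epsilon>. V x \<noteq> 0}"

definition static_metric ::
  "real \<Rightarrow> (real^4 \<Rightarrow> real) \<Rightarrow> (real \<times> (real^4), 4) chart set \<Rightarrow> (real \<times> (real^4), 4) metric" where
  "static_metric \<epsilon> V B p u v =
     (let (a, \<xi>) = ambient_vec B p u; (b, \<zeta>) = ambient_vec B p v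
      in - (V (snd p))\<^sup>2 * a * b + ambient_form \<epsilon> \<xi> \<zeta>)"

definition time_field ::
  "(real \<times> (real^4), 4) chart set \<Rightarrow> real \<times> (real^4) \<Rightarrow> (real \<times> (real^4), 4) tvec" where
  "time_field B p = push B (\<lambda>t. (fst p + t, snd p)) (0::real) 1"

definition time_slice :: "real \<Rightarrow> (real^4 \<Rightarrow> real) \<Rightarrow> real \<Rightarrow> (real \<times> (real^4)) set" where
  "time_slice \<epsilon> V t = {t} \<times> {x \<in> space_form \<epsilon>. V x \<noteq> 0}"

end

theory Submission
  imports Defs
begin

text \<open>
  The contraction of the connection forms with \<open>\<eta>\<close> does not depend on the frame: at \<open>p \<in> S\<close> it is the
  contraction of \<open>\<eta>\<close> with the difference tensor \<open>C\<close> of the two Levi-Civita connections. Both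
  metrics agree along \<open>S\<close>, hence so do their derivatives in directions tangent to \<open>S\<close>, and for such a
  direction \<open>Y\<close> the endomorphism \<open>C\<^sub>Y\<close> is skew-symmetric, i.e. a bivector. In the basis \<open>N, \<nu>, Y, Z\<close> the
  2-form \<open>i\<^sub>N \<eta>\<close>, evaluated on a vector tangent to \<open>S\<close>, only sees the entries \<open>\<langle>\<nu>, C\<^sub>Y Z\<rangle>\<close>, which are the
  differences of the second fundamental forms of \<open>S\<close> in direction \<open>\<nu>\<close>. Their trace is \<open>k\<^sub>0 - k\<close>, because by the
  Gauss formula these second fundamental forms may be computed intrinsically in \<open>\<Omega>\<close> and in the time slice, to
  which \<open>\<nu>\<close> is tangent. The factor \<open>\<bar>V\<bar>\<close> is the length of \<open>N\<close>. That the energy is an integral at all rests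
  on the existence of a partition of unity subordinate to oriented parametrizations.
\<close>

section \<open>Calculus of \<open>C\<^sup>k\<close> maps\<close>

text \<open>The two metrics agree on \<open>S\<close> only: their derivatives transversal to
  \<open>S\<close> are unrelated, so \<open>C\<^sub>Y\<close> is skew-symmetric just for tangent
  \<open>Y\<close>. That suffices because the pulled back form evaluates the connection on tangent
  directions. Contraction with the volume form counts each skew entry twice, which turns 1/(16 pi)
  into 1/(8 pi). The Gram determinant of \<open>N, \<nu>, Y, Z\<close> turns
  \<open>sqrt (- det G)\<close>, multiplied by the volume of that basis, into the length of
  \<open>N\<close> times the area element.

  Much of the work is forced by the form of the data. Mean curvature is a definite description that
  ranges over parametrizations and eigenbases, so an eigenbasis has to be produced, and all choices
  have to lead to the same trace. The outward normal is given pointwise, by a condition that may use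
  a different parametrization at each point; its differentiability comes from an explicit formula.
  The potential is a function on a linear space whose smoothness is known only in charts of the
  space form.\<close>

abbreviation fd :: "('a::real_normed_vector \<Rightarrow> 'b::real_normed_vector) \<Rightarrow> 'a \<Rightarrow> 'a \<Rightarrow> 'b" where
  "fd f x \<equiv> frechet_derivative f (at x)"

lemma fd_eqI: "(f has_derivative f') (at x) \<Longrightarrow> fd f x = f'"
  using frechet_derivative_at by metis

lemma has_fd: "f differentiable at x \<Longrightarrow> (f has_derivative fd f x) (at x)"
  using frechet_derivative_works by blast

lemma fd_linear: "f differentiable at x \<Longrightarrow> linear (fd f x)"
  by (simp add: linear_frechet_derivative)

lemma has_derivative_cong_open:
  assumes "open S" "x \<in> S" "\<And>y. y \<in> S \<Longrightarrow> f y = g y"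
  shows "(f has_derivative D) (at x) \<longleftrightarrow> (g has_derivative D) (at x)"
proof
  show "(f has_derivative D) (at x) \<Longrightarrow> (g has_derivative D) (at x)"
    by (rule has_derivative_transform_within_open[OF _ assms])
  show "(g has_derivative D) (at x) \<Longrightarrow> (f has_derivative D) (at x)"
    by (rule has_derivative_transform_within_open[OF _ assms(1,2)]) (simp_all add: assms(3))
qed

lemma fd_cong:
  assumes "open S" "x \<in> S" "\<And>y. y \<in> S \<Longrightarrow> f y = g y"
  shows "fd f x = fd g x"
  using has_derivative_cong_open[OF assms] by (simp add: frechet_derivative_def)

lemma differentiable_cong_open:
  assumes "open S" "x \<in> S" "\<And>y. y \<in> S \<Longrightarrow> f y = g y"
  shows "f differentiable at x \<longleftrightarrow> g differentiable at x"
  using has_derivative_cong_open[OF assms] by (simp add: differentiable_def)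

lemma fd_compose:
  assumes "g differentiable at x" "f differentiable at (g x)"
  shows "fd (\<lambda>y. f (g y)) x v = fd f (g x) (fd g x v)"
  using frechet_derivative_compose[OF assms] by (simp add: o_def fun_eq_iff)

lemma differentiable_compose_at:
  "g differentiable at x \<Longrightarrow> f differentiable at (g x) \<Longrightarrow> (\<lambda>y. f (g y)) differentiable at x"
  using differentiable_chain_at[of g x f] by (simp add: o_def)

section \<open>Closure properties of the classes C^k\<close>

lemma Ck_on_Suc_open:
  "open S \<Longrightarrow> Ck_on (Suc k) f S \<longleftrightarrow> (\<forall>x\<in>S. f differentiable at x) \<and> (\<forall>v. Ck_on k (\<lambda>x. fd f x v) S)"
  by (simp add: differentiable_on_eq_differentiable_at)

declare Ck_on.simps(2) [simp del]

lemma Ck_on_differentiable: "Ck_on (Suc k) f S \<Longrightarrow> open S \<Longrightarrow> x \<in> S \<Longrightarrow> f differentiable at x"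
  by (simp add: Ck_on_Suc_open)

lemma Ck_on_cong:
  assumes "open S" "\<And>x. x \<in> S \<Longrightarrow> f x = g x"
  shows "Ck_on k f S \<longleftrightarrow> Ck_on k g S"
  using assms(2)
proof (induction k arbitrary: f g)
  case 0
  then show ?case by (auto intro!: continuous_on_cong)
next
  case (Suc k)
  have "f differentiable at x \<longleftrightarrow> g differentiable at x" if "x \<in> S" for x
    using differentiable_cong_open[OF assms(1) that] Suc.prems by blast
  moreover have "Ck_on k (\<lambda>x. fd f x v) S \<longleftrightarrow> Ck_on k (\<lambda>x. fd g x v) S" for v
    by (rule Suc.IH) (use fd_cong[OF assms(1)] Suc.prems in metis)
  ultimately show ?case
    by (simp add: Ck_on_Suc_open assms(1))
qed

text \<open>The step from \<open>Suc k\<close> to \<open>k\<close> is an induction over all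
  functions: \<open>Ck_on (Suc k)\<close> asks for differentiability and for C^k derivatives, so
  continuity comes from differentiability and the rest from the derivatives.\<close>

lemma Ck_on_mono: "Ck_on k f S \<Longrightarrow> open S \<Longrightarrow> j \<le> k \<Longrightarrow> Ck_on j f S"
proof -
  have *: "Ck_on (Suc k) f S \<Longrightarrow> Ck_on k f S" if "open S" for k and f :: "'a \<Rightarrow> 'b"
  proof (induction k arbitrary: f)
    case 0
    then show ?case using that by (simp add: Ck_on.simps(2) differentiable_imp_continuous_on)
  next
    case (Suc k)
    then show ?case by (metis Ck_on.simps(2))
  qed
  assume "Ck_on k f S" "open S" "j \<le> k"
  then show ?thesis
    by (induction k) (auto simp: le_Suc_eq dest: *)
qed

text \<open>Needed because smoothness of a map into or out of a manifold is known chart by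
  chart.\<close>

lemma Ck_on_local:
  assumes "open S" "\<And>x. x \<in> S \<Longrightarrow> \<exists>T. open T \<and> x \<in> T \<and> Ck_on k f (S \<inter> T)"
  shows "Ck_on k f S"
  using assms(2)
proof (induction k arbitrary: f)
  case 0
  then show ?case
    unfolding Ck_on.simps continuous_on_eq_continuous_at[OF assms(1)]
    using assms(1) by (metis IntI continuous_on_eq_continuous_at open_Int)
next
  case (Suc k)
  have "\<exists>T. open T \<and> x \<in> T \<and> Ck_on k (\<lambda>x. fd f x v) (S \<inter> T)" if "x \<in> S" for x v
    using Suc.prems[OF that] by (metis Ck_on.simps(2))
  moreover have "f differentiable at x" if "x \<in> S" for x
    using Suc.prems[OF that] that assms(1) by (metis Ck_on_differentiable IntI open_Int)
  ultimately show ?case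
    using Suc.IH by (simp add: Ck_on_Suc_open assms(1))
qed

lemma Ck_on_subset: "Ck_on k f S \<Longrightarrow> open S \<Longrightarrow> open T \<Longrightarrow> T \<subseteq> S \<Longrightarrow> Ck_on k f T"
proof (induction k arbitrary: f)
  case 0
  then show ?case by (auto intro: continuous_on_subset)
next
  case (Suc k)
  then show ?case
    by (simp add: Ck_on_Suc_open) blast
qed

lemma Ck_on_const [intro]: "Ck_on k (\<lambda>x. a) S"
  by (induction k arbitrary: a) (auto simp: Ck_on.simps(2))

lemma Ck_on_bounded_linear:
  assumes "bounded_linear L" shows "Ck_on k L S"
proof (cases k)
  case 0
  then show ?thesis
    using assms by (simp add: linear_continuous_on)
next
  case (Suc j)
  have "fd L x = L" for x
    using assms bounded_linear_imp_has_derivative fd_eqI by blast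
  then show ?thesis
    using assms Suc by (simp add: Ck_on.simps(2) bounded_linear_imp_differentiable_on Ck_on_const)
qed

text \<open>Any explicit derivative formula may replace \<open>frechet_derivative\<close>. The
  closure properties below are inductions in which the usual differentiation rules supply this
  formula, built from functions already known to be of class C^k.\<close>

lemma Ck_on_SucI:
  assumes "open S" "\<And>x. x \<in> S \<Longrightarrow> (f has_derivative D x) (at x)" "\<And>v. Ck_on k (\<lambda>x. D x v) S"
  shows "Ck_on (Suc k) f S"
proof -
  have "Ck_on k (\<lambda>x. fd f x v) S" for v
    by (rule iffD2[OF Ck_on_cong[OF assms(1)] assms(3)]) (simp add: fd_eqI[OF assms(2)])
  then show ?thesis
    using assms(2) by (auto simp: Ck_on_Suc_open assms(1) differentiable_def)
qed

lemma Ck_on_SucD: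
  assumes "Ck_on (Suc k) f S" "open S"
  shows "\<And>x. x \<in> S \<Longrightarrow> (f has_derivative fd f x) (at x)" "Ck_on k (\<lambda>x. fd f x v) S" "Ck_on k f S"
  using assms Ck_on_mono[OF assms, of k] by (auto simp: Ck_on_Suc_open intro: has_fd)

lemma Ck_on_linear_comp:
  assumes "bounded_linear L" "Ck_on k f S" "open S" shows "Ck_on k (\<lambda>x. L (f x)) S"
  using assms(2)
proof (induction k arbitrary: f)
  case 0
  then show ?case
    by (auto intro!: bounded_linear.continuous_on[OF assms(1)])
next
  case (Suc k)
  note * = Ck_on_SucD[OF Suc.prems assms(3)]
  show ?case
    by (rule Ck_on_SucI[OF assms(3) bounded_linear.has_derivative[OF assms(1) *(1)] Suc.IH[OF *(2)]])
qed

lemma Ck_on_add: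
  assumes "Ck_on k f S" "Ck_on k g S" "open S" shows "Ck_on k (\<lambda>x. f x + g x) S"
  using assms(1,2)
proof (induction k arbitrary: f g)
  case 0
  then show ?case by (auto intro!: continuous_intros)
next
  case (Suc k)
  note f = Ck_on_SucD[OF Suc.prems(1) assms(3)] and g = Ck_on_SucD[OF Suc.prems(2) assms(3)]
  show ?case
    by (rule Ck_on_SucI[OF assms(3) has_derivative_add[OF f(1) g(1)] Suc.IH[OF f(2) g(2)]])
qed

lemma Ck_on_sum:
  assumes "open S" "\<And>i. i \<in> I \<Longrightarrow> Ck_on k (f i) S" shows "Ck_on k (\<lambda>x. \<Sum>i\<in>I. f i x) S"
  using assms(2)
  by (induction I rule: infinite_finite_induct) (auto intro: Ck_on_add[OF _ _ assms(1)])

text \<open>In the product rule each factor appears next to the derivative of the other, so the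
  induction uses both that the derivatives are of class C^k and that the factors themselves
  are.\<close>

lemma Ck_on_bilinear:
  assumes "bounded_bilinear p" "Ck_on k f S" "Ck_on k g S" "open S"
  shows "Ck_on k (\<lambda>x. p (f x) (g x)) S"
  using assms(2,3)
proof (induction k arbitrary: f g)
  case 0
  then show ?case by (auto intro!: bounded_bilinear.continuous_on[OF assms(1)])
next
  case (Suc k)
  note f = Ck_on_SucD[OF Suc.prems(1) assms(4)] and g = Ck_on_SucD[OF Suc.prems(2) assms(4)]
  show ?case
    by (rule Ck_on_SucI[OF assms(4) bounded_bilinear.FDERIV[OF assms(1) f(1) g(1)]
          Ck_on_add[OF Suc.IH[OF f(3) g(2)] Suc.IH[OF f(2) g(3)] assms(4)]])
qed

lemmas Ck_on_mult = Ck_on_bilinear[OF bounded_bilinear_mult]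
lemmas Ck_on_scaleR = Ck_on_bilinear[OF bounded_bilinear_scaleR]
lemmas Ck_on_inner = Ck_on_bilinear[OF bounded_bilinear_inner]

lemma Ck_on_uminus:
  "Ck_on k f S \<Longrightarrow> open S \<Longrightarrow> Ck_on k (\<lambda>x. - f x) S"
  by (rule Ck_on_linear_comp[OF bounded_linear_minus[OF bounded_linear_ident]])

lemma Ck_on_diff:
  "Ck_on k f S \<Longrightarrow> Ck_on k g S \<Longrightarrow> open S \<Longrightarrow> Ck_on k (\<lambda>x. f x - g x) S"
  using Ck_on_add[of k f S "\<lambda>x. - g x"] Ck_on_uminus[of k g S] by simp

lemma Ck_on_prod:
  fixes f :: "'i \<Rightarrow> 'a::real_normed_vector \<Rightarrow> real"
  assumes "open S" "\<And>i. i \<in> I \<Longrightarrow> Ck_on k (f i) S" shows "Ck_on k (\<lambda>x. \<Prod>i\<in>I. f i x) S"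
  using assms(2)
  by (induction I rule: infinite_finite_induct) (auto intro: Ck_on_mult[OF _ _ assms(1)])

lemma linear_basis_expansion:
  fixes f :: "'a::euclidean_space \<Rightarrow> 'b::real_vector"
  assumes "linear f"
  shows "f w = (\<Sum>b\<in>Basis. (w \<bullet> b) *\<^sub>R f b)"
proof -
  have "f w = f (\<Sum>b\<in>Basis. (w \<bullet> b) *\<^sub>R b)" by (simp add: euclidean_representation)
  then show ?thesis
    using assms by (simp add: linear_sum linear_scale del: euclidean_representation)
qed

text \<open>The derivative of \<open>f\<close> at \<open>g x\<close> is a linear map depending on
  the point. Expanding its argument in a basis leaves scalar functions times directional derivatives
  of \<open>f\<close> composed with \<open>g\<close>, to which the induction applies; hence the
  Euclidean space in the middle.\<close>

lemma Ck_on_compose: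
  fixes f :: "'b::euclidean_space \<Rightarrow> 'c::real_normed_vector" and g :: "'a::real_normed_vector \<Rightarrow> 'b"
  assumes "Ck_on k f T" "Ck_on k g S" "open S" "open T" "g ` S \<subseteq> T"
  shows "Ck_on k (\<lambda>x. f (g x)) S"
  using assms(1,2)
proof (induction k arbitrary: f)
  case 0
  then show ?case using assms(5) by (auto intro: continuous_on_compose2)
next
  case (Suc k)
  note f = Ck_on_SucD[OF Suc.prems(1) assms(4)] and g = Ck_on_SucD[OF Suc.prems(2) assms(3)]
  have "((\<lambda>x. f (g x)) has_derivative (\<lambda>v. \<Sum>b\<in>Basis. (fd g x v \<bullet> b) *\<^sub>R fd f (g x) b)) (at x)"
    if x: "x \<in> S" for x
  proof -
    have *: "(f has_derivative fd f (g x)) (at (g x))"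
      using f(1) assms(5) x by blast
    have "fd f (g x) (fd g x v) = (\<Sum>b\<in>Basis. (fd g x v \<bullet> b) *\<^sub>R fd f (g x) b)" for v
      by (rule linear_basis_expansion) (use * has_derivative_linear in blast)
    then show ?thesis
      using has_derivative_compose[OF g(1)[OF x] *] by simp
  qed
  moreover have "Ck_on k (\<lambda>x. \<Sum>b\<in>Basis. (fd g x v \<bullet> b) *\<^sub>R fd f (g x) b) S" for v
    by (intro Ck_on_sum Ck_on_scaleR Ck_on_inner assms(3) g(2) Ck_on_const Suc.IH[OF f(2) g(3)])
  ultimately show ?case
    by (rule Ck_on_SucI[OF assms(3)])
qed

text \<open>The derivative of 1/f is -(1/f) f' (1/f), so the inverse reappears in its own derivative
  and the induction closes. The square root works in the same way.\<close>

lemma Ck_on_inverse: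
  fixes f :: "'a::real_normed_vector \<Rightarrow> real"
  assumes "Ck_on k f S" "open S" "\<And>x. x \<in> S \<Longrightarrow> f x \<noteq> 0"
  shows "Ck_on k (\<lambda>x. inverse (f x)) S"
  using assms(1)
proof (induction k)
  case 0
  then show ?case using assms(3) by (auto intro!: continuous_intros)
next
  case (Suc k)
  note f = Ck_on_SucD[OF Suc.prems(1) assms(2)]
  show ?case
    by (rule Ck_on_SucI[OF assms(2) Deriv.has_derivative_inverse[OF assms(3) f(1)]])
      (auto intro!: Ck_on_uminus Ck_on_mult Suc.IH f assms(2))
qed

lemma Ck_on_divide:
  fixes f g :: "'a::real_normed_vector \<Rightarrow> real"
  assumes "Ck_on k f S" "Ck_on k g S" "open S" "\<And>x. x \<in> S \<Longrightarrow> g x \<noteq> 0"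
  shows "Ck_on k (\<lambda>x. f x / g x) S"
  unfolding divide_inverse by (intro Ck_on_mult Ck_on_inverse assms)

lemma Ck_on_sqrt:
  fixes f :: "'a::real_normed_vector \<Rightarrow> real"
  assumes "Ck_on k f S" "open S" "\<And>x. x \<in> S \<Longrightarrow> f x > 0"
  shows "Ck_on k (\<lambda>x. sqrt (f x)) S"
  using assms(1)
proof (induction k)
  case 0
  then show ?case by (auto intro!: continuous_intros)
next
  case (Suc k)
  note f = Ck_on_SucD[OF Suc.prems(1) assms(2)]
  show ?case
  proof (rule Ck_on_SucI[OF assms(2), where D = "\<lambda>x v. fd f x v / (2 * sqrt (f x))"])
    show "((\<lambda>x. sqrt (f x)) has_derivative (\<lambda>v. fd f x v / (2 * sqrt (f x)))) (at x)" if "x \<in> S" for x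
      by (rule derivative_eq_intros f that assms(3) refl | simp)+ (simp add: field_simps)
    show "Ck_on k (\<lambda>x. fd f x v / (2 * sqrt (f x))) S" for v
      using assms(3) by (intro Ck_on_divide Ck_on_mult Suc.IH f assms(2) Ck_on_const) force+
  qed
qed

lemma Ck_on_vec_lambda:
  fixes f :: "'a::real_normed_vector \<Rightarrow> 'n::finite \<Rightarrow> real"
  assumes "\<And>i. Ck_on k (\<lambda>x. f x i) S" "open S" shows "Ck_on k (\<lambda>x. \<chi> i. f x i) S"
proof -
  have "(\<lambda>x. \<chi> i. f x i) = (\<lambda>x. \<Sum>i\<in>UNIV. f x i *\<^sub>R axis i 1)"
    by (auto simp: fun_eq_iff vec_eq_iff axis_def if_distrib cong: if_cong)
  then show ?thesis
    by (auto intro!: Ck_on_sum Ck_on_scaleR assms)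
qed

lemma Ck_on_det:
  fixes M :: "'a::real_normed_vector \<Rightarrow> real^'n^'n"
  assumes "\<And>i j. Ck_on k (\<lambda>x. M x $ i $ j) S" "open S" shows "Ck_on k (\<lambda>x. det (M x)) S"
  unfolding det_def by (intro Ck_on_sum Ck_on_mult Ck_on_prod assms Ck_on_const)

lemma smooth_onI: "(\<And>k. Ck_on k f S) \<Longrightarrow> smooth_on S f"
  by (simp add: smooth_on_def)

lemma smooth_onD: "smooth_on S f \<Longrightarrow> Ck_on k f S"
  by (simp add: smooth_on_def)

lemma smooth_on_subset: "smooth_on S f \<Longrightarrow> open S \<Longrightarrow> open T \<Longrightarrow> T \<subseteq> S \<Longrightarrow> smooth_on T f"
  by (meson Ck_on_subset smooth_on_def)

lemma smooth_on_cong: "open S \<Longrightarrow> (\<And>x. x \<in> S \<Longrightarrow> f x = g x) \<Longrightarrow> smooth_on S f \<longleftrightarrow> smooth_on S g"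
  unfolding smooth_on_def using Ck_on_cong[of S f g] by blast

lemma smooth_on_local:
  assumes "open S" "\<And>x. x \<in> S \<Longrightarrow> \<exists>T. open T \<and> x \<in> T \<and> smooth_on (S \<inter> T) f"
  shows "smooth_on S f"
  using assms by (meson Ck_on_local smooth_on_def)

lemma smooth_on_compose:
  fixes f :: "'b::euclidean_space \<Rightarrow> 'c::real_normed_vector" and g :: "'a::real_normed_vector \<Rightarrow> 'b"
  assumes "smooth_on T f" "smooth_on S g" "open S" "open T" "g ` S \<subseteq> T"
  shows "smooth_on S (\<lambda>x. f (g x))"
  by (rule smooth_onI, rule Ck_on_compose[OF smooth_onD[OF assms(1)] smooth_onD[OF assms(2)] assms(3-5)])

lemma smooth_on_differentiable: "smooth_on S f \<Longrightarrow> open S \<Longrightarrow> x \<in> S \<Longrightarrow> f differentiable at x"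
  using Ck_on_differentiable smooth_onD by blast

lemma smooth_on_continuous: "smooth_on S f \<Longrightarrow> continuous_on S f"
  using smooth_onD[of S f 0] by simp

lemma smooth_on_fd: "smooth_on S f \<Longrightarrow> open S \<Longrightarrow> smooth_on S (\<lambda>x. fd f x v)"
  using Ck_on_SucD(2)[of _ f S v] by (auto simp: smooth_on_def)

lemma smooth_on_bounded_linear: "bounded_linear f \<Longrightarrow> smooth_on S f"
  by (simp add: Ck_on_bounded_linear smooth_onI)

section \<open>Symmetry of second derivatives\<close>

lemma has_derivative_imp_real_derivative_line:
  fixes f :: "'a::real_normed_vector \<Rightarrow> real"
  assumes "f differentiable at (a + r *\<^sub>R v)"
  shows "((\<lambda>r. f (a + r *\<^sub>R v)) has_real_derivative fd f (a + r *\<^sub>R v) v) (at r)"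
proof -
  have "((\<lambda>r. f (a + r *\<^sub>R v)) has_derivative (\<lambda>h. fd f (a + r *\<^sub>R v) (h *\<^sub>R v))) (at r)"
    by (rule has_derivative_compose[where f="\<lambda>r. a + r *\<^sub>R v" and g=f, OF _ has_fd[OF assms]])
      (auto intro!: derivative_eq_intros)
  then show ?thesis
    unfolding has_field_derivative_def
    by (rule back_subst[where P = "\<lambda>D. (_ has_derivative D) _"])
      (auto simp: fun_eq_iff linear_scale[OF fd_linear[OF assms]])
qed

text \<open>The mean value theorem is applied once, along \<open>v\<close>, to the difference
  \<open>g\<close> of \<open>f\<close> on two opposite sides of the parallelogram. It leaves a
  difference of two values of the directional derivative \<open>F\<close>, for which
  differentiability at the single point \<open>x\<close> is enough.\<close>

lemma second_difference_quotient:
  fixes f :: "'a::real_normed_vector \<Rightarrow> real"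
  assumes W: "open W" "x \<in> W" "\<And>y. y \<in> W \<Longrightarrow> f differentiable at y"
    and D: "(\<lambda>y. fd f y v) differentiable at x" and "e > 0"
  shows "\<exists>d>0. \<forall>t. 0 < t \<and> t < d \<longrightarrow>
    \<bar>f (x + t *\<^sub>R v + t *\<^sub>R w) - f (x + t *\<^sub>R v) - f (x + t *\<^sub>R w) + f x
      - t\<^sup>2 * fd (\<lambda>y. fd f y v) x w\<bar> \<le> e * t\<^sup>2"
proof -
  define F where "F y = fd f y v" for y
  define L where "L = fd F x"
  have L: "(F has_derivative L) (at x)"
    unfolding L_def using has_fd[OF D] by (simp add: F_def[abs_def])
  interpret L: bounded_linear L using L has_derivative_bounded_linear by blast
  \<comment> \<open>Every point of the parallelogram with sides \<open>t *\<^sub>R v\<close> and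
    \<open>t *\<^sub>R w\<close> is within \<open>t * m\<close> of \<open>x\<close>. With
    \<open>e' = e / (2 * m)\<close> each of the two linearization errors of \<open>F\<close> is at
    most \<open>e * t / 2\<close>.\<close>
  define m where "m = norm v + norm w + 1"
  have m: "m > 0" "norm v + norm w \<le> m" by (auto simp: m_def add_nonneg_pos)
  define e' where "e' = e / (2 * m)"
  have "e' > 0" using m \<open>e > 0\<close> by (simp add: e'_def)
  then obtain d1 where d1: "d1 > 0" "\<And>y. norm (y - x) < d1 \<Longrightarrow> norm (F y - F x - L (y - x)) \<le> e' * norm (y - x)"
    using L unfolding has_derivative_at_alt by metis
  obtain d2 where d2: "d2 > 0" "ball x d2 \<subseteq> W"
    using W openE by blast
  define d where "d = min d1 d2 / m"
  have "d > 0" using d1 d2 m by (simp add: d_def)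
  moreover have "\<bar>f (x + t *\<^sub>R v + t *\<^sub>R w) - f (x + t *\<^sub>R v) - f (x + t *\<^sub>R w) + f x - t\<^sup>2 * L w\<bar> \<le> e * t\<^sup>2"
    if t: "0 < t" "t < d" for t
  proof -
    have tm: "t * m < d1" "t * m < d2"
      using t m by (auto simp: d_def field_simps)
    have nb: "norm (a *\<^sub>R (t *\<^sub>R v) + b *\<^sub>R t *\<^sub>R w) \<le> t * m" if "0 \<le> a" "a \<le> 1" "0 \<le> b" "b \<le> 1" for a b
    proof -
      have "norm (a *\<^sub>R (t *\<^sub>R v) + b *\<^sub>R t *\<^sub>R w) \<le> a * (t * norm v) + b * (t * norm w)"
        using norm_triangle_ineq[of "a *\<^sub>R t *\<^sub>R v" "b *\<^sub>R t *\<^sub>R w"] that t by simp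
      also have "\<dots> \<le> 1 * (t * norm v) + 1 * (t * norm w)"
        by (intro add_mono mult_right_mono) (use that t in auto)
      also have "\<dots> \<le> t * m" using m(2) t by (simp add: distrib_left[symmetric])
      finally show ?thesis .
    qed
    define g where "g s = f ((x + t *\<^sub>R w) + s *\<^sub>R (t *\<^sub>R v)) - f (x + s *\<^sub>R (t *\<^sub>R v))" for s
    have inW: "x + t *\<^sub>R w + s *\<^sub>R t *\<^sub>R v \<in> W" "x + s *\<^sub>R t *\<^sub>R v \<in> W" if "0 \<le> s" "s \<le> 1" for s
      using nb[of s 1] nb[of s 0] that tm d2(2) by (auto simp: subset_iff dist_norm norm_minus_commute algebra_simps)
    have der: "(g has_real_derivative (fd f ((x + t *\<^sub>R w) + s *\<^sub>R t *\<^sub>R v) (t *\<^sub>R v) - fd f (x + s *\<^sub>R t *\<^sub>R v) (t *\<^sub>R v))) (at s)"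
      if "0 \<le> s" "s \<le> 1" for s
      unfolding g_def using inW[OF that] W(3)
      by (intro DERIV_diff has_derivative_imp_real_derivative_line) auto
    obtain s where s: "0 < s" "s < 1"
      "g 1 - g 0 = (1 - 0) * (fd f ((x + t *\<^sub>R w) + s *\<^sub>R t *\<^sub>R v) (t *\<^sub>R v) - fd f (x + s *\<^sub>R t *\<^sub>R v) (t *\<^sub>R v))"
      using MVT2[of 0 1 g "\<lambda>s. fd f ((x + t *\<^sub>R w) + s *\<^sub>R t *\<^sub>R v) (t *\<^sub>R v) - fd f (x + s *\<^sub>R t *\<^sub>R v) (t *\<^sub>R v)"] der
      by auto
    define y1 y2 where "y1 = (x + t *\<^sub>R w) + s *\<^sub>R t *\<^sub>R v" and "y2 = x + s *\<^sub>R t *\<^sub>R v"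
    have g1: "g 1 - g 0 = t * (F y1 - F y2)"
      using s W(3) inW[of s] by (simp add: F_def y1_def y2_def linear_scale[OF fd_linear] right_diff_distrib)
    have g2: "g 1 - g 0 = f (x + t *\<^sub>R v + t *\<^sub>R w) - f (x + t *\<^sub>R v) - f (x + t *\<^sub>R w) + f x"
      by (simp add: g_def algebra_simps)
    have Lw: "L (y1 - x) - L (y2 - x) = t * L w"
      by (simp add: y1_def y2_def L.scaleR L.add L.diff)
    have e': "e' * (t * m) = e * t / 2" using m by (simp add: e'_def)
    have eb: "norm (F y - F x - L (y - x)) \<le> e * t / 2" if "norm (y - x) \<le> t * m" for y
      using d1(2)[of y] that tm mult_left_mono[OF that, of e'] \<open>e' > 0\<close> e' by linarith
    have "norm (F y1 - F x - L (y1 - x)) \<le> e * t / 2"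
      by (rule eb) (use nb[of s 1] s in \<open>auto simp: y1_def algebra_simps\<close>)
    moreover have "norm (F y2 - F x - L (y2 - x)) \<le> e * t / 2"
      by (rule eb) (use nb[of s 0] s in \<open>auto simp: y2_def algebra_simps\<close>)
    ultimately have le: "\<bar>(F y1 - F y2) - t * L w\<bar> \<le> e * t"
      using Lw unfolding real_norm_def abs_le_iff by linarith
    have eq: "f (x + t *\<^sub>R v + t *\<^sub>R w) - f (x + t *\<^sub>R v) - f (x + t *\<^sub>R w) + f x = t * (F y1 - F y2)"
      using g1 g2 by simp
    have "t * (F y1 - F y2) - t\<^sup>2 * L w = t * ((F y1 - F y2) - t * L w)"
      by (simp add: power2_eq_square right_diff_distrib)
    moreover have "\<bar>t * ((F y1 - F y2) - t * L w)\<bar> = t * \<bar>(F y1 - F y2) - t * L w\<bar>"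
      using t by (simp add: abs_mult)
    moreover have "t * \<bar>(F y1 - F y2) - t * L w\<bar> \<le> t * (e * t)"
      using t le by (intro mult_left_mono) auto
    moreover have "t * (e * t) = e * t\<^sup>2"
      by (simp add: power2_eq_square)
    ultimately show ?thesis
      unfolding eq by linarith
  qed
  ultimately show ?thesis
    unfolding L_def F_def by blast
qed

text \<open>The second difference is symmetric in \<open>v\<close> and \<open>w\<close>, so it
  approximates both mixed derivatives up to \<open>e * t\<^sup>2\<close>.\<close>

lemma fd_fd_symmetric_real:
  fixes f :: "'a::real_normed_vector \<Rightarrow> real"
  assumes "open W" "x \<in> W" "\<And>y. y \<in> W \<Longrightarrow> f differentiable at y"
    and "(\<lambda>y. fd f y v) differentiable at x" "(\<lambda>y. fd f y w) differentiable at x"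
  shows "fd (\<lambda>y. fd f y v) x w = fd (\<lambda>y. fd f y w) x v"
proof -
  let ?a = "fd (\<lambda>y. fd f y v) x w" and ?b = "fd (\<lambda>y. fd f y w) x v"
  have "\<bar>?a - ?b\<bar> \<le> 2 * e" if e: "e > 0" for e
  proof -
    obtain d where d: "d > 0" "\<And>t. 0 < t \<and> t < d \<Longrightarrow>
      \<bar>f (x + t *\<^sub>R v + t *\<^sub>R w) - f (x + t *\<^sub>R v) - f (x + t *\<^sub>R w) + f x - t\<^sup>2 * ?a\<bar> \<le> e * t\<^sup>2"
      using second_difference_quotient[OF assms(1-4) e, of w] by blast
    obtain d' where d': "d' > 0" "\<And>t. 0 < t \<and> t < d' \<Longrightarrow>
      \<bar>f (x + t *\<^sub>R w + t *\<^sub>R v) - f (x + t *\<^sub>R w) - f (x + t *\<^sub>R v) + f x - t\<^sup>2 * ?b\<bar> \<le> e * t\<^sup>2"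
      using second_difference_quotient[OF assms(1-3,5) e, of v] by blast
    define t where "t = min d d' / 2"
    have t: "0 < t \<and> t < d" "0 < t \<and> t < d'" using d(1) d'(1) by (auto simp: t_def)
    have "\<bar>t\<^sup>2 * ?a - t\<^sup>2 * ?b\<bar> \<le> 2 * e * t\<^sup>2"
      using d(2)[OF t(1)] d'(2)[OF t(2)] by (simp add: algebra_simps abs_le_iff)
    then have "t\<^sup>2 * \<bar>?a - ?b\<bar> \<le> t\<^sup>2 * (2 * e)"
      by (simp add: right_diff_distrib[symmetric] abs_mult mult.commute)
    then show ?thesis using t by simp
  qed
  \<comment> \<open>With a quarter of the gap as \<open>e\<close>, the gap is at most half of
    itself.\<close>
  from this[of "\<bar>?a - ?b\<bar> / 4"] show ?thesis by (cases "?a = ?b") auto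
qed

lemma fd_fd_symmetric:
  fixes f :: "'a::real_normed_vector \<Rightarrow> 'b::euclidean_space"
  assumes "open W" "x \<in> W" "\<And>y. y \<in> W \<Longrightarrow> f differentiable at y"
    and "\<And>v. (\<lambda>y. fd f y v) differentiable at x"
  shows "fd (\<lambda>y. fd f y v) x w = fd (\<lambda>y. fd f y w) x v"
proof (rule euclidean_eqI)
  fix b :: 'b assume "b \<in> Basis"
  have i: "fd (\<lambda>y. g y \<bullet> b) y z = fd g y z \<bullet> b" if "g differentiable at y" for g :: "'a \<Rightarrow> 'b" and y z
    using fd_eqI[OF has_derivative_inner_left[OF has_fd[OF that]]] by simp
  have di: "(\<lambda>y. g y \<bullet> b) differentiable at y" if "g differentiable at y" for g :: "'a \<Rightarrow> 'b" and y
    using that unfolding differentiable_def by (blast intro: has_derivative_inner_left)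
  have *: "fd (\<lambda>y. fd (\<lambda>y. f y \<bullet> b) y v) x = fd (\<lambda>y. fd f y v \<bullet> b) x"
    and **: "(\<lambda>y. fd (\<lambda>y. f y \<bullet> b) y v) differentiable at x" for v
     apply (rule fd_cong[OF assms(1,2)]) using assms(3) i apply blast
    using differentiable_cong_open[OF assms(1,2), of "\<lambda>y. fd (\<lambda>y. f y \<bullet> b) y v" "\<lambda>y. fd f y v \<bullet> b"] assms(3) i
      di[OF assms(4)] by blast
  show "fd (\<lambda>y. fd f y v) x w \<bullet> b = fd (\<lambda>y. fd f y w) x v \<bullet> b"
    using fd_fd_symmetric_real[OF assms(1,2), of "\<lambda>y. f y \<bullet> b" v w] assms(3,4) di ** by (simp add: * i)
qed

lemma smooth_on_fd_fd_symmetric: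
  fixes f :: "'a::real_normed_vector \<Rightarrow> 'b::euclidean_space"
  assumes "smooth_on W f" "open W" "x \<in> W"
  shows "fd (\<lambda>y. fd f y v) x w = fd (\<lambda>y. fd f y w) x v"
  using assms by (intro fd_fd_symmetric[OF assms(2,3)]) (auto intro: smooth_on_differentiable smooth_on_fd)

section \<open>Dividing out an immersion\<close>

text \<open>The error of \<open>s\<close> is \<open>L\<close> applied to the remainder of
  \<open>g\<close> minus the remainder of \<open>f\<close>. The latter is small compared with
  \<open>s z - s u\<close>, which is bounded by the error itself plus a multiple of
  \<open>z - u\<close>, so it can be absorbed on the left. Continuity of \<open>s\<close> is thus
  enough, and the derivative may be taken within an arbitrary set \<open>T\<close>, such as a piece
  of a half-space.\<close>

lemma has_derivative_factor:
  fixes f :: "'a::real_normed_vector \<Rightarrow> 'b::real_normed_vector" and s :: "'e::real_normed_vector \<Rightarrow> 'a"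
  assumes f: "(f has_derivative f') (at (s u))" and L: "bounded_linear L" "\<And>v. L (f' v) = v"
    and g: "(g has_derivative g') (at u within T)"
    and s: "continuous (at u within T) s"
    and eq: "\<And>z. z \<in> T \<Longrightarrow> f (s z) = g z" "f (s u) = g u"
  shows "(s has_derivative (\<lambda>v. L (g' v))) (at u within T)"
  unfolding has_derivative_within_alt
proof (intro conjI allI impI)
  have Lg: "bounded_linear (\<lambda>v. L (g' v))"
    using bounded_linear_compose[OF L(1)] g has_derivative_bounded_linear by blast
  then show "bounded_linear (\<lambda>v. L (g' v))" .
  obtain K where K: "K > 0" "\<And>x. norm (L x) \<le> norm x * K"
    using bounded_linear.pos_bounded[OF L(1)] by blast
  obtain M where M: "M > 0" "\<And>x. norm (L (g' x)) \<le> norm x * M"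
    using bounded_linear.pos_bounded[OF Lg] by blast
  interpret L: bounded_linear L by fact
  fix e :: real assume "e > 0"
  \<comment> \<open>The first bound makes \<open>K * c\<close> at most 1/2, so that the error term
    on the right can be absorbed; the second makes the remaining factor at most
    \<open>e\<close>.\<close>
  define c where "c = min (1 / (2 * K)) (e / (2 * K * (M + 1)))"
  have KM: "2 * K > 0" "2 * K * (M + 1) > 0" using K(1) M(1) by simp_all
  have "c > 0" using KM \<open>e > 0\<close> by (simp add: c_def)
  moreover have "c * (2 * K) \<le> 1"
    using KM(1) pos_le_divide_eq[of "2 * K" c 1] by (simp add: c_def)
  moreover have "c * (2 * K * (M + 1)) \<le> e"
    using KM(2) pos_le_divide_eq[of "2 * K * (M + 1)" c e] by (simp add: c_def)
  ultimately have c: "c > 0" "2 * (K * c) \<le> 1" "2 * (K * c) * (M + 1) \<le> e"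
    by (simp_all add: mult_ac)
  obtain d1 where d1: "d1 > 0" "\<And>y. norm (y - s u) < d1 \<Longrightarrow> norm (f y - f (s u) - f' (y - s u)) \<le> c * norm (y - s u)"
    using f c unfolding has_derivative_at_alt by metis
  obtain d2 where d2: "d2 > 0" "\<And>y. y \<in> T \<Longrightarrow> norm (y - u) < d2 \<Longrightarrow> norm (g y - g u - g' (y - u)) \<le> c * norm (y - u)"
    using g c unfolding has_derivative_within_alt by metis
  obtain d3 where d3: "d3 > 0" "\<And>y. y \<in> T \<Longrightarrow> norm (y - u) < d3 \<Longrightarrow> norm (s y - s u) < d1"
    using s d1 unfolding continuous_within_eps_delta dist_norm by metis
  have "norm (s z - s u - L (g' (z - u))) \<le> e * norm (z - u)" if z: "z \<in> T" "norm (z - u) < min d2 d3" for z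
  proof -
    let ?X = "norm (s z - s u - L (g' (z - u)))"
    have eq': "s z - s u - L (g' (z - u)) = L ((g z - g u - g' (z - u)) - (f (s z) - f (s u) - f' (s z - s u)))"
      using eq z by (simp add: L.diff L(2))
    have "?X \<le> norm ((g z - g u - g' (z - u)) - (f (s z) - f (s u) - f' (s z - s u))) * K"
      unfolding eq' by (rule K(2))
    also have "\<dots> \<le> (c * norm (z - u) + c * norm (s z - s u)) * K"
      using d2(2)[of z] d1(2)[of "s z"] d3(2)[of z] z K(1)
      by (intro mult_right_mono order_trans[OF norm_triangle_ineq4]) auto
    finally have 1: "?X \<le> (K * c) * (norm (z - u) + norm (s z - s u))"
      by (simp add: algebra_simps)
    have 2: "norm (s z - s u) \<le> ?X + norm (z - u) * M"
      using norm_triangle_ineq[of "s z - s u - L (g' (z - u))" "L (g' (z - u))"] M(2)[of "z - u"] by simp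
    have "(K * c) * (norm (z - u) + norm (s z - s u)) \<le> (K * c) * (norm (z - u) * (M + 1) + ?X)"
      by (rule mult_left_mono) (use 2 K(1) c(1) in \<open>auto simp: algebra_simps\<close>)
    then have "?X \<le> (K * c) * (norm (z - u) * (M + 1) + ?X)"
      using 1 by linarith
    moreover have "(K * c) * ?X \<le> (1/2) * ?X"
      by (rule mult_right_mono) (use c in auto)
    ultimately have "?X \<le> (2 * (K * c) * (M + 1)) * norm (z - u)"
      by (simp add: algebra_simps)
    also have "\<dots> \<le> e * norm (z - u)"
      using c by (intro mult_right_mono) auto
    finally show ?thesis .
  qed
  then show "\<exists>d>0. \<forall>y\<in>T. norm (y - u) < d \<longrightarrow> norm (s y - s u - L (g' (y - u))) \<le> e * norm (y - u)"
    using d2(1) d3(1) by (intro exI[of _ "min d2 d3"]) auto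
qed

lemma linear_inj_left_inverse:
  fixes f :: "'a::euclidean_space \<Rightarrow> 'b::euclidean_space"
  assumes "linear f" "inj f" obtains L where "bounded_linear L" "\<And>v. L (f v) = v"
  using linear_injective_left_inverse[OF assms]
  by (metis comp_apply id_apply linear_conv_bounded_linear)

lemma differentiable_factor:
  fixes f :: "'a::euclidean_space \<Rightarrow> 'b::euclidean_space" and s :: "'e::real_normed_vector \<Rightarrow> 'a"
  assumes "f differentiable at (s u)" "inj (fd f (s u))" "g differentiable at u" "isCont s u"
    and eq: "open T" "u \<in> T" "\<And>z. z \<in> T \<Longrightarrow> f (s z) = g z"
  shows "s differentiable at u" "fd f (s u) (fd s u v) = fd g u v"
proof -
  obtain L where L: "bounded_linear L" "\<And>v. L (fd f (s u) v) = v"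
    using linear_inj_left_inverse[OF fd_linear[OF assms(1)] assms(2)] by blast
  have "(s has_derivative (\<lambda>v. L (fd g u v))) (at u within T)"
    by (rule has_derivative_factor[where f=f and g=g and s=s, OF has_fd[OF assms(1)] L])
      (use assms in \<open>auto intro: has_derivative_at_withinI[OF has_fd] continuous_at_imp_continuous_at_within\<close>)
  then show "s differentiable at u"
    using at_within_open[OF eq(2,1)] by (auto simp: differentiable_def)
  then have "fd (\<lambda>z. f (s z)) u v = fd f (s u) (fd s u v)"
    using assms by (intro fd_compose) auto
  then show "fd f (s u) (fd s u v) = fd g u v"
    using fd_cong[OF eq(1,2), of "\<lambda>z. f (s z)" g] eq(3) by simp
qed

text \<open>The derivative of the factor solves the normal equations, by Cramer's rule.\<close>

lemma smooth_on_factor: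
  fixes f :: "real^'k \<Rightarrow> 'b::euclidean_space" and s :: "'e::real_normed_vector \<Rightarrow> real^'k"
  assumes f: "open W" "smooth_on W f" "\<And>x. x \<in> W \<Longrightarrow> inj (fd f x)"
    and g: "open V" "smooth_on V g" and s: "continuous_on V s" "s ` V \<subseteq> W"
    and eq: "\<And>z. z \<in> V \<Longrightarrow> f (s z) = g z"
  shows "smooth_on V s"
proof (rule smooth_onI)
  have d: "s differentiable at z" "fd f (s z) (fd s z v) = fd g z v" if z: "z \<in> V" for z v
  proof -
    have sz: "s z \<in> W" using s z by blast
    note * = smooth_on_differentiable[OF f(2,1) sz] f(3)[OF sz] smooth_on_differentiable[OF g(2,1) z]
    have "isCont s z" using s(1) z g(1) by (simp add: continuous_on_eq_continuous_at)
    note ** = differentiable_factor[OF * this g(1) z eq]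
    show "s differentiable at z" "fd f (s z) (fd s z v) = fd g z v" using ** by blast+
  qed
  define M :: "real^'k \<Rightarrow> real^'k^'k" where "M y = (\<chi> i j. fd f y (axis i 1) \<bullet> fd f y (axis j 1))" for y
  define b :: "'e \<Rightarrow> 'e \<Rightarrow> real^'k" where "b v z = (\<chi> i. fd f (s z) (axis i 1) \<bullet> fd g z v)" for v z
  have exp: "fd f y w = (\<Sum>j\<in>UNIV. (w $ j) *\<^sub>R fd f y (axis j 1))" if "y \<in> W" for y w
  proof -
    have "linear (fd f y)" using that f smooth_on_differentiable fd_linear by blast
    then show ?thesis
      by (subst basis_expansion[symmetric, of w]) (simp add: linear_sum linear_scale scalar_mult_eq_scaleR del: basis_expansion)
  qed
  have Mv: "(M y *v w) $ i = fd f y (axis i 1) \<bullet> fd f y w" if "y \<in> W" for y w i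
    by (simp add: M_def matrix_vector_mult_def exp[OF that, of w] inner_sum_right mult.commute)
  have ex_inner: "fd f y w \<bullet> a = (\<Sum>j\<in>UNIV. w $ j * (fd f y (axis j 1) \<bullet> a))" if "y \<in> W" for y w a
    using arg_cong[OF exp[OF that, of w], of "\<lambda>z. z \<bullet> a"] by (simp add: inner_sum_left)
  have wM: "w \<bullet> (M y *v w) = fd f y w \<bullet> fd f y w" if "y \<in> W" for y w
    by (simp add: ex_inner[OF that, of w "fd f y w"] Mv[OF that] inner_vec_def)
  \<comment> \<open>The quadratic form of \<open>M y\<close> is the squared length of
    \<open>fd f y w\<close>, so injectivity of the derivative makes the normal equations uniquely
    solvable.\<close>
  have det: "det (M y) \<noteq> 0" if "y \<in> W" for y
  proof -
    have "w = 0" if w: "M y *v w = 0" for w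
      using wM[OF \<open>y \<in> W\<close>, of w] w f(3)[OF \<open>y \<in> W\<close>] linear_0[OF fd_linear, of f y]
        smooth_on_differentiable[OF f(2,1) \<open>y \<in> W\<close>] injD[of "fd f y" w 0] by simp
    then show ?thesis
      by (metis invertible_det_nz matrix_left_invertible_ker invertible_left_inverse)
  qed
  fix k show "Ck_on k s V"
  proof (induction k)
    case 0
    then show ?case using s by simp
  next
    case (Suc k)
    \<comment> \<open>Bootstrapping: the solution contains \<open>s\<close> but no derivative of
      \<open>s\<close>, so \<open>s\<close> of class C^k has derivatives of class C^k.\<close>
    have sol: "fd s z v = (\<chi> j. det (\<chi> i l. if l = j then b v z $ i else M (s z) $ i $ l) / det (M (s z)))"
      if "z \<in> V" for z v
      using cramer[of "M (s z)" "fd s z v" "b v z"] det Mv[of "s z" "fd s z v"] d[OF that] s that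
      by (auto simp: b_def vec_eq_iff)
    have fk: "Ck_on k (\<lambda>z. fd f (s z) w) V" for w
      by (rule Ck_on_compose[OF _ Suc g(1) f(1) s(2)]) (use smooth_on_fd[OF f(2,1)] smooth_onD in blast)
    have gk: "Ck_on k (\<lambda>z. fd g z v) V" for v
      using smooth_on_fd[OF g(2,1)] smooth_onD by blast
    have "Ck_on k (\<lambda>z. \<chi> j. det (\<chi> i l. if l = j then b v z $ i else M (s z) $ i $ l) / det (M (s z))) V" for v
    proof (intro Ck_on_vec_lambda Ck_on_divide Ck_on_det g(1))
      show "det (M (s z)) \<noteq> 0" if "z \<in> V" for z
        using det s that by auto
      show M: "Ck_on k (\<lambda>z. M (s z) $ i $ j) V" for i j
        by (simp add: M_def) (intro Ck_on_inner fk g(1))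
      show "Ck_on k (\<lambda>z. (\<chi> i l. if l = j then b v z $ i else M (s z) $ i $ l) $ i $ l) V" for i j l
        by (cases "l = j") (simp_all add: b_def M Ck_on_inner fk gk g(1))
    qed
    note * = iffD2[OF Ck_on_cong[OF g(1) sol] this]
    show ?case
      by (rule Ck_on_SucI[OF g(1) has_fd[OF d(1)] *])
  qed
qed

section \<open>Metric components and Christoffel symbols\<close>

text \<open>A bare bilinear form, so that the same notation covers Lorentzian and Riemannian
  components and also the derivatives of a metric, which are neither definite nor invertible in
  general.\<close>

definition ip :: "real^'n^'n \<Rightarrow> real^'n \<Rightarrow> real^'n \<Rightarrow> real" where
  "ip G a b = a \<bullet> (G *v b)"

lemma ip_linear [simp]:
  "ip G (a + b) c = ip G a c + ip G b c" "ip G a (b + c) = ip G a b + ip G a c"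
  "ip G (r *\<^sub>R a) c = r * ip G a c" "ip G a (r *\<^sub>R c) = r * ip G a c"
  "ip G (a - b) c = ip G a c - ip G b c" "ip G a (b - c) = ip G a b - ip G a c"
  "ip G (- a) c = - ip G a c" "ip G a (- c) = - ip G a c"
  "ip G 0 c = 0" "ip G a 0 = 0"
  by (simp_all add: ip_def inner_add_left inner_add_right matrix_vector_right_distrib matrix_vector_mult_scaleR
      inner_diff_left inner_diff_right matrix_vector_mult_diff_distrib vec.neg)

lemma ip_sum_left: "ip G (\<Sum>i\<in>I. f i) c = (\<Sum>i\<in>I. ip G (f i) c)"
  by (induction I rule: infinite_finite_induct) auto

lemma ip_sum_right: "ip G c (\<Sum>i\<in>I. f i) = (\<Sum>i\<in>I. ip G c (f i))"
  by (induction I rule: infinite_finite_induct) auto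

lemma ip_axis: "ip G (axis i 1) (axis j 1) = G $ i $ j"
  by (simp add: ip_def inner_axis' matrix_vector_mult_basis column_def)

lemma ip_expand: "ip G a b = (\<Sum>i\<in>UNIV. \<Sum>j\<in>UNIV. a $ i * b $ j * G $ i $ j)"
  by (simp add: ip_def inner_vec_def matrix_vector_mult_def sum_distrib_left mult_ac)

lemma bounded_bilinear_matrix_vector_mult:
  "bounded_bilinear ((*v) :: real^'n^'m \<Rightarrow> real^'n \<Rightarrow> real^'m)"
proof -
  have "bilinear ((*v) :: real^'n^'m \<Rightarrow> real^'n \<Rightarrow> real^'m)"
    unfolding bilinear_def
    by (auto intro!: linearI simp: matrix_vector_right_distrib matrix_vector_mult_scaleR
        matrix_vector_mult_add_rdistrib scaleR_matrix_vector_assoc)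
  then show ?thesis
    by (simp add: bilinear_conv_bounded_bilinear)
qed

lemma has_derivative_ip:
  assumes "(G has_derivative G') (at x)" "(a has_derivative a') (at x)" "(b has_derivative b') (at x)"
  shows "((\<lambda>y. ip (G y) (a y) (b y)) has_derivative
    (\<lambda>v. ip (G' v) (a x) (b x) + ip (G x) (a' v) (b x) + ip (G x) (a x) (b' v))) (at x)"
  unfolding ip_def
  using has_derivative_inner[OF assms(2) bounded_bilinear.FDERIV[OF bounded_bilinear_matrix_vector_mult assms(1,3)]]
  by (simp add: inner_add_right add_ac)

lemma differentiable_vec_lambda:
  fixes f :: "'a::real_normed_vector \<Rightarrow> 'n::finite \<Rightarrow> 'b::euclidean_space"
  assumes "\<And>i. (\<lambda>x. f x i) differentiable at x"
  shows "(\<lambda>x. \<chi> i. f x i) differentiable at x"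
proof -
  have "((\<lambda>x. \<chi> i. f x i) has_derivative (\<lambda>v. \<chi> i. fd (\<lambda>x. f x i) x v)) (at x)"
    unfolding has_derivative_componentwise_within[of "\<lambda>x. \<chi> i. f x i"]
    by (auto simp: Basis_vec_def inner_axis intro!: has_derivative_inner_left has_fd assms)
  then show ?thesis
    by (auto simp: differentiable_def)
qed

lemma pd_matrix_entry:
  assumes "G differentiable at x"
  shows "pd i (\<lambda>y. G y $ j $ l) x = fd G x (axis i 1) $ j $ l"
  unfolding pd_def
  by (subst fd_eqI[OF bounded_linear.has_derivative[OF bounded_linear_vec_nth
          bounded_linear.has_derivative[OF bounded_linear_vec_nth has_fd[OF assms]]]]) simp

lemma matrix_inv_right: "invertible A \<Longrightarrow> A ** matrix_inv A = mat 1"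
  and matrix_inv_left: "invertible A \<Longrightarrow> matrix_inv A ** A = mat 1"
  unfolding invertible_def matrix_inv_def by (metis (mono_tags, lifting) someI_ex)+

text \<open>Christoffel symbols of the first kind.\<close>

definition chr :: "(real^'n \<Rightarrow> real^'n^'n) \<Rightarrow> real^'n \<Rightarrow> real^'n \<Rightarrow> real^'n \<Rightarrow> real^'n \<Rightarrow> real" where
  "chr G x a b z = (ip (fd G x a) b z + ip (fd G x b) a z - ip (fd G x z) a b) / 2"

lemma linear_axis_expansion:
  fixes f :: "real^'n \<Rightarrow> 'b::real_vector"
  assumes "linear f" shows "f w = (\<Sum>i\<in>UNIV. w $ i *\<^sub>R f (axis i 1))"
proof -
  have "f w = f (\<Sum>i\<in>UNIV. w $ i *\<^sub>R axis i 1)"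
    using basis_expansion[of w] by (simp add: scalar_mult_eq_scaleR)
  then show ?thesis
    using assms by (simp add: linear_sum linear_scale)
qed

lemma sum_rotate: "(\<Sum>i\<in>I. \<Sum>j\<in>J. \<Sum>l\<in>L. f i j l) = (\<Sum>l\<in>L. \<Sum>i\<in>I. \<Sum>j\<in>J. f i j l)"
proof -
  have "(\<Sum>i\<in>I. \<Sum>j\<in>J. \<Sum>l\<in>L. f i j l) = (\<Sum>i\<in>I. \<Sum>l\<in>L. \<Sum>j\<in>J. f i j l)"
    by (rule sum.cong[OF refl], rule sum.swap)
  also have "\<dots> = (\<Sum>l\<in>L. \<Sum>i\<in>I. \<Sum>j\<in>J. f i j l)"
    by (rule sum.swap)
  finally show ?thesis .
qed

lemma ip_fd_expand:
  assumes "G differentiable at x"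
  shows "ip (fd G x a) b z = (\<Sum>i\<in>UNIV. \<Sum>j\<in>UNIV. \<Sum>l\<in>UNIV. a $ i * b $ j * z $ l * fd G x (axis i 1) $ j $ l)"
proof -
  have "fd G x a = (\<Sum>i\<in>UNIV. a $ i *\<^sub>R fd G x (axis i 1))"
    by (rule linear_axis_expansion[OF fd_linear[OF assms]])
  then have "ip (fd G x a) b z = (\<Sum>j\<in>UNIV. \<Sum>l\<in>UNIV. \<Sum>i\<in>UNIV. a $ i * b $ j * z $ l * fd G x (axis i 1) $ j $ l)"
    by (simp add: ip_expand sum_distrib_left mult_ac)
  also have "\<dots> = (\<Sum>i\<in>UNIV. \<Sum>j\<in>UNIV. \<Sum>l\<in>UNIV. a $ i * b $ j * z $ l * fd G x (axis i 1) $ j $ l)"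
    by (rule sum_rotate)
  finally show ?thesis .
qed

text \<open>Lowering the index cancels \<open>matrix_inv\<close>. From here on the connection is
  handled through the Koszul expression \<open>chr\<close>, without index sums.\<close>

lemma ip_christoffel_vec:
  assumes "G differentiable at x" "invertible (G x)"
  shows "ip (G x) z (christoffel_vec G x a b) = chr G x a b z"
proof -
  define c where "c i j l = (fd G x (axis i 1) $ j $ l + fd G x (axis j 1) $ i $ l - fd G x (axis l 1) $ i $ j) / 2" for i j l
  define q :: "real^'a" where "q = (\<chi> l. \<Sum>i\<in>UNIV. \<Sum>j\<in>UNIV. c i j l * a $ i * b $ j)"
  have "christoffel_vec G x a b = matrix_inv (G x) *v q"
  proof -
    have "christoffel_vec G x a b $ k = (\<Sum>i\<in>UNIV. \<Sum>j\<in>UNIV. \<Sum>l\<in>UNIV. matrix_inv (G x) $ k $ l * (c i j l * a $ i * b $ j))" for k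
      by (simp add: christoffel_vec_def christoffel_def pd_matrix_entry[OF assms(1)] c_def sum_divide_distrib sum_distrib_left sum_distrib_right mult_ac)
    also have "\<dots>k = (\<Sum>l\<in>UNIV. \<Sum>i\<in>UNIV. \<Sum>j\<in>UNIV. matrix_inv (G x) $ k $ l * (c i j l * a $ i * b $ j))" for k
      by (rule sum_rotate)
    finally show ?thesis
      by (simp add: vec_eq_iff matrix_vector_mult_def q_def sum_distrib_left)
  qed
  then have "ip (G x) z (christoffel_vec G x a b) = z \<bullet> q"
    by (simp add: ip_def matrix_vector_mul_assoc matrix_inv_right[OF assms(2)])
  also have "\<dots> = (\<Sum>l\<in>UNIV. \<Sum>i\<in>UNIV. \<Sum>j\<in>UNIV. a $ i * b $ j * z $ l * c i j l)"
    by (simp add: inner_vec_def q_def sum_distrib_left mult_ac)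
  also have "\<dots> = (\<Sum>i\<in>UNIV. \<Sum>j\<in>UNIV. \<Sum>l\<in>UNIV. a $ i * b $ j * z $ l * c i j l)"
    by (rule sum_rotate[symmetric])
  also have "\<dots> = chr G x a b z"
  proof -
    have 2: "ip (fd G x b) a z = (\<Sum>i\<in>UNIV. \<Sum>j\<in>UNIV. \<Sum>l\<in>UNIV. a $ i * b $ j * z $ l * fd G x (axis j 1) $ i $ l)"
      unfolding ip_fd_expand[OF assms(1)] by (subst sum.swap) (simp add: mult_ac)
    have 3: "ip (fd G x z) a b = (\<Sum>i\<in>UNIV. \<Sum>j\<in>UNIV. \<Sum>l\<in>UNIV. a $ i * b $ j * z $ l * fd G x (axis l 1) $ i $ j)"
      unfolding ip_fd_expand[OF assms(1)]
      by (subst sum_rotate) (simp add: mult_ac)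
    show ?thesis
      unfolding chr_def 2 3 ip_fd_expand[OF assms(1), of a]
      by (simp add: c_def sum.distrib[symmetric] sum_subtractf[symmetric] sum_divide_distrib algebra_simps add_divide_distrib diff_divide_distrib)
  qed
  finally show ?thesis .
qed

lemma ip_cov_deriv:
  assumes "G differentiable at (s u)" "invertible (G (s u))"
  shows "ip (G (s u)) z (cov_deriv G s m u w) = ip (G (s u)) z (fd m u w) + chr G (s u) (fd s u w) (m u) z"
  by (simp add: cov_deriv_def ip_christoffel_vec assms)

section \<open>Vector fields along maps and pulled back metrics\<close>

text \<open>Linearity in the vector slot reduces the joint derivative to finitely many directional
  derivatives times coordinates. It is used to differentiate the pushforward of a vector field along
  a map, where point and vector vary together.\<close>

lemma has_derivative_fd_joint:
  fixes F :: "real^'k \<Rightarrow> 'b::euclidean_space"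
  assumes "open W" "smooth_on W F" "x \<in> W"
  shows "((\<lambda>p. fd F (fst p) (snd p)) has_derivative
    (\<lambda>q. fd (\<lambda>y. fd F y v) x (fst q) + fd F x (snd q))) (at (x, v))"
proof -
  have F: "fd F y v = (\<Sum>j\<in>UNIV. v $ j *\<^sub>R fd F y (axis j 1))" if "y \<in> W" for y v
    using that assms by (intro linear_axis_expansion fd_linear) (auto intro: smooth_on_differentiable)
  have d: "((\<lambda>y. fd F y v) has_derivative fd (\<lambda>y. fd F y v) x) (at x)" for v
    using assms by (intro has_fd) (auto intro: smooth_on_differentiable smooth_on_fd)
  have "((\<lambda>y. \<Sum>j\<in>UNIV. v $ j *\<^sub>R fd F y (axis j 1)) has_derivative
      (\<lambda>w. \<Sum>j\<in>UNIV. v $ j *\<^sub>R fd (\<lambda>y. fd F y (axis j 1)) x w)) (at x)"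
    by (rule has_derivative_sum, rule has_derivative_scaleR_right[OF d])
  moreover have "fd (\<lambda>y. fd F y v) x = fd (\<lambda>y. \<Sum>j\<in>UNIV. v $ j *\<^sub>R fd F y (axis j 1)) x"
    by (rule fd_cong[OF assms(1,3) F])
  ultimately have D: "fd (\<lambda>y. fd F y v) x = (\<lambda>w. \<Sum>j\<in>UNIV. v $ j *\<^sub>R fd (\<lambda>y. fd F y (axis j 1)) x w)"
    by (simp add: fd_eqI)
  have "((\<lambda>p. \<Sum>j\<in>UNIV. snd p $ j *\<^sub>R fd F (fst p) (axis j 1)) has_derivative
    (\<lambda>q. \<Sum>j\<in>UNIV. snd (x, v) $ j *\<^sub>R fd (\<lambda>y. fd F y (axis j 1)) x (fst q) + snd q $ j *\<^sub>R fd F (fst (x, v)) (axis j 1))) (at (x, v))"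
  proof (rule has_derivative_sum, rule has_derivative_scaleR)
    fix j
    show "((\<lambda>p. snd p $ j) has_derivative (\<lambda>q. snd q $ j)) (at (x, v))"
      by (intro bounded_linear_imp_has_derivative bounded_linear_compose[OF bounded_linear_vec_nth bounded_linear_snd])
    show "((\<lambda>p. fd F (fst p) (axis j 1)) has_derivative (\<lambda>q. fd (\<lambda>y. fd F y (axis j 1)) x (fst q))) (at (x, v))"
      by (rule has_derivative_compose[of fst fst "(x,v)" UNIV "\<lambda>y. fd F y (axis j 1)", simplified])
        (auto intro!: bounded_linear_imp_has_derivative bounded_linear_fst d)
  qed
  moreover have "(\<Sum>j\<in>UNIV. snd (x, v) $ j *\<^sub>R fd (\<lambda>y. fd F y (axis j 1)) x (fst q) + snd q $ j *\<^sub>R fd F (fst (x, v)) (axis j 1))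
      = fd (\<lambda>y. fd F y v) x (fst q) + fd F x (snd q)" for q
    using F[OF assms(3), of "snd q"] by (simp only: D sum.distrib fst_conv snd_conv)
  ultimately have "((\<lambda>p. \<Sum>j\<in>UNIV. snd p $ j *\<^sub>R fd F (fst p) (axis j 1)) has_derivative
    (\<lambda>q. fd (\<lambda>y. fd F y v) x (fst q) + fd F x (snd q))) (at (x, v))"
    by simp
  moreover have "open (W \<times> UNIV)" "(x, v) \<in> W \<times> UNIV"
    using assms by (auto simp: open_Times)
  moreover have "(\<Sum>j\<in>UNIV. snd p $ j *\<^sub>R fd F (fst p) (axis j 1)) = fd F (fst p) (snd p)"
    if "p \<in> W \<times> UNIV" for p
    by (rule F[symmetric]) (use that in auto)
  ultimately show ?thesis
    by (rule has_derivative_transform_within_open)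
qed

lemma fd_along:
  fixes F :: "real^'k \<Rightarrow> 'b::euclidean_space"
  assumes "open W" "smooth_on W F" "s u \<in> W" "s differentiable at u" "m differentiable at u"
  shows "((\<lambda>y. fd F (s y) (m y)) has_derivative
     (\<lambda>w. fd (\<lambda>y. fd F y (m u)) (s u) (fd s u w) + fd F (s u) (fd m u w))) (at u)"
  using has_derivative_compose[OF has_derivative_Pair[OF has_fd[OF assms(4)] has_fd[OF assms(5)]]
      has_derivative_fd_joint[OF assms(1-3)]] by simp

text \<open>Product rule. Differentiability of \<open>G'\<close> is part of the conclusion: its
  entries are the values of the right-hand side on coordinate vectors.\<close>

lemma fd_pullback_metric:
  fixes F :: "real^'k \<Rightarrow> real^'n"
  assumes W: "open W" "smooth_on W F" "x \<in> W"
    and pb: "\<And>y a b. y \<in> W \<Longrightarrow> ip (G' y) a b = ip (G (F y)) (fd F y a) (fd F y b)"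
    and G: "G differentiable at (F x)"
  shows "G' differentiable at x"
    "ip (fd G' x v) a b = ip (fd G (F x) (fd F x v)) (fd F x a) (fd F x b)
      + ip (G (F x)) (fd (\<lambda>y. fd F y a) x v) (fd F x b) + ip (G (F x)) (fd F x a) (fd (\<lambda>y. fd F y b) x v)"
proof -
  have dF: "F differentiable at x" using W smooth_on_differentiable by blast
  have ddF: "((\<lambda>y. fd F y c) has_derivative fd (\<lambda>y. fd F y c) x) (at x)" for c
    using W by (intro has_fd) (auto intro: smooth_on_differentiable smooth_on_fd)
  have GF: "((\<lambda>y. G (F y)) has_derivative (\<lambda>v. fd G (F x) (fd F x v))) (at x)"
    using has_derivative_compose[OF has_fd[OF dF] has_fd[OF G]] .
  have D: "((\<lambda>y. ip (G' y) a b) has_derivative (\<lambda>v. ip (fd G (F x) (fd F x v)) (fd F x a) (fd F x b)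
      + ip (G (F x)) (fd (\<lambda>y. fd F y a) x v) (fd F x b) + ip (G (F x)) (fd F x a) (fd (\<lambda>y. fd F y b) x v))) (at x)"
    for a b
    by (rule has_derivative_transform_within_open[OF has_derivative_ip[OF GF ddF ddF] W(1,3)]) (simp add: pb)
  have "(\<lambda>y. \<chi> i j. ip (G' y) (axis i 1) (axis j 1)) differentiable at x"
    using D by (intro differentiable_vec_lambda) (auto simp: differentiable_def)
  then show d: "G' differentiable at x"
    by (simp add: ip_axis)
  show "ip (fd G' x v) a b = ip (fd G (F x) (fd F x v)) (fd F x a) (fd F x b)
      + ip (G (F x)) (fd (\<lambda>y. fd F y a) x v) (fd F x b) + ip (G (F x)) (fd F x a) (fd (\<lambda>y. fd F y b) x v)"
    using fun_cong[OF has_derivative_unique[OF has_derivative_ip[OF has_fd[OF d] has_derivative_const has_derivative_const] D], of v]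
    by simp
qed

text \<open>The Gauss formula.\<close>

lemma cov_deriv_pullback:
  fixes F :: "real^'k \<Rightarrow> real^'n" and s :: "'e::real_normed_vector \<Rightarrow> real^'k"
  assumes W: "open W" "smooth_on W F" "s u \<in> W"
    and pb: "\<And>y a b. y \<in> W \<Longrightarrow> ip (G' y) a b = ip (G (F y)) (fd F y a) (fd F y b)"
    and G: "G differentiable at (F (s u))" "invertible (G (F (s u)))" "\<And>a b. ip (G (F (s u))) a b = ip (G (F (s u))) b a"
    and G': "invertible (G' (s u))"
    and sm: "s differentiable at u" "m differentiable at u"
  shows "ip (G (F (s u))) (fd F (s u) z) (cov_deriv G (\<lambda>y. F (s y)) (\<lambda>y. fd F (s y) (m y)) u w)
    = ip (G' (s u)) z (cov_deriv G' s m u w)"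
proof -
  have dF: "F differentiable at (s u)" using W smooth_on_differentiable by blast
  let ?D = "\<lambda>a b. fd (\<lambda>y. fd F y a) (s u) b"
  have sym: "?D a b = ?D b a" for a b
    by (rule smooth_on_fd_fd_symmetric[OF W(2,1,3)])
  have pd: "G' differentiable at (s u)"
    "ip (fd G' (s u) v) a b = ip (fd G (F (s u)) (fd F (s u) v)) (fd F (s u) a) (fd F (s u) b)
      + ip (G (F (s u))) (?D a v) (fd F (s u) b) + ip (G (F (s u))) (fd F (s u) a) (?D b v)" for v a b
    by (rule fd_pullback_metric[OF W pb G(1)]; assumption)+
  have fdFs: "fd (\<lambda>y. F (s y)) u w = fd F (s u) (fd s u w)"
    by (rule fd_compose[OF sm(1) dF])
  have fdm: "fd (\<lambda>y. fd F (s y) (m y)) u w = ?D (m u) (fd s u w) + fd F (s u) (fd m u w)"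
    using fd_eqI[OF fd_along[where m=m, OF W sm]] by simp
  define a where "a = fd s u w"
  \<comment> \<open>By symmetry of the second derivative of \<open>F\<close>, the terms with
    \<open>?D\<close> cancel in pairs in the Koszul combination, except for one. That one is the
    second derivative term in \<open>fdm\<close>.\<close>
  have "chr G' (s u) a (m u) z = chr G (F (s u)) (fd F (s u) a) (fd F (s u) (m u)) (fd F (s u) z)
      + ip (G (F (s u))) (fd F (s u) z) (?D (m u) a)"
    unfolding chr_def pd(2) using sym[of a "m u"] sym[of z "m u"] sym[of a z]
      G(3)[of "fd F (s u) z"] G(3)[of "fd F (s u) a"] G(3)[of "fd F (s u) (m u)"]
    by (simp add: field_simps)
  then show ?thesis
    using ip_cov_deriv[of G "\<lambda>y. F (s y)" u "fd F (s u) z" "\<lambda>y. fd F (s y) (m y)" w]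
      ip_cov_deriv[of G' s u z m w] G G' pd(1) pb[OF W(3)]
    by (simp add: fdFs fdm a_def)
qed

section \<open>Linear algebra\<close>

text \<open>The trace of the bilinear form \<open>B\<close> on the span of \<open>e\<close> and \<open>f\<close>, with respect to \<open>I\<close>.\<close>

definition tr2 :: "('a \<Rightarrow> 'a \<Rightarrow> real) \<Rightarrow> ('a \<Rightarrow> 'a \<Rightarrow> real) \<Rightarrow> 'a \<Rightarrow> 'a \<Rightarrow> real" where
  "tr2 I B e f = (I f f * B e e - I e f * (B e f + B f e) + I e e * B f f) / (I e e * I f f - (I e f)\<^sup>2)"

text \<open>Numerator and denominator both pick up the square of the determinant of the change of
  basis.\<close>

lemma tr2_change_basis:
  fixes I B :: "'a::real_vector \<Rightarrow> 'a \<Rightarrow> real"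
  assumes "bilinear I" "bilinear B" "\<And>v w. I v w = I w v" "a * d - b * c \<noteq> 0"
  shows "tr2 I B (a *\<^sub>R e + b *\<^sub>R f) (c *\<^sub>R e + d *\<^sub>R f) = tr2 I B e f"
proof -
  note [simp] = bilinear_ladd[OF assms(1)] bilinear_radd[OF assms(1)] bilinear_lmul[OF assms(1)] bilinear_rmul[OF assms(1)]
    bilinear_ladd[OF assms(2)] bilinear_radd[OF assms(2)] bilinear_lmul[OF assms(2)] bilinear_rmul[OF assms(2)]
  let ?e = "a *\<^sub>R e + b *\<^sub>R f" and ?f = "c *\<^sub>R e + d *\<^sub>R f"
  have 1: "I ?f ?f * B ?e ?e - I ?e ?f * (B ?e ?f + B ?f ?e) + I ?e ?e * B ?f ?f
      = (a * d - b * c)\<^sup>2 * (I f f * B e e - I e f * (B e f + B f e) + I e e * B f f)"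
    by (simp add: assms(3)[of f e]) algebra
  have 2: "I ?e ?e * I ?f ?f - (I ?e ?f)\<^sup>2 = (a * d - b * c)\<^sup>2 * (I e e * I f f - (I e f)\<^sup>2)"
    by (simp add: assms(3)[of f e]) algebra
  show ?thesis
    using assms(4) unfolding tr2_def 1 2 by simp
qed

text \<open>The combination \<open>I e f *\<^sub>R e - I e e *\<^sub>R f\<close> is orthogonal to
  \<open>e\<close>, and its square is \<open>I e e\<close> times the Gram determinant.\<close>

lemma gram_det_pos:
  fixes I :: "'a::real_vector \<Rightarrow> 'a \<Rightarrow> real"
  assumes "bilinear I" "\<And>v w. I v w = I w v" "\<And>a b. (a, b) \<noteq> (0, 0) \<Longrightarrow> I (a *\<^sub>R e + b *\<^sub>R f) (a *\<^sub>R e + b *\<^sub>R f) > 0"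
  shows "I e e * I f f - (I e f)\<^sup>2 > 0"
proof -
  note [simp] = bilinear_ladd[OF assms(1)] bilinear_radd[OF assms(1)] bilinear_lmul[OF assms(1)] bilinear_rmul[OF assms(1)]
    bilinear_lsub[OF assms(1)] bilinear_rsub[OF assms(1)] bilinear_lneg[OF assms(1)] bilinear_rneg[OF assms(1)]
  have e: "I e e > 0" using assms(3)[of 1 0] by simp
  have "0 < I (I e f *\<^sub>R e + (- I e e) *\<^sub>R f) (I e f *\<^sub>R e + (- I e e) *\<^sub>R f)"
    using e by (intro assms(3)) auto
  also have "\<dots> = I e e * (I e e * I f f - (I e f)\<^sup>2)"
    by (simp add: assms(2)[of f e] power2_eq_square algebra_simps)
  finally show ?thesis using e by (simp add: zero_less_mult_iff)
qed

lemma tr2_eigenbasis: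
  fixes I B :: "'a::real_vector \<Rightarrow> 'a \<Rightarrow> real"
  assumes "bilinear I" "\<And>v w. I v w = I w v" "I e e * I f f - (I e f)\<^sup>2 \<noteq> 0"
    and "\<And>v. B e v = p * I e v" "\<And>v. B f v = q * I f v"
  shows "tr2 I B e f = p + q"
proof -
  have "I f f * B e e - I e f * (B e f + B f e) + I e e * B f f = (p + q) * (I e e * I f f - (I e f)\<^sup>2)"
    by (simp add: assms(4,5) assms(2)[of f e]) algebra
  then show ?thesis using assms(3) by (simp add: tr2_def)
qed

lemma independent2_iff:
  fixes w1 w2 :: "'a::real_vector"
  shows "w1 \<noteq> w2 \<and> independent {w1, w2} \<longleftrightarrow> (\<forall>a b. a *\<^sub>R w1 + b *\<^sub>R w2 = 0 \<longrightarrow> a = 0 \<and> b = 0)"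
proof
  assume asm: "w1 \<noteq> w2 \<and> independent {w1, w2}"
  show "\<forall>a b. a *\<^sub>R w1 + b *\<^sub>R w2 = 0 \<longrightarrow> a = 0 \<and> b = 0"
  proof (intro allI impI)
    fix a b :: real
    assume "a *\<^sub>R w1 + b *\<^sub>R w2 = 0"
    moreover from asm have ne: "w2 \<noteq> w1" by blast
    ultimately have *: "(\<Sum>v\<in>{w1, w2}. (if v = w1 then a else b) *\<^sub>R v) = 0"
      by simp
    have "(if x = w1 then a else b) = 0" if "x \<in> {w1, w2}" for x
      by (rule independentD[OF _ _ _ * that]) (use asm in auto)
    from this[of w1] this[of w2] ne show "a = 0 \<and> b = 0" by simp
  qed
next
  assume asm: "\<forall>a b. a *\<^sub>R w1 + b *\<^sub>R w2 = 0 \<longrightarrow> a = 0 \<and> b = 0"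
  have "w1 \<noteq> w2" using asm[rule_format, of 1 "-1"] by auto
  moreover have "independent {w1, w2}"
  proof (rule independent_if_scalars_zero)
    fix f :: "'a \<Rightarrow> real" and x
    assume "(\<Sum>x\<in>{w1, w2}. f x *\<^sub>R x) = 0" "x \<in> {w1, w2}"
    then show "f x = 0" using asm[rule_format, of "f w1" "f w2"] \<open>w1 \<noteq> w2\<close> by auto
  qed simp
  ultimately show "w1 \<noteq> w2 \<and> independent {w1, w2}" by blast
qed

text \<open>In the index type \<open>2\<close> the numeral 2 is 0. The definitions use the indices 0
  and 1, while \<open>forall_2\<close> enumerates 1 and 2; types \<open>3\<close> and
  \<open>4\<close> behave alike.\<close>

lemma vec2_eq_iff: "(x :: 'a^2) = y \<longleftrightarrow> x $ 0 = y $ 0 \<and> x $ 1 = y $ 1"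
proof -
  have eq: "(2 :: 2) = 0" by simp
  show ?thesis
    unfolding vec_eq_iff forall_2 eq by auto
qed

lemma vec3_eq_iff: "(x :: 'a^3) = y \<longleftrightarrow> x $ 0 = y $ 0 \<and> x $ 1 = y $ 1 \<and> x $ 2 = y $ 2"
proof -
  have eq: "(3 :: 3) = 0" by simp
  show ?thesis
    unfolding vec_eq_iff forall_3 eq by auto
qed

lemma vec4_eq_iff: "(x :: 'a^4) = y \<longleftrightarrow> x $ 0 = y $ 0 \<and> x $ 1 = y $ 1 \<and> x $ 2 = y $ 2 \<and> x $ 3 = y $ 3"
proof -
  have eq: "(4 :: 4) = 0" by simp
  show ?thesis
    unfolding vec_eq_iff forall_4 eq by auto
qed

lemma vec2_expansion: "(v :: real^2) = (v $ 0) *\<^sub>R axis 0 1 + (v $ 1) *\<^sub>R axis 1 1"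
  by (simp add: vec2_eq_iff axis_def)

lemma tr2_axis:
  fixes I B :: "real^2 \<Rightarrow> real^2 \<Rightarrow> real"
  assumes "bilinear I" "bilinear B" "\<And>v w. I v w = I w v" "\<And>v. v \<noteq> 0 \<Longrightarrow> I v v > 0"
    and "w1 \<noteq> w2" "independent {w1, w2}" "\<And>v. B w1 v = p * I w1 v" "\<And>v. B w2 v = q * I w2 v"
  shows "tr2 I B (axis 0 1) (axis 1 1) = p + q"
proof -
  have ind: "a = 0 \<and> b = 0" if "a *\<^sub>R w1 + b *\<^sub>R w2 = 0" for a b
    using that independent2_iff assms(5,6) by blast
  have "w1 $ 0 * w2 $ 1 - w1 $ 1 * w2 $ 0 \<noteq> 0"
  proof
    assume *: "w1 $ 0 * w2 $ 1 - w1 $ 1 * w2 $ 0 = 0"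
    \<comment> \<open>If the determinant vanishes, these two combinations are zero, and independence
      makes their coefficients, among them both components of \<open>w1\<close>, zero.\<close>
    have "(w2 $ 1) *\<^sub>R w1 + (- w1 $ 1) *\<^sub>R w2 = 0" "(w2 $ 0) *\<^sub>R w1 + (- w1 $ 0) *\<^sub>R w2 = 0"
      using * by (simp_all add: vec2_eq_iff mult.commute)
    from this[THEN ind] have "w1 = 0" by (simp add: vec2_eq_iff)
    then show False using ind[of 1 0] by simp
  qed
  then have "tr2 I B ((w1 $ 0) *\<^sub>R axis 0 1 + (w1 $ 1) *\<^sub>R axis 1 1) ((w2 $ 0) *\<^sub>R axis 0 1 + (w2 $ 1) *\<^sub>R axis 1 1)
     = tr2 I B (axis 0 1) (axis 1 1)"
    by (rule tr2_change_basis[OF assms(1-3)])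
  then have "tr2 I B (axis 0 1) (axis 1 1) = tr2 I B w1 w2"
    using vec2_expansion[of w1] vec2_expansion[of w2] by simp
  moreover have "I w1 w1 * I w2 w2 - (I w1 w2)\<^sup>2 > 0"
    by (rule gram_det_pos[OF assms(1,3)]) (use ind in \<open>auto intro!: assms(4)\<close>)
  then have "tr2 I B w1 w2 = p + q"
    by (intro tr2_eigenbasis assms) auto
  ultimately show ?thesis by simp
qed

section \<open>Existence of principal directions\<close>

text \<open>Gram-Schmidt with respect to \<open>I\<close> reduces the claim to a symmetric matrix
  with rows (p, q) and (q, r), whose eigenvalues are given by the quadratic formula.\<close>

lemma symmetric_form_eigenbasis:
  fixes I B :: "real^2 \<Rightarrow> real^2 \<Rightarrow> real"
  assumes "bilinear I" "bilinear B" "\<And>v w. I v w = I w v" "\<And>v w. B v w = B w v" "\<And>v. v \<noteq> 0 \<Longrightarrow> I v v > 0"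
  shows "\<exists>w1 w2 p q. w1 \<noteq> w2 \<and> independent {w1, w2} \<and> (\<forall>v. B w1 v = p * I w1 v) \<and> (\<forall>v. B w2 v = q * I w2 v)"
proof -
  note [simp] = bilinear_ladd[OF assms(1)] bilinear_radd[OF assms(1)] bilinear_lmul[OF assms(1)] bilinear_rmul[OF assms(1)]
    bilinear_ladd[OF assms(2)] bilinear_radd[OF assms(2)] bilinear_lmul[OF assms(2)] bilinear_rmul[OF assms(2)]
    bilinear_lzero[OF assms(1)] bilinear_rzero[OF assms(1)] bilinear_lsub[OF assms(1)] bilinear_rsub[OF assms(1)]
  define e f :: "real^2" where "e = axis 0 1" and "f = axis 1 1"
  have ef: "a = 0 \<and> b = 0" if "a *\<^sub>R e + b *\<^sub>R f = 0" for a b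
    using that by (simp add: e_def f_def vec2_eq_iff axis_def)
  have e: "I e e > 0" using ef[of 1 0] by (intro assms(5)) auto
  define f1 where "f1 = (1 / sqrt (I e e)) *\<^sub>R e"
  have f1: "I f1 f1 = 1" using e by (simp add: f1_def field_simps)
  define g where "g = f - I f1 f *\<^sub>R f1"
  have "g \<noteq> 0"
    using ef[of "- I f1 f / sqrt (I e e)" 1] by (auto simp: g_def f1_def)
  then have g: "I g g > 0" by (rule assms(5))
  have g1: "I f1 g = 0" by (simp add: g_def f1)
  define f2 where "f2 = (1 / sqrt (I g g)) *\<^sub>R g"
  have f2: "I f2 f2 = 1" "I f1 f2 = 0" "I f2 f1 = 0" using g g1 assms(3)[of f2 f1] by (auto simp: f2_def field_simps)
  have span: "\<exists>a b. v = a *\<^sub>R f1 + b *\<^sub>R f2" for v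
  proof -
    have "f = I f1 f *\<^sub>R f1 + sqrt (I g g) *\<^sub>R f2" using g by (simp add: f2_def g_def)
    moreover have "e = sqrt (I e e) *\<^sub>R f1" using e by (simp add: f1_def)
    moreover have "v = (v $ 0) *\<^sub>R e + (v $ 1) *\<^sub>R f"
      using vec2_expansion[of v] by (simp add: e_def f_def)
    ultimately have "v = (v $ 0) *\<^sub>R (sqrt (I e e) *\<^sub>R f1) + (v $ 1) *\<^sub>R (I f1 f *\<^sub>R f1 + sqrt (I g g) *\<^sub>R f2)"
      by simp
    then have "v = (v $ 0 * sqrt (I e e) + v $ 1 * I f1 f) *\<^sub>R f1 + (v $ 1 * sqrt (I g g)) *\<^sub>R f2"
      by (simp add: scaleR_add_left scaleR_add_right add.assoc)
    then show ?thesis by blast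
  qed
  define p q r where "p = B f1 f1" and "q = B f1 f2" and "r = B f2 f2"
  have q': "B f2 f1 = q" using assms(4) by (simp add: q_def)
  have eig: "\<forall>v. B w v = l * I w v" if "B w f1 = l * I w f1" "B w f2 = l * I w f2" for w l
  proof
    fix v obtain a b where "v = a *\<^sub>R f1 + b *\<^sub>R f2" using span by blast
    then show "B w v = l * I w v" using that by (simp add: algebra_simps)
  qed
  have orth: "w1 \<noteq> w2 \<and> independent {w1, w2}" if "I w1 w2 = 0" "w1 \<noteq> 0" "w2 \<noteq> 0" for w1 w2
    unfolding independent2_iff
  proof (intro allI impI)
    fix a b assume *: "a *\<^sub>R w1 + b *\<^sub>R w2 = 0"
    have "I (a *\<^sub>R w1 + b *\<^sub>R w2) w1 = 0" "I (a *\<^sub>R w1 + b *\<^sub>R w2) w2 = 0"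
      unfolding * by simp_all
    then show "a = 0 \<and> b = 0"
      using that(1) assms(3)[of w2 w1] assms(5)[OF that(2)] assms(5)[OF that(3)] by simp
  qed
  show ?thesis
  proof (cases "q = 0")
    case True
    have "f1 \<noteq> 0" "f2 \<noteq> 0" using f1 f2 by auto
    then have "f1 \<noteq> f2 \<and> independent {f1, f2}" by (intro orth f2)
    moreover have "\<forall>v. B f1 v = p * I f1 v" "\<forall>v. B f2 v = r * I f2 v"
      by (intro eig; use True q' f1 f2 in \<open>simp add: p_def q_def r_def\<close>)+
    ultimately show ?thesis by blast
  next
    case False
    \<comment> \<open>\<open>D\<close> is the root of the discriminant of the characteristic
      polynomial, \<open>l\<close> and \<open>m\<close> are its zeros. For \<open>q = 0\<close> both
      vectors \<open>w1\<close> and \<open>w2\<close> would be multiples of \<open>f2\<close>, hence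
      the separate case.\<close>
    define D where "D = sqrt ((p - r)\<^sup>2 + 4 * q\<^sup>2)"
    have D: "D\<^sup>2 = (p - r)\<^sup>2 + 4 * q\<^sup>2" by (simp add: D_def)
    define l m where "l = (p + r + D) / 2" and "m = (p + r - D) / 2"
    have lm: "q\<^sup>2 + (l - p) * r = l * (l - p)" "q\<^sup>2 + (m - p) * r = m * (m - p)" "q\<^sup>2 + (l - p) * (m - p) = 0"
      using D by (simp_all add: l_def m_def power2_eq_square field_simps)
    define w1 w2 where "w1 = q *\<^sub>R f1 + (l - p) *\<^sub>R f2" and "w2 = q *\<^sub>R f1 + (m - p) *\<^sub>R f2"
    have "I w1 f1 = q" "I w2 f1 = q" by (simp_all add: w1_def w2_def f1 f2)
    then have "w1 \<noteq> 0" "w2 \<noteq> 0" using False by auto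
    moreover have "I w1 w2 = 0"
      using lm(3) by (simp add: w1_def w2_def f1 f2 power2_eq_square mult.commute)
    ultimately have "w1 \<noteq> w2 \<and> independent {w1, w2}" by (intro orth)
    moreover have BI: "B (q *\<^sub>R f1 + x *\<^sub>R f2) f1 = q * p + x * q" "B (q *\<^sub>R f1 + x *\<^sub>R f2) f2 = q\<^sup>2 + x * r"
      "I (q *\<^sub>R f1 + x *\<^sub>R f2) f1 = q" "I (q *\<^sub>R f1 + x *\<^sub>R f2) f2 = x" for x
      by (simp_all add: f1 f2 q' p_def[symmetric] q_def[symmetric] r_def[symmetric] power2_eq_square)
    have "\<forall>v. B w1 v = l * I w1 v" "\<forall>v. B w2 v = m * I w2 v"
      by (rule eig; simp only: w1_def w2_def BI lm; simp add: algebra_simps)+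
    ultimately show ?thesis by blast
  qed
qed

lemma invertible_if_ip_pos:
  assumes "\<And>a. a \<noteq> 0 \<Longrightarrow> ip G a a > 0" shows "invertible G"
proof -
  have "a = 0" if "G *v a = 0" for a
    using assms[of a] that by (auto simp: ip_def)
  then show ?thesis
    by (metis invertible_left_inverse matrix_left_invertible_ker)
qed

text \<open>Pairing with \<open>m\<close> shows that the map from (r, v) to
  \<open>r *\<^sub>R m + L v\<close> is injective; between spaces of dimension 3 it is then
  surjective.\<close>

lemma span_normal_surface:
  fixes L :: "real^2 \<Rightarrow> real^3" and G :: "real^3^3"
  assumes L: "linear L" "inj L" and G: "\<And>a. a \<noteq> 0 \<Longrightarrow> ip G a a > 0"
    and m: "\<And>v. ip G m (L v) = 0" "m \<noteq> 0"
  obtains r v where "z = r *\<^sub>R m + L v"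
proof -
  define T :: "real^3 \<Rightarrow> real^3" where "T x = x $ 0 *\<^sub>R m + L (\<chi> i. if i = 0 then x $ 1 else x $ 2)" for x
  have P: "linear (\<lambda>x :: real^3. (\<chi> i. if i = 0 then x $ 1 else x $ 2) :: real^2)"
    by (rule linearI) (auto simp: vec2_eq_iff)
  have T: "linear T"
    unfolding T_def using linear_compose[OF P L(1)]
    by (intro linear_compose_add linear_compose_scale_right) (auto simp: o_def linear_iff scaleR_left_distrib)
  moreover have "inj T"
    unfolding linear_injective_0[OF T]
  proof (intro allI impI)
    fix x assume *: "T x = 0"
    then have "ip G m (T x) = 0" by simp
    then have x0: "x $ 0 = 0" using m G[of m] by (simp add: T_def)
    then have "L (\<chi> i. if i = 0 then x $ 1 else x $ 2) = L 0" using * linear_0[OF L(1)] by (simp add: T_def)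
    then have "(\<chi> i. if i = 0 then x $ 1 else x $ 2) = (0 :: real^2)" using L(2) injD by metis
    then show "x = 0" using x0 by (simp add: vec2_eq_iff vec3_eq_iff)
  qed
  ultimately obtain x where "T x = z"
    using linear_injective_imp_surjective[OF T] by (metis surjD)
  then show ?thesis using that by (auto simp: T_def)
qed

text \<open>The Weingarten form \<open>B\<close> is symmetric, hence diagonalizable with respect to
  the first fundamental form. That the eigenvalue equations hold as vector equations, and not just
  after pairing with tangent vectors, is due to the unit length of \<open>m\<close>.\<close>

lemma weingarten_eigenbasis:
  fixes s m :: "real^2 \<Rightarrow> real^3" and G :: "real^3 \<Rightarrow> real^3^3"
  assumes V: "open V" "u \<in> V" and s: "smooth_on V s" "inj (fd s u)" and m: "m differentiable at u"
    and G: "open W" "s u \<in> W" "G differentiable at (s u)" "\<And>x a b. x \<in> W \<Longrightarrow> ip (G x) a b = ip (G x) b a"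
      "\<And>a. a \<noteq> 0 \<Longrightarrow> ip (G (s u)) a a > 0"
    and orth: "\<And>y v. y \<in> V \<Longrightarrow> ip (G (s y)) (m y) (fd s y v) = 0"
    and unit: "\<And>y. y \<in> V \<Longrightarrow> ip (G (s y)) (m y) (m y) = 1"
  shows "\<exists>w1 w2 p q. w1 \<noteq> w2 \<and> independent {w1, w2} \<and>
    cov_deriv G s m u w1 = p *\<^sub>R fd s u w1 \<and> cov_deriv G s m u w2 = q *\<^sub>R fd s u w2"
proof -
  let ?G = "G (s u)"
  have ds: "s differentiable at u" using V s smooth_on_differentiable by blast
  have dds: "((\<lambda>y. fd s y v) has_derivative fd (\<lambda>y. fd s y v) u) (at u)" for v
    using V s(1) by (intro has_fd) (auto intro: smooth_on_differentiable smooth_on_fd)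
  have lin: "linear (fd s u)" using ds fd_linear by blast
  have linm: "linear (fd m u)" using m fd_linear by blast
  have linG: "linear (fd G (s u))" using G(3) fd_linear by blast
  have inv: "invertible ?G" by (rule invertible_if_ip_pos[OF G(5)])
  have Gs: "((\<lambda>y. G (s y)) has_derivative (\<lambda>w. fd G (s u) (fd s u w))) (at u)"
    using has_derivative_compose[OF has_fd[OF ds] has_fd[OF G(3)]] .
  have symD: "ip (fd G (s u) z) a b = ip (fd G (s u) z) b a" for z a b
  proof -
    have D: "((\<lambda>y. ip (G y) a b) has_derivative (\<lambda>v. ip (fd G (s u) v) a b)) (at (s u))" for a b
      using has_derivative_ip[OF has_fd[OF G(3)] has_derivative_const has_derivative_const] by simp
    have "((\<lambda>y. ip (G y) a b) has_derivative (\<lambda>v. ip (fd G (s u) v) b a)) (at (s u))"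
      by (rule has_derivative_transform_within_open[OF D G(1,2)]) (rule G(4))
    from has_derivative_unique[OF D this] show ?thesis by meson
  qed
  have 1: "ip (fd G (s u) (fd s u w)) (m u) (fd s u v) + ip ?G (fd m u w) (fd s u v) + ip ?G (m u) (fd (\<lambda>y. fd s y v) u w) = 0" for v w
  proof -
    have "((\<lambda>y. ip (G (s y)) (m y) (fd s y v)) has_derivative (\<lambda>w. 0)) (at u)"
      by (rule has_derivative_transform_within_open[OF has_derivative_const V]) (simp add: orth)
    from has_derivative_unique[OF has_derivative_ip[OF Gs has_fd[OF m] dds] this] show ?thesis by meson
  qed
  have 2: "ip (fd G (s u) (fd s u w)) (m u) (m u) + ip ?G (fd m u w) (m u) + ip ?G (m u) (fd m u w) = 0" for w
  proof -
    have "((\<lambda>y. ip (G (s y)) (m y) (m y)) has_derivative (\<lambda>w. 0)) (at u)"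
      by (rule has_derivative_transform_within_open[OF has_derivative_const[of 1] V]) (simp add: unit)
    from has_derivative_unique[OF has_derivative_ip[OF Gs has_fd[OF m] has_fd[OF m]] this] show ?thesis by meson
  qed
  define I B where "I w v = ip ?G (fd s u w) (fd s u v)" and "B w v = ip ?G (fd s u v) (cov_deriv G s m u w)" for w v
  have Beq: "B w v = ip ?G (fd s u v) (fd m u w) + chr G (s u) (fd s u w) (m u) (fd s u v)" for w v
    unfolding B_def by (rule ip_cov_deriv[where G=G and s=s, OF G(3) inv])
  note lins = linear_add[OF lin] linear_scale[OF lin] linear_add[OF linm] linear_scale[OF linm] linear_add[OF linG] linear_scale[OF linG]
  have ipm: "ip (a + b) x y = ip a x y + ip b x y" "ip (r *\<^sub>R a) x y = r * ip a x y" for a b :: "real^3^3" and x y r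
    by (simp_all add: ip_def matrix_vector_mult_add_rdistrib inner_add_right flip: scaleR_matrix_vector_assoc)
  have bI: "bilinear I"
    by (auto simp: bilinear_def I_def lins intro!: linearI)
  have bB: "bilinear B"
    by (auto simp: bilinear_def Beq chr_def lins ipm field_simps intro!: linearI)
  have symI: "I v w = I w v" for v w
    by (simp add: I_def G(4)[OF G(2)])
  have posI: "I v v > 0" if "v \<noteq> 0" for v
    unfolding I_def using that s(2) lin linear_0[OF lin] by (intro G(5)) (metis injD)
  \<comment> \<open>Differentiating the orthogonality of \<open>m\<close> to the surface trades the
    derivative of \<open>m\<close> for a second derivative of \<open>s\<close>, which is symmetric
    in \<open>v\<close> and \<open>w\<close>; the other terms are symmetric because \<open>G\<close>
    and its derivatives are.\<close>
  have symB: "B v w = B w v" for v w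
  proof -
    have "B w v = - ip ?G (m u) (fd (\<lambda>y. fd s y v) u w) + ip (fd G (s u) (m u)) (fd s u w) (fd s u v) / 2
       - (ip (fd G (s u) (fd s u w)) (m u) (fd s u v) + ip (fd G (s u) (fd s u v)) (m u) (fd s u w)) / 2" for v w
      using 1[of w v] G(4)[OF G(2), of "fd s u v" "fd m u w"] symD[of "fd s u v" "fd s u w" "m u"]
      unfolding Beq chr_def by (simp add: field_simps)
    from this[of w v] this[of v w] show ?thesis
      using smooth_on_fd_fd_symmetric[OF s(1) V, of v w] symD[of "m u" "fd s u w" "fd s u v"] by simp
  qed
  obtain w1 w2 p q where w: "w1 \<noteq> w2" "independent {w1, w2}" "\<And>v. B w1 v = p * I w1 v" "\<And>v. B w2 v = q * I w2 v"
    using symmetric_form_eigenbasis[OF bI bB symI symB posI] by blast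
  \<comment> \<open>The defect \<open>z\<close> is orthogonal to all tangent vectors by assumption
    and to \<open>m u\<close> by the derivative of the unit length. Since these span the space,
    \<open>z\<close> is orthogonal to itself and vanishes.\<close>
  have tang: "cov_deriv G s m u w = r *\<^sub>R fd s u w" if r: "\<And>v. B w v = r * I w v" for w r
  proof -
    define z where "z = cov_deriv G s m u w - r *\<^sub>R fd s u w"
    have zs: "ip ?G z (fd s u v) = 0" for v
      using r[of v] G(4)[OF G(2)] by (simp add: z_def B_def I_def)
    have "ip ?G (m u) (cov_deriv G s m u w) = 0"
      using 2[of w] G(4)[OF G(2), of "m u" "fd m u w"] symD[of "m u" "fd s u w" "m u"]
      unfolding ip_cov_deriv[where G=G and s=s, OF G(3) inv] chr_def by (simp add: field_simps)
    then have zm: "ip ?G z (m u) = 0"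
      using orth[OF V(2), of w] G(4)[OF G(2)] by (simp add: z_def)
    have "m u \<noteq> 0" using unit[OF V(2)] by auto
    obtain a v where "z = a *\<^sub>R m u + fd s u v"
      by (rule span_normal_surface[OF lin s(2) G(5) orth[OF V(2)] \<open>m u \<noteq> 0\<close>])
    then have "ip ?G z z = a * ip ?G z (m u) + ip ?G z (fd s u v)"
      by (metis ip_linear(2,4))
    then have "ip ?G z z = 0" using zs zm by simp
    then have "z = 0" using G(5)[of z] by force
    then show ?thesis by (simp add: z_def)
  qed
  show ?thesis
    using w tang by blast
qed

section \<open>The energy integrand in linear algebra\<close>

text \<open>The standard volume form, with the arguments as rows in the order used by
  \<open>induced_orientation\<close>; on coordinate vectors it is the Levi-Civita symbol.\<close>

definition d4 :: "real^4 \<Rightarrow> real^4 \<Rightarrow> real^4 \<Rightarrow> real^4 \<Rightarrow> real" where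
  "d4 p q r s = det (\<chi> i::4. if i = 0 then p else if i = 1 then q else if i = 2 then r else s)"

lemma sum_4': "sum f (UNIV :: 4 set) = f 0 + f 1 + f 2 + f 3"
proof -
  have eq: "(4 :: 4) = 0" by simp
  show ?thesis unfolding sum_4 eq by (simp add: add_ac)
qed

lemma d4_linear:
  "linear (\<lambda>p. d4 p q r s)" "linear (\<lambda>q. d4 p q r s)" "linear (\<lambda>r. d4 p q r s)" "linear (\<lambda>s. d4 p q r s)"
proof -
  have 1: "d4 x q r s = det (\<chi> i::4. if i = 0 then x else if i = 1 then q else if i = 2 then r else s)" for x
    by (simp add: d4_def)
  have 2: "d4 p x r s = det (\<chi> i::4. if i = 1 then x else if i = 0 then p else if i = 2 then r else s)" for x
    by (auto simp: d4_def intro!: arg_cong[where f=det] arg_cong[where f=vec_lambda] ext)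
  have 3: "d4 p q x s = det (\<chi> i::4. if i = 2 then x else if i = 0 then p else if i = 1 then q else s)" for x
    by (auto simp: d4_def intro!: arg_cong[where f=det] arg_cong[where f=vec_lambda] ext)
  have 4: "d4 p q r x = det (\<chi> i::4. if i = 3 then x else if i = 0 then p else if i = 1 then q else r)" for x
  proof -
    have four: "i = 0 \<or> i = 1 \<or> i = 2 \<or> i = 3" for i :: 4
      using exhaust_4[of i] by auto
    have "(if i = 0 then p else if i = 1 then q else if i = 2 then r else x) = (if i = 3 then x else if i = 0 then p else if i = 1 then q else r)" for i :: 4
      using four[of i] by auto
    then show ?thesis by (simp only: d4_def)
  qed
  show "linear (\<lambda>p. d4 p q r s)"
    unfolding 1 by (rule linearI) (simp_all only: det_row_add det_row_mul scalar_mult_eq_scaleR[symmetric] real_scaleR_def)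
  show "linear (\<lambda>q. d4 p q r s)"
    unfolding 2 by (rule linearI) (simp_all only: det_row_add det_row_mul scalar_mult_eq_scaleR[symmetric] real_scaleR_def)
  show "linear (\<lambda>r. d4 p q r s)"
    unfolding 3 by (rule linearI) (simp_all only: det_row_add det_row_mul scalar_mult_eq_scaleR[symmetric] real_scaleR_def)
  show "linear (\<lambda>s. d4 p q r s)"
    unfolding 4 by (rule linearI) (simp_all only: det_row_add det_row_mul scalar_mult_eq_scaleR[symmetric] real_scaleR_def)
qed

lemmas d4_add = d4_linear[THEN linear_add]
lemmas d4_scale = d4_linear[THEN linear_scale]

lemma d4_equal: "d4 p p r s = 0" "d4 p q p s = 0" "d4 p q r p = 0" "d4 p q q s = 0" "d4 p q r q = 0" "d4 p q r r = 0"
proof -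
  show "d4 p p r s = 0" unfolding d4_def by (rule det_identical_rows[of 0 1]) (simp_all add: row_def)
  show "d4 p q p s = 0" unfolding d4_def by (rule det_identical_rows[of 0 2]) (simp_all add: row_def)
  show "d4 p q r p = 0" unfolding d4_def by (rule det_identical_rows[of 0 3]) (simp_all add: row_def)
  show "d4 p q q s = 0" unfolding d4_def by (rule det_identical_rows[of 1 2]) (simp_all add: row_def)
  show "d4 p q r q = 0" unfolding d4_def by (rule det_identical_rows[of 1 3]) (simp_all add: row_def)
  show "d4 p q r r = 0" unfolding d4_def by (rule det_identical_rows[of 2 3]) (simp_all add: row_def)
qed

text \<open>Polarization of the vanishing on equal arguments.\<close>

lemma d4_swap: "d4 q p r s = - d4 p q r s" "d4 p r q s = - d4 p q r s" "d4 p q s r = - d4 p q r s"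
  using d4_equal(1)[of "p + q" r s, unfolded d4_add] d4_equal(4)[of p "q + r" s, unfolded d4_add]
    d4_equal(6)[of p q "r + s", unfolded d4_add]
  by (simp_all add: d4_equal)

lemma d4_mat: "d4 (axis 0 1) (axis 1 1) (axis 2 1) (axis 3 1) = 1"
proof -
  have "i = 0 \<or> i = 1 \<or> i = 2 \<or> i = 3" for i :: 4
    using exhaust_4[of i] by auto
  then have "(\<chi> i::4. if i = 0 then axis 0 1 else if i = 1 then axis 1 1 else if i = 2 then axis 2 1 else axis 3 1) = (mat 1 :: real^4^4)"
    by (simp add: vec_eq_iff mat_def axis_def) (smt (verit))
  then show ?thesis by (simp add: d4_def)
qed

section \<open>Contractions with the volume form\<close>

text \<open>The antisymmetrized product of \<open>Y\<close> and \<open>Z\<close> counts every term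
  of the determinant twice; this cancels the factor 1/2 in \<open>eta_coord\<close>.\<close>

lemma levi_civita_sum:
  "(\<Sum>\<beta>\<in>UNIV. \<Sum>\<mu>\<in>UNIV. \<Sum>\<nu>\<in>UNIV. M \<beta> * levi_civita_symbol a \<beta> \<mu> \<nu> * (Y $ \<mu> * Z $ \<nu> - Y $ \<nu> * Z $ \<mu>))
    = 2 * (\<Sum>\<beta>\<in>UNIV. M \<beta> * d4 (axis a 1) (axis \<beta> 1) Y Z)"
proof -
  have lc: "levi_civita_symbol a b m n = d4 (axis a 1) (axis b 1) (axis m 1) (axis n 1)" for a b m n
    unfolding levi_civita_symbol_def d4_def by (intro arg_cong[where f=det]) (auto simp: vec_eq_iff)
  have d: "d4 p q Y Z = (\<Sum>\<mu>\<in>UNIV. \<Sum>\<nu>\<in>UNIV. d4 p q (axis \<mu> 1) (axis \<nu> 1) * (Y $ \<mu> * Z $ \<nu>))" for p q Y Z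
  proof -
    have "d4 p q Y Z = (\<Sum>\<mu>\<in>UNIV. Y $ \<mu> * d4 p q (axis \<mu> 1) Z)"
      using linear_axis_expansion[OF d4_linear(3)[where p=p and q=q and s=Z], of Y] by simp
    also have "\<dots> = (\<Sum>\<mu>\<in>UNIV. Y $ \<mu> * (\<Sum>\<nu>\<in>UNIV. Z $ \<nu> * d4 p q (axis \<mu> 1) (axis \<nu> 1)))"
      using linear_axis_expansion[OF d4_linear(4)[where p=p and q=q], of _ Z] by simp
    finally show ?thesis by (simp add: sum_distrib_left mult_ac)
  qed
  have "(\<Sum>\<mu>\<in>UNIV. \<Sum>\<nu>\<in>UNIV. M * levi_civita_symbol a \<beta> \<mu> \<nu> * (Y $ \<mu> * Z $ \<nu> - Y $ \<nu> * Z $ \<mu>))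
     = 2 * (M * d4 (axis a 1) (axis \<beta> 1) Y Z)" for \<beta> M
  proof -
    have "(\<Sum>\<mu>\<in>UNIV. \<Sum>\<nu>\<in>UNIV. M * levi_civita_symbol a \<beta> \<mu> \<nu> * (Y $ \<mu> * Z $ \<nu> - Y $ \<nu> * Z $ \<mu>))
       = M * d4 (axis a 1) (axis \<beta> 1) Y Z - M * d4 (axis a 1) (axis \<beta> 1) Z Y"
      unfolding lc d[of "axis a 1" "axis \<beta> 1" Y Z] d[of "axis a 1" "axis \<beta> 1" Z Y]
      by (simp add: sum_distrib_left sum_subtractf[symmetric] algebra_simps)
    then show ?thesis by (simp add: d4_swap(3)[of _ _ Z Y])
  qed
  then show ?thesis by (simp add: sum_distrib_left)
qed

text \<open>The contraction of a 2-tensor with the volume form may be computed from its components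
  in the vectors \<open>E i\<close> instead of the coordinate vectors.\<close>

lemma sum_outer_expansion:
  fixes E :: "4 \<Rightarrow> real^4"
  assumes K: "\<And>\<alpha> \<gamma>. K \<alpha> \<gamma> = (\<Sum>i\<in>UNIV. \<Sum>j\<in>UNIV. k i j * (E i $ \<alpha>) * (E j $ \<gamma>))"
  shows "(\<Sum>\<alpha>\<in>UNIV. \<Sum>\<gamma>\<in>UNIV. K \<alpha> \<gamma> * d4 (axis \<alpha> 1) (axis \<gamma> 1) r s) = (\<Sum>i\<in>UNIV. \<Sum>j\<in>UNIV. k i j * d4 (E i) (E j) r s)"
proof -
  have d: "d4 p q r s = (\<Sum>\<mu>\<in>UNIV. \<Sum>\<nu>\<in>UNIV. d4 (axis \<mu> 1) (axis \<nu> 1) r s * (p $ \<mu> * q $ \<nu>))" for p q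
  proof -
    have "d4 p q r s = (\<Sum>\<mu>\<in>UNIV. p $ \<mu> * d4 (axis \<mu> 1) q r s)"
      using linear_axis_expansion[OF d4_linear(1)[where q=q and r=r and s=s], of p] by simp
    also have "\<dots> = (\<Sum>\<mu>\<in>UNIV. p $ \<mu> * (\<Sum>\<nu>\<in>UNIV. q $ \<nu> * d4 (axis \<mu> 1) (axis \<nu> 1) r s))"
      using linear_axis_expansion[OF d4_linear(2)[where r=r and s=s], of _ q] by simp
    finally show ?thesis by (simp add: sum_distrib_left mult_ac)
  qed
  have "(\<Sum>\<alpha>\<in>UNIV. \<Sum>\<gamma>\<in>UNIV. K \<alpha> \<gamma> * d4 (axis \<alpha> 1) (axis \<gamma> 1) r s)
     = (\<Sum>\<alpha>\<in>UNIV. \<Sum>\<gamma>\<in>UNIV. \<Sum>i\<in>UNIV. \<Sum>j\<in>UNIV. k i j * (d4 (axis \<alpha> 1) (axis \<gamma> 1) r s * (E i $ \<alpha> * E j $ \<gamma>)))"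
    by (simp add: K sum_distrib_right sum_distrib_left mult_ac)
  also have "\<dots> = (\<Sum>\<alpha>\<in>UNIV. \<Sum>i\<in>UNIV. \<Sum>j\<in>UNIV. \<Sum>\<gamma>\<in>UNIV. k i j * (d4 (axis \<alpha> 1) (axis \<gamma> 1) r s * (E i $ \<alpha> * E j $ \<gamma>)))"
    by (rule sum.cong[OF refl], rule sum_rotate[symmetric])
  also have "\<dots> = (\<Sum>i\<in>UNIV. \<Sum>j\<in>UNIV. \<Sum>\<alpha>\<in>UNIV. \<Sum>\<gamma>\<in>UNIV. k i j * (d4 (axis \<alpha> 1) (axis \<gamma> 1) r s * (E i $ \<alpha> * E j $ \<gamma>)))"
    by (rule sum_rotate[symmetric])
  finally show ?thesis
    by (simp add: d[of "E _"] sum_distrib_left)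
qed

text \<open>
  Expand the bivector \<open>C G\<^sup>-\<^sup>1\<close> in the basis \<open>N, n, Y, Z\<close>. Contracting with \<open>r, s = N, Z\<close> or \<open>N, Y\<close>
  leaves only its \<open>n \<and> Y\<close> or \<open>n \<and> Z\<close> component.
\<close>

lemma bivector_contraction:
  fixes G C :: "real^4^4"
  assumes G: "invertible G" "\<And>a b. ip G a b = ip G b a"
    and d: "d4 N n Y Z \<noteq> 0"
    and orth: "ip G N n = 0" "ip G N Y = 0" "ip G N Z = 0" "ip G n Y = 0" "ip G n Z = 0" "ip G n n = 1"
    and D: "ip G Y Y * ip G Z Z - (ip G Y Z)\<^sup>2 \<noteq> 0"
    and C: "ip G Y (C *v n) = - ip G n (C *v Y)" "ip G Z (C *v n) = - ip G n (C *v Z)"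
  shows "(\<Sum>\<alpha>\<in>UNIV. \<Sum>\<gamma>\<in>UNIV. (C ** matrix_inv G) $ \<alpha> $ \<gamma> * d4 (axis \<alpha> 1) (axis \<gamma> 1) N Z)
      = 2 * d4 N n Y Z * (ip G Z Z * ip G n (C *v Y) - ip G Y Z * ip G n (C *v Z)) / (ip G Y Y * ip G Z Z - (ip G Y Z)\<^sup>2)"
   and "(\<Sum>\<alpha>\<in>UNIV. \<Sum>\<gamma>\<in>UNIV. (C ** matrix_inv G) $ \<alpha> $ \<gamma> * d4 (axis \<alpha> 1) (axis \<gamma> 1) N Y)
      = - 2 * d4 N n Y Z * (ip G Y Y * ip G n (C *v Z) - ip G Y Z * ip G n (C *v Y)) / (ip G Y Y * ip G Z Z - (ip G Y Z)\<^sup>2)"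
proof -
  define E :: "4 \<Rightarrow> real^4" where "E i = (if i = 0 then N else if i = 1 then n else if i = 2 then Y else Z)" for i
  define M :: "real^4^4" where "M = (\<chi> i. E i)"
  have "det M \<noteq> 0" using d by (simp add: M_def E_def d4_def)
  then have M: "invertible M" by (simp add: invertible_det_nz)
  define P where "P = matrix_inv M"
  have MP: "P ** M = mat 1" using matrix_inv_left[OF M] by (simp add: P_def)
  define K where "K = C ** matrix_inv G"
  \<comment> \<open>The components of the 2-tensor \<open>K\<close> in the basis \<open>E\<close>:
    conjugating with the inverse of the matrix whose rows are the basis vectors.\<close>
  define k where "k = transpose P ** K ** P"
  have "transpose M ** k ** M = transpose (P ** M) ** K ** (P ** M)"
    unfolding k_def by (simp add: matrix_transpose_mul matrix_mul_assoc)
  then have Kk: "K = transpose M ** k ** M" by (simp add: MP transpose_mat)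
  have K: "K $ \<alpha> $ \<gamma> = (\<Sum>i\<in>UNIV. \<Sum>j\<in>UNIV. k $ i $ j * (E i $ \<alpha>) * (E j $ \<gamma>))" for \<alpha> \<gamma>
  proof -
    have "K $ \<alpha> $ \<gamma> = (\<Sum>j\<in>UNIV. \<Sum>i\<in>UNIV. k $ i $ j * (E i $ \<alpha>) * (E j $ \<gamma>))"
      unfolding Kk by (simp add: matrix_matrix_mult_def transpose_def M_def sum_distrib_right sum_distrib_left mult_ac)
    then show ?thesis by (subst sum.swap)
  qed
  have KG: "C = K ** G"
    by (simp add: K_def matrix_mul_assoc[symmetric] matrix_inv_left[OF G(1)])
  have KE: "a \<bullet> (K *v b) = (\<Sum>i\<in>UNIV. \<Sum>j\<in>UNIV. k $ i $ j * (E i \<bullet> a) * (E j \<bullet> b))" for a b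
  proof -
    have "a \<bullet> (transpose M *v x) = (M *v a) \<bullet> x" for x
      by (metis dot_lmul_matrix inner_commute transpose_matrix_vector)
    then have "a \<bullet> (K *v b) = (M *v a) \<bullet> (k *v (M *v b))"
      unfolding Kk by (simp only: matrix_vector_mul_assoc[symmetric])
    moreover have "(M *v a) $ i = E i \<bullet> a" for a i
      by (simp add: M_def matrix_vector_mult_def inner_vec_def)
    ultimately show ?thesis
      by (simp add: inner_vec_def[of "M *v a"] matrix_vector_mult_def[of k] sum_distrib_left mult_ac)
  qed
  have C': "ip G a (C *v b) = (\<Sum>i\<in>UNIV. \<Sum>j\<in>UNIV. k $ i $ j * ip G a (E i) * ip G (E j) b)" for a b
  proof -
    have "ip G a (C *v b) = ip G (C *v b) a" by (rule G(2))
    also have "\<dots> = (G *v a) \<bullet> (K *v (G *v b))"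
      by (simp add: ip_def inner_commute KG matrix_vector_mul_assoc[symmetric])
    also have "\<dots> = (\<Sum>i\<in>UNIV. \<Sum>j\<in>UNIV. k $ i $ j * ip G (E i) a * ip G (E j) b)"
      unfolding KE by (simp add: ip_def)
    finally show ?thesis by (simp add: G(2)[of a])
  qed
  have orth': "ip G n N = 0" "ip G Y N = 0" "ip G Z N = 0" "ip G Y n = 0" "ip G Z n = 0" "ip G Z Y = ip G Y Z"
    using orth G(2) by metis+
  \<comment> \<open>\<open>N\<close> is orthogonal to \<open>n, Y, Z\<close>, so the row and the
    column of \<open>k\<close> that belong to \<open>N\<close> never enter.\<close>
  have Cn: "ip G Y (C *v n) = k $ 2 $ 1 * ip G Y Y + k $ 3 $ 1 * ip G Y Z" "ip G Z (C *v n) = k $ 2 $ 1 * ip G Y Z + k $ 3 $ 1 * ip G Z Z"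
    unfolding C' by (simp_all add: sum_4' E_def orth orth')
  define a2 a3 where "a2 = ip G n (C *v Y)" and "a3 = ip G n (C *v Z)"
  have a: "a2 = k $ 1 $ 2 * ip G Y Y + k $ 1 $ 3 * ip G Y Z" "a3 = k $ 1 $ 2 * ip G Y Z + k $ 1 $ 3 * ip G Z Z"
    "- a2 = k $ 2 $ 1 * ip G Y Y + k $ 3 $ 1 * ip G Y Z" "- a3 = k $ 2 $ 1 * ip G Y Z + k $ 3 $ 1 * ip G Z Z"
       apply (simp_all add: a2_def a3_def C[symmetric] Cn)
    unfolding C' by (simp_all add: sum_4' E_def orth orth')
  define DD where "DD = ip G Y Y * ip G Z Z - (ip G Y Z)\<^sup>2"
  \<comment> \<open>Cramer's rule for the two systems in \<open>a\<close>, each with the matrix of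
    the first fundamental form and determinant \<open>DD\<close>.\<close>
  have k: "k $ 1 $ 2 * DD = ip G Z Z * a2 - ip G Y Z * a3" "k $ 1 $ 3 * DD = ip G Y Y * a3 - ip G Y Z * a2"
    "k $ 2 $ 1 * DD = - (ip G Z Z * a2 - ip G Y Z * a3)" "k $ 3 $ 1 * DD = - (ip G Y Y * a3 - ip G Y Z * a2)"
    using a unfolding DD_def power2_eq_square by algebra+
  \<comment> \<open>With \<open>N\<close> and \<open>Z\<close> occupying two slots of
    \<open>d4\<close>, only the two orders of \<open>n\<close> and \<open>Y\<close> survive. By the
    skewness expressed in \<open>k\<close> they contribute equally.\<close>
  have "(\<Sum>\<alpha>\<in>UNIV. \<Sum>\<gamma>\<in>UNIV. K $ \<alpha> $ \<gamma> * d4 (axis \<alpha> 1) (axis \<gamma> 1) N Z) = (k $ 1 $ 2 - k $ 2 $ 1) * d4 N n Y Z"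
    unfolding sum_outer_expansion[OF K] using d4_swap(1)[of n Y N Z] d4_swap(1)[of N n Y Z] d4_swap(2)[of n N Y Z]
    by (simp add: sum_4' E_def d4_equal left_diff_distrib)
  then have "DD * (\<Sum>\<alpha>\<in>UNIV. \<Sum>\<gamma>\<in>UNIV. K $ \<alpha> $ \<gamma> * d4 (axis \<alpha> 1) (axis \<gamma> 1) N Z) = 2 * d4 N n Y Z * (ip G Z Z * a2 - ip G Y Z * a3)"
    using k by algebra
  then show "(\<Sum>\<alpha>\<in>UNIV. \<Sum>\<gamma>\<in>UNIV. (C ** matrix_inv G) $ \<alpha> $ \<gamma> * d4 (axis \<alpha> 1) (axis \<gamma> 1) N Z)
      = 2 * d4 N n Y Z * (ip G Z Z * ip G n (C *v Y) - ip G Y Z * ip G n (C *v Z)) / (ip G Y Y * ip G Z Z - (ip G Y Z)\<^sup>2)"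
    using D unfolding K_def[symmetric] a2_def[symmetric] a3_def[symmetric] DD_def[symmetric] by (simp add: field_simps)
  have "(\<Sum>\<alpha>\<in>UNIV. \<Sum>\<gamma>\<in>UNIV. K $ \<alpha> $ \<gamma> * d4 (axis \<alpha> 1) (axis \<gamma> 1) N Y) = - ((k $ 1 $ 3 - k $ 3 $ 1) * d4 N n Y Z)"
    unfolding sum_outer_expansion[OF K] using d4_swap(1)[of n Z N Y] d4_swap(1)[of N n Z Y] d4_swap(2)[of n N Z Y] d4_swap(3)[of N n Z Y]
    by (simp add: sum_4' E_def d4_equal left_diff_distrib)
  then have "DD * (\<Sum>\<alpha>\<in>UNIV. \<Sum>\<gamma>\<in>UNIV. K $ \<alpha> $ \<gamma> * d4 (axis \<alpha> 1) (axis \<gamma> 1) N Y) = - 2 * d4 N n Y Z * (ip G Y Y * a3 - ip G Y Z * a2)"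
    using k by algebra
  then show "(\<Sum>\<alpha>\<in>UNIV. \<Sum>\<gamma>\<in>UNIV. (C ** matrix_inv G) $ \<alpha> $ \<gamma> * d4 (axis \<alpha> 1) (axis \<gamma> 1) N Y)
      = - 2 * d4 N n Y Z * (ip G Y Y * ip G n (C *v Z) - ip G Y Z * ip G n (C *v Y)) / (ip G Y Y * ip G Z Z - (ip G Y Z)\<^sup>2)"
    using D unfolding K_def[symmetric] a2_def[symmetric] a3_def[symmetric] DD_def[symmetric] by (simp add: field_simps)
qed

text \<open>The Gram matrix of the basis is block diagonal, with the blocks \<open>ip G N N\<close>,
  1 and the first fundamental form, and its determinant is that of \<open>G\<close> times the
  squared volume of the basis. It converts coordinate volume into area, and its sign shows later
  that the basis is nondegenerate.\<close>

lemma gram_det_4: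
  fixes G :: "real^4^4"
  assumes "\<And>a b. ip G a b = ip G b a"
    and orth: "ip G N n = 0" "ip G N Y = 0" "ip G N Z = 0" "ip G n Y = 0" "ip G n Z = 0" "ip G n n = 1"
  shows "det G * (d4 N n Y Z)\<^sup>2 = ip G N N * (ip G Y Y * ip G Z Z - (ip G Y Z)\<^sup>2)"
proof -
  define E :: "4 \<Rightarrow> real^4" where "E i = (if i = 0 then N else if i = 1 then n else if i = 2 then Y else Z)" for i
  define M :: "real^4^4" where "M = (\<chi> i. E i)"
  have dM: "det M = d4 N n Y Z" by (simp add: M_def E_def d4_def)
  have orth': "ip G n N = 0" "ip G Y N = 0" "ip G Z N = 0" "ip G Y n = 0" "ip G Z n = 0" "ip G Z Y = ip G Y Z"
    using orth assms(1) by metis+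
  have e: "(M ** G ** transpose M) $ i $ j = ip G (E i) (E j)" for i j
    unfolding ip_expand
    by (subst sum.swap) (simp add: matrix_matrix_mult_def transpose_def M_def sum_distrib_right sum_distrib_left mult_ac)
  have four: "i = 0 \<or> i = 1 \<or> i = 2 \<or> i = 3" for i :: 4
    using exhaust_4[of i] by auto
  have row: "(\<chi> j. ip G a (E j)) = ip G a N *\<^sub>R axis 0 1 + ip G a n *\<^sub>R axis 1 1 + ip G a Y *\<^sub>R axis 2 1 + ip G a Z *\<^sub>R axis 3 1" for a
    by (simp add: vec4_eq_iff axis_def E_def)
  have "M ** G ** transpose M = (\<chi> i. if i = 0 then \<chi> j. ip G N (E j) else if i = 1 then \<chi> j. ip G n (E j) else
      if i = 2 then \<chi> j. ip G Y (E j) else \<chi> j. ip G Z (E j))"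
    by (simp add: vec_eq_iff e E_def)
  then have "det M * det G * det M = d4 (\<chi> j. ip G N (E j)) (\<chi> j. ip G n (E j)) (\<chi> j. ip G Y (E j)) (\<chi> j. ip G Z (E j))"
    unfolding d4_def by (metis det_mul det_transpose)
  also have "\<dots> = ip G N N * (ip G Y Y * ip G Z Z - (ip G Y Z)\<^sup>2)"
    unfolding row by (simp add: orth orth' d4_add d4_scale d4_equal d4_mat d4_swap(3)[where p="axis 0 1" and q="axis 1 1" and r="axis 2 1" and s="axis 3 1"] power2_eq_square algebra_simps)
  finally show ?thesis by (simp add: dM power2_eq_square mult_ac)
qed

section \<open>Charts, tangent vectors and metrics\<close>

locale atlas =
  fixes X :: "'m topology" and A :: "('m, 'n::finite) chart set"
  assumes atlas: "smooth_atlas X A"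
begin

lemma chart_openin: "c \<in> A \<Longrightarrow> openin X (fst c)"
  and chart_open: "c \<in> A \<Longrightarrow> open (snd c ` fst c)"
  and chart_homeo: "c \<in> A \<Longrightarrow> homeomorphic_map (subtopology X (fst c)) (top_of_set (snd c ` fst c)) (snd c)"
  and transition_smooth: "c \<in> A \<Longrightarrow> c' \<in> A \<Longrightarrow> smooth_on (snd c ` (fst c \<inter> fst c')) (snd c' \<circ> cinv c)"
  using atlas by (auto simp: smooth_atlas_def)

lemma chart_subset: "c \<in> A \<Longrightarrow> fst c \<subseteq> topspace X"
  using chart_openin openin_subset by blast

lemma ex_chart: "p \<in> topspace X \<Longrightarrow> \<exists>c\<in>A. p \<in> fst c"
  using atlas by (auto simp: smooth_atlas_def)

lemma chart_at: "p \<in> topspace X \<Longrightarrow> chart_at A p \<in> A \<and> p \<in> fst (chart_at A p)"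
  unfolding chart_at_def by (rule someI_ex) (use ex_chart in blast)

lemma chart_inj: "c \<in> A \<Longrightarrow> inj_on (snd c) (fst c)"
  using homeomorphic_imp_injective_map[OF chart_homeo, of c] chart_subset[of c] by (simp add: Int_absorb1)

lemma cinv_chart: "c \<in> A \<Longrightarrow> p \<in> fst c \<Longrightarrow> cinv c (snd c p) = p"
  using chart_inj inv_into_f_f by fast

lemma cinv_in: "x \<in> snd c ` fst c \<Longrightarrow> cinv c x \<in> fst c"
  by (auto intro: inv_into_into)

lemma chart_continuous: "c \<in> A \<Longrightarrow> continuous_map (subtopology X (fst c)) euclidean (snd c)"
  using homeomorphic_imp_continuous_map[OF chart_homeo] by (simp add: continuous_map_in_subtopology)

lemma cinv_continuous: "c \<in> A \<Longrightarrow> continuous_map (top_of_set (snd c ` fst c)) X (cinv c)"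
proof -
  assume c: "c \<in> A"
  obtain g where g: "homeomorphic_maps (subtopology X (fst c)) (top_of_set (snd c ` fst c)) (snd c) g"
    using chart_homeo[OF c] homeomorphic_map_maps by blast
  have gX: "continuous_map (top_of_set (snd c ` fst c)) X g"
    using g by (simp add: homeomorphic_maps_def continuous_map_in_subtopology)
  have "g x = cinv c x" if "x \<in> snd c ` fst c" for x
    using g that c chart_subset[OF c] by (auto simp: homeomorphic_maps_def cinv_chart Int_absorb1)
  then show ?thesis
    using continuous_map_eq[OF gX] by simp
qed

lemma chart_image_open:
  assumes "c \<in> A" "openin X U" shows "open (snd c ` (fst c \<inter> U))"
proof -
  have "openin (subtopology X (fst c)) (fst c \<inter> U)"
    using assms(2) by (auto simp: openin_subtopology)
  then have "openin (top_of_set (snd c ` fst c)) (snd c ` (fst c \<inter> U))"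
    using homeomorphic_map_openness_eq[OF chart_homeo[OF assms(1)]] by blast
  then show ?thesis
    using chart_open[OF assms(1)] openin_open_eq by blast
qed

lemma transition_differentiable:
  assumes "c \<in> A" "c' \<in> A" "p \<in> fst c \<inter> fst c'"
  shows "(\<lambda>x. snd c' (cinv c x)) differentiable at (snd c p)"
proof -
  have "snd c p \<in> snd c ` (fst c \<inter> fst c')" using assms(3) by blast
  from smooth_on_differentiable[OF transition_smooth[OF assms(1,2)] chart_image_open[OF assms(1) chart_openin[OF assms(2)]] this]
  show ?thesis unfolding o_def .
qed

section \<open>Tangent vectors and differentials\<close>

lemma tangent_space_component:
  assumes "v \<in> tangent_space A p" "c \<in> A" "c' \<in> A" "p \<in> fst c" "p \<in> fst c'"
  shows "v c' = fd (\<lambda>x. snd c' (cinv c x)) (snd c p) (v c)"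
  using assms unfolding tangent_space_def o_def by blast

text \<open>One component vector determines the others through the transition maps, and in charts
  away from the base point the value is 0 by convention.\<close>

lemma tangent_eqI:
  assumes "u \<in> tangent_space A p" "v \<in> tangent_space A p" "c \<in> A" "p \<in> fst c" "u c = v c"
  shows "u = v"
proof
  fix c'
  show "u c' = v c'"
  proof (cases "c' \<in> A \<and> p \<in> fst c'")
    case True
    then show ?thesis
      using tangent_space_component[OF assms(1,3) _ assms(4)] tangent_space_component[OF assms(2,3) _ assms(4)] assms(5) by metis
  next
    case False
    then have "w c' = 0" if "w \<in> tangent_space A p" for w
      using that unfolding tangent_space_def by blast
    then show ?thesis using assms(1,2) by metis
  qed
qed

lemma tangent_zero: "(\<lambda>c. 0) \<in> tangent_space A p"
  unfolding tangent_space_def o_def using linear_0[OF fd_linear[OF transition_differentiable]] by simp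

lemma open_preimage_chart:
  assumes "open W" "continuous_map (top_of_set W) X \<tau>" "openin X U"
  shows "open (W \<inter> \<tau> -` U)"
proof -
  have "openin (top_of_set W) {x \<in> topspace (top_of_set W). \<tau> x \<in> U}"
    using openin_continuous_map_preimage[OF assms(2,3)] .
  moreover have "{x \<in> topspace (top_of_set W). \<tau> x \<in> U} = W \<inter> \<tau> -` U" by auto
  ultimately show ?thesis using assms(1) openin_open_eq by metis
qed

lemma smooth_intoD:
  assumes "smooth_into X A W \<tau>"
  shows "open W" "continuous_map (top_of_set W) X \<tau>" "c \<in> A \<Longrightarrow> smooth_on (W \<inter> \<tau> -` fst c) (\<lambda>x. snd c (\<tau> x))"
    "c \<in> A \<Longrightarrow> open (W \<inter> \<tau> -` fst c)" "x \<in> W \<Longrightarrow> \<tau> x \<in> topspace X"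
proof -
  show W: "open W" and \<tau>: "continuous_map (top_of_set W) X \<tau>"
    using assms by (auto simp: smooth_into_def)
  show "c \<in> A \<Longrightarrow> smooth_on (W \<inter> \<tau> -` fst c) (\<lambda>x. snd c (\<tau> x))"
    using assms by (simp add: smooth_into_def o_def)
  show "c \<in> A \<Longrightarrow> open (W \<inter> \<tau> -` fst c)"
    by (rule open_preimage_chart[OF W \<tau> chart_openin])
  show "x \<in> W \<Longrightarrow> \<tau> x \<in> topspace X"
    using continuous_map_image_subset_topspace[OF \<tau>] by auto
qed

lemma smooth_into_differentiable:
  assumes "smooth_into X A W \<tau>" "x \<in> W" "c \<in> A" "\<tau> x \<in> fst c"
  shows "(\<lambda>x. snd c (\<tau> x)) differentiable at x"
  using smooth_on_differentiable[OF smooth_intoD(3,4)[OF assms(1,3)], of x] assms(2,4) by blast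

lemma push_component: "c \<in> A \<Longrightarrow> \<tau> x \<in> fst c \<Longrightarrow> push A \<tau> x w c = fd (\<lambda>x. snd c (\<tau> x)) x w"
  by (simp add: push_def o_def)

lemma push_tangent:
  assumes "open V" "x \<in> V" "continuous_map (top_of_set V) X \<tau>"
    "\<And>c. c \<in> A \<Longrightarrow> \<tau> x \<in> fst c \<Longrightarrow> (\<lambda>x. snd c (\<tau> x)) differentiable at x"
  shows "push A \<tau> x w \<in> tangent_space A (\<tau> x)"
proof -
  have "push A \<tau> x w c' = fd (\<lambda>x. snd c' (cinv c x)) (snd c (\<tau> x)) (push A \<tau> x w c)"
    if c: "c \<in> A" "c' \<in> A" "\<tau> x \<in> fst c" "\<tau> x \<in> fst c'" for c c'
  proof -
    have "fd (\<lambda>x. snd c' (cinv c (snd c (\<tau> x)))) x w = fd (\<lambda>x. snd c' (cinv c x)) (snd c (\<tau> x)) (fd (\<lambda>x. snd c (\<tau> x)) x w)"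
      by (rule fd_compose) (use assms c transition_differentiable in auto)
    moreover have "fd (\<lambda>x. snd c' (cinv c (snd c (\<tau> x)))) x = fd (\<lambda>x. snd c' (\<tau> x)) x"
      by (rule fd_cong[where S = "V \<inter> \<tau> -` fst c"])
        (use assms c open_preimage_chart[OF assms(1,3) chart_openin[OF c(1)]] in \<open>auto simp: cinv_chart\<close>)
    ultimately show ?thesis using c by (simp add: push_component)
  qed
  moreover have "push A \<tau> x w c = 0" if "c \<notin> A \<or> \<tau> x \<notin> fst c" for c
    using that by (auto simp: push_def)
  ultimately show ?thesis
    unfolding tangent_space_def o_def by blast
qed

lemma push_tangent':
  assumes "smooth_into X A W \<tau>" "x \<in> W"
  shows "push A \<tau> x w \<in> tangent_space A (\<tau> x)"
  by (rule push_tangent[OF smooth_intoD(1)[OF assms(1)] assms(2) smooth_intoD(2)[OF assms(1)]])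
    (use smooth_into_differentiable[OF assms] in blast)

lemma push_linear:
  assumes "smooth_into X A W \<tau>" "x \<in> W"
  shows "push A \<tau> x (a *\<^sub>R v + b *\<^sub>R w) = (\<lambda>c. a *\<^sub>R push A \<tau> x v c + b *\<^sub>R push A \<tau> x w c)"
proof
  fix c
  show "push A \<tau> x (a *\<^sub>R v + b *\<^sub>R w) c = a *\<^sub>R push A \<tau> x v c + b *\<^sub>R push A \<tau> x w c"
  proof (cases "c \<in> A \<and> \<tau> x \<in> fst c")
    case True
    then have "linear (fd (\<lambda>x. snd c (\<tau> x)) x)"
      using smooth_into_differentiable[OF assms] fd_linear by blast
    then show ?thesis using True by (simp add: push_component linear_add linear_scale)
  next
    case False
    then show ?thesis by (auto simp: push_def)
  qed
qed

lemma cinv_smooth_into: "c \<in> A \<Longrightarrow> smooth_into X A (snd c ` fst c) (cinv c)"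
proof -
  assume c: "c \<in> A"
  have "snd c ` fst c \<inter> cinv c -` fst c' = snd c ` (fst c \<inter> fst c')" for c' :: "('m, 'n) chart"
    using c by (auto simp: cinv_chart)
  then show ?thesis
    unfolding smooth_into_def using chart_open[OF c] cinv_continuous[OF c] transition_smooth[OF c] by simp
qed

text \<open>The inverse of taking components in the chart \<open>c\<close> at the point
  \<open>p\<close>.\<close>

definition lift :: "('m, 'n) chart \<Rightarrow> 'm \<Rightarrow> real^'n \<Rightarrow> ('m, 'n) tvec" where
  "lift c p y = push A (cinv c) (snd c p) y"

lemma lift_component:
  assumes "c \<in> A" "p \<in> fst c" shows "lift c p y c = y"
proof -
  have "fd (\<lambda>x. snd c (cinv c x)) (snd c p) = fd (\<lambda>x. x) (snd c p)"
    by (rule fd_cong[OF chart_open[OF assms(1)]]) (use assms in \<open>auto simp: cinv_chart\<close>)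
  then show ?thesis
    using assms by (simp add: lift_def push_component cinv_chart)
qed

lemma lift_tangent: "c \<in> A \<Longrightarrow> p \<in> fst c \<Longrightarrow> lift c p y \<in> tangent_space A p"
  unfolding lift_def using push_tangent'[OF cinv_smooth_into, of c "snd c p"] by (simp add: cinv_chart)

lemma lift_eq: "c \<in> A \<Longrightarrow> p \<in> fst c \<Longrightarrow> Y \<in> tangent_space A p \<Longrightarrow> lift c p (Y c) = Y"
  by (rule tangent_eqI[OF lift_tangent]) (auto simp: lift_component)

lemma lift_linear: "c \<in> A \<Longrightarrow> p \<in> fst c \<Longrightarrow> lift c p (a *\<^sub>R v + b *\<^sub>R w) = (\<lambda>d. a *\<^sub>R lift c p v d + b *\<^sub>R lift c p w d)"
  unfolding lift_def by (rule push_linear[OF cinv_smooth_into]) auto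

end

section \<open>Metrics in components\<close>

text \<open>The common properties of the Lorentz metric \<open>g\<close> and of the static metric
  that the curvature arguments rest on: a symmetric form given by its Gram matrix, with components
  regular enough for Christoffel symbols.\<close>

definition metric_field :: "('m, 'n::finite) chart set \<Rightarrow> 'm set \<Rightarrow> ('m, 'n) metric \<Rightarrow> bool" where
  "metric_field A U g \<longleftrightarrow> (\<forall>c\<in>A. \<forall>p\<in>fst c \<inter> U.
     (\<forall>Y\<in>tangent_space A p. \<forall>Z\<in>tangent_space A p.
        g p Y Z = ip (gram A g (cinv c) (snd c p)) (Y c) (Z c) \<and> g p Y Z = g p Z Y) \<and>
     gram A g (cinv c) differentiable at (snd c p))"

lemma gram_entry: "gram A g \<tau> x $ i $ j = g (\<tau> x) (push A \<tau> x (axis i 1)) (push A \<tau> x (axis j 1))"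
  by (simp add: gram_def)

lemma ip_pullbackI:
  assumes "\<And>i j. G $ i $ j = ip H (L (axis i 1)) (L (axis j 1))" "linear L"
  shows "ip G a b = ip H (L a) (L b)"
proof -
  have "ip H (L a) (L b) = (\<Sum>i\<in>UNIV. \<Sum>j\<in>UNIV. a $ i * b $ j * ip H (L (axis i 1)) (L (axis j 1)))"
    by (subst linear_axis_expansion[OF assms(2), of a], subst linear_axis_expansion[OF assms(2), of b],
        simp add: ip_sum_left ip_sum_right sum_distrib_left mult_ac, rule sum.swap)
  then show ?thesis by (simp add: ip_expand[of G] assms(1))
qed

context atlas
begin

lemma metric_fieldI:
  assumes "\<And>c p Y Z. c \<in> A \<Longrightarrow> p \<in> fst c \<Longrightarrow> p \<in> U \<Longrightarrow> Y \<in> tangent_space A p \<Longrightarrow> Z \<in> tangent_space A p \<Longrightarrow> g p Y Z = b c p (Y c) (Z c)"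
    and "\<And>c p. c \<in> A \<Longrightarrow> p \<in> fst c \<Longrightarrow> p \<in> U \<Longrightarrow> bilinear (b c p)"
    and "\<And>p Y Z. p \<in> U \<Longrightarrow> Y \<in> tangent_space A p \<Longrightarrow> Z \<in> tangent_space A p \<Longrightarrow> g p Y Z = g p Z Y"
    and "\<And>c p. c \<in> A \<Longrightarrow> p \<in> fst c \<Longrightarrow> p \<in> U \<Longrightarrow> gram A g (cinv c) differentiable at (snd c p)"
  shows "metric_field A U g"
  unfolding metric_field_def
proof (intro ballI conjI)
  fix c p Y Z
  assume c: "c \<in> A" and p: "p \<in> fst c \<inter> U" and Y: "Y \<in> tangent_space A p" "Z \<in> tangent_space A p"
  have G: "gram A g (cinv c) (snd c p) $ i $ j = b c p (axis i 1) (axis j 1)" for i j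
    using assms(1)[OF c, of p "lift c p (axis i 1)" "lift c p (axis j 1)"] c p
    by (simp add: gram_entry cinv_chart lift_tangent lift_component lift_def[symmetric])
  have bl: "linear (b c p y)" "linear (\<lambda>y. b c p y z)" for y z
    using assms(2)[OF c, of p] p by (auto simp: bilinear_def)
  have "b c p y z = ip (gram A g (cinv c) (snd c p)) y z" for y z
    by (subst linear_axis_expansion[OF bl(2)], subst linear_axis_expansion[OF bl(1)])
      (simp add: ip_expand G sum_distrib_left mult_ac)
  then show "g p Y Z = ip (gram A g (cinv c) (snd c p)) (Y c) (Z c)"
    using assms(1)[OF c _ _ Y] p by simp
  show "g p Y Z = g p Z Y" using assms(3) p Y by blast
qed (use assms(4) in auto)

lemma metric_field_ip:
  assumes "metric_field A U g" "c \<in> A" "p \<in> fst c" "p \<in> U" "Y \<in> tangent_space A p" "Z \<in> tangent_space A p"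
  shows "g p Y Z = ip (gram A g (cinv c) (snd c p)) (Y c) (Z c)" "g p Y Z = g p Z Y"
  using assms unfolding metric_field_def by blast+

lemma metric_field_ip_sym:
  assumes "metric_field A U g" "c \<in> A" "p \<in> fst c" "p \<in> U"
  shows "ip (gram A g (cinv c) (snd c p)) y z = ip (gram A g (cinv c) (snd c p)) z y"
proof -
  have t: "lift c p y \<in> tangent_space A p" for y using assms lift_tangent by blast
  have "lift c p y c = y" for y using assms lift_component by blast
  then show ?thesis
    using metric_field_ip[OF assms t[of y] t[of z]] metric_field_ip(1)[OF assms t[of z] t[of y]] by simp
qed

lemma metric_field_gram:
  assumes "metric_field A U g" "smooth_into X A W \<tau>" "x \<in> W" "\<tau> x \<in> U"
  shows "ip (gram A g \<tau> x) a b = g (\<tau> x) (push A \<tau> x a) (push A \<tau> x b)"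
    "c \<in> A \<Longrightarrow> \<tau> x \<in> fst c \<Longrightarrow> ip (gram A g \<tau> x) a b =
      ip (gram A g (cinv c) (snd c (\<tau> x))) (fd (\<lambda>x. snd c (\<tau> x)) x a) (fd (\<lambda>x. snd c (\<tau> x)) x b)"
proof -
  have *: "g (\<tau> x) (push A \<tau> x a) (push A \<tau> x b) =
      ip (gram A g (cinv c) (snd c (\<tau> x))) (fd (\<lambda>x. snd c (\<tau> x)) x a) (fd (\<lambda>x. snd c (\<tau> x)) x b)"
    if "c \<in> A" "\<tau> x \<in> fst c" for a b c
    using metric_field_ip(1)[OF assms(1) that assms(4) push_tangent'[OF assms(2,3)] push_tangent'[OF assms(2,3)]] that
    by (simp add: push_component)
  have **: "ip (gram A g \<tau> x) a b =
      ip (gram A g (cinv c) (snd c (\<tau> x))) (fd (\<lambda>x. snd c (\<tau> x)) x a) (fd (\<lambda>x. snd c (\<tau> x)) x b)"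
    if "c \<in> A" "\<tau> x \<in> fst c" for c
    using that by (intro ip_pullbackI) (auto simp: gram_entry * intro!: fd_linear smooth_into_differentiable[OF assms(2,3)])
  obtain c0 where "c0 \<in> A" "\<tau> x \<in> fst c0"
    using ex_chart smooth_intoD(5)[OF assms(2,3)] by blast
  with * ** show "ip (gram A g \<tau> x) a b = g (\<tau> x) (push A \<tau> x a) (push A \<tau> x b)" by metis
  show "c \<in> A \<Longrightarrow> \<tau> x \<in> fst c \<Longrightarrow> ip (gram A g \<tau> x) a b =
      ip (gram A g (cinv c) (snd c (\<tau> x))) (fd (\<lambda>x. snd c (\<tau> x)) x a) (fd (\<lambda>x. snd c (\<tau> x)) x b)"
    by (rule **)
qed

end

text \<open>Nondegeneracy comes from the orthonormal frame: with its components as the rows of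
  \<open>E\<close>, the product \<open>E ** G ** transpose E\<close> is diagonal with entries -1, 1,
  1, 1.\<close>

lemma lorentz_metric_field:
  assumes "smooth_atlas X A" "lorentz_metric A (topspace X) g"
  shows "metric_field A (topspace X) g"
    and "\<And>c p. c \<in> A \<Longrightarrow> p \<in> fst c \<Longrightarrow> invertible (gram A g (cinv c) (snd c p))"
proof -
  interpret atlas X A by standard fact
  note L = assms(2)[unfolded lorentz_metric_def]
  have lin1: "g p (\<lambda>c. a *\<^sub>R Y c + b *\<^sub>R Z c) W = a * g p Y W + b * g p Z W"
    if "p \<in> topspace X" "Y \<in> tangent_space A p" "Z \<in> tangent_space A p" "W \<in> tangent_space A p" for p Y Z W a b
    using L that by blast
  have sym: "g p Y Z = g p Z Y" if "p \<in> topspace X" "Y \<in> tangent_space A p" "Z \<in> tangent_space A p" for p Y Z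
    using L that by blast
  show mf: "metric_field A (topspace X) g"
  proof (rule metric_fieldI[where b = "\<lambda>c p y z. g p (lift c p y) (lift c p z)"])
    fix c p assume c: "c \<in> A" "p \<in> fst c" "p \<in> topspace X"
    have l: "g p (lift c p (a *\<^sub>R v + b *\<^sub>R w)) (lift c p z) = a * g p (lift c p v) (lift c p z) + b * g p (lift c p w) (lift c p z)" for a b v w z
      unfolding lift_linear[OF c(1,2)] using c by (intro lin1 lift_tangent)
    have r: "g p (lift c p z) (lift c p v) = g p (lift c p v) (lift c p z)" for v z
      using c by (intro sym lift_tangent)
    have l': "g p (lift c p (v + w)) (lift c p z) = g p (lift c p v) (lift c p z) + g p (lift c p w) (lift c p z)"
      "g p (lift c p (a *\<^sub>R v)) (lift c p z) = a * g p (lift c p v) (lift c p z)" for v w z a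
      using l[of 1 v 1 w z] l[of a v 0 v z] by simp_all
    define \<beta> where "\<beta> y z = g p (lift c p y) (lift c p z)" for y z
    have \<beta>: "\<beta> (v + w) z = \<beta> v z + \<beta> w z" "\<beta> (a *\<^sub>R v) z = a * \<beta> v z" for v w z a
      unfolding \<beta>_def by (rule l')+
    have \<beta>_sym: "\<beta> z v = \<beta> v z" for v z
      unfolding \<beta>_def by (rule r)
    have "\<beta> z (v + w) = \<beta> z v + \<beta> z w" "\<beta> z (a *\<^sub>R v) = a * \<beta> z v" for v w z a
      using \<beta>(1)[where v=v and w=w and z=z] \<beta>(2)[where a=a and v=v and z=z] \<beta>_sym[of z "v + w"] \<beta>_sym[of z v] \<beta>_sym[of z w] \<beta>_sym[of z "a *\<^sub>R v"]
      by metis+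
    then have "bilinear \<beta>"
      unfolding bilinear_def by (intro conjI allI linearI) (simp_all only: \<beta> real_scaleR_def)
    then show "bilinear (\<lambda>y z. g p (lift c p y) (lift c p z))"
      by (simp only: \<beta>_def[abs_def])
    have "smooth_on (snd c ` (fst c \<inter> topspace X)) (gram A g (cinv c))"
      using L c by blast
    then show "gram A g (cinv c) differentiable at (snd c p)"
      using smooth_on_differentiable chart_image_open[OF c(1) openin_topspace] c by blast
  qed (auto simp: lift_eq sym)
  fix c p assume c: "c \<in> A" "p \<in> fst c"
  then have p: "p \<in> topspace X" using chart_subset by blast
  then obtain e :: "4 \<Rightarrow> _" where e: "\<And>a b. e a \<in> tangent_space A p \<and> g p (e a) (e b) = (if a \<noteq> b then 0 else if a = 0 then -1 else 1)"
    using L by blast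
  define G where "G = gram A g (cinv c) (snd c p)"
  define E :: "real^4^4" where "E = (\<chi> a. e a c)"
  have ipe: "ip G (e a c) (e b c) = (if a \<noteq> b then 0 else if a = 0 then -1 else 1)" for a b
    using metric_field_ip(1)[OF mf c p, of "e a" "e b"] e by (simp add: G_def)
  define J :: "real^4^4" where "J = (\<chi> a b. if a \<noteq> b then 0 else if a = 0 then -1 else 1)"
  have "E ** G ** transpose E = J"
    unfolding vec_eq_iff
  proof (intro allI)
    fix a b
    have "(E ** G ** transpose E) $ a $ b = ip G (e a c) (e b c)"
      unfolding ip_expand
      by (subst sum.swap) (simp add: matrix_matrix_mult_def transpose_def E_def sum_distrib_right sum_distrib_left mult_ac)
    then show "(E ** G ** transpose E) $ a $ b = J $ a $ b" by (simp add: ipe J_def)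
  qed
  moreover have "det J \<noteq> 0"
    by (subst det_diagonal) (auto simp: J_def)
  ultimately have "det G \<noteq> 0" by (metis det_mul mult_zero_left mult_zero_right)
  then show "invertible (gram A g (cinv c) (snd c p))"
    by (simp add: G_def invertible_det_nz)
qed

section \<open>Local parametrizations\<close>

lemma linear_christoffel_vec: "linear (\<lambda>a. christoffel_vec G x a b)"
  by (rule linearI)
    (simp_all add: christoffel_vec_def vec_eq_iff sum.distrib sum_distrib_left algebra_simps)

lemma linear_cov_deriv:
  assumes "s differentiable at u" "m differentiable at u"
  shows "linear (cov_deriv G s m u)"
  using linear_compose_add[OF fd_linear[OF assms(2)] linear_compose[OF fd_linear[OF assms(1)] linear_christoffel_vec]]
  by (simp add: cov_deriv_def[abs_def] o_def)

lemma cov_deriv_cong: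
  assumes "open T" "u \<in> T" "\<And>y. y \<in> T \<Longrightarrow> s y = s' y" "\<And>y. y \<in> T \<Longrightarrow> m y = m' y"
  shows "cov_deriv G s m u w = cov_deriv G s' m' u w"
  unfolding cov_deriv_def using fd_cong[OF assms(1,2), of s s'] fd_cong[OF assms(1,2), of m m'] assms(2-4) by simp

lemma cov_deriv_compose:
  assumes "\<theta> differentiable at u" "s differentiable at (\<theta> u)" "m differentiable at (\<theta> u)"
  shows "cov_deriv G (\<lambda>y. s (\<theta> y)) (\<lambda>y. m (\<theta> y)) u w = cov_deriv G s m (\<theta> u) (fd \<theta> u w)"
  by (simp add: cov_deriv_def fd_compose assms)

context atlas
begin

lemma push_compose:
  assumes "smooth_into X A W \<tau>" "open V" "y \<in> V" "\<And>z. z \<in> V \<Longrightarrow> s z \<in> W" "\<And>z. z \<in> V \<Longrightarrow> \<tau> (s z) = \<sigma> z"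
    and "s differentiable at y"
  shows "push A \<sigma> y v = push A \<tau> (s y) (fd s y v)"
proof
  fix c :: "('m, 'n) chart"
  have eq: "\<tau> (s y) = \<sigma> y" and sy: "s y \<in> W" using assms(3-5) by auto
  show "push A \<sigma> y v c = push A \<tau> (s y) (fd s y v) c"
  proof (cases "c \<in> A \<and> \<sigma> y \<in> fst c")
    case True
    have "fd (\<lambda>z. snd c (\<tau> (s z))) y v = fd (\<lambda>x. snd c (\<tau> x)) (s y) (fd s y v)"
      using True eq sy by (intro fd_compose assms(6) smooth_into_differentiable[OF assms(1)]) auto
    moreover have "fd (\<lambda>z. snd c (\<tau> (s z))) y = fd (\<lambda>z. snd c (\<sigma> z)) y"
      by (rule fd_cong[OF assms(2,3)]) (simp add: assms(5))
    ultimately show ?thesis using True eq by (simp add: push_component)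
  next
    case False
    then show ?thesis using eq by (auto simp: push_def)
  qed
qed

lemma local_paramD:
  assumes "local_param X A H P W \<sigma>"
  shows "smooth_into X A W \<sigma>" "open W" "x \<in> W \<Longrightarrow> inj (push A \<sigma> x)"
    "openin (subtopology X P) (\<sigma> ` (W \<inter> H))"
    "homeomorphic_map (top_of_set (W \<inter> H)) (subtopology X (\<sigma> ` (W \<inter> H))) \<sigma>"
    "\<sigma> ` (W \<inter> H) \<subseteq> P" "inj_on \<sigma> (W \<inter> H)" "x \<in> W \<Longrightarrow> \<sigma> x \<in> topspace X"
proof -
  show 1: "smooth_into X A W \<sigma>" and "x \<in> W \<Longrightarrow> inj (push A \<sigma> x)" and 2: "openin (subtopology X P) (\<sigma> ` (W \<inter> H))"
    and 3: "homeomorphic_map (top_of_set (W \<inter> H)) (subtopology X (\<sigma> ` (W \<inter> H))) \<sigma>"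
    using assms by (auto simp: local_param_def)
  show "open W" "x \<in> W \<Longrightarrow> \<sigma> x \<in> topspace X" using smooth_intoD[OF 1] by auto
  show "\<sigma> ` (W \<inter> H) \<subseteq> P" using openin_subset[OF 2] by auto
  show "inj_on \<sigma> (W \<inter> H)" using homeomorphic_imp_injective_map[OF 3] by simp
qed

lemma local_param_fd_inj:
  assumes "local_param X A H P W \<sigma>" "x \<in> W" "c \<in> A" "\<sigma> x \<in> fst c"
  shows "inj (fd (\<lambda>x. snd c (\<sigma> x)) x)"
proof (rule injI)
  fix v w assume "fd (\<lambda>x. snd c (\<sigma> x)) x v = fd (\<lambda>x. snd c (\<sigma> x)) x w"
  then have "push A \<sigma> x v c = push A \<sigma> x w c" using assms by (simp add: push_component)
  then have "push A \<sigma> x v = push A \<sigma> x w"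
    using push_tangent'[OF local_paramD(1)[OF assms(1)] assms(2)] assms(3,4) by (intro tangent_eqI)
  then show "v = w" using local_paramD(3)[OF assms(1,2)] by (simp add: inj_eq)
qed

text \<open>Reads a continuous map into \<open>P\<close> in the coordinates of a parametrization.
  The homeomorphism property gives continuity; the domain is open only relative to \<open>T\<close>,
  which may itself be part of a half-space.\<close>

lemma local_param_lift:
  assumes lp: "local_param X A H P W \<sigma>" and f: "continuous_map (top_of_set T) (subtopology X P) f"
  defines "\<theta> \<equiv> \<lambda>y. inv_into (W \<inter> H) \<sigma> (f y)" and "T' \<equiv> T \<inter> f -` (\<sigma> ` (W \<inter> H))"
  shows "openin (top_of_set T) T'" "continuous_on T' \<theta>" "y \<in> T' \<Longrightarrow> \<theta> y \<in> W \<inter> H" "y \<in> T' \<Longrightarrow> \<sigma> (\<theta> y) = f y"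
proof -
  have "T' = {y \<in> topspace (top_of_set T). f y \<in> \<sigma> ` (W \<inter> H)}"
    by (auto simp: T'_def)
  then show "openin (top_of_set T) T'"
    using openin_continuous_map_preimage[OF f local_paramD(4)[OF lp]] by simp
  have fT': "f y \<in> \<sigma> ` (W \<inter> H)" if "y \<in> T'" for y
    using that by (simp add: T'_def)
  show in': "y \<in> T' \<Longrightarrow> \<theta> y \<in> W \<inter> H" and eq: "y \<in> T' \<Longrightarrow> \<sigma> (\<theta> y) = f y" for y
    unfolding \<theta>_def using inv_into_into[OF fT'] f_inv_into_f[OF fT'] by blast+
  obtain g where g: "homeomorphic_maps (top_of_set (W \<inter> H)) (subtopology X (\<sigma> ` (W \<inter> H))) \<sigma> g"
    using local_paramD(5)[OF lp] homeomorphic_map_maps by blast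
  have gc: "continuous_map (subtopology X (\<sigma> ` (W \<inter> H))) (top_of_set (W \<inter> H)) g"
    and gs: "\<And>x. x \<in> W \<inter> H \<Longrightarrow> g (\<sigma> x) = x"
    using g by (auto simp: homeomorphic_maps_def)
  have "continuous_map (top_of_set T') X f"
    using continuous_map_from_subtopology[OF f, of T'] by (simp add: continuous_map_in_subtopology subtopology_subtopology T'_def Int_absorb1)
  then have "continuous_map (top_of_set T') (subtopology X (\<sigma> ` (W \<inter> H))) f"
    by (auto simp: continuous_map_in_subtopology T'_def)
  then have "continuous_map (top_of_set T') (top_of_set (W \<inter> H)) (g \<circ> f)"
    using gc continuous_map_compose by blast
  then have "continuous_on T' (g \<circ> f)"
    by (simp add: continuous_map_in_subtopology)
  moreover have "(g \<circ> f) y = \<theta> y" if "y \<in> T'" for y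
    using gs[OF in'[OF that]] eq[OF that] by simp
  ultimately show "continuous_on T' \<theta>"
    by (metis (no_types, lifting) continuous_on_cong)
qed

text \<open>Continuity of the lift improves to differentiability because the parametrization, read
  in a chart, has an injective derivative that can be divided out.\<close>

lemma local_param_lift_differentiable:
  assumes lp: "local_param X A H P W \<sigma>"
    and V: "open V" "continuous_map (top_of_set V) (subtopology X P) f" "u \<in> V" "f u \<in> \<sigma> ` (W \<inter> H)"
    and f: "\<And>y c. y \<in> V \<Longrightarrow> c \<in> A \<Longrightarrow> f y \<in> fst c \<Longrightarrow> (\<lambda>y. snd c (f y)) differentiable at y"
  obtains T \<theta> where "open T" "u \<in> T" "T \<subseteq> V" "\<And>y. y \<in> T \<Longrightarrow> \<theta> y \<in> W \<inter> H" "\<And>y. y \<in> T \<Longrightarrow> \<sigma> (\<theta> y) = f y"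
    "\<And>y. y \<in> T \<Longrightarrow> \<theta> differentiable at y" "\<And>y v. y \<in> T \<Longrightarrow> push A \<sigma> (\<theta> y) (fd \<theta> y v) = push A f y v"
proof -
  define \<theta> where "\<theta> y = inv_into (W \<inter> H) \<sigma> (f y)" for y
  define T where "T = V \<inter> f -` (\<sigma> ` (W \<inter> H))"
  note l = local_param_lift[OF lp V(2), folded \<theta>_def T_def]
  have T: "open T" using l(1) V(1) openin_open_eq by blast
  have fX: "continuous_map (top_of_set V) X f"
    using V(2) by (simp add: continuous_map_in_subtopology)
  have d: "\<theta> differentiable at y \<and> push A \<sigma> (\<theta> y) (fd \<theta> y v) = push A f y v" if y: "y \<in> T" for y v
  proof -
    have yV: "y \<in> V" using y by (simp add: T_def)
    have \<theta>y: "\<theta> y \<in> W" "\<sigma> (\<theta> y) = f y" using l(3,4)[OF y] by auto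
    have "f y \<in> topspace X" using local_paramD(8)[OF lp \<theta>y(1)] \<theta>y(2) by simp
    then obtain c where c: "c \<in> A" "f y \<in> fst c" using ex_chart by blast
    have c': "\<sigma> (\<theta> y) \<in> fst c" using c \<theta>y by simp
    define T2 where "T2 = T \<inter> (V \<inter> f -` fst c)"
    have T2: "open T2" "y \<in> T2"
      using T open_preimage_chart[OF V(1) fX chart_openin[OF c(1)]] y yV c by (auto simp: T2_def)
    have cont: "isCont \<theta> y"
      using l(2) T y by (simp add: continuous_on_eq_continuous_at)
    note D = differentiable_factor[of "\<lambda>x. snd c (\<sigma> x)" \<theta> y "\<lambda>y. snd c (f y)" T2,
        OF smooth_into_differentiable[OF local_paramD(1)[OF lp] \<theta>y(1) c(1) c']
          local_param_fd_inj[OF lp \<theta>y(1) c(1) c'] f[OF yV c] cont T2]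
    have eq: "snd c (\<sigma> (\<theta> z)) = snd c (f z)" if "z \<in> T2" for z
      using l(4) that by (simp add: T2_def)
    have "push A \<sigma> (\<theta> y) (fd \<theta> y v) = push A f y v"
    proof (rule tangent_eqI[OF _ _ c])
      show "push A \<sigma> (\<theta> y) (fd \<theta> y v) \<in> tangent_space A (f y)"
        using push_tangent'[OF local_paramD(1)[OF lp] \<theta>y(1)] \<theta>y(2) by metis
      show "push A f y v \<in> tangent_space A (f y)"
        by (rule push_tangent[OF V(1) yV fX]) (use f yV in blast)
      show "push A \<sigma> (\<theta> y) (fd \<theta> y v) c = push A f y v c"
        using D(2)[OF eq] c c' by (simp add: push_component)
    qed
    then show ?thesis using D(1)[OF eq] by blast
  qed
  show ?thesis
    by (rule that[OF T _ _ _ l(4)]) (use V(3,4) d l(3) in \<open>auto simp: T_def\<close>)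
qed

lemma local_param_continuous:
  assumes "local_param X A UNIV P W \<sigma>"
  shows "continuous_map (top_of_set W) (subtopology X P) \<sigma>"
  using smooth_intoD(2)[OF local_paramD(1)[OF assms]] local_paramD(6)[OF assms]
  by (auto simp: continuous_map_in_subtopology)

lemma local_param_transition:
  assumes lp: "local_param X A UNIV P W \<sigma>" and lp': "local_param X A UNIV P W' \<sigma>'" "u \<in> W'" "\<sigma>' u \<in> \<sigma> ` W"
  obtains T \<theta> where "open T" "u \<in> T" "T \<subseteq> W'" "\<And>y. y \<in> T \<Longrightarrow> \<theta> y \<in> W" "\<And>y. y \<in> T \<Longrightarrow> \<sigma> (\<theta> y) = \<sigma>' y"
    "\<And>y. y \<in> T \<Longrightarrow> \<theta> differentiable at y" "\<And>y v. y \<in> T \<Longrightarrow> push A \<sigma> (\<theta> y) (fd \<theta> y v) = push A \<sigma>' y v"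
  using local_param_lift_differentiable[OF lp local_paramD(2)[OF lp'(1)] local_param_continuous[OF lp'(1)] lp'(2)]
    lp'(3) smooth_into_differentiable[OF local_paramD(1)[OF lp'(1)]] by (metis (no_types, lifting) Int_UNIV_right)

section \<open>Mean curvature as a trace\<close>

lemma gram_pos:
  assumes "metric_field A (topspace X) g" "spacelike X A g H Q" "local_param X A H Q W \<tau>" "x \<in> W \<inter> H" "a \<noteq> 0"
  shows "ip (gram A g \<tau> x) a a > 0"
proof -
  have x: "x \<in> W" using assms(4) by blast
  have lin: "push A \<tau> x 0 = (\<lambda>c. 0)"
    using push_linear[OF local_paramD(1)[OF assms(3)] x, of 0 0 0 0] by simp
  have "push A \<tau> x a \<noteq> (\<lambda>c. 0)"
    using lin local_paramD(3)[OF assms(3) x] assms(5) by (metis injD)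
  moreover have "push A \<tau> x a \<in> tangent_sub X A H Q (\<tau> x)"
    using assms(3,4) unfolding tangent_sub_def by blast
  moreover have "\<tau> x \<in> Q" using local_paramD(6)[OF assms(3)] assms(4) by blast
  ultimately have "g (\<tau> x) (push A \<tau> x a) (push A \<tau> x a) > 0"
    using assms(2) unfolding spacelike_def by blast
  then show ?thesis
    using metric_field_gram(1)[OF assms(1) local_paramD(1)[OF assms(3)] x local_paramD(8)[OF assms(3) x]] by simp
qed

text \<open>The mean curvature with respect to \<open>n\<close> computed in an ambient chart, with
  the connection of the ambient metric. The covariant derivative is paired with tangent vectors, so
  the component by which it differs from the intrinsic one drops out.\<close>

definition surface_trace ::
  "('m, 'n) metric \<Rightarrow> ('m, 'n) chart \<Rightarrow> (real^2 \<Rightarrow> 'm) \<Rightarrow> ('m \<Rightarrow> ('m, 'n) tvec) \<Rightarrow> real^2 \<Rightarrow> real" where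
  "surface_trace g c \<sigma> n u =
    (let G = gram A g (cinv c); s = (\<lambda>y. snd c (\<sigma> y)); m = (\<lambda>y. n (\<sigma> y) c) in
      tr2 (\<lambda>w v. ip (G (s u)) (fd s u w) (fd s u v)) (\<lambda>w v. ip (G (s u)) (fd s u v) (cov_deriv G s m u w))
        (axis 0 1) (axis 1 1))"

text \<open>Uniqueness of the mean curvature. A change of parameters \<open>\<theta>\<close> carries
  the data of the definition to the given \<open>\<sigma>\<close>, the Gauss formula replaces the
  induced metric of \<open>Q\<close> by the ambient one, and the trace removes the dependence on the
  eigenbasis. Differentiability of the normal is a by-product, since the definition supplies
  differentiable coordinates \<open>m\<close> for it.\<close>

lemma is_mean_curvature_trace:
  assumes mf: "metric_field A (topspace X) g" and sp: "spacelike X A g half_space Q"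
    and k: "is_mean_curvature X A g Q S n p k"
    and lp: "local_param X A UNIV S W \<sigma>" "u \<in> W" "\<sigma> u = p"
    and c: "c \<in> A" "p \<in> fst c" "invertible (gram A g (cinv c) (snd c p))"
  shows "k = surface_trace g c \<sigma> n u" "(\<lambda>y. n (\<sigma> y) c) differentiable at u"
proof -
  obtain W1 \<tau> W2 \<sigma>1 and s :: "real^2 \<Rightarrow> real^3" and m u1 w1 w2 \<kappa>1 \<kappa>2 where
    \<tau>: "local_param X A half_space Q W1 \<tau>" and \<sigma>1: "local_param X A UNIV S W2 \<sigma>1" "u1 \<in> W2" "\<sigma>1 u1 = p"
    and sm: "s differentiable_on W2" "m differentiable_on W2"
    and eq: "\<And>y. y \<in> W2 \<Longrightarrow> s y \<in> W1 \<inter> half_space \<and> \<tau> (s y) = \<sigma>1 y \<and> push A \<tau> (s y) (m y) = n (\<sigma>1 y)"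
    and w: "w1 \<noteq> w2" "independent {w1, w2}"
      "cov_deriv (gram A g \<tau>) s m u1 w1 = \<kappa>1 *\<^sub>R fd s u1 w1"
      "cov_deriv (gram A g \<tau>) s m u1 w2 = \<kappa>2 *\<^sub>R fd s u1 w2"
    and k': "k = \<kappa>1 + \<kappa>2"
    using k unfolding is_mean_curvature_def by blast
  have sm': "s differentiable at y" "m differentiable at y" if "y \<in> W2" for y
    using sm that local_paramD(2)[OF \<sigma>1(1)] differentiable_on_eq_differentiable_at by blast+
  have "\<sigma> u \<in> \<sigma>1 ` W2" using imageI[OF \<sigma>1(2), of \<sigma>1] lp(3) \<sigma>1(3) by simp
  then obtain T \<theta> where T: "open T" "u \<in> T" "T \<subseteq> W"
    and \<theta>: "\<And>y. y \<in> T \<Longrightarrow> \<theta> y \<in> W2" "\<And>y. y \<in> T \<Longrightarrow> \<sigma>1 (\<theta> y) = \<sigma> y"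
    "\<And>y. y \<in> T \<Longrightarrow> \<theta> differentiable at y" "\<And>y v. y \<in> T \<Longrightarrow> push A \<sigma>1 (\<theta> y) (fd \<theta> y v) = push A \<sigma> y v"
    using local_param_transition[OF \<sigma>1(1) lp(1,2)] by metis
  have \<theta>u: "\<theta> u = u1"
    using \<theta>(1,2)[OF T(2)] lp(3) \<sigma>1(2,3) local_paramD(7)[OF \<sigma>1(1)] by (simp add: inj_on_def)
  have lin\<theta>: "linear (fd \<theta> u)" using \<theta>(3)[OF T(2)] fd_linear by blast
  have inj\<theta>: "inj (fd \<theta> u)"
    unfolding inj_def using \<theta>(4)[OF T(2)] injD[OF local_paramD(3)[OF lp(1,2)]] by metis
  then have surj\<theta>: "surj (fd \<theta> u)"
    using linear_injective_imp_surjective[OF lin\<theta>] by blast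
  define s' m' where "s' y = s (\<theta> y)" and "m' y = m (\<theta> y)" for y
  have s': "s' y \<in> W1 \<inter> half_space" "\<tau> (s' y) = \<sigma> y" "push A \<tau> (s' y) (m' y) = n (\<sigma> y)" if "y \<in> T" for y
    using eq[OF \<theta>(1)[OF that]] \<theta>(2)[OF that] by (auto simp: s'_def m'_def)
  have ds': "s' differentiable at u" "m' differentiable at u"
    unfolding s'_def[abs_def] m'_def[abs_def]
    using differentiable_compose_at[OF \<theta>(3)[OF T(2)] sm'(1)[OF \<theta>(1)[OF T(2)]]]
      differentiable_compose_at[OF \<theta>(3)[OF T(2)] sm'(2)[OF \<theta>(1)[OF T(2)]]] by simp_all
  \<comment> \<open>The parametrization of \<open>Q\<close> read in the ambient chart, the immersion
    to which the Gauss formula is applied.\<close>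
  define F where "F x = snd c (\<tau> x)" for x
  define WF where "WF = W1 \<inter> \<tau> -` fst c"
  have WF: "open WF" "smooth_on WF F"
    using smooth_intoD(3,4)[OF local_paramD(1)[OF \<tau>] c(1)] by (auto simp: WF_def F_def[abs_def])
  have s'u: "s' u \<in> WF" "s' u \<in> W1 \<inter> half_space" "\<tau> (s' u) = p"
    using s'[OF T(2)] lp(3) c(2) by (auto simp: WF_def)
  define G where "G = gram A g (cinv c)"
  define G' where "G' = gram A g \<tau>"
  have pb: "ip (G' y) a b = ip (G (F y)) (fd F y a) (fd F y b)" if "y \<in> WF" for y a b
    unfolding G'_def G_def F_def
    using that metric_field_gram(2)[OF mf local_paramD(1)[OF \<tau>] _ local_paramD(8)[OF \<tau>] c(1)] by (simp add: WF_def)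
  have Fu: "F (s' u) = snd c p" using s'u by (simp add: F_def)
  have pX: "p \<in> topspace X" using c chart_subset by blast
  have G: "G differentiable at (F (s' u))" "invertible (G (F (s' u)))" "\<And>a b. ip (G (F (s' u))) a b = ip (G (F (s' u))) b a"
    unfolding Fu G_def using c mf pX metric_field_ip_sym[OF mf c(1,2) pX] by (auto simp: metric_field_def)
  have pos: "ip (G' (s' u)) a a > 0" if "a \<noteq> 0" for a
    unfolding G'_def by (rule gram_pos[OF mf sp \<tau> s'u(2) that])
  have inv: "invertible (G' (s' u))" by (rule invertible_if_ip_pos[OF pos])
  define T2 where "T2 = T \<inter> (W \<inter> \<sigma> -` fst c)"
  have T2: "open T2" "u \<in> T2"
    using T lp c smooth_intoD(4)[OF local_paramD(1)[OF lp(1)] c(1)] by (auto simp: T2_def)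
  have eqF: "F (s' y) = snd c (\<sigma> y)" "fd F (s' y) (m' y) = n (\<sigma> y) c" if "y \<in> T2" for y
  proof -
    have y: "y \<in> T" "\<sigma> y \<in> fst c" using that by (auto simp: T2_def)
    show "F (s' y) = snd c (\<sigma> y)" using s'(2)[OF y(1)] by (simp add: F_def)
    have "push A \<tau> (s' y) (m' y) c = fd F (s' y) (m' y)"
      unfolding F_def[abs_def] using s'(2)[OF y(1)] y(2) c(1) by (intro push_component) auto
    then show "fd F (s' y) (m' y) = n (\<sigma> y) c" using s'(3)[OF y(1)] by simp
  qed
  show "(\<lambda>y. n (\<sigma> y) c) differentiable at u"
    using has_derivative_transform_within_open[OF fd_along[OF WF s'u(1) ds'] T2 eqF(2)] differentiableI by blast
  have dF: "F differentiable at (s' u)" using smooth_on_differentiable[OF WF(2,1) s'u(1)] .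
  have D\<sigma>: "fd (\<lambda>y. snd c (\<sigma> y)) u v = fd F (s' u) (fd s' u v)" for v
    using fd_compose[OF ds'(1) dF, of v] fd_cong[OF T2, of "\<lambda>y. F (s' y)" "\<lambda>y. snd c (\<sigma> y)"] eqF(1) by simp
  have cov: "cov_deriv G (\<lambda>y. snd c (\<sigma> y)) (\<lambda>y. n (\<sigma> y) c) u w = cov_deriv G (\<lambda>y. F (s' y)) (\<lambda>y. fd F (s' y) (m' y)) u w" for w
    by (rule cov_deriv_cong[OF T2]) (simp_all add: eqF)
  have B: "ip (G (snd c p)) (fd (\<lambda>y. snd c (\<sigma> y)) u v) (cov_deriv G (\<lambda>y. snd c (\<sigma> y)) (\<lambda>y. n (\<sigma> y) c) u w)
      = ip (G' (s' u)) (fd s' u v) (cov_deriv G' s' m' u w)" for v w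
    unfolding D\<sigma> cov Fu[symmetric]
    by (rule cov_deriv_pullback[where s = s' and m = m' and u = u and F = F and W = WF])
      (fact WF s'u pb G inv ds')+
  have I: "ip (G (snd c p)) (fd (\<lambda>y. snd c (\<sigma> y)) u w) (fd (\<lambda>y. snd c (\<sigma> y)) u v)
      = ip (G' (s' u)) (fd s' u w) (fd s' u v)" for v w
    unfolding D\<sigma> Fu[symmetric] pb[OF s'u(1)] ..
  have sym': "ip (G' (s' u)) a b = ip (G' (s' u)) b a" for a b
    unfolding pb[OF s'u(1)] by (rule G(3))
  have covs: "cov_deriv G' s' m' u w = cov_deriv G' s m u1 (fd \<theta> u w)" for w
    unfolding s'_def[abs_def] m'_def[abs_def]
    using cov_deriv_compose[OF \<theta>(3)[OF T(2)] sm'[OF \<theta>(1)[OF T(2)]]] \<theta>u by simp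
  have fds': "fd s' u w = fd s u1 (fd \<theta> u w)" for w
    unfolding s'_def[abs_def]
    using fd_compose[OF \<theta>(3)[OF T(2)] sm'(1)[OF \<theta>(1)[OF T(2)]]] \<theta>u by simp
  \<comment> \<open>The eigenvectors are given in the parameters of \<open>\<sigma>1\<close>; since
    the derivative of \<open>\<theta>\<close> is bijective, they come from vectors in the parameters
    of \<open>\<sigma>\<close>.\<close>
  obtain w1' w2' where w': "fd \<theta> u w1' = w1" "fd \<theta> u w2' = w2"
    using surj\<theta> by (metis surjD)
  have lins': "linear (fd s' u)" using ds' fd_linear by blast
  have injs': "inj (fd s' u)"
    unfolding inj_def using injD[OF local_param_fd_inj[OF lp(1,2) c(1)]] lp(3) c(2) D\<sigma> by metis
  have "k = tr2 (\<lambda>w v. ip (G' (s' u)) (fd s' u w) (fd s' u v)) (\<lambda>w v. ip (G' (s' u)) (fd s' u v) (cov_deriv G' s' m' u w))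
        (axis 0 1) (axis 1 1)"
    unfolding k'
  proof (rule tr2_axis[symmetric])
    note lins = linear_add[OF lins'] linear_scale[OF lins'] linear_add[OF linear_cov_deriv[OF ds']] linear_scale[OF linear_cov_deriv[OF ds']]
    show "bilinear (\<lambda>w v. ip (G' (s' u)) (fd s' u w) (fd s' u v))"
      "bilinear (\<lambda>w v. ip (G' (s' u)) (fd s' u v) (cov_deriv G' s' m' u w))"
      unfolding bilinear_def by (auto intro!: linearI simp: lins)
    show "ip (G' (s' u)) (fd s' u v) (fd s' u w) = ip (G' (s' u)) (fd s' u w) (fd s' u v)" for v w
      by (rule sym')
    show "ip (G' (s' u)) (fd s' u v) (fd s' u v) > 0" if "v \<noteq> 0" for v
      using that injs' linear_0[OF lins'] by (intro pos) (metis injD)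
    have "a = 0 \<and> b = 0" if "a *\<^sub>R w1' + b *\<^sub>R w2' = 0" for a b
    proof -
      have "a *\<^sub>R w1 + b *\<^sub>R w2 = fd \<theta> u (a *\<^sub>R w1' + b *\<^sub>R w2')"
        by (simp add: w' linear_add[OF lin\<theta>] linear_scale[OF lin\<theta>])
      then have "a *\<^sub>R w1 + b *\<^sub>R w2 = 0" using that linear_0[OF lin\<theta>] by simp
      then show ?thesis using w(1,2) independent2_iff[of w1 w2] by blast
    qed
    then show "w1' \<noteq> w2'" "independent {w1', w2'}"
      using independent2_iff[of w1' w2'] by blast+
    show "ip (G' (s' u)) (fd s' u v) (cov_deriv G' s' m' u w1') = \<kappa>1 * ip (G' (s' u)) (fd s' u w1') (fd s' u v)" for v
      using sym' by (simp add: covs fds' w' w(3)[folded G'_def])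
    show "ip (G' (s' u)) (fd s' u v) (cov_deriv G' s' m' u w2') = \<kappa>2 * ip (G' (s' u)) (fd s' u w2') (fd s' u v)" for v
      using sym' by (simp add: covs fds' w' w(4)[folded G'_def])
  qed
  then show "k = surface_trace g c \<sigma> n u"
    by (simp add: surface_trace_def Let_def lp(3) G_def[symmetric] B I)
qed

text \<open>Existence makes the definite description meaningful, and the trace formula, valid for
  every candidate, makes it unique.\<close>

lemma mean_curvature_eq_trace:
  assumes "metric_field A (topspace X) g" "spacelike X A g half_space Q"
    and "\<exists>k. is_mean_curvature X A g Q S n p k"
    and "local_param X A UNIV S W \<sigma>" "u \<in> W" "\<sigma> u = p"
    and "c \<in> A" "p \<in> fst c" "invertible (gram A g (cinv c) (snd c p))"
  shows "mean_curvature X A g Q S n p = surface_trace g c \<sigma> n u" "(\<lambda>y. n (\<sigma> y) c) differentiable at u"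
proof -
  note * = is_mean_curvature_trace[OF assms(1,2) _ assms(4-9)]
  obtain k where k: "is_mean_curvature X A g Q S n p k" using assms(3) by blast
  then show "mean_curvature X A g Q S n p = surface_trace g c \<sigma> n u"
    unfolding mean_curvature_def using *(1) by (intro the_equality) auto
  show "(\<lambda>y. n (\<sigma> y) c) differentiable at u" using *(2)[OF k] .
qed

text \<open>Existence follows once surface and normal have coordinates \<open>s\<close> and
  \<open>m\<close> in one parametrization of \<open>Q\<close>: the induced metric is positive
  definite there, so \<open>weingarten_eigenbasis\<close> applies.\<close>

lemma ex_mean_curvature:
  fixes \<sigma> :: "real^2 \<Rightarrow> 'm"
  assumes mf: "metric_field A (topspace X) g" and sp: "spacelike X A g half_space Q"
    and \<tau>: "local_param X A half_space Q W \<tau>" and \<sigma>: "local_param X A UNIV S W' \<sigma>" "u \<in> W'"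
    and s: "smooth_on W' s" and m: "\<And>y. y \<in> W' \<Longrightarrow> m differentiable at y"
    and eq: "\<And>y. y \<in> W' \<Longrightarrow> s y \<in> W \<inter> half_space \<and> \<tau> (s y) = \<sigma> y \<and> push A \<tau> (s y) (m y) = n (\<sigma> y)"
    and orth: "\<And>y v. y \<in> W' \<Longrightarrow> g (\<sigma> y) (n (\<sigma> y)) (push A \<sigma> y v) = 0"
    and unit: "\<And>y. y \<in> W' \<Longrightarrow> g (\<sigma> y) (n (\<sigma> y)) (n (\<sigma> y)) = 1"
  shows "\<exists>k. is_mean_curvature X A g Q S n (\<sigma> u) k"
proof -
  let ?G = "gram A g \<tau>"
  have W': "open W'" using local_paramD(2)[OF \<sigma>(1)] .
  have \<tau>s: "smooth_into X A W \<tau>" using local_paramD(1)[OF \<tau>] .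
  have sW: "s y \<in> W" if "y \<in> W'" for y using eq that by blast
  have ds: "s differentiable at y" if "y \<in> W'" for y using smooth_on_differentiable[OF s W' that] .
  have p\<sigma>: "push A \<sigma> y v = push A \<tau> (s y) (fd s y v)" if "y \<in> W'" for y v
    by (rule push_compose[OF \<tau>s W' that _ _ ds[OF that]]) (use eq in auto)
  have gr: "ip (?G x) a b = g (\<tau> x) (push A \<tau> x a) (push A \<tau> x b)" if "x \<in> W" for x a b
    by (rule metric_field_gram(1)[OF mf \<tau>s that local_paramD(8)[OF \<tau> that]])
  have sym: "ip (?G x) a b = ip (?G x) b a" if x: "x \<in> W" for x a b
  proof -
    obtain c where c: "c \<in> A" "\<tau> x \<in> fst c" using ex_chart local_paramD(8)[OF \<tau> x] by blast
    show ?thesis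
      unfolding gr[OF x] by (rule metric_field_ip(2)[OF mf c local_paramD(8)[OF \<tau> x] push_tangent'[OF \<tau>s x] push_tangent'[OF \<tau>s x]])
  qed
  have dG: "?G differentiable at x" if x: "x \<in> W" for x
  proof -
    obtain c where c: "c \<in> A" "\<tau> x \<in> fst c" using ex_chart local_paramD(8)[OF \<tau> x] by blast
    show ?thesis
    proof (rule fd_pullback_metric(1)[where G = "gram A g (cinv c)"])
      show "open (W \<inter> \<tau> -` fst c)" "smooth_on (W \<inter> \<tau> -` fst c) (\<lambda>x. snd c (\<tau> x))" "x \<in> W \<inter> \<tau> -` fst c"
        using smooth_intoD(3,4)[OF \<tau>s c(1)] x c(2) by auto
      show "ip (gram A g \<tau> y) a b = ip (gram A g (cinv c) (snd c (\<tau> y))) (fd (\<lambda>x. snd c (\<tau> x)) y a) (fd (\<lambda>x. snd c (\<tau> x)) y b)"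
        if "y \<in> W \<inter> \<tau> -` fst c" for y a b
        using that metric_field_gram(2)[OF mf \<tau>s _ local_paramD(8)[OF \<tau>] c(1)] by simp
      show "gram A g (cinv c) differentiable at (snd c (\<tau> x))"
        using mf c local_paramD(8)[OF \<tau> x] by (auto simp: metric_field_def)
    qed
  qed
  have inj: "inj (fd s u)"
    unfolding inj_def using injD[OF local_paramD(3)[OF \<sigma>]] p\<sigma>[OF \<sigma>(2)] by metis
  have "\<exists>w1 w2 p q. w1 \<noteq> w2 \<and> independent {w1, w2} \<and>
    cov_deriv ?G s m u w1 = p *\<^sub>R fd s u w1 \<and> cov_deriv ?G s m u w2 = q *\<^sub>R fd s u w2"
  proof (rule weingarten_eigenbasis[OF W' \<sigma>(2) s inj m[OF \<sigma>(2)] local_paramD(2)[OF \<tau>] sW[OF \<sigma>(2)] dG[OF sW[OF \<sigma>(2)]]])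
    show "ip (?G x) a b = ip (?G x) b a" if "x \<in> W" for x a b
      by (rule sym[OF that])
    show "ip (?G (s u)) a a > 0" if "a \<noteq> 0" for a
      by (rule gram_pos[OF mf sp \<tau> _ that]) (use eq \<sigma>(2) in blast)
    show "ip (?G (s y)) (m y) (fd s y v) = 0" if "y \<in> W'" for y v
      unfolding gr[OF sW[OF that]] using eq[OF that] p\<sigma>[OF that] orth[OF that] by metis
    show "ip (?G (s y)) (m y) (m y) = 1" if "y \<in> W'" for y
      unfolding gr[OF sW[OF that]] using eq[OF that] unit[OF that] by metis
  qed
  then obtain w1 w2 p q where "w1 \<noteq> w2" "independent {w1, w2}"
    "cov_deriv ?G s m u w1 = p *\<^sub>R fd s u w1" "cov_deriv ?G s m u w2 = q *\<^sub>R fd s u w2"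
    by blast
  moreover have "s differentiable_on W'" "m differentiable_on W'"
    using ds m differentiable_on_eq_differentiable_at[OF W'] by blast+
  ultimately have "is_mean_curvature X A g Q S n (\<sigma> u) (p + q)"
    unfolding is_mean_curvature_def using \<tau> \<sigma> eq by blast
  then show ?thesis by blast
qed

end

section \<open>Submanifolds with boundary\<close>

lemma line_in_open:
  fixes v :: "'a::real_normed_vector"
  assumes "open B" "x \<in> B" shows "\<exists>e>0. \<forall>t. 0 \<le> t \<and> t \<le> e \<longrightarrow> x + t *\<^sub>R v \<in> B"
proof -
  have "isCont (\<lambda>t. x + t *\<^sub>R v) 0" by (intro continuous_intros)
  then have "\<forall>\<^sub>F t in nhds 0. x + t *\<^sub>R v \<in> B"
    unfolding continuous_at tendsto_def using assms by (auto simp: eventually_nhds_conv_at)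
  then obtain d where "d > 0" "\<And>t. dist t 0 < d \<Longrightarrow> x + t *\<^sub>R v \<in> B"
    unfolding eventually_nhds_metric by blast
  then show ?thesis by (intro exI[of _ "d / 2"]) (auto simp: dist_norm)
qed

lemma has_derivative_one_sided:
  fixes f :: "'a::real_normed_vector \<Rightarrow> 'b::real_normed_vector"
  assumes f: "(f has_derivative f') (at x within T)" and e: "e > 0" "\<And>t. 0 \<le> t \<Longrightarrow> t \<le> e \<Longrightarrow> x + t *\<^sub>R v \<in> T"
  shows "((\<lambda>t. f (x + t *\<^sub>R v)) has_vector_derivative f' v) (at 0 within {0..e})"
proof -
  have "(\<lambda>t. x + t *\<^sub>R v) ` {0..e} \<subseteq> T" using e by auto
  then have "(f has_derivative f') (at (x + 0 *\<^sub>R v) within (\<lambda>t. x + t *\<^sub>R v) ` {0..e})"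
    using has_derivative_subset[OF f] by simp
  moreover have "((\<lambda>t. x + t *\<^sub>R v) has_derivative (\<lambda>t. t *\<^sub>R v)) (at 0 within {0..e})"
    by (auto intro!: derivative_eq_intros)
  ultimately have "((\<lambda>t. f (x + t *\<^sub>R v)) has_derivative (\<lambda>t. f' (t *\<^sub>R v))) (at 0 within {0..e})"
    by (rule has_derivative_in_compose[rotated])
  moreover have "linear f'" using f has_derivative_linear by blast
  ultimately show ?thesis
    by (simp add: has_vector_derivative_def linear_scale)
qed

lemma one_sided_derivative_nonpos:
  fixes f :: "real \<Rightarrow> real"
  assumes "(f has_vector_derivative d) (at 0 within {0..e})" "e > 0" "\<And>t. 0 \<le> t \<Longrightarrow> t \<le> e \<Longrightarrow> f t \<le> f 0"
  shows "d \<le> 0"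
proof (rule ccontr)
  assume "\<not> d \<le> 0"
  then obtain h where "h > 0" "\<And>t. t > 0 \<Longrightarrow> 0 + t \<in> {0..e} \<Longrightarrow> t < h \<Longrightarrow> f 0 < f (0 + t)"
    using has_real_derivative_pos_inc_right[of f d 0 "{0..e}"] assms(1)
    unfolding has_real_derivative_iff_has_vector_derivative by auto
  note h = this
  define t where "t = min (h / 2) e"
  have t: "t > 0" "t < h" "t \<le> e" using h(1) assms(2) by (auto simp: t_def)
  then have "f 0 < f t" using h(2)[of t] by simp
  moreover have "f t \<le> f 0" using assms(3)[of t] t by simp
  ultimately show False by simp
qed

text \<open>Applied to \<open>v\<close> and \<open>- v\<close>, the hypothesis shows that the
  boundary plane is preserved. If a vector outside the half-space also went into the plane, so would
  every vector, against surjectivity.\<close>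

lemma linear_half_space:
  fixes L :: "real^'n \<Rightarrow> real^'n"
  assumes L: "linear L" "surj L" and le: "\<And>v. v $ i \<le> 0 \<Longrightarrow> L v $ i \<le> 0" and w: "w $ i > 0"
  shows "L w $ i > 0"
proof -
  have z: "L v $ i = 0" if "v $ i = 0" for v
    using le[of v] le[of "- v"] that linear_neg[OF L(1), of v] by simp
  have ge: "L w $ i \<ge> 0"
    using le[of "- w"] w linear_neg[OF L(1), of w] by simp
  have "L w $ i \<noteq> 0"
  proof
    assume *: "L w $ i = 0"
    have "L v $ i = 0" for v
    proof -
      have "(v - (v $ i / w $ i) *\<^sub>R w) $ i = 0" using w by simp
      from z[OF this] show ?thesis
        using * by (simp add: linear_diff[OF L(1)] linear_scale[OF L(1)])
    qed
    moreover obtain v where "L v = axis i 1" using L(2) by (metis surjD)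
    ultimately show False by (metis axis_nth zero_neq_one)
  qed
  with ge show ?thesis by simp
qed

context atlas
begin

text \<open>The transition map is defined only on a relatively open part of the half-space; its
  derivative \<open>L\<close> is found there by dividing out the immersion. One-sided curves show
  that, over a boundary point, \<open>L\<close> keeps directions into the half-space inside it. With
  surjectivity this forces boundary points to correspond to boundary points and outward directions
  to stay outward.\<close>

lemma half_space_transition:
  assumes lp: "local_param X A half_space P W \<tau>" "x \<in> W" "x \<in> half_space"
    and lp': "local_param X A half_space P W' \<tau>'" "x' \<in> W'" "x' \<in> half_space"
    and eq: "\<tau> x = \<tau>' x'"
  obtains L where "linear L" "\<And>v. push A \<tau>' x' v = push A \<tau> x (L v)" "x $ 0 = 0 \<Longrightarrow> x' $ 0 = 0"
    "\<And>w. x $ 0 = 0 \<Longrightarrow> w $ 0 > 0 \<Longrightarrow> L w $ 0 > 0"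
proof -
  let ?H = half_space
  have \<tau>s: "smooth_into X A W \<tau>" and \<tau>s': "smooth_into X A W' \<tau>'"
    using local_paramD(1)[OF lp(1)] local_paramD(1)[OF lp'(1)] .
  obtain c where c: "c \<in> A" "\<tau> x \<in> fst c" using ex_chart local_paramD(8)[OF lp(1,2)] by blast
  have c': "\<tau>' x' \<in> fst c" using c eq by simp
  have "continuous_map (top_of_set (W' \<inter> ?H)) X \<tau>'"
    using continuous_map_from_subtopology[OF smooth_intoD(2)[OF \<tau>s'], of ?H] by (simp add: subtopology_subtopology)
  then have cont: "continuous_map (top_of_set (W' \<inter> ?H)) (subtopology X P) \<tau>'"
    using local_paramD(6)[OF lp'(1)] by (auto simp: continuous_map_in_subtopology)
  define \<theta> where "\<theta> y = inv_into (W \<inter> ?H) \<tau> (\<tau>' y)" for y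
  define T where "T = (W' \<inter> ?H) \<inter> \<tau>' -` (\<tau> ` (W \<inter> ?H))"
  note l = local_param_lift[OF lp(1) cont, folded \<theta>_def T_def]
  have "\<tau>' x' \<in> \<tau> ` (W \<inter> ?H)" using imageI[of x "W \<inter> ?H" \<tau>] lp(2,3) eq by simp
  then have x'T: "x' \<in> T" using lp'(2,3) by (simp add: T_def)
  have \<theta>x: "\<theta> x' = x"
    using l(3,4)[OF x'T] lp(2,3) eq local_paramD(7)[OF lp(1)] by (auto simp: inj_on_def)
  obtain Q where Q: "open Q" "T = W' \<inter> ?H \<inter> Q" using l(1) by (auto simp: openin_open)
  define F F' where "F y = snd c (\<tau> y)" and "F' y = snd c (\<tau>' y)" for y
  have dF: "F differentiable at x" and dF': "F' differentiable at x'"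
    unfolding F_def[abs_def] F'_def[abs_def] using smooth_into_differentiable[OF \<tau>s lp(2) c] smooth_into_differentiable[OF \<tau>s' lp'(2) c(1) c'] .
  have injF: "inj (fd F x)" and injF': "inj (fd F' x')"
    unfolding F_def[abs_def] F'_def[abs_def]
    using local_param_fd_inj[OF lp(1,2) c] local_param_fd_inj[OF lp'(1,2) c(1) c'] .
  obtain K where K: "bounded_linear K" "\<And>v. K (fd F x v) = v"
    using linear_inj_left_inverse[OF fd_linear[OF dF] injF] by blast
  define L where "L v = K (fd F' x' v)" for v
  have linL: "linear L"
    unfolding L_def[abs_def]
    using linear_compose[OF fd_linear[OF dF'], of K] K(1) bounded_linear.linear by (auto simp: o_def)
  have D\<theta>: "(\<theta> has_derivative L) (at x' within T)"
    unfolding L_def[abs_def]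
  proof (rule has_derivative_factor[where f=F and g=F', OF _ K])
    show "(F has_derivative fd F x) (at (\<theta> x'))" using has_fd[OF dF] \<theta>x by simp
    show "(F' has_derivative fd F' x') (at x' within T)" by (rule has_derivative_at_withinI[OF has_fd[OF dF']])
    show "continuous (at x' within T) \<theta>" using l(2) x'T by (simp add: continuous_on_eq_continuous_within)
    show "F (\<theta> z) = F' z" if "z \<in> T" for z using l(4)[OF that] by (simp add: F_def F'_def)
    show "F (\<theta> x') = F' x'" using l(4)[OF x'T] by (simp add: F_def F'_def)
  qed
  \<comment> \<open>Admissible are the directions into the half-space, and all directions if
    \<open>x'\<close> is interior. Along such a ray the identity between \<open>F\<close> after
    \<open>\<theta>\<close> and \<open>F'\<close> can be differentiated from one side, and if
    \<open>x\<close> is a boundary point, component 0 of \<open>\<theta>\<close> cannot exceed its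
    initial value 0.\<close>
  have adm: "fd F x (L v) = fd F' x' v \<and> (x $ 0 = 0 \<longrightarrow> L v $ 0 \<le> 0)"
    if v: "v $ 0 \<le> 0 \<or> x' $ 0 < 0" for v
  proof -
    obtain e1 where e1: "e1 > 0" "\<And>t. 0 \<le> t \<Longrightarrow> t \<le> e1 \<Longrightarrow> x' + t *\<^sub>R v \<in> W' \<inter> Q"
      using line_in_open[of "W' \<inter> Q" x' v] local_paramD(2)[OF lp'(1)] Q x'T by blast
    have "\<exists>e>0. \<forall>t. 0 \<le> t \<and> t \<le> e \<longrightarrow> x' + t *\<^sub>R v \<in> ?H"
    proof (cases "v $ 0 \<le> 0")
      case True
      then have "x' + t *\<^sub>R v \<in> ?H" if "0 \<le> t" for t
        using lp'(3) that mult_nonneg_nonpos[of t "v $ 0"] by (simp add: half_space_def)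
      then show ?thesis by (intro exI[of _ 1]) auto
    next
      case False
      have "open {y :: real^3. y $ 0 < 0}" by (intro open_Collect_less continuous_intros)
      then show ?thesis
        using line_in_open[of "{y :: real^3. y $ 0 < 0}" x' v] v False by (force simp: half_space_def)
    qed
    then obtain e2 where e2: "e2 > 0" "\<And>t. 0 \<le> t \<Longrightarrow> t \<le> e2 \<Longrightarrow> x' + t *\<^sub>R v \<in> ?H" by blast
    define e where "e = min e1 e2"
    have e: "e > 0" "\<And>t. 0 \<le> t \<Longrightarrow> t \<le> e \<Longrightarrow> x' + t *\<^sub>R v \<in> T"
      using e1 e2 Q(2) by (auto simp: e_def)
    note d\<theta> = has_derivative_one_sided[OF D\<theta> e]
    have "(F has_derivative fd F x) (at (\<theta> (x' + 0 *\<^sub>R v)))" using has_fd[OF dF] \<theta>x by simp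
    then have "((\<lambda>t. F (\<theta> (x' + t *\<^sub>R v))) has_derivative (\<lambda>t. fd F x (t *\<^sub>R L v))) (at 0 within {0..e})"
      using has_derivative_in_compose[OF d\<theta>[unfolded has_vector_derivative_def], of F "fd F x"]
        has_derivative_at_withinI by blast
    then have 1: "((\<lambda>t. F (\<theta> (x' + t *\<^sub>R v))) has_vector_derivative fd F x (L v)) (at 0 within {0..e})"
      by (simp add: has_vector_derivative_def linear_scale[OF fd_linear[OF dF]])
    have 2: "((\<lambda>t. F' (x' + t *\<^sub>R v)) has_vector_derivative fd F' x' v) (at 0 within {0..e})"
      by (rule has_derivative_one_sided[OF has_derivative_at_withinI[OF has_fd[OF dF']] e])
    have "((\<lambda>t. F (\<theta> (x' + t *\<^sub>R v))) has_vector_derivative fd F' x' v) (at 0 within {0..e})"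
      by (rule has_vector_derivative_transform[OF _ _ 2]) (use e l(4) in \<open>auto simp: F_def F'_def\<close>)
    then have eqs: "fd F x (L v) = fd F' x' v"
      using 1 e(1) by (intro vector_derivative_unique_within[of 0 "{0..e}"]) (auto simp: trivial_limit_within islimpt_Icc)
    have "L v $ 0 \<le> 0" if "x $ 0 = 0"
    proof (rule one_sided_derivative_nonpos[OF _ e(1)])
      show "((\<lambda>t. \<theta> (x' + t *\<^sub>R v) $ 0) has_vector_derivative L v $ 0) (at 0 within {0..e})"
        by (rule bounded_linear.has_vector_derivative[OF bounded_linear_vec_nth d\<theta>])
      show "\<theta> (x' + t *\<^sub>R v) $ 0 \<le> \<theta> (x' + 0 *\<^sub>R v) $ 0" if "0 \<le> t" "t \<le> e" for t
        using l(3)[OF e(2)[OF that]] \<theta>x \<open>x $ 0 = 0\<close> by (simp add: half_space_def)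
    qed
    with eqs show ?thesis by blast
  qed
  \<comment> \<open>One of \<open>v\<close> and \<open>- v\<close> is admissible, and both sides are
    linear.\<close>
  have FL: "fd F x (L v) = fd F' x' v" for v
    using adm[of v] adm[of "- v"] linear_neg[OF fd_linear[OF dF]] linear_neg[OF fd_linear[OF dF']] linear_neg[OF linL]
    by (cases "v $ 0 \<le> 0") auto
  have injL: "inj L" unfolding inj_def using FL injD[OF injF'] by metis
  have surjL: "surj L" using linear_injective_imp_surjective[OF linL] injL by blast
  show ?thesis
  proof (rule that[OF linL])
    show "push A \<tau>' x' v = push A \<tau> x (L v)" for v
      by (rule tangent_eqI[OF _ _ c(1) c'])
        (use push_tangent'[OF \<tau>s' lp'(2)] push_tangent'[OF \<tau>s lp(2)] eq c c' FL in \<open>auto simp: push_component F_def[abs_def] F'_def[abs_def]\<close>)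
    \<comment> \<open>At an interior \<open>x'\<close> every direction would be admissible, so
      component 0 of \<open>L v\<close> would never be positive.\<close>
    show "x' $ 0 = 0" if x0: "x $ 0 = 0"
    proof (rule ccontr)
      assume "x' $ 0 \<noteq> 0"
      then have lt: "x' $ 0 < 0" using lp'(3) by (simp add: half_space_def)
      obtain v where v: "L v = axis 0 1" using surjL by (metis surjD)
      then show False using adm[of v] lt x0 by simp
    qed
    show "L w $ 0 > 0" if "x $ 0 = 0" "w $ 0 > 0" for w
      using linear_half_space[OF linL surjL _ that(2)] adm that(1) by blast
  qed
qed

lemma boundary_point_iff:
  assumes "local_param X A half_space P W \<tau>" "x \<in> W" "x \<in> half_space"
  shows "\<tau> x \<in> submanifold_boundary X A P \<longleftrightarrow> x $ 0 = 0"
proof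
  assume "\<tau> x \<in> submanifold_boundary X A P"
  then obtain W' \<tau>' x' where lp': "local_param X A half_space P W' \<tau>'" "x' \<in> W'" "x' $ 0 = 0" "\<tau> x = \<tau>' x'"
    unfolding submanifold_boundary_def by blast
  moreover have "x' \<in> half_space" using lp'(3) by (simp add: half_space_def)
  ultimately show "x $ 0 = 0"
    using half_space_transition[of P W' \<tau>' x' W \<tau> x] assms by metis
next
  assume "x $ 0 = 0"
  then show "\<tau> x \<in> submanifold_boundary X A P"
    unfolding submanifold_boundary_def using assms by blast
qed

section \<open>New parametrizations from given ones\<close>

lemma homeomorphic_map_onI:
  assumes "continuous_map (top_of_set T) X f" "continuous_map (subtopology X (f ` T)) (top_of_set T) g" "\<And>x. x \<in> T \<Longrightarrow> g (f x) = x"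
  shows "homeomorphic_map (top_of_set T) (subtopology X (f ` T)) f"
proof -
  have "homeomorphic_maps (top_of_set T) (subtopology X (f ` T)) f g"
    unfolding homeomorphic_maps_def using assms by (auto simp: continuous_map_in_subtopology)
  then show ?thesis using homeomorphic_map_maps by blast
qed

lemma local_param_inverse:
  assumes "local_param X A H P W \<sigma>"
  obtains g where "continuous_map (subtopology X (\<sigma> ` (W \<inter> H))) (top_of_set (W \<inter> H)) g" "\<And>x. x \<in> W \<inter> H \<Longrightarrow> g (\<sigma> x) = x"
proof -
  obtain g where g: "homeomorphic_maps (top_of_set (W \<inter> H)) (subtopology X (\<sigma> ` (W \<inter> H))) \<sigma> g"
    using local_paramD(5)[OF assms] homeomorphic_map_maps by blast
  then show ?thesis by (intro that[of g]) (auto simp: homeomorphic_maps_def)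
qed

lemma smooth_into_compose:
  fixes \<rho> :: "'e::real_normed_vector \<Rightarrow> 'f::euclidean_space"
  assumes "smooth_into X A W \<sigma>" "smooth_on V \<rho>" "open V" "\<rho> ` V \<subseteq> W"
  shows "smooth_into X A V (\<lambda>y. \<sigma> (\<rho> y))"
proof -
  have c\<rho>: "continuous_map (top_of_set V) (top_of_set W) \<rho>"
    using smooth_on_continuous[OF assms(2)] assms(4) by (auto simp: continuous_map_in_subtopology)
  have cont: "continuous_map (top_of_set V) X (\<lambda>y. \<sigma> (\<rho> y))"
    using continuous_map_compose[OF c\<rho> smooth_intoD(2)[OF assms(1)]] by (simp add: o_def)
  have "smooth_on (V \<inter> (\<lambda>y. \<sigma> (\<rho> y)) -` fst c) (\<lambda>y. snd c (\<sigma> (\<rho> y)))" if c: "c \<in> A" for c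
  proof -
    have o: "open (V \<inter> (\<lambda>y. \<sigma> (\<rho> y)) -` fst c)" by (rule open_preimage_chart[OF assms(3) cont chart_openin[OF c]])
    show ?thesis
      by (rule smooth_on_compose[OF smooth_intoD(3)[OF assms(1) c] smooth_on_subset[OF assms(2,3) o] o smooth_intoD(4)[OF assms(1) c]])
        (use assms(4) in auto)
  qed
  then show ?thesis
    unfolding smooth_into_def using assms(3) cont by (simp add: o_def)
qed

text \<open>Serves twice: for \<open>face\<close>, which restricts a parametrization with boundary
  to its boundary plane, and for \<open>swap2\<close>, which reverses the orientation of a surface
  parametrization. Openness of the image is an assumption because \<open>P'\<close> may be smaller
  than \<open>P\<close>.\<close>

lemma local_param_linear:
  fixes \<iota> :: "real^'l \<Rightarrow> real^'k"
  assumes lp: "local_param X A H P W \<sigma>" and \<iota>: "bounded_linear \<iota>" "range \<iota> \<subseteq> H" and \<pi>: "bounded_linear \<pi>" "\<And>y. \<pi> (\<iota> y) = y"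
    and op: "openin (subtopology X P') (\<sigma> ` \<iota> ` (\<iota> -` W))"
  shows "local_param X A UNIV P' (\<iota> -` W) (\<lambda>y. \<sigma> (\<iota> y))"
proof -
  have oW: "open (\<iota> -` W)"
    using continuous_open_vimage[OF local_paramD(2)[OF lp]] linear_continuous_at[OF \<iota>(1)] by (auto simp: continuous_at_imp_continuous_on)
  have s: "smooth_into X A (\<iota> -` W) (\<lambda>y. \<sigma> (\<iota> y))"
    by (rule smooth_into_compose[OF local_paramD(1)[OF lp] smooth_on_bounded_linear[OF \<iota>(1)] oW]) auto
  have push: "push A (\<lambda>y. \<sigma> (\<iota> y)) y v = push A \<sigma> (\<iota> y) (\<iota> v)" if "y \<in> \<iota> -` W" for y v
    using push_compose[OF local_paramD(1)[OF lp] oW that, of \<iota> "\<lambda>y. \<sigma> (\<iota> y)"] \<iota>(1)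
      fd_eqI[OF bounded_linear_imp_has_derivative[OF \<iota>(1)]] bounded_linear_imp_differentiable by auto
  have "inj (push A (\<lambda>y. \<sigma> (\<iota> y)) y)" if "y \<in> \<iota> -` W" for y
    unfolding inj_def push[OF that] using injD[OF local_paramD(3)[OF lp]] that \<pi>(2) by (metis vimageD)
  moreover have "homeomorphic_map (top_of_set (\<iota> -` W)) (subtopology X ((\<lambda>y. \<sigma> (\<iota> y)) ` (\<iota> -` W))) (\<lambda>y. \<sigma> (\<iota> y))"
  proof -
    obtain g where g: "continuous_map (subtopology X (\<sigma> ` (W \<inter> H))) (top_of_set (W \<inter> H)) g" "\<And>x. x \<in> W \<inter> H \<Longrightarrow> g (\<sigma> x) = x"
      using local_param_inverse[OF lp] by blast
    have sub: "(\<lambda>y. \<sigma> (\<iota> y)) ` (\<iota> -` W) \<subseteq> \<sigma> ` (W \<inter> H)" using \<iota>(2) by auto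
    have gi: "g (\<sigma> (\<iota> y)) = \<iota> y" if "\<iota> y \<in> W" for y
      using g(2)[of "\<iota> y"] that \<iota>(2) by blast
    have "continuous_map (subtopology X ((\<lambda>y. \<sigma> (\<iota> y)) ` (\<iota> -` W))) euclidean g"
      by (rule continuous_map_from_subtopology_mono[OF _ sub]) (use g(1) in \<open>simp add: continuous_map_in_subtopology\<close>)
    moreover have "continuous_map euclidean euclidean \<pi>"
      using linear_continuous_on[OF \<pi>(1)] by simp
    ultimately have "continuous_map (subtopology X ((\<lambda>y. \<sigma> (\<iota> y)) ` (\<iota> -` W))) euclidean (\<pi> \<circ> g)"
      using continuous_map_compose by blast
    then have "continuous_map (subtopology X ((\<lambda>y. \<sigma> (\<iota> y)) ` (\<iota> -` W))) (top_of_set (\<iota> -` W)) (\<pi> \<circ> g)"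
      using gi \<pi>(2) by (auto simp: continuous_map_in_subtopology)
    then show ?thesis
      by (rule homeomorphic_map_onI[OF smooth_intoD(2)[OF s]]) (use gi \<pi>(2) in auto)
  qed
  ultimately show ?thesis
    unfolding local_param_def using s op[unfolded image_image] by simp
qed

lemma local_param_restrict:
  assumes lp: "local_param X A H P W \<sigma>" and V: "open V" "V \<subseteq> W"
  shows "local_param X A H P V \<sigma>"
proof -
  have s: "smooth_into X A V (\<lambda>y. \<sigma> y)"
    by (rule smooth_into_compose[OF local_paramD(1)[OF lp] smooth_on_bounded_linear[OF bounded_linear_ident] V(1)]) (use V in simp)
  have "openin (top_of_set (W \<inter> H)) (V \<inter> H)" using V by (auto simp: openin_open)
  then have "openin (subtopology X (\<sigma> ` (W \<inter> H))) (\<sigma> ` (V \<inter> H))"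
    using homeomorphic_map_openness_eq[OF local_paramD(5)[OF lp]] by blast
  moreover have "subtopology X (\<sigma> ` (W \<inter> H)) = subtopology (subtopology X P) (\<sigma> ` (W \<inter> H))"
    using local_paramD(6)[OF lp] by (simp add: subtopology_subtopology Int_absorb1)
  ultimately have op: "openin (subtopology X P) (\<sigma> ` (V \<inter> H))"
    using openin_trans_full[OF _ local_paramD(4)[OF lp]] by simp
  obtain g where g: "continuous_map (subtopology X (\<sigma> ` (W \<inter> H))) (top_of_set (W \<inter> H)) g" "\<And>x. x \<in> W \<inter> H \<Longrightarrow> g (\<sigma> x) = x"
    using local_param_inverse[OF lp] by blast
  have sub: "\<sigma> ` (V \<inter> H) \<subseteq> \<sigma> ` (W \<inter> H)" using V(2) by auto
  have "continuous_map (subtopology X (\<sigma> ` (V \<inter> H))) euclidean g"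
    by (rule continuous_map_from_subtopology_mono[OF _ sub]) (use g(1) in \<open>simp add: continuous_map_in_subtopology\<close>)
  moreover have "g \<in> \<sigma> ` (V \<inter> H) \<rightarrow> V \<inter> H"
    using g(2) V(2) by auto
  ultimately have gc: "continuous_map (subtopology X (\<sigma> ` (V \<inter> H))) (top_of_set (V \<inter> H)) g"
    by (auto simp: continuous_map_in_subtopology)
  have "continuous_map (top_of_set (V \<inter> H)) X \<sigma>"
    using continuous_map_from_subtopology[OF smooth_intoD(2)[OF s], of H] by (simp add: subtopology_subtopology)
  then have "homeomorphic_map (top_of_set (V \<inter> H)) (subtopology X (\<sigma> ` (V \<inter> H))) \<sigma>"
    by (rule homeomorphic_map_onI[OF _ gc]) (use g(2) V(2) in auto)
  then show ?thesis
    unfolding local_param_def using s op V(2) local_paramD(3)[OF lp] by auto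
qed

end

section \<open>The boundary of a spacelike domain\<close>

text \<open>The boundary plane of the half-space, identified with the parameter plane of surfaces;
  \<open>face_inv\<close> is the projection onto it.\<close>

definition face :: "real^2 \<Rightarrow> real^3" where
  "face y = (\<chi> i. if i = 0 then 0 else if i = 1 then y $ 0 else y $ 1)"

definition face_inv :: "real^3 \<Rightarrow> real^2" where
  "face_inv x = (\<chi> i. if i = 0 then x $ 1 else x $ 2)"

lemma bounded_linear_face: "bounded_linear face"
  unfolding linear_conv_bounded_linear[symmetric]
  by (rule linearI) (simp_all add: vec3_eq_iff face_def)

lemma bounded_linear_face_inv: "bounded_linear face_inv"
  unfolding linear_conv_bounded_linear[symmetric]
  by (rule linearI) (simp_all add: vec2_eq_iff face_inv_def)

lemma face_inv_face [simp]: "face_inv (face y) = y"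
  by (simp add: vec2_eq_iff face_def face_inv_def)

lemma face_face_inv: "x $ 0 = 0 \<Longrightarrow> face (face_inv x) = x"
  by (simp add: vec3_eq_iff face_def face_inv_def)

lemma face_0 [simp]: "face y $ 0 = 0"
  by (simp add: face_def)

lemma fd_face: "fd face y = face"
  by (rule fd_eqI[OF bounded_linear_imp_has_derivative[OF bounded_linear_face]])

lemma face_half_space: "face y \<in> half_space"
  by (simp add: half_space_def)

section \<open>The outward unit normal and its regularity\<close>

lemma differentiable_det:
  fixes M :: "'a::real_normed_vector \<Rightarrow> real^'n^'n"
  assumes "\<And>i j. (\<lambda>x. M x $ i $ j) differentiable at x"
  shows "(\<lambda>x. det (M x)) differentiable at x"
proof -
  have "(\<lambda>x. \<Prod>i\<in>UNIV. M x $ i $ p i) differentiable at x" for p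
    by (rule differentiableI, rule has_derivative_prod, rule has_fd[OF assms])
  then show ?thesis
    unfolding det_def by (intro differentiable_sum ballI differentiable_mult finite_permutations) auto
qed

text \<open>The unit vector orthogonal to the plane \<open>x\<^sub>0 = 0\<close> with respect to \<open>G\<close>, on the side \<open>x\<^sub>0 > 0\<close>.\<close>

definition unit_normal :: "real^3^3 \<Rightarrow> real^3" where
  "unit_normal G = (let z = matrix_inv G *v axis 0 1 in (1 / sqrt (z $ 0)) *\<^sub>R z)"

text \<open>Orthogonality to the plane says that \<open>G *v z\<close> is a multiple of the first
  coordinate vector, and the unit length fixes the multiple. The resulting closed formula is the
  source of the differentiability of \<nu>.\<close>

lemma unit_normal_eqI:
  assumes sym: "\<And>a b. ip G a b = ip G b a" and inv: "invertible G"
    and z: "z $ 0 > 0" "\<And>\<eta>. ip G z (face \<eta>) = 0" "ip G z z = 1"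
  shows "z = unit_normal G"
proof -
  have orth: "(G *v z) \<bullet> face \<eta> = 0" for \<eta>
    using z(2)[of \<eta>] sym[of z] by (simp add: ip_def inner_commute)
  have "face (axis 0 1) = axis 1 1" "face (axis 1 1) = axis 2 1"
    by (simp_all add: vec3_eq_iff face_def axis_def)
  then have "(G *v z) $ 1 = 0" "(G *v z) $ 2 = 0"
    using orth[of "axis 0 1"] orth[of "axis 1 1"] by (simp_all add: inner_axis)
  then have Gz: "G *v z = ((G *v z) $ 0) *\<^sub>R axis 0 1"
    by (simp add: vec3_eq_iff axis_def)
  define l where "l = (G *v z) $ 0"
  define q where "q = matrix_inv G *v axis 0 1"
  have "z = matrix_inv G *v (G *v z)"
    by (simp add: matrix_vector_mul_assoc matrix_inv_left[OF inv])
  also have "\<dots> = l *\<^sub>R q"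
    by (subst Gz) (simp add: l_def q_def matrix_vector_mult_scaleR)
  finally have zq: "z = l *\<^sub>R q" .
  have "1 = z \<bullet> (G *v z)" using z(3) by (simp add: ip_def)
  also have "\<dots> = l * z $ 0"
    by (subst Gz) (simp add: l_def inner_axis)
  finally have lz: "l * z $ 0 = 1" by simp
  then have l: "l > 0" using z(1) by (metis zero_less_mult_pos2 zero_less_one)
  have "l * l * q $ 0 = 1" using lz zq by (metis mult.assoc real_scaleR_def vector_scaleR_component)
  then have "q $ 0 = 1 / l\<^sup>2" using l by (simp add: power2_eq_square field_simps)
  then have "sqrt (q $ 0) = 1 / l" using l by (simp add: real_sqrt_divide)
  then show ?thesis
    unfolding unit_normal_def Let_def q_def[symmetric] using zq by simp
qed

context atlas
begin

context
  fixes g :: "('m, 'n) metric" and \<Omega> S :: "'m set" and \<nu> :: "'m \<Rightarrow> ('m, 'n) tvec"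
  assumes mf: "metric_field A (topspace X) g"
    and sp: "spacelike X A g half_space \<Omega>"
    and S: "S = submanifold_boundary X A \<Omega>"
    and out: "\<And>p. p \<in> S \<Longrightarrow> outward_unit_normal X A g \<Omega> S p (\<nu> p)"
begin

text \<open>By \<open>boundary_point_iff\<close>, the image of the boundary plane is the part of
  \<open>S\<close> inside the image of \<open>\<tau>\<close>, hence open in
  \<open>S\<close>.\<close>

lemma boundary_local_param:
  assumes lp: "local_param X A half_space \<Omega> W \<tau>"
  shows "local_param X A UNIV S (face -` W) (\<lambda>y. \<tau> (face y))"
proof (rule local_param_linear[OF lp bounded_linear_face _ bounded_linear_face_inv])
  show "range face \<subseteq> half_space" using face_half_space by blast
  have "S \<subseteq> \<Omega>"
    unfolding S submanifold_boundary_def using local_paramD(6) by (fastforce simp: half_space_def)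
  have "\<tau> ` face ` (face -` W) = S \<inter> \<tau> ` (W \<inter> half_space)"
  proof (intro equalityI subsetI)
    fix q assume "q \<in> \<tau> ` face ` (face -` W)"
    then obtain y where y: "q = \<tau> (face y)" "face y \<in> W" by blast
    then have "q \<in> S" unfolding S using boundary_point_iff[OF lp y(2) face_half_space] by simp
    then show "q \<in> S \<inter> \<tau> ` (W \<inter> half_space)" using y face_half_space by blast
  next
    fix q assume "q \<in> S \<inter> \<tau> ` (W \<inter> half_space)"
    then obtain x where x: "q = \<tau> x" "x \<in> W" "x \<in> half_space" "q \<in> S" by blast
    then have "x $ 0 = 0" using boundary_point_iff[OF lp x(2,3)] unfolding S by simp
    then have "face (face_inv x) = x" by (rule face_face_inv)
    then show "q \<in> \<tau> ` face ` (face -` W)" using x(1,2) by (metis imageI vimageI)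
  qed
  moreover have "openin (subtopology X S) (S \<inter> \<tau> ` (W \<inter> half_space))"
  proof -
    obtain O' where "openin X O'" "\<tau> ` (W \<inter> half_space) = O' \<inter> \<Omega>"
      using local_paramD(4)[OF lp] unfolding openin_subtopology by blast
    then have "S \<inter> \<tau> ` (W \<inter> half_space) = O' \<inter> S" using \<open>S \<subseteq> \<Omega>\<close> by blast
    then show ?thesis using \<open>openin X O'\<close> unfolding openin_subtopology by blast
  qed
  ultimately show "openin (subtopology X S) (\<tau> ` face ` (face -` W))" by simp
qed simp

lemma push_face:
  assumes lp: "local_param X A half_space \<Omega> W \<tau>" and y: "face y \<in> W"
  shows "push A (\<lambda>y. \<tau> (face y)) y v = push A \<tau> (face y) (face v)"
  using push_compose[OF local_paramD(1)[OF lp] local_paramD(2)[OF boundary_local_param[OF lp]], of y face "\<lambda>y. \<tau> (face y)"]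
    y bounded_linear_imp_differentiable[OF bounded_linear_face] by (simp add: fd_face)

lemma boundary_chart:
  assumes "p \<in> S"
  obtains W \<tau> y where "local_param X A half_space \<Omega> W \<tau>" "face y \<in> W" "p = \<tau> (face y)"
  using assms unfolding S submanifold_boundary_def using face_face_inv by (smt (verit) mem_Collect_eq)

lemma boundary_gram:
  assumes lp: "local_param X A half_space \<Omega> W \<tau>" and y: "face y \<in> W"
  shows "ip (gram A g \<tau> (face y)) a b = g (\<tau> (face y)) (push A \<tau> (face y) a) (push A \<tau> (face y) b)"
    "ip (gram A g \<tau> (face y)) a b = ip (gram A g \<tau> (face y)) b a"
    "invertible (gram A g \<tau> (face y))" "gram A g \<tau> differentiable at (face y)"
proof -
  note \<tau>s = local_paramD(1)[OF lp] and \<tau>X = local_paramD(8)[OF lp y]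
  obtain c where c: "c \<in> A" "\<tau> (face y) \<in> fst c" using ex_chart \<tau>X by blast
  show 1: "ip (gram A g \<tau> (face y)) a b = g (\<tau> (face y)) (push A \<tau> (face y) a) (push A \<tau> (face y) b)" for a b
    by (rule metric_field_gram(1)[OF mf \<tau>s y \<tau>X])
  show "ip (gram A g \<tau> (face y)) a b = ip (gram A g \<tau> (face y)) b a"
    unfolding 1 by (rule metric_field_ip(2)[OF mf c \<tau>X push_tangent'[OF \<tau>s y] push_tangent'[OF \<tau>s y]])
  show "invertible (gram A g \<tau> (face y))"
    by (rule invertible_if_ip_pos, rule gram_pos[OF mf sp lp]) (use y face_half_space in auto)
  show "gram A g \<tau> differentiable at (face y)"
  proof (rule fd_pullback_metric(1)[where G = "gram A g (cinv c)"])
    show "open (W \<inter> \<tau> -` fst c)" "smooth_on (W \<inter> \<tau> -` fst c) (\<lambda>x. snd c (\<tau> x))" "face y \<in> W \<inter> \<tau> -` fst c"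
      using smooth_intoD(3,4)[OF \<tau>s c(1)] y c(2) by auto
    show "ip (gram A g \<tau> x) a b = ip (gram A g (cinv c) (snd c (\<tau> x))) (fd (\<lambda>x. snd c (\<tau> x)) x a) (fd (\<lambda>x. snd c (\<tau> x)) x b)"
      if "x \<in> W \<inter> \<tau> -` fst c" for x a b
      using that metric_field_gram(2)[OF mf \<tau>s _ local_paramD(8)[OF lp] c(1)] by simp
    show "gram A g (cinv c) differentiable at (snd c (\<tau> (face y)))"
      using mf c \<tau>X by (auto simp: metric_field_def)
  qed
qed

text \<open>The parametrization that witnesses outwardness need not be \<open>\<tau>\<close>. The
  derivative of the transition keeps component 0 positive, and orthogonality and unit length then
  leave only one vector.\<close>

lemma boundary_normal:
  assumes lp: "local_param X A half_space \<Omega> W \<tau>" and y: "face y \<in> W"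
  shows "\<nu> (\<tau> (face y)) = push A \<tau> (face y) (unit_normal (gram A g \<tau> (face y)))"
proof -
  let ?p = "\<tau> (face y)"
  have pS: "?p \<in> S" unfolding S using boundary_point_iff[OF lp y face_half_space] by simp
  obtain W' \<tau>' x' w where lp': "local_param X A half_space \<Omega> W' \<tau>'" "x' \<in> W'" "x' $ 0 = 0" "\<tau>' x' = ?p"
    and w: "w $ 0 > 0" "\<nu> ?p = push A \<tau>' x' w"
    and orth: "\<And>Y. Y \<in> surface_tangent X A S ?p \<Longrightarrow> g ?p (\<nu> ?p) Y = 0" and unit: "g ?p (\<nu> ?p) (\<nu> ?p) = 1"
    using out[OF pS] unfolding outward_unit_normal_def by blast
  have x': "x' \<in> half_space" using lp'(3) by (simp add: half_space_def)
  obtain L where L: "\<And>v. push A \<tau>' x' v = push A \<tau> (face y) (L v)" "\<And>w. w $ 0 > 0 \<Longrightarrow> L w $ 0 > 0"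
    using half_space_transition[OF lp y face_half_space lp'(1,2) x' lp'(4)[symmetric]] face_0 by metis
  have "L w = unit_normal (gram A g \<tau> (face y))"
  proof (rule unit_normal_eqI[OF boundary_gram(2,3)[OF lp y] L(2)[OF w(1)]])
    show "ip (gram A g \<tau> (face y)) (L w) (face \<eta>) = 0" for \<eta>
    proof -
      have "push A (\<lambda>y. \<tau> (face y)) y \<eta> \<in> surface_tangent X A S ?p"
        unfolding tangent_sub_def using boundary_local_param[OF lp] y by blast
      then show ?thesis
        unfolding boundary_gram(1)[OF lp y] using orth L(1) w(2) push_face[OF lp y] by metis
    qed
    show "ip (gram A g \<tau> (face y)) (L w) (L w) = 1"
      unfolding boundary_gram(1)[OF lp y] using unit L(1) w(2) by metis
  qed
  then show ?thesis using L(1) w(2) by simp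
qed

text \<open>In boundary coordinates the surface is \<open>face\<close>, and its normal is an
  explicit function of the Gram matrix, so the regularity of the metric passes to the
  normal.\<close>

lemma ex_mean_curvature_boundary:
  assumes "p \<in> S"
  shows "\<exists>k. is_mean_curvature X A g \<Omega> S \<nu> p k"
proof -
  obtain W \<tau> y0 where lp: "local_param X A half_space \<Omega> W \<tau>" and y0: "face y0 \<in> W" "p = \<tau> (face y0)"
    using boundary_chart[OF assms] by metis
  note lp2 = boundary_local_param[OF lp]
  have oW: "open (face -` W)" using local_paramD(2)[OF lp2] .
  have inS: "\<tau> (face y) \<in> S" if "y \<in> face -` W" for y
    using local_paramD(6)[OF lp2] that by blast
  have "\<exists>k. is_mean_curvature X A g \<Omega> S \<nu> (\<tau> (face y0)) k"
  proof (rule ex_mean_curvature[OF mf sp lp lp2, where s = face and m = "\<lambda>y. unit_normal (gram A g \<tau> (face y))"])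
    show "y0 \<in> face -` W" using y0 by simp
    show "smooth_on (face -` W) face" by (rule smooth_on_bounded_linear[OF bounded_linear_face])
    show "(\<lambda>y. unit_normal (gram A g \<tau> (face y))) differentiable at y" if y: "y \<in> face -` W" for y
    proof -
      have y': "face y \<in> W" using y by simp
      define G where "G y = gram A g \<tau> (face y)" for y
      have dG: "G differentiable at y"
        unfolding G_def[abs_def]
        by (rule differentiable_compose_at[OF bounded_linear_imp_differentiable[OF bounded_linear_face] boundary_gram(4)[OF lp y']])
      then have dGe: "(\<lambda>y. G y $ i $ j) differentiable at y" for i j
        unfolding differentiable_def
        using bounded_linear.has_derivative[OF bounded_linear_vec_nth bounded_linear.has_derivative[OF bounded_linear_vec_nth]] by blast
      \<comment> \<open>Cramer's rule for the first column of the inverse matrix, a form in which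
        differentiability is visible.\<close>
      define z :: "real^2 \<Rightarrow> real^3" where
        "z y = (\<chi> k. det (\<chi> i j. if j = k then axis 0 1 $ i else G y $ i $ j) / det (G y))" for y
      have det: "det (G y) \<noteq> 0" if "y \<in> face -` W" for y
        using boundary_gram(3)[OF lp, of y] that by (simp add: G_def invertible_det_nz)
      have zeq: "matrix_inv (G y) *v axis 0 1 = z y" if "y \<in> face -` W" for y
      proof -
        have "invertible (G y)" using det[OF that] by (simp add: invertible_det_nz)
        then have "G y *v (matrix_inv (G y) *v axis 0 1) = axis 0 1"
          by (simp add: matrix_vector_mul_assoc matrix_inv_right)
        then show ?thesis unfolding z_def using cramer[OF det[OF that]] by blast
      qed
      have z: "z differentiable at y"
        unfolding z_def[abs_def]
      proof (intro differentiable_vec_lambda differentiable_divide differentiable_det det[OF y] dGe)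
        show "(\<lambda>x. (\<chi> i j. if j = k then axis 0 1 $ i else G x $ i $ j) $ i $ j) differentiable at y" for k i j
          using dGe by (cases "j = k") simp_all
      qed
      \<comment> \<open>Since \<open>G y *v z y\<close> is the first coordinate vector, the squared
        length of \<open>z y\<close> is its component 0; definiteness makes the argument of the
        square root positive.\<close>
      have z0: "z y $ 0 > 0"
      proof -
        have "unit_normal (G y) \<noteq> 0"
        proof
          assume *: "unit_normal (G y) = 0"
          have "g (\<tau> (face y)) (\<nu> (\<tau> (face y))) (\<nu> (\<tau> (face y))) = ip (G y) (unit_normal (G y)) (unit_normal (G y))"
            unfolding boundary_normal[OF lp y'] G_def boundary_gram(1)[OF lp y'] ..
          then show False using * out[OF inS[OF y]] by (simp add: outward_unit_normal_def)
        qed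
        then have zn: "z y \<noteq> 0" "z y $ 0 \<noteq> 0" unfolding unit_normal_def Let_def zeq[OF y] by auto
        have "invertible (G y)" using det[OF y] by (simp add: invertible_det_nz)
        then have "G y *v z y = axis 0 1"
          unfolding zeq[OF y, symmetric] by (simp add: matrix_vector_mul_assoc matrix_inv_right)
        then have "ip (G y) (z y) (z y) = z y $ 0" by (simp add: ip_def inner_axis)
        moreover have "ip (G y) (z y) (z y) > 0"
          unfolding G_def by (rule gram_pos[OF mf sp lp _ zn(1)]) (use y' face_half_space in auto)
        ultimately show ?thesis by simp
      qed
      have "(\<lambda>y. (1 / sqrt (z y $ 0)) *\<^sub>R z y) differentiable at y"
      proof -
        have "(\<lambda>y. z y $ 0) differentiable at y"
          by (rule differentiableI, rule bounded_linear.has_derivative[OF bounded_linear_vec_nth has_fd[OF z]])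
        moreover have "sqrt differentiable at (z y $ 0)"
          using DERIV_real_sqrt[OF z0] unfolding has_field_derivative_def by (rule differentiableI)
        ultimately have "(\<lambda>y. sqrt (z y $ 0)) differentiable at y"
          by (rule differentiable_compose_at)
        then show ?thesis
          using z0 z by (intro differentiable_scaleR differentiable_divide) auto
      qed
      moreover have "(1 / sqrt (z y $ 0)) *\<^sub>R z y = unit_normal (gram A g \<tau> (face y))" if "y \<in> face -` W" for y
        unfolding unit_normal_def Let_def G_def[symmetric] zeq[OF that] ..
      ultimately show ?thesis
        using differentiable_cong_open[OF oW y, of "\<lambda>y. (1 / sqrt (z y $ 0)) *\<^sub>R z y" "\<lambda>y. unit_normal (gram A g \<tau> (face y))"] by simp
    qed
    show "face y \<in> W \<inter> half_space \<and> \<tau> (face y) = \<tau> (face y) \<and>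
        push A \<tau> (face y) (unit_normal (gram A g \<tau> (face y))) = \<nu> (\<tau> (face y))" if "y \<in> face -` W" for y
      using boundary_normal[OF lp] face_half_space that by simp
    show "g (\<tau> (face y)) (\<nu> (\<tau> (face y))) (push A (\<lambda>y. \<tau> (face y)) y v) = 0" if "y \<in> face -` W" for y v
    proof -
      have "push A (\<lambda>y. \<tau> (face y)) y v \<in> surface_tangent X A S (\<tau> (face y))"
        unfolding tangent_sub_def using lp2 that by blast
      then show ?thesis using out[OF inS[OF that]] unfolding outward_unit_normal_def by blast
    qed
    show "g (\<tau> (face y)) (\<nu> (\<tau> (face y))) (\<nu> (\<tau> (face y))) = 1" if "y \<in> face -` W" for y
      using out[OF inS[OF that]] unfolding outward_unit_normal_def by blast
  qed
  then show ?thesis using y0(2) by simp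
qed

text \<open>Transfers the orthogonality of \<open>N\<close> to the domain into orthogonality to the
  surface.\<close>

lemma surface_tangent_domain:
  assumes \<sigma>: "local_param X A UNIV S W' \<sigma>" "u \<in> W'"
  shows "push A \<sigma> u v \<in> tangent_sub X A half_space \<Omega> (\<sigma> u)"
proof -
  have "\<sigma> u \<in> S" using local_paramD(6)[OF \<sigma>(1)] \<sigma>(2) by blast
  then obtain W \<tau> y0 where lp: "local_param X A half_space \<Omega> W \<tau>" and y0: "face y0 \<in> W" "\<sigma> u = \<tau> (face y0)"
    using boundary_chart by metis
  note lp2 = boundary_local_param[OF lp]
  have "\<sigma> u \<in> (\<lambda>y. \<tau> (face y)) ` (face -` W)" using y0 by auto
  then obtain T \<theta> where T: "u \<in> T" "\<And>y. y \<in> T \<Longrightarrow> \<theta> y \<in> face -` W" "\<And>y. y \<in> T \<Longrightarrow> \<tau> (face (\<theta> y)) = \<sigma> y"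
    "\<And>y v. y \<in> T \<Longrightarrow> push A (\<lambda>y. \<tau> (face y)) (\<theta> y) (fd \<theta> y v) = push A \<sigma> y v"
    using local_param_transition[OF lp2 \<sigma>] by metis
  have "push A \<sigma> u v = push A \<tau> (face (\<theta> u)) (face (fd \<theta> u v))"
    using T(4)[OF T(1)] push_face[OF lp, of "\<theta> u"] T(2)[OF T(1)] by simp
  then show ?thesis
    unfolding tangent_sub_def using lp T(2,3)[OF T(1)] face_half_space by blast
qed

lemma normal_domain:
  assumes "p \<in> S" shows "\<nu> p \<in> tangent_sub X A half_space \<Omega> p" "\<nu> p \<in> tangent_space A p"
proof -
  obtain W \<tau> x w where *: "local_param X A half_space \<Omega> W \<tau>" "x \<in> W" "x $ 0 = 0" "\<tau> x = p" "\<nu> p = push A \<tau> x w"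
    using out[OF assms] unfolding outward_unit_normal_def by blast
  then have "x \<in> W \<inter> half_space" by (simp add: half_space_def)
  with * show "\<nu> p \<in> tangent_sub X A half_space \<Omega> p"
    unfolding tangent_sub_def by blast
  show "\<nu> p \<in> tangent_space A p"
    using push_tangent'[OF local_paramD(1)[OF *(1)] *(2)] *(4,5) by simp
qed

end

end

section \<open>Space forms\<close>

lemma bilinear_ambient_form: "bilinear (ambient_form \<epsilon>)"
  by (auto simp: bilinear_def ambient_form_def algebra_simps intro!: linearI)

lemma bounded_bilinear_ambient_form: "bounded_bilinear (ambient_form \<epsilon>)"
  using bilinear_ambient_form bilinear_conv_bounded_bilinear by blast

lemmas ambient_form_simps =
  bilinear_ladd[OF bilinear_ambient_form] bilinear_radd[OF bilinear_ambient_form]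
  bilinear_lmul[OF bilinear_ambient_form] bilinear_rmul[OF bilinear_ambient_form]
  bilinear_lsub[OF bilinear_ambient_form] bilinear_rsub[OF bilinear_ambient_form]
  bilinear_lzero[OF bilinear_ambient_form] bilinear_rzero[OF bilinear_ambient_form]

lemma ambient_form_commute: "ambient_form \<epsilon> x y = ambient_form \<epsilon> y x"
  by (simp add: ambient_form_def)

text \<open>For \<open>\<epsilon> = -1\<close> the point \<open>p\<close> is timelike, so its
  complement is spacelike: Cauchy-Schwarz for the spatial components, obtained from Lagrange's
  identity, bounds \<open>(1 + r) * (v $ 0)\<^sup>2\<close> by \<open>r * s\<close>, and
  \<open>s \<le> (v $ 0)\<^sup>2\<close> would force \<open>v = 0\<close>.\<close>

lemma ambient_form_tangent_pos:
  assumes \<epsilon>: "\<epsilon> = 1 \<or> \<epsilon> = -1" and p: "ambient_form \<epsilon> p p = \<epsilon>" and orth: "ambient_form \<epsilon> p v = 0" and v: "v \<noteq> 0"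
  shows "ambient_form \<epsilon> v v > 0"
  using \<epsilon>
proof
  assume "\<epsilon> = 1"
  then have "ambient_form \<epsilon> v v = v \<bullet> v"
    by (simp add: ambient_form_def inner_vec_def sum_4')
  then show ?thesis using v by simp
next
  assume \<epsilon>: "\<epsilon> = -1"
  define s where "s = (v $ 1)\<^sup>2 + (v $ 2)\<^sup>2 + (v $ 3)\<^sup>2"
  define r where "r = (p $ 1)\<^sup>2 + (p $ 2)\<^sup>2 + (p $ 3)\<^sup>2"
  have p0: "(p $ 0)\<^sup>2 = 1 + r" using p by (simp add: \<epsilon> ambient_form_def r_def power2_eq_square)
  have "p $ 0 * v $ 0 = p $ 1 * v $ 1 + p $ 2 * v $ 2 + p $ 3 * v $ 3"
    using orth by (simp add: \<epsilon> ambient_form_def)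
  then have "(p $ 0)\<^sup>2 * (v $ 0)\<^sup>2 = (p $ 1 * v $ 1 + p $ 2 * v $ 2 + p $ 3 * v $ 3)\<^sup>2"
    by (simp add: power_mult_distrib[symmetric])
  also have "\<dots> \<le> r * s"
  proof -
    have "r * s - (p $ 1 * v $ 1 + p $ 2 * v $ 2 + p $ 3 * v $ 3)\<^sup>2 =
      (p $ 1 * v $ 2 - p $ 2 * v $ 1)\<^sup>2 + (p $ 1 * v $ 3 - p $ 3 * v $ 1)\<^sup>2 + (p $ 2 * v $ 3 - p $ 3 * v $ 2)\<^sup>2"
      unfolding r_def s_def by algebra
    then show ?thesis by (smt (verit) zero_le_power2)
  qed
  finally have *: "(1 + r) * (v $ 0)\<^sup>2 \<le> r * s" by (simp add: p0)
  have r: "r \<ge> 0" by (simp add: r_def)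
  have "s - (v $ 0)\<^sup>2 > 0"
  proof (rule ccontr)
    assume "\<not> s - (v $ 0)\<^sup>2 > 0"
    then have s: "s \<le> (v $ 0)\<^sup>2" by simp
    then have "r * s \<le> r * (v $ 0)\<^sup>2" using r by (rule mult_left_mono)
    then have v0: "(v $ 0)\<^sup>2 \<le> 0" using *[unfolded distrib_right] by linarith
    then have "s \<le> 0" using s by simp
    then have "v $ 1 = 0" "v $ 2 = 0" "v $ 3 = 0"
      by (smt (verit) s_def zero_le_power2 zero_eq_power2)+
    then show False using v v0 by (simp add: vec4_eq_iff)
  qed
  then show ?thesis by (simp add: \<epsilon> ambient_form_def s_def power2_eq_square)
qed

text \<open>
  Near a point \<open>p\<close> the space form is the graph over its tangent space at \<open>p\<close>, translated so that
  \<open>p\<close> has a negative coordinate \<open>0\<close>: the image then lies over the interior of the half-space.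
\<close>

lemma space_form_graph:
  fixes p :: "real^4"
  assumes \<epsilon>: "\<epsilon> = 1 \<or> \<epsilon> = -1" and p: "p \<in> space_form \<epsilon>"
  obtains W and \<psi> :: "real^3 \<Rightarrow> real^4" and P b where "open W" "smooth_on W \<psi>" "bounded_linear P"
    "\<And>y. y \<in> W \<Longrightarrow> \<psi> y \<in> space_form \<epsilon> \<and> P (\<psi> y) + b = y \<and> y $ 0 < 0"
    "openin (top_of_set (space_form \<epsilon>)) (\<psi> ` W)" "p \<in> \<psi> ` W"
    "\<And>y v. y \<in> W \<Longrightarrow> P (fd \<psi> y v) = v" "\<And>y v. y \<in> W \<Longrightarrow> ambient_form \<epsilon> (\<psi> y) (fd \<psi> y v) = 0"
    "\<And>y \<xi>. y \<in> W \<Longrightarrow> ambient_form \<epsilon> (\<psi> y) \<xi> = 0 \<Longrightarrow> fd \<psi> y (P \<xi>) = \<xi>"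
proof -
  let ?a = "ambient_form \<epsilon>"
  note [simp] = ambient_form_simps
  have \<epsilon>2: "\<epsilon> * \<epsilon> = 1" using \<epsilon> by auto
  have pp: "?a p p = \<epsilon>" and p0: "\<epsilon> = -1 \<Longrightarrow> p $ 0 > 0" using p by (auto simp: space_form_def)
  \<comment> \<open>The Euclidean representative of the linear form of \<open>p\<close>. The tangent
    space at \<open>p\<close> thus becomes a hyperplane, which \<open>E\<close> parametrizes
    linearly.\<close>
  define a :: "real^4" where "a = (\<chi> i. if i = 0 then \<epsilon> * p $ 0 else p $ i)"
  have a: "a \<bullet> x = ?a p x" for x
    by (simp add: a_def inner_vec_def sum_4' ambient_form_def)
  have "a \<noteq> 0" using a[of p] pp \<epsilon> by auto
  then have "dim {x. a \<bullet> x = 0} = dim (UNIV :: (real^3) set)"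
    by (simp add: dim_hyperplane)
  then obtain E :: "real^3 \<Rightarrow> real^4" and R where E: "linear E" "linear R" "range E = {x. a \<bullet> x = 0}" "\<And>y. R (E y) = y"
    "\<And>x. a \<bullet> x = 0 \<Longrightarrow> E (R x) = x"
    using isometries_subspaces[of "UNIV :: (real^3) set" "{x. a \<bullet> x = 0}"] subspace_hyperplane[of a]
    by (metis (mono_tags, lifting) UNIV_I mem_Collect_eq subspace_UNIV)
  have pE: "?a p (E y) = 0" "?a (E y) p = 0" for y
  proof -
    have "E y \<in> {x. a \<bullet> x = 0}" using E(3) by blast
    then show "?a p (E y) = 0" using a[of "E y"] by simp
    then show "?a (E y) p = 0" by (simp add: ambient_form_commute)
  qed
  \<comment> \<open>Coordinates of the part of \<open>x\<close> orthogonal to \<open>p\<close>. The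
    coefficient contains \<open>\<epsilon>\<close> because the square of \<open>p\<close> is
    \<open>\<epsilon>\<close>, its own inverse.\<close>
  define P where "P x = R (x - (\<epsilon> * ?a x p) *\<^sub>R p)" for x
  have EP: "E (P x) = x - (\<epsilon> * ?a x p) *\<^sub>R p" for x
    unfolding P_def
  proof (rule E(5))
    have "a \<bullet> (x - (\<epsilon> * ?a x p) *\<^sub>R p) = ?a p x - (\<epsilon> * \<epsilon>) * ?a p x"
      by (simp add: a pp ambient_form_commute[of \<epsilon> x p])
    then show "a \<bullet> (x - (\<epsilon> * ?a x p) *\<^sub>R p) = 0" by (simp add: \<epsilon>2)
  qed
  have PE: "P (E y + l *\<^sub>R p) = y" for y l
  proof -
    have "E y + l *\<^sub>R p - (\<epsilon> * ?a (E y + l *\<^sub>R p) p) *\<^sub>R p = E y"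
      using \<epsilon>2 by (simp add: pE pp mult.left_commute)
    then show ?thesis unfolding P_def by (simp only: E(4))
  qed
  have linP: "linear P"
    unfolding P_def[abs_def]
    by (rule linear_compose[of _ R, unfolded o_def]) (auto intro!: linearI E(2) simp: algebra_simps)
  define b :: "real^3" where "b = - axis 0 1"
  define q where "q y = ?a (E (y - b)) (E (y - b))" for y
  \<comment> \<open>Chosen so that the graph lies on the quadric: the square of
    \<open>E (y - b) + l y *\<^sub>R p\<close> is \<open>q y + (l y)\<^sup>2 * \<epsilon>\<close>,
    and this has to equal \<open>\<epsilon>\<close>.\<close>
  define l where "l y = sqrt (1 - \<epsilon> * q y)" for y
  define \<psi> where "\<psi> y = E (y - b) + l y *\<^sub>R p" for y
  define W1 where "W1 = {y. 1 - \<epsilon> * q y > 0}"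
  have sE: "smooth_on W (\<lambda>y. E (y - b))" if "open W" for W
  proof (rule smooth_onI)
    fix k
    have "Ck_on k (\<lambda>y. y - b) W"
      by (intro Ck_on_diff Ck_on_const that Ck_on_bounded_linear bounded_linear_ident)
    then show "Ck_on k (\<lambda>y. E (y - b)) W"
      using Ck_on_linear_comp[OF _ _ that, of E] E(1) linear_conv_bounded_linear by blast
  qed
  have sq: "Ck_on k (\<lambda>y. 1 - \<epsilon> * q y) W" if "open W" for k W
    unfolding q_def
    by (intro Ck_on_diff Ck_on_mult Ck_on_const that Ck_on_bilinear[OF bounded_bilinear_ambient_form] smooth_onD[OF sE])
  have W1: "open W1"
    using Ck_on.simps(1)[THEN iffD1, OF sq[OF open_UNIV]] unfolding W1_def
    by (intro open_Collect_less) auto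
  have sl: "Ck_on k l W1" for k
    unfolding l_def[abs_def] by (rule Ck_on_sqrt[OF sq[OF W1] W1]) (simp add: W1_def)
  have s\<psi>1: "smooth_on W1 \<psi>"
    unfolding \<psi>_def[abs_def]
    by (intro smooth_onI Ck_on_add Ck_on_scaleR sl Ck_on_const W1 smooth_onD[OF sE])
  define W where "W = W1 \<inter> \<psi> -` {x. \<epsilon> = -1 \<longrightarrow> x $ 0 > 0} \<inter> {y. y $ 0 < 0}"
  have "open {x :: real^4. \<epsilon> = -1 \<longrightarrow> x $ 0 > 0}"
    by (cases "\<epsilon> = -1") (auto intro!: open_Collect_less continuous_intros)
  then have "open (W1 \<inter> \<psi> -` {x. \<epsilon> = -1 \<longrightarrow> x $ 0 > 0})"
    using continuous_open_preimage[OF smooth_on_continuous[OF s\<psi>1] W1] by blast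
  moreover have "open {y :: real^3. y $ 0 < 0}"
    by (intro open_Collect_less continuous_intros)
  ultimately have W: "open W" unfolding W_def by blast
  have s\<psi>: "smooth_on W \<psi>" by (rule smooth_on_subset[OF s\<psi>1 W1 W]) (auto simp: W_def)
  have l2: "(l y)\<^sup>2 = 1 - \<epsilon> * q y" "l y > 0" if "y \<in> W" for y
    using that by (auto simp: l_def W_def W1_def)
  have a\<psi>: "?a (\<psi> y) (\<psi> y) = \<epsilon>" if "y \<in> W" for y
  proof -
    have "?a (\<psi> y) (\<psi> y) = q y + (l y)\<^sup>2 * \<epsilon>"
      by (simp add: \<psi>_def pE pp q_def power2_eq_square)
    also have "\<dots> = \<epsilon>" using \<epsilon>2 by (simp add: l2[OF that] algebra_simps)
    finally show ?thesis .
  qed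
  have in_sf: "\<psi> y \<in> space_form \<epsilon>" if "y \<in> W" for y
    using a\<psi>[OF that] that by (simp add: space_form_def W_def)
  have P\<psi>: "P (\<psi> y) + b = y" for y
    unfolding \<psi>_def PE by simp
  have a\<psi>p: "?a (\<psi> y) p = l y * \<epsilon>" "?a p (\<psi> y) = l y * \<epsilon>" for y
    by (simp_all add: \<psi>_def pE pp)
  have d\<psi>: "\<psi> differentiable at y" if "y \<in> W" for y
    using smooth_on_differentiable[OF s\<psi> W that] .
  have bP: "bounded_linear P" using linP linear_conv_bounded_linear by blast
  have fdP: "P (fd \<psi> y v) = v" if "y \<in> W" for y v
  proof -
    have "((\<lambda>y. P (\<psi> y) + b) has_derivative (\<lambda>v. P (fd \<psi> y v) + 0)) (at y)"
      by (intro has_derivative_add has_derivative_const bounded_linear.has_derivative[OF bP has_fd[OF d\<psi>[OF that]]])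
    then have "((\<lambda>y. y) has_derivative (\<lambda>v. P (fd \<psi> y v))) (at y)" by (simp add: P\<psi>)
    from fun_cong[OF has_derivative_unique[OF has_derivative_ident this], of v] show ?thesis by simp
  qed
  have tang: "?a (\<psi> y) (fd \<psi> y v) = 0" if "y \<in> W" for y v
  proof -
    have "((\<lambda>y. ?a (\<psi> y) (\<psi> y)) has_derivative (\<lambda>v. ?a (\<psi> y) (fd \<psi> y v) + ?a (fd \<psi> y v) (\<psi> y))) (at y)"
      by (rule bounded_bilinear.FDERIV[OF bounded_bilinear_ambient_form has_fd has_fd]; rule d\<psi>[OF that])
    moreover have "((\<lambda>y. ?a (\<psi> y) (\<psi> y)) has_derivative (\<lambda>v. 0)) (at y)"
      by (rule has_derivative_transform_within_open[OF has_derivative_const W that]) (simp add: a\<psi>)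
    ultimately have "(\<lambda>v. ?a (\<psi> y) (fd \<psi> y v) + ?a (fd \<psi> y v) (\<psi> y)) = (\<lambda>v. 0)"
      by (rule has_derivative_unique)
    from fun_cong[OF this, of v] have "?a (\<psi> y) (fd \<psi> y v) + ?a (fd \<psi> y v) (\<psi> y) = 0" by simp
    then show ?thesis by (simp add: ambient_form_commute[of _ "fd \<psi> y v"])
  qed
  \<comment> \<open>The kernel of \<open>P\<close> is the line of \<open>p\<close>. This line is not
    tangent at \<open>\<psi> y\<close>, since the pairing of \<open>\<psi> y\<close> with
    \<open>p\<close> is \<open>l y * \<epsilon>\<close> and nonzero.\<close>
  have proj: "fd \<psi> y (P \<xi>) = \<xi>" if y: "y \<in> W" and \<xi>: "?a (\<psi> y) \<xi> = 0" for y \<xi>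
  proof -
    define d where "d = fd \<psi> y (P \<xi>) - \<xi>"
    have "P d = 0" unfolding d_def using fdP[OF y] by (simp add: linear_diff[OF linP])
    then have dp: "d = (\<epsilon> * ?a d p) *\<^sub>R p" using EP[of d] linear_0[OF E(1)] by simp
    have "?a (\<psi> y) d = 0" unfolding d_def using tang[OF y] \<xi> by simp
    moreover have "?a (\<psi> y) d = (\<epsilon> * ?a d p) * ?a (\<psi> y) p"
      by (subst dp) simp
    ultimately have "\<epsilon> * ?a d p = 0" using l2(2)[OF y] \<epsilon> by (auto simp: a\<psi>p)
    with dp have "d = 0" by (metis scaleR_zero_left)
    then show ?thesis by (simp add: d_def)
  qed
  \<comment> \<open>Over each point of the tangent space the quadric leaves two opposite
    coefficients of \<open>p\<close>. Positivity of \<open>\<epsilon> * ?a x p\<close> selects the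
    one of the graph, which exhibits the image as relatively open.\<close>
  have img: "\<psi> ` W = space_form \<epsilon> \<inter> {x. \<epsilon> * ?a x p > 0 \<and> (P x + b) $ 0 < 0}"
  proof (intro equalityI subsetI)
    fix x assume "x \<in> \<psi> ` W"
    then obtain y where y: "x = \<psi> y" "y \<in> W" by blast
    have "\<epsilon> * ?a x p = l y" using \<epsilon>2 by (simp add: y a\<psi>p mult.left_commute)
    moreover have "(P x + b) $ 0 < 0" unfolding y(1) P\<psi> using y(2) by (simp add: W_def)
    ultimately show "x \<in> space_form \<epsilon> \<inter> {x. \<epsilon> * ?a x p > 0 \<and> (P x + b) $ 0 < 0}"
      using in_sf[OF y(2)] l2(2)[OF y(2)] y(1) by simp
  next
    fix x assume x: "x \<in> space_form \<epsilon> \<inter> {x. \<epsilon> * ?a x p > 0 \<and> (P x + b) $ 0 < 0}"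
    define y where "y = P x + b"
    define r where "r = \<epsilon> * ?a x p"
    have r: "r > 0" using x by (simp add: r_def)
    have ex: "x = E (y - b) + r *\<^sub>R p" using EP[of x] by (simp add: y_def r_def)
    have "\<epsilon> = ?a x x" using x by (simp add: space_form_def)
    also have "\<dots> = q y + r\<^sup>2 * \<epsilon>"
      by (subst (1 2) ex) (simp add: pE pp q_def power2_eq_square)
    finally have "r\<^sup>2 = 1 - \<epsilon> * q y" using \<epsilon>2 by algebra
    then have "l y = r" "1 - \<epsilon> * q y > 0"
      using r zero_less_power[OF r, of 2] by (auto simp: l_def real_sqrt_unique)
    then have "\<psi> y = x" "y \<in> W1" using ex by (simp_all add: \<psi>_def W1_def)
    moreover from this have "y \<in> W" using x by (auto simp: W_def y_def space_form_def)
    ultimately show "x \<in> \<psi> ` W" by blast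
  qed
  have "open {x. \<epsilon> * ?a x p > 0 \<and> (P x + b) $ 0 < 0}"
  proof -
    have c: "continuous_on UNIV (\<lambda>x. \<epsilon> * ?a x p)" "continuous_on UNIV (\<lambda>x. (P x + b) $ 0)"
      by (intro continuous_intros bounded_bilinear.continuous_on[OF bounded_bilinear_ambient_form] linear_continuous_on[OF bP])+
    have "{x. \<epsilon> * ?a x p > 0 \<and> (P x + b) $ 0 < 0} = {x. \<epsilon> * ?a x p > 0} \<inter> {x. (P x + b) $ 0 < 0}" by blast
    then show ?thesis using c by (simp add: open_Collect_less open_Int)
  qed
  then have opn: "openin (top_of_set (space_form \<epsilon>)) (\<psi> ` W)"
    unfolding img openin_open by blast
  have "P p = 0" using PE[of 0 1] linear_0[OF E(1)] by simp
  then have pW: "p \<in> \<psi> ` W"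
    unfolding img using p pp \<epsilon>2 by (simp add: b_def axis_def)
  show ?thesis
    by (rule that[OF W s\<psi> bP _ opn pW fdP tang proj]) (use in_sf P\<psi> in \<open>auto simp: W_def\<close>)
qed

section \<open>Static spacetimes\<close>

lemma submanifold_atlasD:
  assumes "c \<in> submanifold_atlas Q"
  shows "open (snd c ` fst c)" "smooth_on (snd c ` fst c) (cinv c)" "x \<in> snd c ` fst c \<Longrightarrow> inj (fd (cinv c) x)" "fst c \<subseteq> Q"
proof -
  have "openin (top_of_set Q) (fst c)" using assms by (simp add: submanifold_atlas_def)
  then show "fst c \<subseteq> Q" using openin_subset by fastforce
qed (use assms in \<open>auto simp: submanifold_atlas_def\<close>)

text \<open>\<open>static_potential\<close> speaks about \<open>V\<close> in charts of the atlas, so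
  the graph must be recognized as such a chart before anything is known about \<open>V\<close>
  composed with \<open>\<psi>\<close>.\<close>

lemma graph_chart:
  fixes \<psi> :: "real^3 \<Rightarrow> real^4"
  assumes W: "open W" "smooth_on W \<psi>" "bounded_linear P"
    and \<psi>: "\<And>y. y \<in> W \<Longrightarrow> \<psi> y \<in> space_form \<epsilon> \<and> P (\<psi> y) + b = y \<and> y $ 0 < 0"
    and op: "openin (top_of_set (space_form \<epsilon>)) (\<psi> ` W)"
    and fdP: "\<And>y v. y \<in> W \<Longrightarrow> P (fd \<psi> y v) = v"
  shows "(\<psi> ` W, \<lambda>x. P x + b) \<in> space_form_atlas \<epsilon>" "y \<in> W \<Longrightarrow> inv_into (\<psi> ` W) (\<lambda>x. P x + b) y = \<psi> y"
    "(\<lambda>x. P x + b) ` (\<psi> ` W) = W"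
proof -
  have inj: "inj_on (\<lambda>x. P x + b) (\<psi> ` W)"
    by (rule inj_on_inverseI[where g = \<psi>]) (use \<psi> in force)
  show img: "(\<lambda>x. P x + b) ` (\<psi> ` W) = W" using \<psi> by (auto simp: image_image)
  have inv: "inv_into (\<psi> ` W) (\<lambda>x. P x + b) y = \<psi> y" if "y \<in> W" for y
    using inv_into_f_f[OF inj, of "\<psi> y"] \<psi>[OF that] that by simp
  then show "y \<in> W \<Longrightarrow> inv_into (\<psi> ` W) (\<lambda>x. P x + b) y = \<psi> y" .
  have cP: "continuous_on S (\<lambda>x. P x + b)" for S
    by (intro continuous_intros linear_continuous_on[OF W(3)])
  have "homeomorphic_maps (top_of_set (\<psi> ` W)) (top_of_set W) (\<lambda>x. P x + b) \<psi>"
    unfolding homeomorphic_maps_def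
    using \<psi> cP smooth_on_continuous[OF W(2)] by (auto simp: continuous_map_in_subtopology)
  then have "homeomorphic_map (top_of_set (\<psi> ` W)) (top_of_set W) (\<lambda>x. P x + b)"
    using homeomorphic_map_maps by blast
  moreover have "smooth_on W (inv_into (\<psi> ` W) (\<lambda>x. P x + b))"
    using smooth_on_cong[OF W(1), of "inv_into (\<psi> ` W) (\<lambda>x. P x + b)" \<psi>] inv W(2) by blast
  moreover have "inj (fd (inv_into (\<psi> ` W) (\<lambda>x. P x + b)) y)" if "y \<in> W" for y
  proof -
    have eq: "fd (inv_into (\<psi> ` W) (\<lambda>x. P x + b)) y = fd \<psi> y"
      by (rule fd_cong[OF W(1) that inv])
    show ?thesis
      unfolding eq by (rule inj_on_inverseI[where g = P]) (rule fdP[OF that])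
  qed
  ultimately show "(\<psi> ` W, \<lambda>x. P x + b) \<in> space_form_atlas \<epsilon>"
    unfolding submanifold_atlas_def mem_Collect_eq fst_conv snd_conv img using op W(1) by blast
qed

locale static =
  fixes \<epsilon> :: real and V :: "real^4 \<Rightarrow> real" and B :: "(real \<times> (real^4), 4) chart set"
  assumes \<epsilon>: "\<epsilon> = 1 \<or> \<epsilon> = -1" and potential: "static_potential \<epsilon> V"
    and B: "B \<subseteq> submanifold_atlas (static_spacetime \<epsilon> V)"
    and atlas_B: "smooth_atlas (top_of_set (static_spacetime \<epsilon> V)) B"
begin

abbreviation "ST \<equiv> static_spacetime \<epsilon> V"

sublocale atlas "top_of_set ST" B
  by standard (rule atlas_B)

definition form :: "real \<times> (real^4) \<Rightarrow> real \<times> (real^4) \<Rightarrow> real \<times> (real^4) \<Rightarrow> real" where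
  "form p u v = - (V (snd p))\<^sup>2 * fst u * fst v + ambient_form \<epsilon> (snd u) (snd v)"

lemma static_metric_form: "static_metric \<epsilon> V B p u v = form p (ambient_vec B p u) (ambient_vec B p v)"
  by (simp add: static_metric_def form_def split: prod.splits)

lemma bilinear_form: "bilinear (form p)"
  by (auto simp: bilinear_def form_def ambient_form_simps algebra_simps intro!: linearI)

lemma form_commute: "form p u v = form p v u"
  by (simp add: form_def ambient_form_commute mult_ac)

lemma chart_smooth: "c \<in> B \<Longrightarrow> smooth_on (snd c ` fst c) (cinv c)"
  and chart_fd_inj: "c \<in> B \<Longrightarrow> x \<in> snd c ` fst c \<Longrightarrow> inj (fd (cinv c) x)"
  and chart_static: "c \<in> B \<Longrightarrow> fst c \<subseteq> ST"
  using submanifold_atlasD[of c ST] B by blast+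

lemma cinv_differentiable: "c \<in> B \<Longrightarrow> p \<in> fst c \<Longrightarrow> cinv c differentiable at (snd c p)"
  using smooth_on_differentiable[OF chart_smooth chart_open] by blast

lemma ambient_vec_chart:
  assumes "u \<in> tangent_space B p" "c \<in> B" "p \<in> fst c"
  shows "ambient_vec B p u = fd (cinv c) (snd c p) (u c)"
proof -
  have pX: "p \<in> topspace (top_of_set ST)" using assms chart_subset by blast
  define d where "d = chart_at B p"
  have d: "d \<in> B" "p \<in> fst d" using chart_at[OF pX] by (auto simp: d_def)
  let ?O = "snd d ` (fst d \<inter> fst c)"
  have O': "open ?O" "snd d p \<in> ?O" using chart_image_open[OF d(1) chart_openin[OF assms(2)]] d assms by auto
  have "fd (\<lambda>x. cinv c (snd c (cinv d x))) (snd d p) (u d) = fd (cinv c) (snd c (cinv d (snd d p))) (fd (\<lambda>x. snd c (cinv d x)) (snd d p) (u d))"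
    by (rule fd_compose) (use transition_differentiable[OF d(1) assms(2)] d assms cinv_differentiable[OF assms(2,3)] in \<open>auto simp: cinv_chart\<close>)
  moreover have "fd (\<lambda>x. cinv c (snd c (cinv d x))) (snd d p) = fd (cinv d) (snd d p)"
    by (rule fd_cong[OF O']) (use d assms in \<open>auto simp: cinv_chart\<close>)
  ultimately have "fd (cinv d) (snd d p) (u d) = fd (cinv c) (snd c p) (u c)"
    using tangent_space_component[OF assms(1) d(1) assms(2) d(2) assms(3)] d by (simp add: cinv_chart)
  then show ?thesis by (simp add: ambient_vec_def Let_def d_def)
qed

lemma ambient_vec_inj:
  assumes "u \<in> tangent_space B p" "v \<in> tangent_space B p" "p \<in> ST" "ambient_vec B p u = ambient_vec B p v"
  shows "u = v"
proof -
  obtain c where c: "c \<in> B" "p \<in> fst c" using ex_chart[of p] assms(3) by auto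
  have "fd (cinv c) (snd c p) (u c) = fd (cinv c) (snd c p) (v c)"
    using ambient_vec_chart[OF assms(1) c] ambient_vec_chart[OF assms(2) c] assms(4) by simp
  then have "u c = v c" using chart_fd_inj[OF c(1)] c(2) by (simp add: inj_eq)
  then show ?thesis by (rule tangent_eqI[OF assms(1,2) c])
qed

text \<open>Inverse charts are immersions into the linear space, so they can be divided out of a map
  that is smooth there.\<close>

lemma smooth_into_static:
  fixes f :: "'e::real_normed_vector \<Rightarrow> real \<times> (real^4)"
  assumes f: "open O'" "smooth_on O' f" "f ` O' \<subseteq> ST"
  shows "smooth_into (top_of_set ST) B O' f"
proof -
  have cont: "continuous_map (top_of_set O') (top_of_set ST) f"
    using smooth_on_continuous[OF f(2)] f(3) by (auto simp: continuous_map_in_subtopology)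
  have "smooth_on (O' \<inter> f -` fst c) (\<lambda>y. snd c (f y))" if c: "c \<in> B" for c
  proof (rule smooth_on_factor[OF chart_open[OF c] chart_smooth[OF c] chart_fd_inj[OF c]])
    show o: "open (O' \<inter> f -` fst c)" by (rule open_preimage_chart[OF f(1) cont chart_openin[OF c]])
    show "smooth_on (O' \<inter> f -` fst c) f" by (rule smooth_on_subset[OF f(2,1) o]) simp
    have "continuous_map (top_of_set (O' \<inter> f -` fst c)) (subtopology (top_of_set ST) (fst c)) f"
      using continuous_map_from_subtopology[OF cont, of "f -` fst c"]
      by (auto simp: continuous_map_in_subtopology subtopology_subtopology)
    from continuous_map_compose[OF this chart_continuous[OF c]]
    show "continuous_on (O' \<inter> f -` fst c) (\<lambda>y. snd c (f y))" by (simp add: o_def)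
    show "(\<lambda>y. snd c (f y)) ` (O' \<inter> f -` fst c) \<subseteq> snd c ` fst c" by auto
    show "cinv c (snd c (f z)) = f z" if "z \<in> O' \<inter> f -` fst c" for z using that c by (simp add: cinv_chart)
  qed
  then show ?thesis
    unfolding smooth_into_def using f(1) cont by (simp add: o_def)
qed

lemma ambient_vec_push:
  assumes f: "smooth_into (top_of_set ST) B O' f" "y \<in> O'"
  shows "ambient_vec B (f y) (push B f y v) = fd f y v"
proof -
  obtain c where c: "c \<in> B" "f y \<in> fst c" using ex_chart[of "f y"] smooth_intoD(5)[OF f] by auto
  have "ambient_vec B (f y) (push B f y v) = fd (cinv c) (snd c (f y)) (fd (\<lambda>y. snd c (f y)) y v)"
    using ambient_vec_chart[OF push_tangent'[OF f] c] c by (simp add: push_component)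
  also have "\<dots> = fd (\<lambda>y. cinv c (snd c (f y))) y v"
    by (rule fd_compose[symmetric, OF smooth_into_differentiable[OF f c] cinv_differentiable[OF c]])
  also have "fd (\<lambda>y. cinv c (snd c (f y))) y = fd f y"
    by (rule fd_cong[OF smooth_intoD(4)[OF f(1) c(1)]]) (use f c in \<open>auto simp: cinv_chart\<close>)
  finally show ?thesis .
qed

text \<open>Derivative of the equation of the quadric.\<close>

lemma ambient_vec_tangent:
  assumes "u \<in> tangent_space B p" "p \<in> ST"
  shows "ambient_form \<epsilon> (snd p) (snd (ambient_vec B p u)) = 0"
proof -
  obtain c where c: "c \<in> B" "p \<in> fst c" using ex_chart[of p] assms(2) by auto
  let ?f = "\<lambda>x. snd (cinv c x)"
  have d: "(?f has_derivative (\<lambda>v. snd (fd (cinv c) (snd c p) v))) (at (snd c p))"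
    by (rule has_derivative_snd[OF has_fd[OF cinv_differentiable[OF c]]])
  have "((\<lambda>x. ambient_form \<epsilon> (?f x) (?f x)) has_derivative
      (\<lambda>v. ambient_form \<epsilon> (?f (snd c p)) (snd (fd (cinv c) (snd c p) v)) + ambient_form \<epsilon> (snd (fd (cinv c) (snd c p) v)) (?f (snd c p)))) (at (snd c p))"
    by (rule bounded_bilinear.FDERIV[OF bounded_bilinear_ambient_form d d])
  moreover have "((\<lambda>x. ambient_form \<epsilon> (?f x) (?f x)) has_derivative (\<lambda>v. 0)) (at (snd c p))"
  proof (rule has_derivative_transform_within_open[OF has_derivative_const[of \<epsilon>] chart_open[OF c(1)]])
    show "snd c p \<in> snd c ` fst c" using c by blast
    show "\<epsilon> = ambient_form \<epsilon> (?f x) (?f x)" if "x \<in> snd c ` fst c" for x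
      using chart_static[OF c(1)] cinv_in[OF that] by (auto simp: static_spacetime_def space_form_def)
  qed
  ultimately have "(\<lambda>v. ambient_form \<epsilon> (?f (snd c p)) (snd (fd (cinv c) (snd c p) v)) + ambient_form \<epsilon> (snd (fd (cinv c) (snd c p) v)) (?f (snd c p))) = (\<lambda>v. 0)"
    by (rule has_derivative_unique)
  from fun_cong[OF this, of "u c"] show ?thesis
    using ambient_vec_chart[OF assms(1) c] c by (simp add: cinv_chart ambient_form_commute[of _ _ "snd p"])
qed

text \<open>\<open>V\<close> is controlled on the space form only. Writing it near the point as
  \<open>V\<close> on the graph after the linear projection \<open>P\<close> transfers its
  regularity to the charts of \<open>B\<close>.\<close>

lemma potential_differentiable:
  assumes "c \<in> B" "p \<in> fst c"
  shows "(\<lambda>x. V (snd (cinv c x))) differentiable at (snd c p)"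
proof -
  have p: "snd p \<in> space_form \<epsilon>" using chart_static[OF assms(1)] assms(2) by (auto simp: static_spacetime_def)
  obtain W and \<psi> :: "real^3 \<Rightarrow> real^4" and P b where G: "open W" "smooth_on W \<psi>" "bounded_linear P"
    "\<And>y. y \<in> W \<Longrightarrow> \<psi> y \<in> space_form \<epsilon> \<and> P (\<psi> y) + b = y \<and> y $ 0 < 0"
    "openin (top_of_set (space_form \<epsilon>)) (\<psi> ` W)" "snd p \<in> \<psi> ` W" "\<And>y v. y \<in> W \<Longrightarrow> P (fd \<psi> y v) = v"
    by (rule space_form_graph[OF \<epsilon> p]) blast
  note gc = graph_chart[OF G(1-5,7)]
  have "smooth_on W (V \<circ> inv_into (\<psi> ` W) (\<lambda>x. P x + b))"
    using potential gc(1,3) unfolding static_potential_def by fastforce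
  then have VW: "smooth_on W (\<lambda>y. V (\<psi> y))"
    using smooth_on_cong[OF G(1), of "V \<circ> inv_into (\<psi> ` W) (\<lambda>x. P x + b)" "\<lambda>y. V (\<psi> y)"] gc(2) by simp
  obtain Q where Q: "open Q" "\<psi> ` W = space_form \<epsilon> \<inter> Q" using G(5) by (auto simp: openin_open)
  let ?O = "snd c ` fst c \<inter> (\<lambda>x. snd (cinv c x)) -` Q"
  have O': "open ?O" "snd c p \<in> ?O"
  proof -
    have "continuous_on (snd c ` fst c) (\<lambda>x. snd (cinv c x))"
      by (intro continuous_on_snd smooth_on_continuous[OF chart_smooth[OF assms(1)]])
    then show "open ?O" by (rule continuous_open_preimage[OF _ chart_open[OF assms(1)] Q(1)])
    show "snd c p \<in> ?O" using assms G(6) Q(2) by (auto simp: cinv_chart)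
  qed
  have inW: "snd (cinv c x) \<in> \<psi> ` W" if "x \<in> ?O" for x
    using that chart_static[OF assms(1)] cinv_in[of x c] Q(2) by (auto simp: static_spacetime_def)
  have eq: "V (\<psi> (P (snd (cinv c x)) + b)) = V (snd (cinv c x))" if "x \<in> ?O" for x
    using inW[OF that] G(4) by auto
  have "P (snd p) + b \<in> W" using G(4,6) by auto
  then have d1: "(\<lambda>y. V (\<psi> y)) differentiable at (P (snd (cinv c (snd c p))) + b)"
    using smooth_on_differentiable[OF VW G(1)] assms by (simp add: cinv_chart)
  have "((\<lambda>x. P (snd (cinv c x)) + b) has_derivative (\<lambda>v. P (snd (fd (cinv c) (snd c p) v)) + 0)) (at (snd c p))"
    by (intro has_derivative_add has_derivative_const bounded_linear.has_derivative[OF G(3)] has_derivative_snd has_fd cinv_differentiable assms)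
  then have d2: "(\<lambda>x. P (snd (cinv c x)) + b) differentiable at (snd c p)" by (rule differentiableI)
  have "(\<lambda>x. V (\<psi> (P (snd (cinv c x)) + b))) differentiable at (snd c p)"
    using differentiable_compose_at[OF d2 d1] .
  then show ?thesis
    using differentiable_cong_open[OF O', of "\<lambda>x. V (\<psi> (P (snd (cinv c x)) + b))" "\<lambda>x. V (snd (cinv c x))"] eq by blast
qed

lemma metric_field_static: "metric_field B (topspace (top_of_set ST)) (static_metric \<epsilon> V B)"
proof (rule metric_fieldI[where b = "\<lambda>c p y z. form p (fd (cinv c) (snd c p) y) (fd (cinv c) (snd c p) z)"])
  fix c p assume c: "c \<in> B" "p \<in> fst c"
  note lin = fd_linear[OF cinv_differentiable[OF c]]
  show "bilinear (\<lambda>y z. form p (fd (cinv c) (snd c p) y) (fd (cinv c) (snd c p) z))"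
    unfolding bilinear_def
    by (auto intro!: linearI simp: linear_add[OF lin] linear_scale[OF lin] bilinear_ladd[OF bilinear_form]
        bilinear_radd[OF bilinear_form] bilinear_lmul[OF bilinear_form] bilinear_rmul[OF bilinear_form])
  show "gram B (static_metric \<epsilon> V B) (cinv c) differentiable at (snd c p)"
  proof -
    let ?g = "\<lambda>x i. fd (cinv c) x (axis i 1)"
    have O': "open (snd c ` fst c)" "snd c p \<in> snd c ` fst c" using chart_open c by auto
    have dg: "(\<lambda>x. ?g x i) differentiable at (snd c p)" for i
      by (rule smooth_on_differentiable[OF smooth_on_fd[OF chart_smooth[OF c(1)] O'(1)] O'])
    have dfst: "(\<lambda>x. fst (?g x i)) differentiable at (snd c p)" and dsnd: "(\<lambda>x. snd (?g x i)) differentiable at (snd c p)" for i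
      using has_derivative_fst[OF has_fd[OF dg]] has_derivative_snd[OF has_fd[OF dg]] by (auto intro: differentiableI)
    have "(\<lambda>x. \<chi> i j. form (cinv c x) (?g x i) (?g x j)) differentiable at (snd c p)"
    proof (intro differentiable_vec_lambda)
      fix i j
      have "(\<lambda>x. ambient_form \<epsilon> (snd (?g x i)) (snd (?g x j))) differentiable at (snd c p)"
        using bounded_bilinear.FDERIV[OF bounded_bilinear_ambient_form has_fd[OF dsnd] has_fd[OF dsnd]] by (rule differentiableI)
      moreover have "(\<lambda>x. - (V (snd (cinv c x)))\<^sup>2 * fst (?g x i) * fst (?g x j)) differentiable at (snd c p)"
        by (intro differentiable_mult differentiable_minus differentiable_power potential_differentiable[OF c] dfst)
      ultimately show "(\<lambda>x. form (cinv c x) (?g x i) (?g x j)) differentiable at (snd c p)"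
        unfolding form_def by (intro differentiable_add)
    qed
    moreover have "gram B (static_metric \<epsilon> V B) (cinv c) x = (\<chi> i j. form (cinv c x) (?g x i) (?g x j))" if "x \<in> snd c ` fst c" for x
      using ambient_vec_push[OF cinv_smooth_into[OF c(1)] that] by (simp add: vec_eq_iff gram_entry static_metric_form)
    ultimately show ?thesis
      using differentiable_cong_open[OF O', of "gram B (static_metric \<epsilon> V B) (cinv c)"] by simp
  qed
qed (auto simp: static_metric_form ambient_vec_chart form_commute)

lemma ambient_vec_time_field:
  assumes "p \<in> ST" shows "ambient_vec B p (time_field B p) = (1, 0)"
proof -
  let ?f = "\<lambda>t. (fst p + t, snd p)"
  have d: "(?f has_derivative (\<lambda>t. (t, 0))) (at x)" for x
    by (auto intro!: derivative_eq_intros)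
  have "Ck_on k ?f UNIV" for k
  proof (cases k)
    case 0
    then show ?thesis by (auto intro!: continuous_intros)
  next
    case (Suc j)
    show ?thesis unfolding Suc by (rule Ck_on_SucI[OF open_UNIV d]) blast
  qed
  then have s: "smooth_into (top_of_set ST) B UNIV ?f"
    using assms by (intro smooth_into_static smooth_onI) (auto simp: static_spacetime_def)
  from ambient_vec_push[OF s, of 0 1] show ?thesis
    unfolding time_field_def fd_eqI[OF d] by simp
qed

section \<open>The time slice as a spacelike hypersurface\<close>

text \<open>The graph lies over the interior of the half-space, which lets the slice, a hypersurface
  without boundary, use the half-space parametrizations that \<open>is_mean_curvature\<close>
  expects.\<close>

lemma slice_param:
  assumes p: "p \<in> time_slice \<epsilon> V T\<^sub>0"
  obtains W and \<psi> :: "real^3 \<Rightarrow> real^4" and P b where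
    "local_param (top_of_set ST) B half_space (time_slice \<epsilon> V T\<^sub>0) W (\<lambda>y. (T\<^sub>0, \<psi> y))"
    "p \<in> (\<lambda>y. (T\<^sub>0, \<psi> y)) ` W" "W \<subseteq> half_space" "smooth_on W \<psi>" "bounded_linear P" "\<And>y. y \<in> W \<Longrightarrow> P (\<psi> y) + b = y"
    "\<And>y v. y \<in> W \<Longrightarrow> P (fd \<psi> y v) = v" "\<And>y v. y \<in> W \<Longrightarrow> ambient_form \<epsilon> (\<psi> y) (fd \<psi> y v) = 0"
    "\<And>y \<xi>. y \<in> W \<Longrightarrow> ambient_form \<epsilon> (\<psi> y) \<xi> = 0 \<Longrightarrow> fd \<psi> y (P \<xi>) = \<xi>"
    "\<And>y v. y \<in> W \<Longrightarrow> fd (\<lambda>y. (T\<^sub>0, \<psi> y)) y v = (0, fd \<psi> y v)"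
proof -
  have p': "fst p = T\<^sub>0" "snd p \<in> space_form \<epsilon>" "V (snd p) \<noteq> 0" using p by (auto simp: time_slice_def)
  obtain W and \<psi> :: "real^3 \<Rightarrow> real^4" and P b where G: "open W" "smooth_on W \<psi>" "bounded_linear P"
    "\<And>y. y \<in> W \<Longrightarrow> \<psi> y \<in> space_form \<epsilon> \<and> P (\<psi> y) + b = y \<and> y $ 0 < 0"
    "openin (top_of_set (space_form \<epsilon>)) (\<psi> ` W)" "snd p \<in> \<psi> ` W" "\<And>y v. y \<in> W \<Longrightarrow> P (fd \<psi> y v) = v"
    and G2: "\<And>y v. y \<in> W \<Longrightarrow> ambient_form \<epsilon> (\<psi> y) (fd \<psi> y v) = 0"
    "\<And>y \<xi>. y \<in> W \<Longrightarrow> ambient_form \<epsilon> (\<psi> y) \<xi> = 0 \<Longrightarrow> fd \<psi> y (P \<xi>) = \<xi>"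
    by (rule space_form_graph[OF \<epsilon> p'(2)]) blast
  note gc = graph_chart[OF G(1-5,7)]
  have "smooth_on W (V \<circ> inv_into (\<psi> ` W) (\<lambda>x. P x + b))"
    using potential gc(1,3) unfolding static_potential_def by fastforce
  then have VW: "smooth_on W (\<lambda>y. V (\<psi> y))"
    using smooth_on_cong[OF G(1), of "V \<circ> inv_into (\<psi> ` W) (\<lambda>x. P x + b)" "\<lambda>y. V (\<psi> y)"] gc(2) by simp
  \<comment> \<open>Points where \<open>V\<close> vanishes do not belong to the slice; continuity of
    \<open>V\<close> on the graph keeps the domain open.\<close>
  define W' where "W' = W \<inter> (\<lambda>y. V (\<psi> y)) -` (- {0})"
  have W': "open W'"
    unfolding W'_def by (rule continuous_open_preimage[OF smooth_on_continuous[OF VW] G(1)]) auto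
  have sub: "W' \<subseteq> W" by (auto simp: W'_def)
  have inW: "y \<in> W" if "y \<in> W'" for y using sub that by blast
  have s\<psi>: "smooth_on W' \<psi>" by (rule smooth_on_subset[OF G(2,1) W' sub])
  have half: "W' \<subseteq> half_space" using G(4) sub by (force simp: half_space_def)
  let ?t = "\<lambda>y. (T\<^sub>0, \<psi> y)"
  have d\<psi>: "\<psi> differentiable at y" if "y \<in> W'" for y using smooth_on_differentiable[OF s\<psi> W' that] .
  have dt: "fd ?t y v = (0, fd \<psi> y v)" if "y \<in> W'" for y v
    by (subst fd_eqI[OF has_derivative_Pair[OF has_derivative_const has_fd[OF d\<psi>[OF that]]]]) simp
  have eq: "?t = (\<lambda>y. (T\<^sub>0, 0) + (0, \<psi> y))" by auto
  have "smooth_on W' ?t"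
    unfolding eq
  proof (intro smooth_onI Ck_on_add Ck_on_const W')
    fix k
    have bl: "bounded_linear (\<lambda>x :: real^4. (0 :: real, x))"
      by (intro bounded_linear_Pair bounded_linear_zero bounded_linear_ident)
    show "Ck_on k (\<lambda>y. (0 :: real, \<psi> y)) W'"
      by (rule Ck_on_linear_comp[OF bl smooth_onD[OF s\<psi>] W'])
  qed
  then have st: "smooth_into (top_of_set ST) B W' ?t"
    using G(4) by (intro smooth_into_static W') (auto simp: W'_def static_spacetime_def)
  have inj: "inj (push B ?t y)" if "y \<in> W'" for y
  proof (rule injI)
    fix v w assume "push B ?t y v = push B ?t y w"
    then have "fd ?t y v = fd ?t y w" using ambient_vec_push[OF st that] by metis
    then have "fd \<psi> y v = fd \<psi> y w" using dt[OF that] by simp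
    then show "v = w" using G(7) that sub by (metis subsetD)
  qed
  have slice: "time_slice \<epsilon> V T\<^sub>0 \<subseteq> ST" by (auto simp: time_slice_def static_spacetime_def)
  obtain Q where Q: "open Q" "\<psi> ` W = space_form \<epsilon> \<inter> Q" using G(5) by (auto simp: openin_open)
  have img: "?t ` W' = time_slice \<epsilon> V T\<^sub>0 \<inter> (UNIV \<times> Q)"
  proof (intro equalityI subsetI)
    fix q assume "q \<in> ?t ` W'"
    then show "q \<in> time_slice \<epsilon> V T\<^sub>0 \<inter> (UNIV \<times> Q)"
      using Q(2) G(4) by (auto simp: W'_def time_slice_def)
  next
    fix q assume q: "q \<in> time_slice \<epsilon> V T\<^sub>0 \<inter> (UNIV \<times> Q)"
    then have "snd q \<in> \<psi> ` W" using Q(2) by (auto simp: time_slice_def)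
    then obtain y where y: "y \<in> W" "snd q = \<psi> y" by auto
    then have "q = ?t y" "y \<in> W'" using q by (auto simp: time_slice_def W'_def)
    then show "q \<in> ?t ` W'" by blast
  qed
  have H: "W' \<inter> half_space = W'" using half by blast
  have op: "openin (subtopology (top_of_set ST) (time_slice \<epsilon> V T\<^sub>0)) (?t ` (W' \<inter> half_space))"
  proof -
    have "subtopology (top_of_set ST) (time_slice \<epsilon> V T\<^sub>0) = top_of_set (time_slice \<epsilon> V T\<^sub>0)"
      using slice by (simp add: subtopology_subtopology Int_absorb1)
    then show ?thesis
      unfolding H img using openin_open_Int[OF open_Times[OF open_UNIV Q(1)]] by metis
  qed
  have hm: "homeomorphic_map (top_of_set (W' \<inter> half_space)) (subtopology (top_of_set ST) (?t ` (W' \<inter> half_space))) ?t"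
    unfolding H
  proof (rule homeomorphic_map_onI[OF smooth_intoD(2)[OF st]])
    have "continuous_on S (\<lambda>q. P (snd q) + b)" for S :: "(real \<times> (real^4)) set"
      by (intro continuous_intros bounded_linear.continuous_on[OF G(3)])
    then show "continuous_map (subtopology (top_of_set ST) (?t ` W')) (top_of_set W') (\<lambda>q. P (snd q) + b)"
      using G(4) inW by (auto simp: continuous_map_in_subtopology subtopology_subtopology)
    show "P (snd (?t y)) + b = y" if "y \<in> W'" for y using G(4)[OF inW[OF that]] by simp
  qed
  have lp: "local_param (top_of_set ST) B half_space (time_slice \<epsilon> V T\<^sub>0) W' ?t"
    unfolding local_param_def using st inj op hm by blast
  have "p \<in> ?t ` W'" unfolding img using p Q(2) G(6) by (auto simp: mem_Times_iff)
  note pW' = this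
  show ?thesis
  proof (rule that[OF lp pW' half s\<psi> G(3)])
    fix y assume y: "y \<in> W'"
    show "P (\<psi> y) + b = y" using G(4)[OF inW[OF y]] by blast
    show "P (fd \<psi> y v) = v" for v by (rule G(7)[OF inW[OF y]])
    show "ambient_form \<epsilon> (\<psi> y) (fd \<psi> y v) = 0" for v by (rule G2(1)[OF inW[OF y]])
    show "fd \<psi> y (P \<xi>) = \<xi>" if "ambient_form \<epsilon> (\<psi> y) \<xi> = 0" for \<xi> by (rule G2(2)[OF inW[OF y] that])
    show "fd (\<lambda>y. (T\<^sub>0, \<psi> y)) y v = (0, fd \<psi> y v)" for v by (rule dt[OF y])
  qed
qed

text \<open>A tangent vector may come from any parametrization. The derivative of the transition
  moves it to the graph, where the time component vanishes and the rest is tangent to the space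
  form.\<close>

lemma spacelike_slice: "spacelike (top_of_set ST) B (static_metric \<epsilon> V B) half_space (time_slice \<epsilon> V T\<^sub>0)"
  unfolding spacelike_def
proof (intro ballI impI)
  fix p Y assume p: "p \<in> time_slice \<epsilon> V T\<^sub>0" and Y: "Y \<in> tangent_sub (top_of_set ST) B half_space (time_slice \<epsilon> V T\<^sub>0) p" and nz: "Y \<noteq> (\<lambda>c. 0)"
  have pST: "p \<in> ST" using p by (auto simp: time_slice_def static_spacetime_def)
  obtain W' \<tau>' x' w where lp': "local_param (top_of_set ST) B half_space (time_slice \<epsilon> V T\<^sub>0) W' \<tau>'"
    and x': "x' \<in> W'" "x' \<in> half_space" "\<tau>' x' = p" "Y = push B \<tau>' x' w"
    using Y unfolding tangent_sub_def by blast
  obtain W and \<psi> :: "real^3 \<Rightarrow> real^4" and P b where S: "local_param (top_of_set ST) B half_space (time_slice \<epsilon> V T\<^sub>0) W (\<lambda>y. (T\<^sub>0, \<psi> y))"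
    "p \<in> (\<lambda>y. (T\<^sub>0, \<psi> y)) ` W" "W \<subseteq> half_space"
    "\<And>y v. y \<in> W \<Longrightarrow> ambient_form \<epsilon> (\<psi> y) (fd \<psi> y v) = 0"
    "\<And>y v. y \<in> W \<Longrightarrow> fd (\<lambda>y. (T\<^sub>0, \<psi> y)) y v = (0, fd \<psi> y v)"
    by (rule slice_param[OF p]) blast
  obtain x where x: "x \<in> W" "p = (T\<^sub>0, \<psi> x)" using S(2) by auto
  obtain L where L: "\<And>v. push B \<tau>' x' v = push B (\<lambda>y. (T\<^sub>0, \<psi> y)) x (L v)"
  proof (rule half_space_transition[OF S(1) x(1) _ lp' x'(1,2)])
    show "x \<in> half_space" using x(1) S(3) by blast
    show "(T\<^sub>0, \<psi> x) = \<tau>' x'" using x(2) x'(3) by simp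
  qed blast
  have st: "smooth_into (top_of_set ST) B W (\<lambda>y. (T\<^sub>0, \<psi> y))" using local_paramD(1)[OF S(1)] .
  have amb: "ambient_vec B p Y = (0, fd \<psi> x (L w))"
    using ambient_vec_push[OF st x(1), of "L w"] S(5)[OF x(1)] L x x' by simp
  have YT: "Y \<in> tangent_space B p"
    using push_tangent'[OF local_paramD(1)[OF lp'] x'(1)] x' by simp
  have "fd \<psi> x (L w) \<noteq> 0"
  proof
    assume "fd \<psi> x (L w) = 0"
    moreover have "ambient_vec B p (\<lambda>c. 0) = (0, 0)"
    proof -
      obtain c where c: "c \<in> B" "p \<in> fst c" using ex_chart[of p] pST by auto
      show ?thesis
        using ambient_vec_chart[OF tangent_zero c] linear_0[OF fd_linear[OF cinv_differentiable[OF c]]] by (simp add: zero_prod_def)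
    qed
    ultimately show False using ambient_vec_inj[OF YT tangent_zero pST] amb nz by simp
  qed
  then have "ambient_form \<epsilon> (fd \<psi> x (L w)) (fd \<psi> x (L w)) > 0"
    using ambient_form_tangent_pos[OF \<epsilon>, of "\<psi> x"] S(4)[OF x(1)] p x(2) by (auto simp: time_slice_def space_form_def)
  then show "static_metric \<epsilon> V B p Y Y > 0"
    by (simp add: static_metric_form amb form_def)
qed

end

section \<open>Reference embeddings\<close>

lemma (in static) smooth_into_smooth_on:
  fixes f :: "'e::real_normed_vector \<Rightarrow> real \<times> (real^4)"
  assumes f: "smooth_into (top_of_set ST) B O' f"
  shows "smooth_on O' f"
proof (rule smooth_on_local[OF smooth_intoD(1)[OF f]])
  fix y assume y: "y \<in> O'"
  obtain c where c: "c \<in> B" "f y \<in> fst c" using ex_chart[of "f y"] smooth_intoD(5)[OF f y] by auto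
  let ?T = "O' \<inter> f -` fst c"
  have T: "open ?T" by (rule smooth_intoD(4)[OF f c(1)])
  have "smooth_on ?T (\<lambda>z. cinv c (snd c (f z)))"
    by (rule smooth_on_compose[OF chart_smooth[OF c(1)] smooth_intoD(3)[OF f c(1)] T chart_open[OF c(1)]]) auto
  then have "smooth_on ?T f"
    using smooth_on_cong[OF T, of "\<lambda>z. cinv c (snd c (f z))" f] c by (auto simp: cinv_chart)
  then show "\<exists>T. open T \<and> y \<in> T \<and> smooth_on (O' \<inter> T) f"
    using T y c by (intro exI[of _ ?T]) (auto simp: Int_absorb1)
qed

text \<open>The data along \<open>S\<close> for the pointwise computation, detached from the domain
  \<Omega>. The regularity \<open>\<nu>_diff\<close> and the orthogonality \<open>\<nu>_orth\<close>
  are consequences of \<nu> being the outward unit normal, and \<open>inv_g\<close> of the Lorentz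
  signature; they are supplied at the interpretation.\<close>

locale reference = M: atlas X A + static \<epsilon> V B
  for X :: "'m topology" and A :: "('m, 4) chart set" and \<epsilon> V B +
  fixes g :: "('m, 4) metric" and U S :: "'m set" and \<phi> :: "'m \<Rightarrow> real \<times> (real^4)" and N \<nu> :: "'m \<Rightarrow> ('m, 4) tvec" and T\<^sub>0 :: real
  assumes mf: "metric_field A (topspace X) g"
    and inv_g: "\<And>c p. c \<in> A \<Longrightarrow> p \<in> fst c \<Longrightarrow> invertible (gram A g (cinv c) (snd c p))"
    and emb: "smooth_embedding X A U (top_of_set ST) B \<phi>"
    and SU: "S \<subseteq> U"
    and iso: "\<And>p Y Z. p \<in> S \<Longrightarrow> Y \<in> tangent_space A p \<Longrightarrow> Z \<in> tangent_space A p \<Longrightarrow>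
      pullback_metric A B \<phi> (static_metric \<epsilon> V B) p Y Z = g p Y Z"
    and \<nu>_tangent: "\<And>p. p \<in> S \<Longrightarrow> \<nu> p \<in> tangent_space A p"
    and \<nu>_unit: "\<And>p. p \<in> S \<Longrightarrow> g p (\<nu> p) (\<nu> p) = 1"
    and \<nu>_orth: "\<And>W (\<sigma> :: real^2 \<Rightarrow> 'm) u v. local_param X A UNIV S W \<sigma> \<Longrightarrow> u \<in> W \<Longrightarrow> g (\<sigma> u) (\<nu> (\<sigma> u)) (push A \<sigma> u v) = 0"
    and \<nu>_diff: "\<And>W (\<sigma> :: real^2 \<Rightarrow> 'm) u c. local_param X A UNIV S W \<sigma> \<Longrightarrow> u \<in> W \<Longrightarrow> c \<in> A \<Longrightarrow> \<sigma> u \<in> fst c \<Longrightarrow>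
      (\<lambda>y. \<nu> (\<sigma> y) c) differentiable at u"
    and N_tangent: "\<And>p. p \<in> S \<Longrightarrow> N p \<in> tangent_space A p"
    and \<nu>_N: "\<And>p. p \<in> S \<Longrightarrow> g p (\<nu> p) (N p) = 0"
    and N_time: "\<And>p. p \<in> S \<Longrightarrow> differential A B \<phi> p (N p) = time_field B (\<phi> p)"
    and slice: "\<phi> ` S \<subseteq> time_slice \<epsilon> V T\<^sub>0"
begin

abbreviation "h \<equiv> static_metric \<epsilon> V B"
abbreviation "g' \<equiv> pullback_metric A B \<phi> h"

lemma U_open: "openin X U"
  and \<phi>_smooth: "c \<in> A \<Longrightarrow> smooth_into (top_of_set ST) B (snd c ` (fst c \<inter> U)) (\<lambda>x. \<phi> (cinv c x))"
  and \<phi>_inj: "p \<in> U \<Longrightarrow> inj_on (differential A B \<phi> p) (tangent_space A p)"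
  and \<phi>_homeo: "homeomorphic_map (subtopology X U) (subtopology (top_of_set ST) (\<phi> ` U)) \<phi>"
  using emb by (auto simp: smooth_embedding_def o_def)

lemma U_subset: "U \<subseteq> topspace X" using U_open openin_subset by blast

lemma \<phi>_cont: "continuous_map (subtopology X U) (top_of_set ST) \<phi>"
  using homeomorphic_imp_continuous_map[OF \<phi>_homeo] by (simp add: continuous_map_in_subtopology)

lemma \<phi>_inj_on: "inj_on \<phi> U"
  using homeomorphic_imp_injective_map[OF \<phi>_homeo] U_subset by (simp add: Int_absorb1)

lemma \<phi>_ST: "p \<in> U \<Longrightarrow> \<phi> p \<in> ST"
  using continuous_map_image_subset_topspace[OF \<phi>_cont] U_subset by auto

lemma differential_chart:
  assumes v: "v \<in> tangent_space A p" and c: "c \<in> A" "p \<in> fst c" "p \<in> U"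
  shows "differential A B \<phi> p v = push B (\<lambda>x. \<phi> (cinv c x)) (snd c p) (v c)"
proof -
  define d where "d = chart_at A p"
  have d: "d \<in> A" "p \<in> fst d" using M.chart_at[of p] c(3) U_subset by (auto simp: d_def)
  let ?O = "snd d ` (fst d \<inter> (fst c \<inter> U))"
  have O: "open ?O" "snd d p \<in> ?O"
    using M.chart_image_open[OF d(1) openin_Int[OF M.chart_openin[OF c(1)] U_open]] d c by auto
  have "push B (\<lambda>x. \<phi> (cinv d x)) (snd d p) (v d) = push B (\<lambda>x. \<phi> (cinv c x)) (snd c (cinv d (snd d p))) (fd (\<lambda>x. snd c (cinv d x)) (snd d p) (v d))"
    by (rule push_compose[OF \<phi>_smooth[OF c(1)] O]) (use d c M.transition_differentiable[OF d(1) c(1)] in \<open>auto simp: M.cinv_chart\<close>)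
  also have "\<dots> = push B (\<lambda>x. \<phi> (cinv c x)) (snd c p) (v c)"
    using M.tangent_space_component[OF v d(1) c(1) d(2) c(2)] d by (simp add: M.cinv_chart)
  finally show ?thesis by (simp add: differential_def Let_def d_def o_def)
qed

lemma differential_tangent:
  assumes "v \<in> tangent_space A p" "p \<in> U"
  shows "differential A B \<phi> p v \<in> tangent_space B (\<phi> p)"
proof -
  obtain c where c: "c \<in> A" "p \<in> fst c" using M.ex_chart assms(2) U_subset by blast
  have "snd c p \<in> snd c ` (fst c \<inter> U)" using c assms(2) by blast
  from push_tangent'[OF \<phi>_smooth[OF c(1)] this] show ?thesis
    unfolding differential_chart[OF assms(1) c assms(2)] using c by (simp add: M.cinv_chart)
qed

lemma smooth_into_\<phi>:
  fixes \<sigma> :: "'e::euclidean_space \<Rightarrow> 'm"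
  assumes \<sigma>: "smooth_into X A W \<sigma>" "\<sigma> ` W \<subseteq> U"
  shows "smooth_into (top_of_set ST) B W (\<lambda>y. \<phi> (\<sigma> y))"
    "y \<in> W \<Longrightarrow> push B (\<lambda>y. \<phi> (\<sigma> y)) y v = differential A B \<phi> (\<sigma> y) (push A \<sigma> y v)"
proof -
  have loc: "\<exists>T c. open T \<and> y \<in> T \<and> T \<subseteq> W \<and> c \<in> A \<and> \<sigma> ` T \<subseteq> fst c" if y: "y \<in> W" for y
  proof -
    obtain c where c: "c \<in> A" "\<sigma> y \<in> fst c" using M.ex_chart M.smooth_intoD(5)[OF \<sigma>(1) y] by blast
    then show ?thesis using M.smooth_intoD(4)[OF \<sigma>(1) c(1)] y by (intro exI[of _ "W \<inter> \<sigma> -` fst c"] exI[of _ c]) auto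
  qed
  have "smooth_on W (\<lambda>y. \<phi> (\<sigma> y))"
  proof (rule smooth_on_local[OF M.smooth_intoD(1)[OF \<sigma>(1)]])
    fix y assume "y \<in> W"
    then obtain T c where T: "open T" "y \<in> T" "T \<subseteq> W" and c: "c \<in> A" "\<sigma> ` T \<subseteq> fst c" using loc by blast
    have o: "open (W \<inter> \<sigma> -` fst c)" by (rule M.smooth_intoD(4)[OF \<sigma>(1) c(1)])
    have sub: "T \<subseteq> W \<inter> \<sigma> -` fst c" using T(3) c(2) by auto
    have "smooth_on T (\<lambda>y. snd c (\<sigma> y))"
      by (rule smooth_on_subset[OF M.smooth_intoD(3)[OF \<sigma>(1) c(1)] o T(1) sub])
    moreover have "(\<lambda>y. snd c (\<sigma> y)) ` T \<subseteq> snd c ` (fst c \<inter> U)"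
      using T(3) c(2) \<sigma>(2) by blast
    ultimately have "smooth_on T (\<lambda>y. \<phi> (cinv c (snd c (\<sigma> y))))"
      by (intro smooth_on_compose[OF smooth_into_smooth_on[OF \<phi>_smooth[OF c(1)]] _ T(1) smooth_intoD(1)[OF \<phi>_smooth[OF c(1)]]])
    moreover have "\<phi> (cinv c (snd c (\<sigma> y))) = \<phi> (\<sigma> y)" if "y \<in> T" for y
      using that c M.cinv_chart[OF c(1)] by auto
    ultimately have "smooth_on T (\<lambda>y. \<phi> (\<sigma> y))"
      using smooth_on_cong[OF T(1), of "\<lambda>y. \<phi> (cinv c (snd c (\<sigma> y)))" "\<lambda>y. \<phi> (\<sigma> y)"] by blast
    then show "\<exists>T. open T \<and> y \<in> T \<and> smooth_on (W \<inter> T) (\<lambda>y. \<phi> (\<sigma> y))"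
      using T by (intro exI[of _ T]) (auto simp: Int_absorb1)
  qed
  then show "smooth_into (top_of_set ST) B W (\<lambda>y. \<phi> (\<sigma> y))"
    using \<sigma>(2) \<phi>_ST by (intro smooth_into_static M.smooth_intoD(1)[OF \<sigma>(1)]) auto
  assume y: "y \<in> W"
  then obtain T c where T: "open T" "y \<in> T" "T \<subseteq> W" and c: "c \<in> A" "\<sigma> ` T \<subseteq> fst c" using loc by blast
  have yc: "\<sigma> y \<in> fst c" "\<sigma> y \<in> U" using T c \<sigma>(2) by auto
  have "push B (\<lambda>y. \<phi> (\<sigma> y)) y v = push B (\<lambda>x. \<phi> (cinv c x)) (snd c (\<sigma> y)) (fd (\<lambda>y. snd c (\<sigma> y)) y v)"
  proof (rule push_compose[OF \<phi>_smooth[OF c(1)] T(1,2)])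
    show "snd c (\<sigma> z) \<in> snd c ` (fst c \<inter> U)" "\<phi> (cinv c (snd c (\<sigma> z))) = \<phi> (\<sigma> z)" if "z \<in> T" for z
    proof -
      have "\<sigma> z \<in> fst c \<inter> U" using that T(3) c(2) \<sigma>(2) by blast
      then show "snd c (\<sigma> z) \<in> snd c ` (fst c \<inter> U)" "\<phi> (cinv c (snd c (\<sigma> z))) = \<phi> (\<sigma> z)"
        using M.cinv_chart[OF c(1)] by simp_all
    qed
    show "(\<lambda>y. snd c (\<sigma> y)) differentiable at y"
      by (rule M.smooth_into_differentiable[OF \<sigma>(1) y c(1) yc(1)])
  qed
  also have "\<dots> = differential A B \<phi> (\<sigma> y) (push A \<sigma> y v)"
    using differential_chart[OF M.push_tangent'[OF \<sigma>(1) y] c(1) yc] c(1) yc by (simp add: M.push_component)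
  finally show "push B (\<lambda>y. \<phi> (\<sigma> y)) y v = differential A B \<phi> (\<sigma> y) (push A \<sigma> y v)" .
qed

text \<open>The homeomorphism \<open>\<phi>\<close> restricts to \<open>S\<close> and to the image
  of \<open>\<sigma>\<close>, and its differential is injective on tangent spaces.\<close>

lemma local_param_\<phi>:
  fixes \<sigma> :: "real^2 \<Rightarrow> 'm"
  assumes lp: "local_param X A UNIV S W \<sigma>"
  shows "local_param (top_of_set ST) B UNIV (\<phi> ` S) W (\<lambda>y. \<phi> (\<sigma> y))"
proof -
  have \<sigma>S: "\<sigma> ` W \<subseteq> S" using M.local_paramD(6)[OF lp] by simp
  have \<sigma>U: "\<sigma> ` W \<subseteq> U" using \<sigma>S SU by blast
  note s = smooth_into_\<phi>[OF M.local_paramD(1)[OF lp] \<sigma>U]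
  have "inj (push B (\<lambda>y. \<phi> (\<sigma> y)) y)" if y: "y \<in> W" for y
  proof (rule injI)
    fix v w assume "push B (\<lambda>y. \<phi> (\<sigma> y)) y v = push B (\<lambda>y. \<phi> (\<sigma> y)) y w"
    then have "differential A B \<phi> (\<sigma> y) (push A \<sigma> y v) = differential A B \<phi> (\<sigma> y) (push A \<sigma> y w)"
      using s(2)[OF y] by metis
    moreover have "\<sigma> y \<in> U" using \<sigma>U y by blast
    ultimately have "push A \<sigma> y v = push A \<sigma> y w"
      using inj_onD[OF \<phi>_inj] M.push_tangent'[OF M.local_paramD(1)[OF lp] y] by blast
    then show "v = w" using M.local_paramD(3)[OF lp y] by (simp add: inj_eq)
  qed
  moreover have hs: "homeomorphic_map (subtopology X P) (subtopology (top_of_set ST) (\<phi> ` P)) \<phi>" if "P \<subseteq> U" for P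
  proof -
    have "topspace X \<inter> U \<inter> P = P" "ST \<inter> \<phi> ` U \<inter> \<phi> ` P = \<phi> ` P"
      using that U_subset \<phi>_ST by blast+
    then have "homeomorphic_map (subtopology (subtopology X U) P) (subtopology (subtopology (top_of_set ST) (\<phi> ` U)) (\<phi> ` P)) \<phi>"
      by (intro homeomorphic_map_subtopologies[OF \<phi>_homeo]) simp
    moreover have "U \<inter> P = P" "\<phi> ` U \<inter> \<phi> ` P = \<phi> ` P" using that by blast+
    ultimately show ?thesis by (simp only: subtopology_subtopology Int_assoc)
  qed
  have "openin (subtopology (top_of_set ST) (\<phi> ` S)) (\<phi> ` \<sigma> ` W)"
    using homeomorphic_map_openness_eq[OF hs[OF SU], of "\<sigma> ` W"] M.local_paramD(4)[OF lp] by simp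
  moreover have "homeomorphic_map (top_of_set W) (subtopology (top_of_set ST) (\<phi> ` \<sigma> ` W)) (\<phi> \<circ> \<sigma>)"
    using homeomorphic_map_compose[OF _ hs[OF \<sigma>U]] M.local_paramD(5)[OF lp] by simp
  ultimately show ?thesis
    unfolding local_param_def using s(1) by (simp add: image_image o_def)
qed

lemma gram_pullback:
  assumes c: "c \<in> A" and x: "x \<in> snd c ` (fst c \<inter> U)"
  shows "gram A g' (cinv c) x = gram B h (\<lambda>x. \<phi> (cinv c x)) x"
proof -
  have x': "x \<in> snd c ` fst c" "cinv c x \<in> fst c" "cinv c x \<in> U" "snd c (cinv c x) = x"
    using x c by (auto simp: M.cinv_chart)
  have "differential A B \<phi> (cinv c x) (push A (cinv c) x v) = push B (\<lambda>x. \<phi> (cinv c x)) x v" for v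
    using differential_chart[OF M.lift_tangent[OF c x'(2)] c x'(2,3), of v] M.lift_component[OF c x'(2)] x'(4)
    by (simp add: M.lift_def)
  then show ?thesis
    by (simp add: vec_eq_iff gram_entry pullback_metric_def)
qed

text \<open>The equality holds at points of \<open>S\<close> only, so it may be differentiated along
  \<open>S\<close> but not across it.\<close>

lemma gram_pullback_surface:
  assumes c: "c \<in> A" "p \<in> fst c" and p: "p \<in> S"
  shows "gram A g' (cinv c) (snd c p) = gram A g (cinv c) (snd c p)"
  using iso[OF p M.lift_tangent[OF c] M.lift_tangent[OF c]] c by (simp add: vec_eq_iff gram_entry M.cinv_chart M.lift_def)

section \<open>Normal and mean curvature of the image surface\<close>

text \<open>A field on the image of \<open>S\<close>, spelled exactly as in the statement of the
  theorem.\<close>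

definition normal :: "real \<times> (real^4) \<Rightarrow> (real \<times> (real^4), 4) tvec" where
  "normal q = (let p' = inv_into S \<phi> q in differential A B \<phi> p' (\<nu> p'))"

lemma normal_\<phi>: "p \<in> S \<Longrightarrow> normal (\<phi> p) = differential A B \<phi> p (\<nu> p)"
  using inv_into_f_f[OF inj_on_subset[OF \<phi>_inj_on SU]] by (simp add: normal_def Let_def)

lemma normal_tangent: "p \<in> S \<Longrightarrow> normal (\<phi> p) \<in> tangent_space B (\<phi> p)"
  using normal_\<phi> differential_tangent[OF \<nu>_tangent] SU by auto

text \<open>\<nu> is orthogonal to \<open>N\<close>, whose image is the Killing field, and
  \<open>V\<close> does not vanish on the slice, so the time component is zero. This makes the image
  of \<nu> tangent to the slice.\<close>

lemma normal_ambient: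
  assumes p: "p \<in> S" shows "fst (ambient_vec B (\<phi> p) (normal (\<phi> p))) = 0"
proof -
  have "h (\<phi> p) (normal (\<phi> p)) (time_field B (\<phi> p)) = 0"
    using iso[OF p \<nu>_tangent[OF p] N_tangent[OF p]] \<nu>_N[OF p] N_time[OF p] normal_\<phi>[OF p] by (simp add: pullback_metric_def)
  moreover have "\<phi> p \<in> ST" "V (snd (\<phi> p)) \<noteq> 0"
    using slice p by (auto simp: time_slice_def static_spacetime_def)
  ultimately show ?thesis
    by (simp add: static_metric_form ambient_vec_time_field form_def ambient_form_simps)
qed

text \<open>Presents \<open>\<phi>\<close> in charts as an immersion \<open>F\<close> that pulls the
  static metric back, the form in which the Gauss formula can be applied.\<close>

lemma reference_chart:
  assumes c: "c \<in> A" and d: "d \<in> B"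
  defines "F \<equiv> \<lambda>x. snd d (\<phi> (cinv c x))" and "D \<equiv> snd c ` (fst c \<inter> U) \<inter> (\<lambda>x. \<phi> (cinv c x)) -` fst d"
  shows "open D" "smooth_on D F"
    "p \<in> fst c \<Longrightarrow> p \<in> U \<Longrightarrow> \<phi> p \<in> fst d \<Longrightarrow> snd c p \<in> D \<and> F (snd c p) = snd d (\<phi> p)"
    "p \<in> fst c \<Longrightarrow> p \<in> U \<Longrightarrow> \<phi> p \<in> fst d \<Longrightarrow> v \<in> tangent_space A p \<Longrightarrow> differential A B \<phi> p v d = fd F (snd c p) (v c)"
    "x \<in> D \<Longrightarrow> ip (gram A g' (cinv c) x) a b = ip (gram B h (cinv d) (F x)) (fd F x a) (fd F x b)"
    "x \<in> D \<Longrightarrow> inj (fd F x)"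
proof -
  note s = \<phi>_smooth[OF c]
  show D: "open D" "smooth_on D F" using smooth_intoD(3,4)[OF s d] by (simp_all add: D_def F_def)
  show 1: "snd c p \<in> D \<and> F (snd c p) = snd d (\<phi> p)" if "p \<in> fst c" "p \<in> U" "\<phi> p \<in> fst d" for p
    using that c by (auto simp: D_def F_def M.cinv_chart)
  show 2: "differential A B \<phi> p v d = fd F (snd c p) (v c)"
    if "p \<in> fst c" "p \<in> U" "\<phi> p \<in> fst d" "v \<in> tangent_space A p" for p v
    unfolding differential_chart[OF that(4) c that(1,2)]
    using push_component[OF d, of "\<lambda>x. \<phi> (cinv c x)" "snd c p"] that c by (simp add: M.cinv_chart F_def)
  show "ip (gram A g' (cinv c) x) a b = ip (gram B h (cinv d) (F x)) (fd F x a) (fd F x b)" if x: "x \<in> D"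
  proof -
    have x': "x \<in> snd c ` (fst c \<inter> U)" "\<phi> (cinv c x) \<in> fst d" using x by (auto simp: D_def)
    show ?thesis
      unfolding gram_pullback[OF c x'(1)]
      using metric_field_gram(2)[OF metric_field_static s x'(1) smooth_intoD(5)[OF s x'(1)] d x'(2)] by (simp add: F_def[abs_def])
  qed
  show "inj (fd F x)" if x: "x \<in> D"
  proof (rule injI)
    fix v w assume vw: "fd F x v = fd F x w"
    define p where "p = cinv c x"
    have p: "p \<in> fst c" "p \<in> U" "\<phi> p \<in> fst d" "snd c p = x" using x c by (auto simp: D_def p_def M.cinv_chart)
    have t: "M.lift c p v \<in> tangent_space A p" for v by (rule M.lift_tangent[OF c p(1)])
    have "differential A B \<phi> p (M.lift c p v) d = differential A B \<phi> p (M.lift c p w) d"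
      using 2[OF p(1-3) t] vw p(4) M.lift_component[OF c p(1)] by simp
    then have "differential A B \<phi> p (M.lift c p v) = differential A B \<phi> p (M.lift c p w)"
      by (rule tangent_eqI[OF differential_tangent[OF t p(2)] differential_tangent[OF t p(2)] d p(3)])
    then have "M.lift c p v = M.lift c p w" using inj_onD[OF \<phi>_inj[OF p(2)]] t by blast
    then show "v = w" using M.lift_component[OF c p(1)] by metis
  qed
qed

lemma normal_along:
  fixes \<sigma> :: "real^2 \<Rightarrow> 'm"
  assumes lp: "local_param X A UNIV S W \<sigma>" "u \<in> W" and d: "d \<in> B" "\<phi> (\<sigma> u) \<in> fst d"
  shows "(\<lambda>y. normal (\<phi> (\<sigma> y)) d) differentiable at u"
proof -
  have \<sigma>S: "\<sigma> y \<in> S" if "y \<in> W" for y using M.local_paramD(6)[OF lp(1)] that by auto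
  have uU: "\<sigma> u \<in> U" using \<sigma>S[OF lp(2)] SU by blast
  obtain c where c: "c \<in> A" "\<sigma> u \<in> fst c" using M.ex_chart M.local_paramD(8)[OF lp] by blast
  note R = reference_chart[OF c(1) d(1)]
  let ?F = "\<lambda>x. snd d (\<phi> (cinv c x))"
  let ?T = "(W \<inter> \<sigma> -` fst c) \<inter> (W \<inter> (\<lambda>y. \<phi> (\<sigma> y)) -` fst d)"
  have T: "open ?T" "u \<in> ?T"
    using M.smooth_intoD(4)[OF M.local_paramD(1)[OF lp(1)] c(1)] smooth_intoD(4)[OF local_paramD(1)[OF local_param_\<phi>[OF lp(1)]] d(1)] lp c d
    by auto
  have uD: "snd c (\<sigma> u) \<in> snd c ` (fst c \<inter> U) \<inter> (\<lambda>x. \<phi> (cinv c x)) -` fst d"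
    using R(3)[OF c(2) uU d(2)] by blast
  note D = fd_along[where s = "\<lambda>y. snd c (\<sigma> y)" and u = u and m = "\<lambda>y. \<nu> (\<sigma> y) c", OF R(1,2) uD
      M.smooth_into_differentiable[OF M.local_paramD(1)[OF lp(1)] lp(2) c] \<nu>_diff[OF lp c]]
  have "normal (\<phi> (\<sigma> y)) d = fd ?F (snd c (\<sigma> y)) (\<nu> (\<sigma> y) c)" if "y \<in> ?T" for y
    using R(4)[OF _ _ _ \<nu>_tangent[OF \<sigma>S]] normal_\<phi>[OF \<sigma>S] that \<sigma>S SU by auto
  then show ?thesis
    using has_derivative_transform_within_open[OF D T] differentiableI by (metis (no_types, lifting))
qed

text \<open>The coordinates \<open>s\<close> and \<open>m\<close> of surface and normal in the slice
  are images of their ambient counterparts under \<open>P\<close>, an affine and a linear one, so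
  they inherit regularity directly.\<close>

lemma ex_mean_curvature_slice:
  fixes \<sigma> :: "real^2 \<Rightarrow> 'm"
  assumes lp: "local_param X A UNIV S W \<sigma>" "u \<in> W"
  shows "\<exists>k. is_mean_curvature (top_of_set ST) B h (time_slice \<epsilon> V T\<^sub>0) (\<phi> ` S) normal (\<phi> (\<sigma> u)) k"
proof -
  have \<sigma>S: "\<sigma> y \<in> S" if "y \<in> W" for y using M.local_paramD(6)[OF lp(1)] that by auto
  have sl: "\<phi> (\<sigma> y) \<in> time_slice \<epsilon> V T\<^sub>0" if "y \<in> W" for y using slice \<sigma>S[OF that] by blast
  have slST: "\<phi> (\<sigma> y) \<in> ST" if "y \<in> W" for y using sl[OF that] by (auto simp: time_slice_def static_spacetime_def)
  obtain W1 and \<psi> :: "real^3 \<Rightarrow> real^4" and P b where \<tau>: "local_param (top_of_set ST) B half_space (time_slice \<epsilon> V T\<^sub>0) W1 (\<lambda>y. (T\<^sub>0, \<psi> y))"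
    "\<phi> (\<sigma> u) \<in> (\<lambda>y. (T\<^sub>0, \<psi> y)) ` W1" "W1 \<subseteq> half_space" "bounded_linear P" "\<And>y. y \<in> W1 \<Longrightarrow> P (\<psi> y) + b = y"
    and \<psi>: "\<And>y \<xi>. y \<in> W1 \<Longrightarrow> ambient_form \<epsilon> (\<psi> y) \<xi> = 0 \<Longrightarrow> fd \<psi> y (P \<xi>) = \<xi>"
    "\<And>y v. y \<in> W1 \<Longrightarrow> fd (\<lambda>y. (T\<^sub>0, \<psi> y)) y v = (0, fd \<psi> y v)"
    by (rule slice_param[OF sl[OF lp(2)]]) blast
  let ?t = "\<lambda>y. (T\<^sub>0, \<psi> y)"
  let ?f = "\<lambda>y. \<phi> (\<sigma> y)"
  note lpf = local_param_\<phi>[OF lp(1)]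
  have cont: "continuous_map (top_of_set W) (subtopology (top_of_set ST) (time_slice \<epsilon> V T\<^sub>0)) ?f"
    using smooth_intoD(2)[OF local_paramD(1)[OF lpf]] sl by (auto simp: continuous_map_in_subtopology)
  define T where "T = W \<inter> ?f -` (?t ` (W1 \<inter> half_space))"
  have T: "open T" "T \<subseteq> W" "u \<in> T"
  proof -
    have "openin (top_of_set W) T" unfolding T_def by (rule local_param_lift(1)[OF \<tau>(1) cont])
    then show "open T" using M.local_paramD(2)[OF lp(1)] openin_open_eq by blast
    show "T \<subseteq> W" by (auto simp: T_def)
    have "W1 \<inter> half_space = W1" using \<tau>(3) by blast
    then show "u \<in> T" using \<tau>(2) lp(2) by (simp add: T_def)
  qed
  have lpT: "local_param (top_of_set ST) B UNIV (\<phi> ` S) T ?f" by (rule local_param_restrict[OF lpf T(1,2)])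
  define s where "s y = P (snd (?f y)) + b" for y
  define m where "m y = P (snd (ambient_vec B (?f y) (normal (?f y))))" for y
  have sT: "s y \<in> W1" "?t (s y) = ?f y" if "y \<in> T" for y
  proof -
    obtain x where x: "x \<in> W1" "?f y = ?t x" using \<open>y \<in> T\<close> by (auto simp: T_def)
    then have "s y = x" using \<tau>(5)[OF x(1)] by (simp add: s_def)
    then show "s y \<in> W1" "?t (s y) = ?f y" using x by auto
  qed
  show ?thesis
  proof (rule ex_mean_curvature[OF metric_field_static spacelike_slice \<tau>(1) lpT T(3), where s = s and m = m])
    have "smooth_on T ?f" by (rule smooth_into_smooth_on[OF local_paramD(1)[OF lpT]])
    then show "smooth_on T s"
      unfolding s_def[abs_def]
      by (intro smooth_onI Ck_on_add Ck_on_const T(1) Ck_on_linear_comp[OF \<tau>(4)] Ck_on_linear_comp[OF bounded_linear_snd]) (rule smooth_onD)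
    show "m differentiable at y" if y: "y \<in> T" for y
    proof -
      have yW: "y \<in> W" using y T(2) by blast
      obtain d where d: "d \<in> B" "?f y \<in> fst d" using ex_chart[of "?f y"] slST[OF yW] by auto
      let ?O = "T \<inter> ?f -` fst d"
      have O: "open ?O" "y \<in> ?O" using smooth_intoD(4)[OF local_paramD(1)[OF lpT] d(1)] y d(2) by auto
      have yd: "snd d (?f y) \<in> snd d ` fst d" using d(2) by blast
      note D = fd_along[where s = "\<lambda>y. snd d (?f y)" and u = y and m = "\<lambda>y. normal (?f y) d", OF chart_open[OF d(1)] chart_smooth[OF d(1)] yd
          smooth_into_differentiable[OF local_paramD(1)[OF lpT] y d] normal_along[OF lp(1) yW d]]
      have "fd (cinv d) (snd d (?f z)) (normal (?f z) d) = ambient_vec B (?f z) (normal (?f z))" if "z \<in> ?O" for z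
        using ambient_vec_chart[OF normal_tangent[OF \<sigma>S] d(1), of z] that T(2) by auto
      then have "(\<lambda>z. ambient_vec B (?f z) (normal (?f z))) differentiable at y"
        using has_derivative_transform_within_open[OF D O] differentiableI by (metis (no_types, lifting))
      from bounded_linear.has_derivative[OF \<tau>(4) has_derivative_snd[OF has_fd[OF this]]]
      show ?thesis unfolding m_def[abs_def] by (rule differentiableI)
    qed
    show "s y \<in> W1 \<inter> half_space \<and> ?t (s y) = ?f y \<and> push B ?t (s y) (m y) = normal (?f y)" if y: "y \<in> T" for y
    proof -
      have yW: "y \<in> W" using y T(2) by blast
      note nt = normal_tangent[OF \<sigma>S[OF yW]]
      have \<tau>s: "smooth_into (top_of_set ST) B W1 ?t" by (rule local_paramD(1)[OF \<tau>(1)])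
      define \<xi> where "\<xi> = snd (ambient_vec B (?f y) (normal (?f y)))"
      have a: "ambient_vec B (?f y) (normal (?f y)) = (0, \<xi>)"
        using normal_ambient[OF \<sigma>S[OF yW]] by (simp add: \<xi>_def prod_eq_iff)
      have "snd (?f y) = \<psi> (s y)" using sT(2)[OF y] by (metis snd_conv)
      then have "ambient_form \<epsilon> (\<psi> (s y)) \<xi> = 0"
        using ambient_vec_tangent[OF nt slST[OF yW]] by (simp add: \<xi>_def)
      then have "fd \<psi> (s y) (m y) = \<xi>" using \<psi>(1)[OF sT(1)[OF y]] by (simp add: m_def \<xi>_def)
      then have "ambient_vec B (?f y) (push B ?t (s y) (m y)) = (0, \<xi>)"
        using ambient_vec_push[OF \<tau>s sT(1)[OF y], of "m y"] \<psi>(2)[OF sT(1)[OF y]] sT(2)[OF y] by simp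
      moreover have "push B ?t (s y) (m y) \<in> tangent_space B (?f y)"
        using push_tangent'[OF \<tau>s sT(1)[OF y], of "m y"] sT(2)[OF y] by simp
      ultimately have "push B ?t (s y) (m y) = normal (?f y)"
        using ambient_vec_inj[OF _ nt slST[OF yW]] a by simp
      then show ?thesis using sT[OF y] \<tau>(3) by blast
    qed
    show "h (?f y) (normal (?f y)) (push B ?f y v) = 0" if y: "y \<in> T" for y v
    proof -
      have yW: "y \<in> W" using y T(2) by blast
      have \<sigma>U: "\<sigma> ` W \<subseteq> U" using \<sigma>S SU by blast
      have "h (?f y) (normal (?f y)) (push B ?f y v) = g' (\<sigma> y) (\<nu> (\<sigma> y)) (push A \<sigma> y v)"
        using smooth_into_\<phi>(2)[OF M.local_paramD(1)[OF lp(1)] \<sigma>U yW] normal_\<phi>[OF \<sigma>S[OF yW]] by (simp add: pullback_metric_def)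
      also have "\<dots> = 0"
        using iso[OF \<sigma>S[OF yW] \<nu>_tangent[OF \<sigma>S[OF yW]] M.push_tangent'[OF M.local_paramD(1)[OF lp(1)] yW]] \<nu>_orth[OF lp(1) yW] by simp
      finally show ?thesis .
    qed
    show "h (?f y) (normal (?f y)) (normal (?f y)) = 1" if y: "y \<in> T" for y
    proof -
      have yS: "\<sigma> y \<in> S" using y T(2) \<sigma>S by blast
      then show ?thesis
        using iso[OF yS \<nu>_tangent[OF yS] \<nu>_tangent[OF yS]] \<nu>_unit[OF yS] normal_\<phi>[OF yS] by (simp add: pullback_metric_def)
    qed
  qed
qed

text \<open>Moves \<open>k\<^sub>0\<close> back to a chart of \<open>M\<close>: both mean curvatures
  become traces for the same \<open>s\<close> and \<open>m\<close>, and only the Gram matrices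
  differ.\<close>

lemma mean_curvature_reference:
  fixes \<sigma> :: "real^2 \<Rightarrow> 'm"
  assumes lp: "local_param X A UNIV S W \<sigma>" "u \<in> W" and c: "c \<in> A" "\<sigma> u \<in> fst c"
  shows "mean_curvature (top_of_set ST) B h (time_slice \<epsilon> V T\<^sub>0) (\<phi> ` S) normal (\<phi> (\<sigma> u)) = M.surface_trace g' c \<sigma> \<nu> u"
    "gram A g' (cinv c) differentiable at (snd c (\<sigma> u))"
proof -
  have \<sigma>S: "\<sigma> y \<in> S" if "y \<in> W" for y using M.local_paramD(6)[OF lp(1)] that by auto
  have uU: "\<sigma> u \<in> U" using \<sigma>S[OF lp(2)] SU by blast
  have fST: "\<phi> (\<sigma> u) \<in> ST" by (rule \<phi>_ST[OF uU])
  obtain d where d: "d \<in> B" "\<phi> (\<sigma> u) \<in> fst d" using ex_chart[of "\<phi> (\<sigma> u)"] fST by auto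
  note R = reference_chart[OF c(1) d(1)]
  define F where "F x = snd d (\<phi> (cinv c x))" for x
  define D where "D = snd c ` (fst c \<inter> U) \<inter> (\<lambda>x. \<phi> (cinv c x)) -` fst d"
  define Gd where "Gd = gram B h (cinv d)"
  define G' where "G' = gram A g' (cinv c)"
  define s where "s y = snd c (\<sigma> y)" for y
  define m where "m y = \<nu> (\<sigma> y) c" for y
  note R = R[folded F_def D_def Gd_def G'_def]
  have uD: "s u \<in> D" "F (s u) = snd d (\<phi> (\<sigma> u))" using R(3)[OF c(2) uU d(2)] by (auto simp: s_def)
  have ds: "s differentiable at u" "m differentiable at u"
    unfolding s_def[abs_def] m_def[abs_def]
    using M.smooth_into_differentiable[OF M.local_paramD(1)[OF lp(1)] lp(2) c] \<nu>_diff[OF lp c] by auto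
  have dGd: "Gd differentiable at (F (s u))"
    unfolding Gd_def uD(2) using metric_field_static d fST by (auto simp: metric_field_def)
  have symGd: "ip (Gd (F (s u))) a b = ip (Gd (F (s u))) b a" for a b
    unfolding Gd_def uD(2) by (rule metric_field_ip_sym[OF metric_field_static d]) (use fST in simp)
  have invG': "invertible (G' (s u))"
    unfolding G'_def s_def using gram_pullback_surface[OF c \<sigma>S[OF lp(2)]] inv_g[OF c] by simp
  have dF: "F differentiable at (s u)" using smooth_on_differentiable[OF R(2,1) uD(1)] .
  have surj: "surj (fd F (s u))"
    using linear_injective_imp_surjective[OF fd_linear[OF dF]] R(6)[OF uD(1)] by blast
  \<comment> \<open>The pulled back Gram matrix is that of \<open>g\<close> at points of
    \<open>S\<close>, hence invertible; since the derivative of \<open>F\<close> is bijective, so is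
    the static one.\<close>
  have invGd: "invertible (Gd (F (s u)))"
  proof -
    have "z = 0" if z: "Gd (F (s u)) *v z = 0" for z
    proof -
      obtain a where a: "z = fd F (s u) a" using surj by (metis surjD)
      have "ip (G' (s u)) b a = 0" for b
        using R(5)[OF uD(1), of b a] z by (simp add: a[symmetric] ip_def)
      then have "(G' (s u) *v a) \<bullet> (G' (s u) *v a) = 0" unfolding ip_def .
      then have "G' (s u) *v a = 0" by simp
      then have "a = 0" using matrix_left_invertible_ker invG' invertible_left_inverse by metis
      then show ?thesis using a linear_0[OF fd_linear[OF dF]] by simp
    qed
    then show ?thesis by (metis invertible_left_inverse matrix_left_invertible_ker)
  qed
  show dG': "gram A g' (cinv c) differentiable at (snd c (\<sigma> u))"
    using fd_pullback_metric(1)[where G' = G' and G = Gd, OF R(1,2) uD(1) R(5) dGd] by (simp add: G'_def s_def)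
  note lpf = local_param_\<phi>[OF lp(1)]
  have "mean_curvature (top_of_set ST) B h (time_slice \<epsilon> V T\<^sub>0) (\<phi> ` S) normal (\<phi> (\<sigma> u)) = surface_trace h d (\<lambda>y. \<phi> (\<sigma> y)) normal u"
    by (rule mean_curvature_eq_trace(1)[OF metric_field_static spacelike_slice ex_mean_curvature_slice[OF lp] lpf lp(2) refl d])
      (use invGd in \<open>simp add: Gd_def uD(2)\<close>)
  also have "\<dots> = M.surface_trace g' c \<sigma> \<nu> u"
  proof -
    define T where "T = (W \<inter> \<sigma> -` fst c) \<inter> (W \<inter> (\<lambda>y. \<phi> (\<sigma> y)) -` fst d)"
    have T: "open T" "u \<in> T"
      using M.smooth_intoD(4)[OF M.local_paramD(1)[OF lp(1)] c(1)] smooth_intoD(4)[OF local_paramD(1)[OF lpf] d(1)] lp c d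
      by (auto simp: T_def)
    have eq: "snd d (\<phi> (\<sigma> y)) = F (s y)" "normal (\<phi> (\<sigma> y)) d = fd F (s y) (m y)" if "y \<in> T" for y
    proof -
      have y: "y \<in> W" "\<sigma> y \<in> fst c" "\<phi> (\<sigma> y) \<in> fst d" using that by (auto simp: T_def)
      have yU: "\<sigma> y \<in> U" using \<sigma>S[OF y(1)] SU by blast
      show "snd d (\<phi> (\<sigma> y)) = F (s y)" using R(3)[OF y(2) yU y(3)] by (simp add: s_def)
      show "normal (\<phi> (\<sigma> y)) d = fd F (s y) (m y)"
        using R(4)[OF y(2) yU y(3) \<nu>_tangent[OF \<sigma>S[OF y(1)]]] normal_\<phi>[OF \<sigma>S[OF y(1)]] by (simp add: s_def m_def)
    qed
    have fdd: "fd (\<lambda>y. snd d (\<phi> (\<sigma> y))) u v = fd F (s u) (fd s u v)" for v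
      using fd_compose[OF ds(1) dF, of v] fd_cong[OF T, of "\<lambda>y. snd d (\<phi> (\<sigma> y))" "\<lambda>y. F (s y)"] eq(1) by simp
    have cov: "cov_deriv Gd (\<lambda>y. snd d (\<phi> (\<sigma> y))) (\<lambda>y. normal (\<phi> (\<sigma> y)) d) u w = cov_deriv Gd (\<lambda>y. F (s y)) (\<lambda>y. fd F (s y) (m y)) u w" for w
      by (rule cov_deriv_cong[OF T]) (simp_all add: eq)
    have pull: "ip (Gd (F (s u))) (fd F (s u) z) (cov_deriv Gd (\<lambda>y. F (s y)) (\<lambda>y. fd F (s y) (m y)) u w) = ip (G' (s u)) z (cov_deriv G' s m u w)" for z w
      by (rule cov_deriv_pullback[where s = s and m = m and u = u and F = F and W = D])
        (fact R(1,2) uD(1) R(5) dGd invGd symGd invG' ds)+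
    show ?thesis
      unfolding surface_trace_def M.surface_trace_def Let_def Gd_def[symmetric] G'_def[symmetric] uD(2)[symmetric]
      by (simp only: fdd cov pull R(5)[OF uD(1), symmetric] s_def[symmetric] m_def[symmetric])
  qed
  finally show "mean_curvature (top_of_set ST) B h (time_slice \<epsilon> V T\<^sub>0) (\<phi> ` S) normal (\<phi> (\<sigma> u)) = M.surface_trace g' c \<sigma> \<nu> u" .
qed

end

section \<open>Oriented partitions of unity\<close>

context atlas
begin

text \<open>\<open>surface_integral\<close> picks its partition by choice, so one has to exist.
  Compactness and the Hausdorff property make \<open>S\<close> normal; Urysohn functions at finitely
  many points, divided by their sum, form the partition.\<close>

lemma ex_oriented_partition:
  assumes S: "compactin X S" and T2: "Hausdorff_space X"
    and loc: "\<And>p. p \<in> S \<Longrightarrow> \<exists>W (\<sigma> :: real^2 \<Rightarrow> 'm) u. local_param X A UNIV S W \<sigma> \<and> u \<in> W \<and> \<sigma> u = p \<and>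
      (\<forall>y\<in>W. pos (\<sigma> y) (push A \<sigma> y (axis 0 1)) (push A \<sigma> y (axis 1 1)))"
  shows "\<exists>P. oriented_partition X A S pos P"
proof -
  let ?Y = "subtopology X S"
  have SX: "S \<subseteq> topspace X" using S by (simp add: compactin_def)
  have tY: "topspace ?Y = S" using SX by auto
  have cY: "compact_space ?Y" using S compact_space_subtopology by blast
  have hY: "Hausdorff_space ?Y" using T2 Hausdorff_space_subtopology by blast
  have rY: "regular_space ?Y" and nY: "normal_space ?Y"
    using compact_Hausdorff_imp_regular_space[OF cY hY] compact_Hausdorff_or_regular_imp_normal_space[OF cY] hY by auto
  define Q where "Q p W \<sigma> f \<longleftrightarrow> local_param X A UNIV S W \<sigma> \<and> (\<forall>y\<in>W. pos (\<sigma> y) (push A \<sigma> y (axis 0 1)) (push A \<sigma> y (axis 1 1))) \<and>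
      continuous_map ?Y euclideanreal f \<and> (\<forall>q\<in>S. 0 \<le> f q) \<and> f p > 0 \<and> ?Y closure_of {q \<in> S. f q \<noteq> 0} \<subseteq> \<sigma> ` W"
    for p W f and \<sigma> :: "real^2 \<Rightarrow> 'm"
  have "\<forall>p\<in>S. \<exists>W \<sigma> f. Q p W \<sigma> f"
  proof
    fix p assume p: "p \<in> S"
    obtain W u and \<sigma> :: "real^2 \<Rightarrow> 'm" where \<sigma>: "local_param X A UNIV S W \<sigma>" "u \<in> W" "\<sigma> u = p"
      "\<forall>y\<in>W. pos (\<sigma> y) (push A \<sigma> y (axis 0 1)) (push A \<sigma> y (axis 1 1))" using loc[OF p] by blast
    have op: "openin ?Y (\<sigma> ` W)" using local_paramD(4)[OF \<sigma>(1)] by simp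
    have pW: "p \<in> \<sigma> ` W" using \<sigma>(2,3) by blast
    have "closedin ?Y (S - \<sigma> ` W)" using closedin_diff[OF closedin_topspace op] tY by simp
    \<comment> \<open>Separating \<open>p\<close> from the complement of the parametrized piece
      gives a neighbourhood whose closure stays inside that piece, so functions vanishing off
      \<open>V\<close> have support there.\<close>
    then obtain V V' where V: "openin ?Y V" "openin ?Y V'" "p \<in> V" "S - \<sigma> ` W \<subseteq> V'" "disjnt V V'"
      using p pW tY rY[unfolded regular_space_def, rule_format, of "S - \<sigma> ` W" p] by auto
    have "closedin ?Y (S - V')" using closedin_diff[OF closedin_topspace V(2)] tY by simp
    moreover have VS: "V \<subseteq> S - V'" using V(1,5) openin_subset[OF V(1)] tY by (auto simp: disjnt_iff)
    ultimately have cl: "?Y closure_of V \<subseteq> \<sigma> ` W" using V(4) closure_of_minimal[of V "S - V'" ?Y] by blast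
    have c1: "closedin ?Y (S - V)" using closedin_diff[OF closedin_topspace V(1)] tY by simp
    have c2: "closedin ?Y {p}" using hY p tY by (simp add: closedin_Hausdorff_singleton)
    have "disjnt (S - V) {p}" using V(3) by (auto simp: disjnt_iff)
    then obtain f where f: "continuous_map ?Y (top_of_set {0..1 :: real}) f" "f ` (S - V) \<subseteq> {0}" "f ` {p} \<subseteq> {1}"
      using Urysohn_lemma[OF nY c1 c2, of 0 1] by auto
    have fr: "continuous_map ?Y euclideanreal f" and f0: "\<forall>q\<in>S. 0 \<le> f q"
      using f(1) tY by (auto simp: continuous_map_in_subtopology)
    have "{q \<in> S. f q \<noteq> 0} \<subseteq> V" using f(2) by auto
    then have "?Y closure_of {q \<in> S. f q \<noteq> 0} \<subseteq> \<sigma> ` W" using cl closure_of_mono by blast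
    then show "\<exists>W \<sigma> f. Q p W \<sigma> f"
      unfolding Q_def using \<sigma>(1,4) fr f0 f(3) by (intro exI[of _ W] exI[of _ \<sigma>] exI[of _ f]) auto
  qed
  from bchoice[OF this] obtain W where "\<forall>p\<in>S. \<exists>\<sigma> f. Q p (W p) \<sigma> f" ..
  from bchoice[OF this] obtain \<sigma> where "\<forall>p\<in>S. \<exists>f. Q p (W p) (\<sigma> p) f" ..
  from bchoice[OF this] obtain f where "\<forall>p\<in>S. Q p (W p) (\<sigma> p) (f p)" ..
  then have L: "\<And>p. p \<in> S \<Longrightarrow> local_param X A UNIV S (W p) (\<sigma> p)"
    "\<And>p y. p \<in> S \<Longrightarrow> y \<in> W p \<Longrightarrow> pos (\<sigma> p y) (push A (\<sigma> p) y (axis 0 1)) (push A (\<sigma> p) y (axis 1 1))"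
    "\<And>p. p \<in> S \<Longrightarrow> continuous_map ?Y euclideanreal (f p)" "\<And>p q. p \<in> S \<Longrightarrow> q \<in> S \<Longrightarrow> 0 \<le> f p q" "\<And>p. p \<in> S \<Longrightarrow> f p p > 0"
    "\<And>p. p \<in> S \<Longrightarrow> ?Y closure_of {q \<in> S. f p q \<noteq> 0} \<subseteq> \<sigma> p ` W p"
    unfolding Q_def by blast+
  define O' where "O' p = {q \<in> topspace ?Y. f p q \<in> {0<..}}" for p
  have O': "openin ?Y (O' p)" if "p \<in> S" for p
    unfolding O'_def by (rule openin_continuous_map_preimage[OF L(3)[OF that]]) auto
  have "compactin ?Y (topspace ?Y)" using cY by (simp add: compact_space_def)
  moreover have "topspace ?Y \<subseteq> \<Union>(O' ` S)" using L(5) tY by (auto simp: O'_def)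
  ultimately obtain F where F: "finite F" "F \<subseteq> O' ` S" "topspace ?Y \<subseteq> \<Union>F"
    unfolding compactin_def using O' by (metis (no_types, lifting) imageE)
  obtain K where K: "K \<subseteq> S" "finite K" "F = O' ` K" using finite_subset_image[OF F(1,2)] by blast
  have pos: "\<exists>p\<in>K. f p q > 0" if "q \<in> S" for q
    using F(3) that unfolding K(3) tY by (auto simp: O'_def)
  define \<Sigma> where "\<Sigma> q = (\<Sum>p\<in>K. f p q)" for q
  have \<Sigma>: "\<Sigma> q > 0" if "q \<in> S" for q
  proof -
    obtain p where p: "p \<in> K" "f p q > 0" using pos[OF \<open>q \<in> S\<close>] by blast
    show ?thesis unfolding \<Sigma>_def using K L(4) that p by (intro sum_pos2[OF K(2) p(1)]) auto
  qed
  obtain b where b: "bij_betw b {0..<card K} K" using ex_bij_betw_nat_finite[OF K(2)] by blast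
  have bK: "b i \<in> S" if "i < card K" for i using bij_betwE[OF b] that K(1) by auto
  have "continuous_map ?Y euclideanreal \<Sigma>"
    unfolding \<Sigma>_def[abs_def] using K L(3) by (intro continuous_map_sum) auto
  then have cont: "continuous_map ?Y euclideanreal (\<lambda>q. f (b i) q / \<Sigma> q)" if "i < card K" for i
    using L(3)[OF bK[OF that]] \<Sigma> tY by (intro continuous_map_real_divide) force+
  have supp: "{q \<in> S. f (b i) q / \<Sigma> q \<noteq> 0} = {q \<in> S. f (b i) q \<noteq> 0}" for i
    using \<Sigma> by force
  have one: "(\<Sum>i<card K. f (b i) q / \<Sigma> q) = 1" if "q \<in> S" for q
  proof -
    have "(\<Sum>i<card K. f (b i) q) = \<Sigma> q"
      unfolding \<Sigma>_def using sum.reindex_bij_betw[OF b, of "\<lambda>p. f p q"] by (simp add: atLeast0LessThan)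
    then show ?thesis using \<Sigma>[OF that] by (simp add: sum_divide_distrib[symmetric])
  qed
  have "oriented_partition X A S pos (card K, \<lambda>i. W (b i), \<lambda>i. \<sigma> (b i), \<lambda>i q. f (b i) q / \<Sigma> q)"
    unfolding oriented_partition_def split supp
  proof (intro conjI allI impI ballI)
    fix i assume "i < card K"
    note i = bK[OF this]
    show "local_param X A UNIV S (W (b i)) (\<sigma> (b i))" by (rule L(1)[OF i])
    show "pos (\<sigma> (b i) y) (push A (\<sigma> (b i)) y (axis 0 1)) (push A (\<sigma> (b i)) y (axis 1 1))" if "y \<in> W (b i)" for y
      by (rule L(2)[OF i that])
    show "continuous_map ?Y euclideanreal (\<lambda>q. f (b i) q / \<Sigma> q)" by (rule cont) fact
    show "0 \<le> f (b i) q / \<Sigma> q" if "q \<in> S" for q using L(4)[OF i that] \<Sigma>[OF that] by simp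
    show "?Y closure_of {q \<in> S. f (b i) q \<noteq> 0} \<subseteq> \<sigma> (b i) ` W (b i)" by (rule L(6)[OF i])
  qed (rule one)
  then show ?thesis by blast
qed

end

section \<open>Orienting a parametrization\<close>

lemma continuous_on_d4:
  assumes "continuous_on T p" "continuous_on T q" "continuous_on T r" "continuous_on T s"
  shows "continuous_on T (\<lambda>y. d4 (p y) (q y) (r y) (s y))"
proof -
  have "continuous_on T (\<lambda>y. if i = 0 then p y else if i = 1 then q y else if i = 2 then r y else s y)" for i :: 4
    using assms by (cases "i = 0"; cases "i = 1"; cases "i = 2"; simp)
  then have "continuous_on T (\<lambda>y. (if i = 0 then p y else if i = 1 then q y else if i = 2 then r y else s y) $ j)" for i j :: 4
    by (rule continuous_on_component)
  then show ?thesis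
    unfolding d4_def det_def vec_lambda_beta
    by (intro continuous_on_sum continuous_on_mult continuous_on_const continuous_on_prod)
qed

definition swap2 :: "real^2 \<Rightarrow> real^2" where
  "swap2 y = (\<chi> i. if i = 0 then y $ 1 else y $ 0)"

lemma bounded_linear_swap2: "bounded_linear swap2"
  unfolding linear_conv_bounded_linear[symmetric]
  by (rule linearI) (simp_all add: vec2_eq_iff swap2_def)

lemma swap2_swap2 [simp]: "swap2 (swap2 y) = y"
  by (simp add: vec2_eq_iff swap2_def)

lemma swap2_axis: "swap2 (axis 0 1) = axis 1 1" "swap2 (axis 1 1) = axis 0 1"
  by (simp_all add: vec2_eq_iff swap2_def axis_def)

lemma d4_matrix:
  "d4 (J *v p) (J *v q) (J *v r) (J *v s) = det J * d4 p q r s"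
proof -
  let ?M = "(\<chi> i::4. if i = 0 then p else if i = 1 then q else if i = 2 then r else s) :: real^4^4"
  have "(\<chi> i::4. if i = 0 then J *v p else if i = 1 then J *v q else if i = 2 then J *v r else J *v s) = ?M ** transpose J"
    by (simp add: vec_eq_iff matrix_matrix_mult_def matrix_vector_mult_def transpose_def mult.commute)
  then show ?thesis by (simp add: d4_def det_mul mult.commute)
qed

text \<open>A change of chart multiplies \<open>d4\<close> by the transition determinant, which is
  positive in an oriented atlas, so one chart decides.\<close>

lemma induced_orientation_chart:
  assumes atl: "smooth_atlas X A" and or: "\<And>c c' p. c \<in> A \<Longrightarrow> c' \<in> A \<Longrightarrow> p \<in> fst c \<inter> fst c' \<Longrightarrow> det (matrix (fd (snd c' \<circ> cinv c) (snd c p))) > 0"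
    and c: "c \<in> A" "p \<in> fst c" and t: "N p \<in> tangent_space A p" "n p \<in> tangent_space A p" "Y \<in> tangent_space A p" "Z \<in> tangent_space A p"
  shows "induced_orientation A N n p Y Z \<longleftrightarrow> d4 (N p c) (n p c) (Y c) (Z c) > 0"
proof
  interpret atlas X A by standard fact
  assume pos: "d4 (N p c) (n p c) (Y c) (Z c) > 0"
  have "d4 (N p c') (n p c') (Y c') (Z c') > 0" if c': "c' \<in> A" "p \<in> fst c'" for c'
  proof -
    define J where "J = matrix (fd (snd c' \<circ> cinv c) (snd c p))"
    have "linear (fd (snd c' \<circ> cinv c) (snd c p))"
      using fd_linear[OF transition_differentiable[OF c(1) c'(1), of p]] c c' by (simp add: o_def)
    then have "v c' = J *v v c" if "v \<in> tangent_space A p" for v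
      using tangent_space_component[OF that c(1) c'(1) c(2) c'(2)] by (simp add: J_def matrix_works o_def)
    then have "d4 (N p c') (n p c') (Y c') (Z c') = det J * d4 (N p c) (n p c) (Y c) (Z c)"
      using t d4_matrix by metis
    then show ?thesis using pos or[OF c(1) c'(1), of p] c c' by (simp add: J_def)
  qed
  then show "induced_orientation A N n p Y Z"
    unfolding induced_orientation_def d4_def by blast
next
  assume "induced_orientation A N n p Y Z"
  then show "d4 (N p c) (n p c) (Y c) (Z c) > 0"
    unfolding induced_orientation_def d4_def using c by blast
qed

text \<open>Continuity keeps the sign of \<open>D\<close> near \<open>u\<close>; a negative sign is
  reversed by exchanging the two parameters.\<close>

lemma (in atlas) ex_oriented_param:
  fixes S :: "'m set" and \<sigma> :: "real^2 \<Rightarrow> 'm"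
  assumes lp: "local_param X A UNIV S W \<sigma>" "u \<in> W" and c: "c \<in> A" "\<sigma> u \<in> fst c"
    and cont: "continuous_on (W \<inter> \<sigma> -` fst c) (\<lambda>y. D (\<sigma> y) (push A \<sigma> y (axis 0 1)) (push A \<sigma> y (axis 1 1)))"
    and nz: "D (\<sigma> u) (push A \<sigma> u (axis 0 1)) (push A \<sigma> u (axis 1 1)) \<noteq> (0 :: real)"
    and swap: "\<And>p Y Z. D p Z Y = - D p Y Z"
  shows "\<exists>W' (\<sigma>' :: real^2 \<Rightarrow> 'm) u'. local_param X A UNIV S W' \<sigma>' \<and> u' \<in> W' \<and> \<sigma>' u' = \<sigma> u \<and>
    (\<forall>y\<in>W'. \<sigma>' y \<in> fst c \<and> D (\<sigma>' y) (push A \<sigma>' y (axis 0 1)) (push A \<sigma>' y (axis 1 1)) > 0)"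
proof -
  let ?D = "\<lambda>y. D (\<sigma> y) (push A \<sigma> y (axis 0 1)) (push A \<sigma> y (axis 1 1))"
  have o: "open (W \<inter> \<sigma> -` fst c)" by (rule smooth_intoD(4)[OF local_paramD(1)[OF lp(1)] c(1)])
  show ?thesis
  proof (cases "?D u > 0")
    case True
    define T where "T = (W \<inter> \<sigma> -` fst c) \<inter> ?D -` {0<..}"
    have T: "open T" unfolding T_def by (rule continuous_open_preimage[OF cont o]) simp
    have TW: "T \<subseteq> W" unfolding T_def by blast
    have "local_param X A UNIV S T \<sigma>" by (rule local_param_restrict[OF lp(1) T TW])
    moreover have "u \<in> T" using True lp(2) c(2) by (simp add: T_def)
    moreover have "\<forall>y\<in>T. \<sigma> y \<in> fst c \<and> ?D y > 0" by (simp add: T_def)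
    ultimately show ?thesis by (intro exI[of _ T] exI[of _ \<sigma>] exI[of _ u] conjI refl)
  next
    case False
    then have neg: "?D u < 0" using nz by simp
    define T where "T = (W \<inter> \<sigma> -` fst c) \<inter> ?D -` {..<0}"
    have T: "open T" unfolding T_def by (rule continuous_open_preimage[OF cont o]) simp
    have TW: "T \<subseteq> W" unfolding T_def by blast
    have lpT: "local_param X A UNIV S T \<sigma>" by (rule local_param_restrict[OF lp(1) T TW])
    have sT: "swap2 ` (swap2 -` T) = T" using surj_image_vimage_eq[OF surjI[of swap2 swap2, OF swap2_swap2]] .
    have lpS: "local_param X A UNIV S (swap2 -` T) (\<lambda>y. \<sigma> (swap2 y))"
    proof (rule local_param_linear[OF lpT bounded_linear_swap2 subset_UNIV bounded_linear_swap2 swap2_swap2])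
      show "openin (subtopology X S) (\<sigma> ` swap2 ` (swap2 -` T))"
        unfolding sT using local_paramD(4)[OF lpT] by simp
    qed
    have "push A (\<lambda>y. \<sigma> (swap2 y)) y v = push A \<sigma> (swap2 y) (swap2 v)" if "y \<in> swap2 -` T" for y v
      using push_compose[OF local_paramD(1)[OF lpT] local_paramD(2)[OF lpS] that, of swap2 "\<lambda>y. \<sigma> (swap2 y)" v]
        bounded_linear_imp_differentiable[OF bounded_linear_swap2]
      by (simp add: fd_eqI[OF bounded_linear_imp_has_derivative[OF bounded_linear_swap2]])
    then have "\<forall>y\<in>swap2 -` T. \<sigma> (swap2 y) \<in> fst c \<and> D (\<sigma> (swap2 y)) (push A (\<lambda>y. \<sigma> (swap2 y)) y (axis 0 1)) (push A (\<lambda>y. \<sigma> (swap2 y)) y (axis 1 1)) > 0"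
      by (simp add: swap2_axis T_def swap[of _ "push A \<sigma> _ (axis 1 1)" "push A \<sigma> _ (axis 0 1)"])
    moreover have "swap2 u \<in> swap2 -` T" "\<sigma> (swap2 (swap2 u)) = \<sigma> u" using neg lp(2) c(2) by (simp_all add: T_def)
    ultimately show ?thesis using lpS by (intro exI[of _ "swap2 -` T"] exI[of _ "\<lambda>y. \<sigma> (swap2 y)"] exI[of _ "swap2 u"] conjI)
  qed
qed

section \<open>The integrand of the energy\<close>

definition christoffel_diff :: "(real^'n \<Rightarrow> real^'n^'n) \<Rightarrow> (real^'n \<Rightarrow> real^'n^'n) \<Rightarrow> real^'n \<Rightarrow> real^'n \<Rightarrow> real^'n^'n::finite" where
  "christoffel_diff G G' x y = matrix (\<lambda>z. christoffel_vec G x y z - christoffel_vec G' x y z)"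

lemma christoffel_diff_works:
  fixes G G' :: "real^'n \<Rightarrow> real^'n^'n"
  shows "christoffel_diff G G' x y *v z = christoffel_vec G x y z - christoffel_vec G' x y z"
proof -
  have "linear (christoffel_vec H x y)" for H :: "real^'n \<Rightarrow> real^'n^'n"
    by (rule linearI) (simp_all add: christoffel_vec_def vec_eq_iff sum.distrib sum_distrib_left algebra_simps)
  then show ?thesis
    unfolding christoffel_diff_def
    by (intro matrix_works) (simp add: linear_compose_sub linear_def[symmetric] scalar_mult_eq_scaleR[abs_def])
qed

text \<open>The derivative of the frame is common to both connection forms and cancels; what remains
  is the difference tensor conjugated by the frame matrix.\<close>

lemma conn_form_diff:
  assumes "cinv c (snd c p) = p"
  shows "conn_form A g c e p a b Y - conn_form A g' c e p a b Y =
    (matrix_inv (frame_matrix c e p) ** christoffel_diff (gram A g (cinv c)) (gram A g' (cinv c)) (snd c p) (Y c) ** frame_matrix c e p) $ a $ b"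
proof -
  let ?F = "frame_matrix c e p"
  let ?C = "christoffel_diff (gram A g (cinv c)) (gram A g' (cinv c)) (snd c p) (Y c)"
  have F: "?F *v axis b 1 = e p b c"
    by (simp add: matrix_vector_mult_basis column_def frame_matrix_def vec_eq_iff)
  have entry: "M $ a $ b = (M *v axis b 1) $ a" for M :: "real^4^4"
    by (simp add: matrix_vector_mult_basis column_def)
  have "fd (\<lambda>x. x) y z = z" for y z :: "real^4" 
    using fd_eqI[OF has_derivative_ident, of y] by simp
  then show ?thesis
    unfolding entry[of "_ ** ?F"] conn_form_def cov_deriv_def vector_minus_component[symmetric]
    by (simp only: matrix_vector_mult_diff_distrib[symmetric] matrix_vector_mul_assoc[symmetric] F christoffel_diff_works assms)
      (simp add: matrix_vector_mult_diff_distrib matrix_vector_right_distrib)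
qed

text \<open>Each frame index meets its dual, so \<open>F\<close> and its inverse cancel. This is the
  independence of the frame.\<close>

lemma frame_contraction:
  fixes F C E :: "real^'n^'n"
  assumes "invertible F"
  shows "(\<Sum>a\<in>UNIV. \<Sum>b\<in>UNIV. (matrix_inv F ** C ** F) $ a $ b * (\<Sum>\<alpha>\<in>UNIV. \<Sum>\<beta>\<in>UNIV. F $ \<alpha> $ a * matrix_inv F $ b $ \<beta> * E $ \<alpha> $ \<beta>))
    = (\<Sum>\<alpha>\<in>UNIV. \<Sum>\<beta>\<in>UNIV. C $ \<alpha> $ \<beta> * E $ \<alpha> $ \<beta>)"
proof -
  define K where "K = matrix_inv F ** C ** F"
  define f where "f a b \<alpha> \<beta> = F $ \<alpha> $ a * K $ a $ b * matrix_inv F $ b $ \<beta> * E $ \<alpha> $ \<beta>" for a b \<alpha> \<beta>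
  have FK: "F ** K ** matrix_inv F = C"
  proof -
    have "F ** K ** matrix_inv F = (F ** matrix_inv F) ** C ** (F ** matrix_inv F)"
      by (simp only: K_def matrix_mul_assoc)
    then show ?thesis by (simp add: matrix_inv_right[OF assms])
  qed
  have "(\<Sum>a\<in>UNIV. \<Sum>b\<in>UNIV. K $ a $ b * (\<Sum>\<alpha>\<in>UNIV. \<Sum>\<beta>\<in>UNIV. F $ \<alpha> $ a * matrix_inv F $ b $ \<beta> * E $ \<alpha> $ \<beta>))
      = (\<Sum>a\<in>UNIV. \<Sum>b\<in>UNIV. \<Sum>\<alpha>\<in>UNIV. \<Sum>\<beta>\<in>UNIV. f a b \<alpha> \<beta>)"
    by (simp add: f_def sum_distrib_left mult_ac)
  also have "\<dots> = (\<Sum>\<alpha>\<in>UNIV. \<Sum>a\<in>UNIV. \<Sum>b\<in>UNIV. \<Sum>\<beta>\<in>UNIV. f a b \<alpha> \<beta>)" by (rule sum_rotate)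
  also have "\<dots> = (\<Sum>\<alpha>\<in>UNIV. \<Sum>\<beta>\<in>UNIV. \<Sum>a\<in>UNIV. \<Sum>b\<in>UNIV. f a b \<alpha> \<beta>)"
    by (rule sum.cong[OF refl], rule sum_rotate)
  also have "\<dots> = (\<Sum>\<alpha>\<in>UNIV. \<Sum>\<beta>\<in>UNIV. \<Sum>b\<in>UNIV. \<Sum>a\<in>UNIV. f a b \<alpha> \<beta>)"
    by (rule sum.cong[OF refl], rule sum.cong[OF refl], rule sum.swap)
  also have "\<dots> = (\<Sum>\<alpha>\<in>UNIV. \<Sum>\<beta>\<in>UNIV. (F ** K ** matrix_inv F) $ \<alpha> $ \<beta> * E $ \<alpha> $ \<beta>)"
    by (simp add: f_def matrix_matrix_mult_def sum_distrib_right)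
  finally show ?thesis unfolding FK by (simp only: K_def)
qed

abbreviation bivector_trace :: "real^4^4 \<Rightarrow> real^4 \<Rightarrow> real^4 \<Rightarrow> real" where
  "bivector_trace M Y Z \<equiv> (\<Sum>\<alpha>\<in>UNIV. \<Sum>\<gamma>\<in>UNIV. M $ \<alpha> $ \<gamma> * d4 (axis \<alpha> 1) (axis \<gamma> 1) Y Z)"

lemma eta_contraction:
  fixes A :: "('m, 4) chart set" and g :: "('m, 4) metric"
  assumes "invertible (frame_matrix c e p)"
  defines "F \<equiv> frame_matrix c e p" and "G \<equiv> gram A g (cinv c) (snd c p)"
  shows "(\<Sum>a\<in>UNIV. \<Sum>b\<in>UNIV. (matrix_inv F ** C ** F) $ a $ b * eta_frame A g c e p a b Y Z)
    = sqrt (- det G) * bivector_trace (C ** matrix_inv G) (Y c) (Z c)"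
proof -
  have eta: "eta_coord A g c p \<alpha> \<beta> Y Z = sqrt (- det G) * (\<Sum>\<gamma>\<in>UNIV. matrix_inv G $ \<beta> $ \<gamma> * d4 (axis \<alpha> 1) (axis \<gamma> 1) (Y c) (Z c))" for \<alpha> \<beta>
    unfolding eta_coord_def Let_def levi_civita_sum G_def by simp
  define E where "E = (\<chi> \<alpha> \<beta>. eta_coord A g c p \<alpha> \<beta> Y Z)"
  have "(\<Sum>a\<in>UNIV. \<Sum>b\<in>UNIV. (matrix_inv F ** C ** F) $ a $ b * eta_frame A g c e p a b Y Z)
      = (\<Sum>a\<in>UNIV. \<Sum>b\<in>UNIV. (matrix_inv F ** C ** F) $ a $ b * (\<Sum>\<alpha>\<in>UNIV. \<Sum>\<beta>\<in>UNIV. F $ \<alpha> $ a * matrix_inv F $ b $ \<beta> * E $ \<alpha> $ \<beta>))"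
    by (simp add: eta_frame_def F_def E_def)
  also have "\<dots> = (\<Sum>\<alpha>\<in>UNIV. \<Sum>\<beta>\<in>UNIV. C $ \<alpha> $ \<beta> * E $ \<alpha> $ \<beta>)"
    by (rule frame_contraction) (simp add: F_def assms(1))
  also have "\<dots> = sqrt (- det G) * (\<Sum>\<alpha>\<in>UNIV. \<Sum>\<beta>\<in>UNIV. \<Sum>\<gamma>\<in>UNIV. C $ \<alpha> $ \<beta> * matrix_inv G $ \<beta> $ \<gamma> * d4 (axis \<alpha> 1) (axis \<gamma> 1) (Y c) (Z c))"
    by (simp add: E_def eta sum_distrib_left mult_ac)
  also have "(\<Sum>\<alpha>\<in>UNIV. \<Sum>\<beta>\<in>UNIV. \<Sum>\<gamma>\<in>UNIV. C $ \<alpha> $ \<beta> * matrix_inv G $ \<beta> $ \<gamma> * d4 (axis \<alpha> 1) (axis \<gamma> 1) (Y c) (Z c))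
      = (\<Sum>\<alpha>\<in>UNIV. \<Sum>\<gamma>\<in>UNIV. \<Sum>\<beta>\<in>UNIV. C $ \<alpha> $ \<beta> * matrix_inv G $ \<beta> $ \<gamma> * d4 (axis \<alpha> 1) (axis \<gamma> 1) (Y c) (Z c))"
    by (rule sum.cong[OF refl], rule sum.swap)
  finally show ?thesis by (simp add: matrix_matrix_mult_def sum_distrib_right)
qed

lemma cnt_form_contraction:
  fixes A :: "('m, 4) chart set" and g g' :: "('m, 4) metric"
  assumes "cinv c (snd c p) = p" "invertible (frame_matrix c e p)"
  defines "G \<equiv> gram A g (cinv c)" and "G' \<equiv> gram A g' (cinv c)"
  shows "cnt_form A g g' c e N p Y Z = sqrt (- det (G (snd c p))) *
    (bivector_trace (christoffel_diff G G' (snd c p) (Y c) ** matrix_inv (G (snd c p))) (N p c) (Z c)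
     - bivector_trace (christoffel_diff G G' (snd c p) (Z c) ** matrix_inv (G (snd c p))) (N p c) (Y c))"
  unfolding cnt_form_def conn_form_diff[where c = c and p = p, OF assms(1)] sum_subtractf eta_contraction[OF assms(2)]
  by (simp add: G_def G'_def right_diff_distrib)

text \<open>Metric compatibility: in the part symmetric in \<open>n\<close> and \<open>v\<close>,
  only derivatives of \<open>G\<close> in the direction \<open>w\<close> survive.\<close>

lemma chr_antisymmetric_part: "chr G x w n v + chr G x w v n = (ip (fd G x w) n v + ip (fd G x w) v n) / 2"
  by (simp add: chr_def field_simps)

text \<open>The symmetric parts of the two Koszul expressions agree because they involve only the
  common derivative in the direction \<open>w\<close>; the difference is therefore skew.\<close>

lemma christoffel_diff_antisymmetric:
  assumes G: "G differentiable at x" "invertible (G x)" and G': "G' differentiable at x" "G' x = G x"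
    and w: "fd G x w = fd G' x w"
  shows "ip (G x) v (christoffel_diff G G' x w *v n) = - ip (G x) n (christoffel_diff G G' x w *v v)"
proof -
  have "ip (G x) b (christoffel_diff G G' x w *v a) = chr G x w a b - chr G' x w a b" for a b
    using ip_christoffel_vec[OF G] ip_christoffel_vec[OF G'(1)] G' G(2) by (simp add: christoffel_diff_works)
  then show ?thesis
    using chr_antisymmetric_part[of G x w n v] chr_antisymmetric_part[of G' x w n v] w by simp
qed

section \<open>Pointwise evaluation of the energy form\<close>

context reference
begin

lemma g_N: assumes p: "p \<in> S" shows "g p (N p) (N p) = - (V (snd (\<phi> p)))\<^sup>2"
proof -
  have "g p (N p) (N p) = h (\<phi> p) (time_field B (\<phi> p)) (time_field B (\<phi> p))"
    using iso[OF p N_tangent[OF p] N_tangent[OF p]] N_time[OF p] by (simp add: pullback_metric_def)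
  moreover have "\<phi> p \<in> ST" using \<phi>_ST SU p by blast
  ultimately show ?thesis
    by (simp add: static_metric_form ambient_vec_time_field form_def ambient_form_simps)
qed

text \<open>Supplies the orthogonality relations both for evaluating the integrand and for showing
  that this basis has a definite orientation.\<close>

lemma orthogonal_frame:
  fixes \<sigma> :: "real^2 \<Rightarrow> 'm"
  assumes lp: "local_param X A UNIV S W \<sigma>" "u \<in> W" and c: "c \<in> A" "\<sigma> u \<in> fst c"
    and sp: "spacelike X A g (UNIV :: (real^2) set) S"
    and N_orth: "\<And>v. g (\<sigma> u) (N (\<sigma> u)) (push A \<sigma> u v) = 0"
  defines "G \<equiv> gram A g (cinv c) (snd c (\<sigma> u))" and "N0 \<equiv> N (\<sigma> u) c" and "n \<equiv> \<nu> (\<sigma> u) c"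
    and "y \<equiv> push A \<sigma> u (axis 0 1) c" and "z \<equiv> push A \<sigma> u (axis 1 1) c"
  shows "ip G N0 n = 0" "ip G N0 y = 0" "ip G N0 z = 0" "ip G n y = 0" "ip G n z = 0" "ip G n n = 1"
    "ip G y y * ip G z z - (ip G y z)\<^sup>2 > 0"
proof -
  define s where "s y = snd c (\<sigma> y)" for y
  have yz: "y = fd s u (axis 0 1)" "z = fd s u (axis 1 1)"
    using c by (simp_all add: y_def z_def M.push_component s_def[abs_def])
  have uS: "\<sigma> u \<in> S" using M.local_paramD(6)[OF lp(1)] lp(2) by auto
  have uX: "\<sigma> u \<in> topspace X" using uS SU U_subset by blast
  have t: "push A \<sigma> u v \<in> tangent_space A (\<sigma> u)" "\<nu> (\<sigma> u) \<in> tangent_space A (\<sigma> u)" "N (\<sigma> u) \<in> tangent_space A (\<sigma> u)" for v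
    using M.push_tangent'[OF M.local_paramD(1)[OF lp(1)] lp(2)] \<nu>_tangent[OF uS] N_tangent[OF uS] by auto
  have ip: "g (\<sigma> u) a b = ip G (a c) (b c)" if "a \<in> tangent_space A (\<sigma> u)" "b \<in> tangent_space A (\<sigma> u)" for a b
    unfolding G_def by (rule M.metric_field_ip(1)[OF mf c uX that])
  have sym: "ip G a b = ip G b a" for a b
    unfolding G_def by (rule M.metric_field_ip_sym[OF mf c uX])
  show "ip G N0 n = 0" "ip G N0 y = 0" "ip G N0 z = 0" "ip G n y = 0" "ip G n z = 0" "ip G n n = 1"
    using \<nu>_N[OF uS] N_orth \<nu>_orth[OF lp] \<nu>_unit[OF uS] ip[OF t(2,3)] ip[OF t(3,1)] ip[OF t(2,1)] ip[OF t(2,2)] sym[of n N0]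
    unfolding n_def N0_def y_def z_def by simp_all
  have pos2: "ip (gram A g \<sigma> u) a a > 0" if "a \<noteq> 0" for a
    by (rule M.gram_pos[OF mf sp lp(1) _ that]) (use lp(2) in simp)
  have gr: "ip (gram A g \<sigma> u) a b = ip G (fd s u a) (fd s u b)" for a b
    using M.metric_field_gram(2)[OF mf M.local_paramD(1)[OF lp(1)] lp(2) uX c] by (simp add: G_def s_def[abs_def])
  have "ip (gram A g \<sigma> u) (axis 0 1) (axis 0 1) * ip (gram A g \<sigma> u) (axis 1 1) (axis 1 1) - (ip (gram A g \<sigma> u) (axis 0 1) (axis 1 1))\<^sup>2 > 0"
  proof (rule gram_det_pos)
    show "bilinear (ip (gram A g \<sigma> u))" by (simp add: bilinear_def linear_iff)
    show "ip (gram A g \<sigma> u) v w = ip (gram A g \<sigma> u) w v" for v w unfolding gr by (rule sym)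
    fix a b :: real assume "(a, b) \<noteq> (0, 0)"
    then have "a *\<^sub>R axis 0 1 + b *\<^sub>R axis 1 1 \<noteq> (0 :: real^2)" by (auto simp: vec2_eq_iff axis_def)
    then show "0 < ip (gram A g \<sigma> u) (a *\<^sub>R axis 0 1 + b *\<^sub>R axis 1 1) (a *\<^sub>R axis 0 1 + b *\<^sub>R axis 1 1)" by (rule pos2)
  qed
  then show "ip G y y * ip G z z - (ip G y z)\<^sup>2 > 0" unfolding gr yz .
qed

text \<open>Pointwise form of the result. The two terms of the wedge product combine to the trace of
  \<open>P\<close> over the tangent plane, which is the difference of the two surface
  traces.\<close>

lemma cnt_form_reference:
  fixes \<sigma> :: "real^2 \<Rightarrow> 'm"
  assumes lp: "local_param X A UNIV S W \<sigma>" "u \<in> W" and c: "c \<in> A" "\<sigma> u \<in> fst c"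
    and sp: "spacelike X A g (UNIV :: (real^2) set) S"
    and N_orth: "\<And>v. g (\<sigma> u) (N (\<sigma> u)) (push A \<sigma> u v) = 0"
    and e: "local_frame X A (\<sigma> u) e"
  defines "Y \<equiv> push A \<sigma> u (axis 0 1)" and "Z \<equiv> push A \<sigma> u (axis 1 1)"
  assumes pos: "d4 (N (\<sigma> u) c) (\<nu> (\<sigma> u) c) (Y c) (Z c) > 0"
  shows "cnt_form A g g' c e N (\<sigma> u) Y Z =
    2 * \<bar>V (snd (\<phi> (\<sigma> u)))\<bar> * (M.surface_trace g' c \<sigma> \<nu> u - M.surface_trace g c \<sigma> \<nu> u) * area_element g (\<sigma> u) Y Z"
proof -
  define p where "p = \<sigma> u"
  define x where "x = snd c p"
  define G where "G = gram A g (cinv c)"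
  define G' where "G' = gram A g' (cinv c)"
  define s where "s y = snd c (\<sigma> y)" for y
  define m where "m y = \<nu> (\<sigma> y) c" for y
  define n where "n = \<nu> p c"
  define N0 where "N0 = N p c"
  define y where "y = Y c"
  define z where "z = Z c"
  define C where "C = christoffel_diff G G' x"
  define D where "D = ip (G x) y y * ip (G x) z z - (ip (G x) y z)\<^sup>2"
  have pS: "p \<in> S" using M.local_paramD(6)[OF lp(1)] lp(2) by (auto simp: p_def)
  have pX: "p \<in> topspace X" using pS SU U_subset by blast
  have pc: "p \<in> fst c" using c(2) by (simp add: p_def)
  have sx: "s u = x" by (simp add: s_def x_def p_def)
  have yz: "y = fd s u (axis 0 1)" "z = fd s u (axis 1 1)"
    using c by (simp_all add: y_def z_def Y_def Z_def M.push_component s_def[abs_def])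
  have t: "Y \<in> tangent_space A p" "Z \<in> tangent_space A p" "\<nu> p \<in> tangent_space A p" "N p \<in> tangent_space A p"
    unfolding Y_def Z_def p_def using M.push_tangent'[OF M.local_paramD(1)[OF lp(1)] lp(2)] \<nu>_tangent N_tangent pS by (auto simp: p_def)
  have ip: "g p a b = ip (G x) (a c) (b c)" if "a \<in> tangent_space A p" "b \<in> tangent_space A p" for a b
    unfolding G_def x_def by (rule M.metric_field_ip(1)[OF mf c(1) pc pX that])
  have sym: "ip (G x) a b = ip (G x) b a" for a b
    unfolding G_def x_def by (rule M.metric_field_ip_sym[OF mf c(1) pc pX])
  have inv: "invertible (G x)" unfolding G_def x_def by (rule inv_g[OF c(1) pc])
  have dG: "G differentiable at x" unfolding G_def x_def using mf c(1) pc pX by (auto simp: metric_field_def)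
  have dG': "G' differentiable at x" unfolding G'_def x_def p_def by (rule mean_curvature_reference(2)[OF lp c])
  have eq: "G' x = G x" unfolding G_def G'_def x_def by (rule gram_pullback_surface[OF c(1) pc pS])
  note orth = orthogonal_frame(1-6)[OF lp c sp N_orth, folded p_def Y_def Z_def, folded x_def y_def z_def n_def N0_def G_def]
  have Dpos: "D > 0"
    using orthogonal_frame(7)[OF lp c sp N_orth, folded p_def Y_def Z_def, folded x_def y_def z_def] by (simp add: D_def G_def)
  have ds: "s differentiable at u"
    unfolding s_def[abs_def] by (rule M.smooth_into_differentiable[OF M.local_paramD(1)[OF lp(1)] lp(2) c])
  \<comment> \<open>The Gram fields agree along the surface; by the chain rule their derivatives
    agree on vectors tangent to it.\<close>
  have fdG: "fd G x (fd s u v) = fd G' x (fd s u v)" for v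
  proof -
    define T where "T = W \<inter> \<sigma> -` fst c"
    have T: "open T" "u \<in> T" using M.smooth_intoD(4)[OF M.local_paramD(1)[OF lp(1)] c(1)] lp(2) c(2) by (auto simp: T_def)
    have "G' (s w) = G (s w)" if "w \<in> T" for w
      unfolding G_def G'_def s_def
      by (rule gram_pullback_surface[OF c(1)]) (use that M.local_paramD(6)[OF lp(1)] in \<open>auto simp: T_def\<close>)
    then have "fd (\<lambda>w. G (s w)) u = fd (\<lambda>w. G' (s w)) u"
      using fd_cong[OF T, of "\<lambda>w. G (s w)" "\<lambda>w. G' (s w)"] by simp
    moreover have "fd (\<lambda>w. G (s w)) u v = fd G (s u) (fd s u v)" "fd (\<lambda>w. G' (s w)) u v = fd G' (s u) (fd s u v)"
      by (rule fd_compose[OF ds], simp add: sx dG dG')+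
    ultimately show ?thesis by (simp add: sx)
  qed
  have anti: "ip (G x) v (C (fd s u w) *v n) = - ip (G x) n (C (fd s u w) *v v)" for v w
    unfolding C_def by (rule christoffel_diff_antisymmetric[OF dG inv dG' eq fdG])
  define d where "d = d4 N0 n y z"
  have d: "d > 0" using pos by (simp add: d_def N0_def n_def y_def z_def p_def)
  have inv_e: "invertible (frame_matrix c e p)"
  proof -
    obtain O' where "p \<in> O'" "\<forall>q\<in>O'. \<forall>c\<in>A. q \<in> fst c \<longrightarrow> det (\<chi> a. e q a c) \<noteq> 0"
      using e unfolding local_frame_def p_def by blast
    then have "det (\<chi> a. e p a c) \<noteq> 0" using c(1) pc by blast
    moreover have "frame_matrix c e p = transpose (\<chi> a. e p a c)" by (simp add: frame_matrix_def transpose_def)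
    ultimately show ?thesis by (simp add: invertible_det_nz det_transpose)
  qed
  have K: "D \<noteq> 0" "d4 N0 n y z \<noteq> 0" using Dpos d by (auto simp: d_def)
  define P where "P a b = ip (G x) n (C a *v b)" for a b
  note BC = bivector_contraction[OF inv sym K(2) orth K(1)[unfolded D_def]]
  have b1: "bivector_trace (C y ** matrix_inv (G x)) N0 z = 2 * d * (ip (G x) z z * P y y - ip (G x) y z * P y z) / D"
    unfolding P_def D_def d_def by (rule BC(1)) (simp_all only: yz anti)
  have b2: "bivector_trace (C z ** matrix_inv (G x)) N0 y = - 2 * d * (ip (G x) y y * P z z - ip (G x) y z * P z y) / D"
    unfolding P_def D_def d_def by (rule BC(2)) (simp_all only: yz anti)
  have "cnt_form A g g' c e N p Y Z = sqrt (- det (G x)) *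
      (bivector_trace (C y ** matrix_inv (G x)) N0 z - bivector_trace (C z ** matrix_inv (G x)) N0 y)"
    using cnt_form_contraction[where c = c and p = p, OF M.cinv_chart[OF c(1) pc] inv_e]
    unfolding C_def G_def G'_def x_def y_def z_def N0_def by simp
  then have cnt: "cnt_form A g g' c e N p Y Z = 2 * (sqrt (- det (G x)) * d) *
      ((ip (G x) z z * P y y - ip (G x) y z * (P y z + P z y) + ip (G x) y y * P z z) / D)"
    unfolding b1 b2 by (simp add: algebra_simps diff_divide_distrib add_divide_distrib)
  \<comment> \<open>The derivative of the components of \<nu> is common to both connections, so the
    covariant derivatives differ by \<open>C\<close> applied to \<nu>. Moving \<open>C\<close> to
    the other argument by skewness produces the sign that leads to
    \<open>k\<^sub>0 - k\<close>.\<close>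
  have cov: "ip (G x) v (cov_deriv G' s m u w) = ip (G x) v (cov_deriv G s m u w) + P (fd s u w) v" for v w
  proof -
    have "cov_deriv G s m u w = cov_deriv G' s m u w + C (fd s u w) *v n"
      by (simp add: cov_deriv_def C_def christoffel_diff_works sx m_def n_def p_def)
    then show ?thesis using anti[of v w] by (simp add: P_def)
  qed
  have tr: "M.surface_trace g' c \<sigma> \<nu> u - M.surface_trace g c \<sigma> \<nu> u
      = (ip (G x) z z * P y y - ip (G x) y z * (P y z + P z y) + ip (G x) y y * P z z) / D"
    unfolding M.surface_trace_def Let_def G_def[symmetric] G'_def[symmetric] s_def[symmetric] m_def[symmetric] sx eq tr2_def cov
      yz[symmetric] D_def diff_divide_distrib[symmetric]
    by (simp add: algebra_simps)
  \<comment> \<open>The coordinate volume factor becomes intrinsic: the Gram determinant of the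
    basis is the square of \<open>N\<close>, which is minus the squared potential, times
    \<open>D\<close>.\<close>
  have "sqrt (- det (G x)) * d = \<bar>V (snd (\<phi> p))\<bar> * sqrt D"
  proof -
    have "det (G x) * d\<^sup>2 = ip (G x) N0 N0 * D"
      unfolding d_def D_def by (rule gram_det_4[OF sym orth])
    also have "ip (G x) N0 N0 = - (V (snd (\<phi> p)))\<^sup>2" using g_N[OF pS] ip[OF t(4,4)] by (simp add: N0_def)
    finally have "- det (G x) * d\<^sup>2 = (V (snd (\<phi> p)))\<^sup>2 * D" by simp
    then have "sqrt (- det (G x) * d\<^sup>2) = sqrt ((V (snd (\<phi> p)))\<^sup>2 * D)" by simp
    then show ?thesis using d unfolding real_sqrt_mult by simp
  qed
  moreover have "area_element g p Y Z = sqrt D"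
    using ip[OF t(1,1)] ip[OF t(2,2)] ip[OF t(1,2)] by (simp add: area_element_def D_def y_def z_def)
  ultimately show ?thesis
    using cnt tr by (simp add: p_def[symmetric] mult_ac)
qed

end

section \<open>Integration of the pointwise identity\<close>

text \<open>\<open>surface_integral\<close> evaluates its integrand only on coordinate frames of
  positively oriented parametrizations, so the identity is required just there; both integrals use
  the same chosen partition.\<close>

lemma surface_integral_scale:
  fixes X :: "'m topology"
  assumes "\<exists>P. oriented_partition X A S pos P"
    and "\<And>W (\<sigma> :: real^2 \<Rightarrow> 'm) u. local_param X A UNIV S W \<sigma> \<Longrightarrow> u \<in> W \<Longrightarrow>
      pos (\<sigma> u) (push A \<sigma> u (axis 0 1)) (push A \<sigma> u (axis 1 1)) \<Longrightarrow>
      F (\<sigma> u) (push A \<sigma> u (axis 0 1)) (push A \<sigma> u (axis 1 1)) = a * F' (\<sigma> u) (push A \<sigma> u (axis 0 1)) (push A \<sigma> u (axis 1 1))"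
  shows "surface_integral X A S pos F = a * surface_integral X A S pos F'"
proof -
  obtain r W \<sigma> f where P: "(SOME P. oriented_partition X A S pos P) = (r, W, \<sigma>, f)" by (metis prod_cases4)
  have P': "oriented_partition X A S pos (r, W, \<sigma>, f)" using someI_ex[OF assms(1)] P by simp
  have "(LINT u:W i|lborel. f i (\<sigma> i u) * F (\<sigma> i u) (push A (\<sigma> i) u (axis 0 1)) (push A (\<sigma> i) u (axis 1 1)))
      = a * (LINT u:W i|lborel. f i (\<sigma> i u) * F' (\<sigma> i u) (push A (\<sigma> i) u (axis 0 1)) (push A (\<sigma> i) u (axis 1 1)))"
    if i: "i < r" for i
  proof -
    have lp: "local_param X A UNIV S (W i) (\<sigma> i)"
      and pos: "\<And>u. u \<in> W i \<Longrightarrow> pos (\<sigma> i u) (push A (\<sigma> i) u (axis 0 1)) (push A (\<sigma> i) u (axis 1 1))"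
      using P' i unfolding oriented_partition_def by auto
    have "open (W i)" using lp by (simp add: local_param_def smooth_into_def)
    then have "W i \<in> sets lborel" by simp
    then show ?thesis
      unfolding set_integral_mult_right[symmetric]
      by (rule set_lebesgue_integral_cong) (use assms(2)[OF lp] pos in auto)
  qed
  then show ?thesis
    unfolding surface_integral_def P by (simp add: sum_distrib_left)
qed

theorem corollary1p2:
  fixes X :: "'m topology" and A :: "('m, 4) chart set"
    and g :: "('m, 4) metric" and t :: "'m \<Rightarrow> ('m, 4) tvec"
    and S \<Omega> U :: "'m set" and N \<nu> :: "'m \<Rightarrow> ('m, 4) tvec"
    and \<epsilon> T\<^sub>0 :: real and V :: "real^4 \<Rightarrow> real"
    and B :: "(real \<times> (real^4), 4) chart set"
    and h :: "(real \<times> (real^4), 4) metric"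
    and \<phi> :: "'m \<Rightarrow> real \<times> (real^4)"
    and c :: "'m \<Rightarrow> ('m, 4) chart" and e :: "'m \<Rightarrow> 'm \<Rightarrow> 4 \<Rightarrow> ('m, 4) tvec"
  assumes "oriented_manifold X A"
    and "lorentz_metric A (topspace X) g"
    and "time_orientation X A g t"
    \<comment> \<open>the surface, the domain, the normals\<close>
    and "compactin X S"
    and "submanifold X A (UNIV :: (real^2) set) S"
    and "spacelike X A g (UNIV :: (real^2) set) S"
    and "submanifold X A half_space \<Omega>"
    and "spacelike X A g half_space \<Omega>"
    and "S = submanifold_boundary X A \<Omega>"
    and "\<forall>p\<in>S. outward_unit_normal X A g \<Omega> S p (\<nu> p)"
    and "smooth_along_surface X A S N"
    and "\<forall>p\<in>S. future_timelike A g t p (N p)"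
    and "\<forall>p\<in>S. \<forall>Y\<in>tangent_sub X A half_space \<Omega> p. g p (N p) Y = 0"
    \<comment> \<open>de Sitter or anti-de Sitter spacetime\<close>
    and "\<epsilon> = 1 \<or> \<epsilon> = -1"
    and "static_potential \<epsilon> V"
    and "B \<subseteq> submanifold_atlas (static_spacetime \<epsilon> V)"
    and "oriented_manifold (top_of_set (static_spacetime \<epsilon> V)) B"
    and "h = static_metric \<epsilon> V B"
    \<comment> \<open>a 4D isometric matching reference\<close>
    and "S \<subseteq> U"
    and "smooth_embedding X A U (top_of_set (static_spacetime \<epsilon> V)) B \<phi>"
    and "preserves_orientation A U B \<phi>"
    and "preserves_time_orientation A U g t B h (time_field B) \<phi>"
    and "\<forall>p\<in>S. \<forall>Y\<in>tangent_space A p. \<forall>Z\<in>tangent_space A p.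
           pullback_metric A B \<phi> h p Y Z = g p Y Z"
    \<comment> \<open>conditions (1) and (2)\<close>
    and "\<forall>p\<in>S. differential A B \<phi> p (N p) = time_field B (\<phi> p)"
    and "\<phi> ` S \<subseteq> time_slice \<epsilon> V T\<^sub>0"
    \<comment> \<open>the coordinates and frames in which the integrand of the energy is computed\<close>
    and "\<forall>p\<in>S. c p \<in> A \<and> p \<in> fst (c p) \<and> local_frame X A p (e p)"
  shows "cnt_energy X A g S (induced_orientation A N \<nu>) N B h \<phi> c e =
    1 / (8 * pi) * surface_integral X A S (induced_orientation A N \<nu>)
      (\<lambda>p Y Z. \<bar>V (snd (\<phi> p))\<bar> *
         (mean_curvature (top_of_set (static_spacetime \<epsilon> V)) B h (time_slice \<epsilon> V T\<^sub>0) (\<phi> ` S)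
            (\<lambda>q. let p' = inv_into S \<phi> q in differential A B \<phi> p' (\<nu> p')) (\<phi> p)
          - mean_curvature X A g \<Omega> S \<nu> p) * area_element g p Y Z)"
proof -
  note H = assms
  have atl: "smooth_atlas X A" and T2: "Hausdorff_space X"
    and or: "\<And>c c' p. c \<in> A \<Longrightarrow> c' \<in> A \<Longrightarrow> p \<in> fst c \<inter> fst c' \<Longrightarrow> det (matrix (fd (snd c' \<circ> cinv c) (snd c p))) > 0"
    using H(1) unfolding oriented_manifold_def by blast+
  have atlB: "smooth_atlas (top_of_set (static_spacetime \<epsilon> V)) B" using H(17) unfolding oriented_manifold_def by blast
  interpret M: atlas X A by standard (rule atl)
  note mf = lorentz_metric_field(1)[OF atl H(2)]
  note inv_g = lorentz_metric_field(2)[OF atl H(2)]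
  have out: "outward_unit_normal X A g \<Omega> S p (\<nu> p)" if "p \<in> S" for p using H(10) that by blast
  note bnd = mf H(8,9) out
  have SX: "S \<subseteq> topspace X" using H(4) by (simp add: compactin_def)
  have \<nu>t: "\<nu> p \<in> tangent_space A p" "\<nu> p \<in> tangent_sub X A half_space \<Omega> p" if "p \<in> S" for p
    using M.normal_domain[OF bnd that] by auto
  have Nt: "N p \<in> tangent_space A p" "g p (N p) (N p) < 0" if "p \<in> S" for p
    using H(12) that by (auto simp: future_timelike_def)
  have \<sigma>S: "\<sigma> u \<in> S" if "local_param X A UNIV S W \<sigma>" "u \<in> W" for W u and \<sigma> :: "real^2 \<Rightarrow> 'm"
    using M.local_paramD(6)[OF that(1)] that(2) by auto
  have \<nu>_orth: "g (\<sigma> u) (\<nu> (\<sigma> u)) (push A \<sigma> u v) = 0"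
    if "local_param X A UNIV S W \<sigma>" "u \<in> W" for W u v and \<sigma> :: "real^2 \<Rightarrow> 'm"
  proof -
    have "push A \<sigma> u v \<in> surface_tangent X A S (\<sigma> u)" unfolding tangent_sub_def using that by blast
    then show ?thesis using out[OF \<sigma>S[OF that]] unfolding outward_unit_normal_def by blast
  qed
  have N_orth: "g (\<sigma> u) (N (\<sigma> u)) (push A \<sigma> u v) = 0"
    if "local_param X A UNIV S W \<sigma>" "u \<in> W" for W u v and \<sigma> :: "real^2 \<Rightarrow> 'm"
    using M.surface_tangent_domain[OF bnd that] H(13) \<sigma>S[OF that] by blast
  have sym: "g p Y Z = g p Z Y" if "p \<in> S" "Y \<in> tangent_space A p" "Z \<in> tangent_space A p" for p Y Z
    using H(2) SX that unfolding lorentz_metric_def by blast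
  \<comment> \<open>The existence of the mean curvature also yields the differentiability of \<nu>,
    through the coordinates of the normal contained in \<open>is_mean_curvature\<close>.\<close>
  have trace: "mean_curvature X A g \<Omega> S \<nu> (\<sigma> u) = M.surface_trace g c \<sigma> \<nu> u" "(\<lambda>y. \<nu> (\<sigma> y) c) differentiable at u"
    if "local_param X A UNIV S W \<sigma>" "u \<in> W" "c \<in> A" "\<sigma> u \<in> fst c" for W u c and \<sigma> :: "real^2 \<Rightarrow> 'm"
    using M.mean_curvature_eq_trace[OF mf H(8) M.ex_mean_curvature_boundary[OF bnd \<sigma>S[OF that(1,2)]] that(1,2) refl that(3,4) inv_g[OF that(3,4)]]
    by auto
  interpret reference X A \<epsilon> V B g U S \<phi> N \<nu> T\<^sub>0
  proof
    show "\<epsilon> = 1 \<or> \<epsilon> = -1" "static_potential \<epsilon> V" "B \<subseteq> submanifold_atlas (static_spacetime \<epsilon> V)" by (fact H)+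
    show "smooth_atlas (top_of_set (static_spacetime \<epsilon> V)) B" by (fact atlB)
    show "metric_field A (topspace X) g" by (fact mf)
    show "smooth_embedding X A U (top_of_set (static_spacetime \<epsilon> V)) B \<phi>" "S \<subseteq> U" "\<phi> ` S \<subseteq> time_slice \<epsilon> V T\<^sub>0" by (fact H)+
  next
    fix p assume p: "p \<in> S"
    show "\<nu> p \<in> tangent_space A p" "N p \<in> tangent_space A p" by (fact \<nu>t(1)[OF p] Nt(1)[OF p])+
    show "g p (\<nu> p) (\<nu> p) = 1" using out[OF p] unfolding outward_unit_normal_def by blast
    show "g p (\<nu> p) (N p) = 0" using H(13) p \<nu>t[OF p] sym[OF p Nt(1)[OF p] \<nu>t(1)[OF p]] by auto
    show "differential A B \<phi> p (N p) = time_field B (\<phi> p)" using H(24) p by blast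
  next
    show "invertible (gram A g (cinv c) (snd c p))" if "c \<in> A" "p \<in> fst c" for c p by (rule inv_g[OF that])
    show "pullback_metric A B \<phi> (static_metric \<epsilon> V B) p Y Z = g p Y Z"
      if "p \<in> S" "Y \<in> tangent_space A p" "Z \<in> tangent_space A p" for p Y Z
      using H(23) that unfolding H(18) by blast
    show "g (\<sigma> u) (\<nu> (\<sigma> u)) (push A \<sigma> u v) = 0"
      if "local_param X A UNIV S W \<sigma>" "u \<in> W" for W u v and \<sigma> :: "real^2 \<Rightarrow> 'm" by (rule \<nu>_orth[OF that])
    show "(\<lambda>y. \<nu> (\<sigma> y) c) differentiable at u"
      if "local_param X A UNIV S W \<sigma>" "u \<in> W" "c \<in> A" "\<sigma> u \<in> fst c" for W u c and \<sigma> :: "real^2 \<Rightarrow> 'm" by (rule trace(2)[OF that])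
  qed
  let ?pos = "induced_orientation A N \<nu>"
  define D where "D d p Y Z = d4 (N p d) (\<nu> p d) (Y d) (Z d)" for d :: "('m, 4) chart" and p and Y Z :: "('m, 4) tvec"
  have chart_orientation: "?pos (\<sigma> u) (push A \<sigma> u (axis 0 1)) (push A \<sigma> u (axis 1 1))
      \<longleftrightarrow> D d (\<sigma> u) (push A \<sigma> u (axis 0 1)) (push A \<sigma> u (axis 1 1)) > 0"
    if lp: "local_param X A UNIV S W \<sigma>" "u \<in> W" and d: "d \<in> A" "\<sigma> u \<in> fst d" for W u d and \<sigma> :: "real^2 \<Rightarrow> 'm"
    unfolding D_def
    by (rule induced_orientation_chart[OF atl or d])
      (rule Nt(1)[OF \<sigma>S[OF lp]] \<nu>t(1)[OF \<sigma>S[OF lp]] M.push_tangent'[OF M.local_paramD(1)[OF lp(1)] lp(2)] | assumption)+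
  have partition: "\<exists>P. oriented_partition X A S ?pos P"
  proof (rule M.ex_oriented_partition[OF H(4) T2])
    fix p assume p: "p \<in> S"
    obtain W and \<sigma> :: "real^2 \<Rightarrow> 'm" where lp: "local_param X A UNIV S W \<sigma>" and "p \<in> \<sigma> ` (W \<inter> UNIV)"
      using H(5) p unfolding submanifold_def by blast
    then obtain u where lp: "local_param X A UNIV S W \<sigma>" "u \<in> W" and up: "\<sigma> u = p" by auto
    obtain d where d: "d \<in> A" "\<sigma> u \<in> fst d" using M.ex_chart M.local_paramD(8)[OF lp] by blast
    let ?T = "W \<inter> \<sigma> -` fst d"
    note s = M.local_paramD(1)[OF lp(1)]
    have push: "continuous_on ?T (\<lambda>y. push A \<sigma> y v d)" for v
    proof -
      have "continuous_on ?T (\<lambda>y. fd (\<lambda>y. snd d (\<sigma> y)) y v)"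
        by (rule smooth_on_continuous[OF smooth_on_fd[OF M.smooth_intoD(3)[OF s d(1)] M.smooth_intoD(4)[OF s d(1)]]])
      then show ?thesis
        by (rule continuous_on_eq) (simp add: M.push_component[OF d(1)])
    qed
    have cN: "continuous_on ?T (\<lambda>y. N (\<sigma> y) d)"
      using H(11) lp(1) d(1) unfolding smooth_along_surface_def by (blast intro: smooth_on_continuous)
    have c\<nu>: "continuous_on ?T (\<lambda>y. \<nu> (\<sigma> y) d)"
      by (intro continuous_at_imp_continuous_on ballI differentiable_imp_continuous_within trace(2)[OF lp(1) _ d(1)]) auto
    \<comment> \<open>In the Gram determinant identity the square of \<open>N\<close> is negative
      and the first fundamental form has positive determinant, so the volume of the basis cannot be
      zero.\<close>
    have nz: "D d (\<sigma> u) (push A \<sigma> u (axis 0 1)) (push A \<sigma> u (axis 1 1)) \<noteq> 0"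
    proof -
      note frame = orthogonal_frame[OF lp d H(6) N_orth[OF lp]]
      have X: "\<sigma> u \<in> topspace X" using \<sigma>S[OF lp] SX by blast
      have "ip (gram A g (cinv d) (snd d (\<sigma> u))) (N (\<sigma> u) d) (N (\<sigma> u) d) < 0"
        using M.metric_field_ip(1)[OF mf d X Nt(1)[OF \<sigma>S[OF lp]] Nt(1)[OF \<sigma>S[OF lp]]] Nt(2)[OF \<sigma>S[OF lp]] by simp
      then show ?thesis
        using gram_det_4[OF M.metric_field_ip_sym[OF mf d X] frame(1-6)] frame(7) by (auto simp: D_def)
    qed
    obtain W' u' and \<sigma>' :: "real^2 \<Rightarrow> 'm" where *: "local_param X A UNIV S W' \<sigma>'" "u' \<in> W'" "\<sigma>' u' = \<sigma> u"
      "\<And>y. y \<in> W' \<Longrightarrow> \<sigma>' y \<in> fst d" "\<And>y. y \<in> W' \<Longrightarrow> D d (\<sigma>' y) (push A \<sigma>' y (axis 0 1)) (push A \<sigma>' y (axis 1 1)) > 0"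
    proof -
      have c4: "continuous_on ?T (\<lambda>y. D d (\<sigma> y) (push A \<sigma> y (axis 0 1)) (push A \<sigma> y (axis 1 1)))"
        unfolding D_def by (rule continuous_on_d4[OF cN c\<nu> push push])
      have sw: "D d p Z Y = - D d p Y Z" for p Y Z unfolding D_def by (rule d4_swap(3))
      show thesis using M.ex_oriented_param[where D = "D d", OF lp d c4 nz sw] that by blast
    qed
    then show "\<exists>W (\<sigma> :: real^2 \<Rightarrow> 'm) u. local_param X A UNIV S W \<sigma> \<and> u \<in> W \<and> \<sigma> u = p \<and>
        (\<forall>y\<in>W. ?pos (\<sigma> y) (push A \<sigma> y (axis 0 1)) (push A \<sigma> y (axis 1 1)))"
      using chart_orientation[OF *(1) _ d(1) *(4)] up
      by (intro exI[of _ W'] exI[of _ \<sigma>'] exI[of _ u'] conjI ballI) auto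
  qed
  have "surface_integral X A S ?pos (\<lambda>p. cnt_form A g (pullback_metric A B \<phi> h) (c p) (e p) N p)
    = 2 * surface_integral X A S ?pos (\<lambda>p Y Z. \<bar>V (snd (\<phi> p))\<bar> *
         (mean_curvature (top_of_set (static_spacetime \<epsilon> V)) B h (time_slice \<epsilon> V T\<^sub>0) (\<phi> ` S)
            (\<lambda>q. let p' = inv_into S \<phi> q in differential A B \<phi> p' (\<nu> p')) (\<phi> p)
          - mean_curvature X A g \<Omega> S \<nu> p) * area_element g p Y Z)"
  proof (rule surface_integral_scale[OF partition])
    fix W u and \<sigma> :: "real^2 \<Rightarrow> 'm"
    let ?Y = "push A \<sigma> u (axis 0 1)" and ?Z = "push A \<sigma> u (axis 1 1)"
    assume lp: "local_param X A UNIV S W \<sigma>" "u \<in> W" and pos: "?pos (\<sigma> u) ?Y ?Z"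
    let ?c = "c (\<sigma> u)"
    have c: "?c \<in> A" "\<sigma> u \<in> fst ?c" "local_frame X A (\<sigma> u) (e (\<sigma> u))" using H(26) \<sigma>S[OF lp] by blast+
    have k0: "mean_curvature (top_of_set (static_spacetime \<epsilon> V)) B h (time_slice \<epsilon> V T\<^sub>0) (\<phi> ` S)
        (\<lambda>q. let p' = inv_into S \<phi> q in differential A B \<phi> p' (\<nu> p')) (\<phi> (\<sigma> u)) = M.surface_trace (pullback_metric A B \<phi> h) ?c \<sigma> \<nu> u"
      using mean_curvature_reference(1)[OF lp c(1,2)] unfolding normal_def[abs_def] H(18) .
    have "d4 (N (\<sigma> u) ?c) (\<nu> (\<sigma> u) ?c) (?Y ?c) (?Z ?c) > 0"
      using chart_orientation[OF lp c(1,2)] pos by (simp add: D_def)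
    note cnt_form_reference[OF lp c(1,2) H(6) N_orth[OF lp] c(3) this]
    then show "cnt_form A g (pullback_metric A B \<phi> h) ?c (e (\<sigma> u)) N (\<sigma> u) ?Y ?Z
      = 2 * (\<bar>V (snd (\<phi> (\<sigma> u)))\<bar> *
         (mean_curvature (top_of_set (static_spacetime \<epsilon> V)) B h (time_slice \<epsilon> V T\<^sub>0) (\<phi> ` S)
            (\<lambda>q. let p' = inv_into S \<phi> q in differential A B \<phi> p' (\<nu> p')) (\<phi> (\<sigma> u))
          - mean_curvature X A g \<Omega> S \<nu> (\<sigma> u)) * area_element g (\<sigma> u) ?Y ?Z)"
      unfolding k0 trace(1)[OF lp c(1,2)] unfolding H(18) by simp
  qed
  then show ?thesis
    by (simp add: cnt_energy_def)
qed

end
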